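(* Let $7/3<p<5$ and $\mu>0$. Let $R_n\to\infty$ and let $(u_n)$ be a sequence such that $u_n\in S_{\mu,R_n}$ is a positive critical point of $E_{R_n}$ constrained on $S_{\mu,R_n}$, each $u_n$ is radially symmetric and decreasing with respect to $(x_1,x_2)$ and with respect to $x_3$, and $E_{R_n}(u_n)\to\beta$ as $n\to\infty$ with $\beta\neq\frac12\Lambda_0\mu$. Then, up to a subsequence, $u_n\to u$ strongly in $H$ (extending $u_n$ by zero outside $B_{R_n}$), and $u\in S_\mu$ is a positive critical point of $E$ constrained on $S_\mu$ with $E(u)=\beta$.
   Context: $V(x)=x_1^2+x_2^2$; $H=\{u\in H^1(\mathbb R^3):\int V|u|^2<\infty\}$ with norm $\|u\|_H^2=\int(|\nabla u|^2+(V+1)|u|^2)$; $E(u)=\frac12\int_{\mathbb R^3}(|\nabla u|^2+V|u|^2)-\frac1{p+1}\int|u|^{p+1}$; $S_\mu=\{u\in H:\int|u|^2=\mu\}$. $B_R=\{|x|<R\}$; $E_R(u)=\frac12\int_{B_R}(|\nabla u|^2+V|u|^2)-\frac1{p+1}\int_{B_R}|u|^{p+1}$ on $H^1_0(B_R)$; $S_{\mu,R}=\{u\in H^1_0(B_R):\int_{B_R}|u|^2=\mu\}$. Critical points on the spheres are solutions of $-\Delta u+Vu+\lambda u=|u|^{p-1}u$ (weakly, in $B_R$ resp. $\mathbb R^3$) for some $\lambda\in\mathbb R$. $\Lambda_0=\inf\{\int(|\nabla w|^2+V|w|^2):w\in H,\int|w|^2=1\}$. "Radially symmetric and decreasing w.r.t.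 $(x_1,x_2)$" means depending on $(x_1,x_2)$ only through $\sqrt{x_1^2+x_2^2}$ and decreasing in it; "decreasing w.r.t. $x_3$" means even in $x_3$ and decreasing in $|x_3|$. *)

theory Defs
  imports "HOL-Analysis.Analysis"
begin

type_synonym R3 = "real^3"

definition pderiv3 :: "3 \<Rightarrow> (R3 \<Rightarrow> real) \<Rightarrow> R3 \<Rightarrow> real" where
  "pderiv3 i f x = frechet_derivative f (at x) (axis i 1)"

fun dd :: "3 list \<Rightarrow> (R3 \<Rightarrow> real) \<Rightarrow> R3 \<Rightarrow> real" where
  "dd [] f = f"
| "dd (i # is) f = pderiv3 i (dd is f)"

definition smooth3 :: "(R3 \<Rightarrow> real) \<Rightarrow> bool" where
  "smooth3 f \<longleftrightarrow> (\<forall>is x. dd is f differentiable (at x))"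

definition tsupp :: "(R3 \<Rightarrow> real) \<Rightarrow> R3 set" where
  "tsupp f = closure {x. f x \<noteq> 0}"

definition test_fun :: "R3 set \<Rightarrow> (R3 \<Rightarrow> real) \<Rightarrow> bool" where
  "test_fun \<Omega> \<phi> \<longleftrightarrow> smooth3 \<phi> \<and> compact (tsupp \<phi>) \<and> tsupp \<phi> \<subseteq> \<Omega>"

definition grad3 :: "(R3 \<Rightarrow> real) \<Rightarrow> R3 \<Rightarrow> R3" where
  "grad3 \<phi> x = (\<chi> i. pderiv3 i \<phi> x)"

definition L2 :: "(R3 \<Rightarrow> real) \<Rightarrow> bool" where
  "L2 u \<longleftrightarrow> u \<in> borel_measurable lborel \<and> integrable lborel (\<lambda>x. (u x)\<^sup>2)"

definition has_weak_grad :: "(R3 \<Rightarrow> real) \<Rightarrow> (R3 \<Rightarrow> R3) \<Rightarrow> bool" where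
  "has_weak_grad u g \<longleftrightarrow>
     (\<forall>i. L2 (\<lambda>x. g x $ i)) \<and>
     (\<forall>\<phi> i. test_fun UNIV \<phi> \<longrightarrow>
        (\<integral>x. u x * pderiv3 i \<phi> x \<partial>lborel) = - (\<integral>x. g x $ i * \<phi> x \<partial>lborel))"

definition H1 :: "(R3 \<Rightarrow> real) set" where
  "H1 = {u. L2 u \<and> (\<exists>g. has_weak_grad u g)}"

definition wgrad :: "(R3 \<Rightarrow> real) \<Rightarrow> R3 \<Rightarrow> R3" where
  "wgrad u = (SOME g. has_weak_grad u g)"

definition V :: "R3 \<Rightarrow> real" where
  "V x = (x $ 1)\<^sup>2 + (x $ 2)\<^sup>2"

definition Hsp :: "(R3 \<Rightarrow> real) set" where
  "Hsp = {u \<in> H1. integrable lborel (\<lambda>x. V x * (u x)\<^sup>2)}"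

definition H_norm :: "(R3 \<Rightarrow> real) \<Rightarrow> real" where
  "H_norm u = sqrt (\<integral>x. (norm (wgrad u x))\<^sup>2 + (V x + 1) * (u x)\<^sup>2 \<partial>lborel)"

definition H1_norm :: "(R3 \<Rightarrow> real) \<Rightarrow> real" where
  "H1_norm u = sqrt (\<integral>x. (norm (wgrad u x))\<^sup>2 + (u x)\<^sup>2 \<partial>lborel)"

text \<open>H^1_0(B_R), realised (extended by zero) as the H^1-closure of C_c^infinity(B_R).\<close>
definition H10_ball :: "real \<Rightarrow> (R3 \<Rightarrow> real) set" where
  "H10_ball R = {u \<in> H1. \<exists>\<phi>. (\<forall>k. test_fun (ball 0 R) (\<phi> k)) \<and>
                              (\<lambda>k. H1_norm (\<lambda>x. \<phi> k x - u x)) \<longlonglongrightarrow> 0}"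

definition Energy :: "real \<Rightarrow> (R3 \<Rightarrow> real) \<Rightarrow> real" where
  "Energy p u = (1/2) * (\<integral>x. (norm (wgrad u x))\<^sup>2 + V x * (u x)\<^sup>2 \<partial>lborel)
                - (1/(p+1)) * (\<integral>x. \<bar>u x\<bar> powr (p+1) \<partial>lborel)"

definition Energy_R :: "real \<Rightarrow> real \<Rightarrow> (R3 \<Rightarrow> real) \<Rightarrow> real" where
  "Energy_R p R u = (1/2) * (\<integral>x\<in>ball 0 R. (norm (wgrad u x))\<^sup>2 + V x * (u x)\<^sup>2 \<partial>lborel)
                - (1/(p+1)) * (\<integral>x\<in>ball 0 R. \<bar>u x\<bar> powr (p+1) \<partial>lborel)"

definition mass :: "(R3 \<Rightarrow> real) \<Rightarrow> real" where
  "mass u = (\<integral>x. (u x)\<^sup>2 \<partial>lborel)"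

definition S_mu :: "real \<Rightarrow> (R3 \<Rightarrow> real) set" where
  "S_mu \<mu> = {u \<in> Hsp. mass u = \<mu>}"

definition S_mu_R :: "real \<Rightarrow> real \<Rightarrow> (R3 \<Rightarrow> real) set" where
  "S_mu_R \<mu> R = {u \<in> H10_ball R. (\<integral>x\<in>ball 0 R. (u x)\<^sup>2 \<partial>lborel) = \<mu>}"

definition weak_sol :: "real \<Rightarrow> real \<Rightarrow> R3 set \<Rightarrow> (R3 \<Rightarrow> real) \<Rightarrow> bool" where
  "weak_sol p lam \<Omega> u \<longleftrightarrow> (\<forall>\<phi>. test_fun \<Omega> \<phi> \<longrightarrow>
     (\<integral>x. wgrad u x \<bullet> grad3 \<phi> x + V x * u x * \<phi> x + lam * u x * \<phi> x \<partial>lborel)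
     = (\<integral>x. \<bar>u x\<bar> powr (p-1) * u x * \<phi> x \<partial>lborel))"

text \<open>Constrained critical points (characterised via the Lagrange-multiplier equation).\<close>
definition crit_S_mu_R :: "real \<Rightarrow> real \<Rightarrow> real \<Rightarrow> (R3 \<Rightarrow> real) \<Rightarrow> bool" where
  "crit_S_mu_R p \<mu> R u \<longleftrightarrow> u \<in> S_mu_R \<mu> R \<and> (\<exists>lam. weak_sol p lam (ball 0 R) u)"

definition crit_S_mu :: "real \<Rightarrow> real \<Rightarrow> (R3 \<Rightarrow> real) \<Rightarrow> bool" where
  "crit_S_mu p \<mu> u \<longleftrightarrow> u \<in> S_mu \<mu> \<and> (\<exists>lam. weak_sol p lam UNIV u)"

definition Lambda0 :: real where
  "Lambda0 = Inf {(\<integral>x. (norm (wgrad w x))\<^sup>2 + V x * (w x)\<^sup>2 \<partial>lborel) | w. w \<in> Hsp \<and> mass w = 1}"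

text \<open>Radially symmetric and (non-strictly) decreasing in (x1,x2); even and decreasing in |x3|.
  Monotonicity in both directions forces equality on level sets, i.e. the symmetry.\<close>
definition radial_decr_12 :: "(R3 \<Rightarrow> real) \<Rightarrow> bool" where
  "radial_decr_12 u \<longleftrightarrow> (\<forall>x y. x $ 3 = y $ 3 \<longrightarrow>
      (x $ 1)\<^sup>2 + (x $ 2)\<^sup>2 \<le> (y $ 1)\<^sup>2 + (y $ 2)\<^sup>2 \<longrightarrow> u y \<le> u x)"

definition decr_3 :: "(R3 \<Rightarrow> real) \<Rightarrow> bool" where
  "decr_3 u \<longleftrightarrow> (\<forall>x y. x $ 1 = y $ 1 \<longrightarrow> x $ 2 = y $ 2 \<longrightarrow>
      \<bar>x $ 3\<bar> \<le> \<bar>y $ 3\<bar> \<longrightarrow> u y \<le> u x)"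

end

theory Submission
  imports Defs "HOL-Library.Diagonal_Subsequence"
begin

text \<open>Pohozaev's identity on a ball has a boundary term of known sign; with \<open>p > 7/3\<close> and the bounded energies it bounds
  \<open>u\<^sub>n\<close> in \<open>H\<close> and the multipliers \<open>\<lambda>\<^sub>n\<close>. By monotonicity, Helly's selection principle yields a limit almost everywhere,
  and monotonicity together with the confinement in \<open>(x\<^sub>1,x\<^sub>2)\<close> turns it into a limit in \<open>L\<^sup>q\<close> for \<open>2 < q < 6\<close>.

  The spectrum of \<open>-\<Delta> + V\<close> starts at \<open>2\<close>. Positivity of \<open>u\<^sub>n\<close>, tested against approximate ground states, gives
  \<open>\<lambda> = lim \<lambda>\<^sub>n \<ge> -2\<close>. If \<open>\<lambda> = -2\<close>, the same test forces the limit to vanish, so that the quadratic part of the energy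
  tends to \<open>\<mu> = \<Lambda>\<^sub>0 \<mu> / 2\<close>, which is excluded. Hence \<open>\<lambda> > -2\<close>, the quadratic form of \<open>-\<Delta> + V + \<lambda>\<close> is coercive, and testing the
  equation of \<open>u\<^sub>m\<close> with \<open>u\<^sub>m - u\<^sub>n\<close> (admissible when \<open>R\<^sub>n \<le> R\<^sub>m\<close>) shows that the sequence is Cauchy in \<open>H\<close>.\<close>

section \<open>Square-integrable functions\<close>

text \<open>The obstacle is the free direction x_3. Mass can spread along it at no cost above the
  bottom of the spectrum, so monotonicity gives compactness in \<open>L^q\<close> only for
  \<open>q > 2\<close>; the missing \<open>L^2\<close> convergence must come from the equation,
  through the strict inequality for the limiting multiplier. The excluded energy is the one
  approached by a profile that spreads along x_3 while keeping the ground state shape in (x_1, x_2).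
  The number 2 is the sum of the ground energies 1 of the two one-dimensional oscillators.

  The exponents enter as follows. Pohozaev bounds the nonlinear energy by the fraction 2/(3(p-1)) of
  the difference of the gradient and potential terms, and this fraction is below 1/2 exactly for p >
  7/3. The bound p < 5 keeps p + 1 below the Sobolev exponent 6.

  No regularity theory for weak solutions is invoked: derivatives are moved onto test functions, or
  a solution is compared with its own dilation. Barriers must therefore be smooth with compact
  support, which is the purpose of \<open>theta\<close> and of the cut-off Gaussians.\<close>

definition sqint :: "(R3 \<Rightarrow> real) \<Rightarrow> real" where
  "sqint f = (\<integral>x. (f x)\<^sup>2 \<partial>lborel)"

lemma L2_meas [measurable_dest]: "L2 f \<Longrightarrow> f \<in> borel_measurable borel"
  by (simp add: L2_def)

lemma L2_sq: "L2 f \<Longrightarrow> integrable lborel (\<lambda>x. (f x)\<^sup>2)"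
  by (simp add: L2_def)

lemma sqint_nonneg: "0 \<le> sqint f"
  unfolding sqint_def by (rule integral_nonneg_AE) auto

lemma L2_bound:
  assumes f: "f \<in> borel_measurable borel" and g: "integrable lborel g" and le: "AE x in lborel. (f x)\<^sup>2 \<le> g x"
  shows "L2 f"
proof -
  note [measurable] = f
  have "integrable lborel (\<lambda>x. (f x)\<^sup>2)"
    using le by (intro Bochner_Integration.integrable_bound[OF g]) auto
  then show ?thesis using f by (simp add: L2_def)
qed

lemma L2_mult_integrable:
  assumes "L2 f" "L2 g"
  shows "integrable lborel (\<lambda>x. f x * g x)"
proof -
  note [measurable] = L2_meas[OF assms(1)] L2_meas[OF assms(2)]
  have "\<bar>f x * g x\<bar> \<le> (f x)\<^sup>2 + (g x)\<^sup>2" for x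
  proof -
    have "0 \<le> (\<bar>f x\<bar> - \<bar>g x\<bar>)\<^sup>2" by simp
    then have "2 * (\<bar>f x\<bar> * \<bar>g x\<bar>) \<le> (f x)\<^sup>2 + (g x)\<^sup>2" by (simp add: power2_diff)
    moreover have "0 \<le> \<bar>f x\<bar> * \<bar>g x\<bar>" by simp
    ultimately show ?thesis unfolding abs_mult by linarith
  qed
  then have "AE x in lborel. norm (f x * g x) \<le> norm ((f x)\<^sup>2 + (g x)\<^sup>2)" by (intro always_eventually) simp
  moreover have "integrable lborel (\<lambda>x. (f x)\<^sup>2 + (g x)\<^sup>2)"
    using assms by (simp add: L2_def)
  moreover have "(\<lambda>x. f x * g x) \<in> borel_measurable lborel" by simp
  ultimately show ?thesis using Bochner_Integration.integrable_bound by blast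
qed

lemma L2_scale: "L2 f \<Longrightarrow> L2 (\<lambda>x. c * f x)"
  by (auto simp: L2_def power_mult_distrib intro: borel_measurable_times)

lemma L2_minus: "L2 f \<Longrightarrow> L2 (\<lambda>x. - f x)"
  by (simp add: L2_def)

lemma L2_zero: "L2 (\<lambda>x. 0)"
  by (simp add: L2_def)

lemma L2_add:
  assumes "L2 f" "L2 g" shows "L2 (\<lambda>x. f x + g x)"
proof -
  note [measurable] = L2_meas[OF assms(1)] L2_meas[OF assms(2)]
  have "integrable lborel (\<lambda>x. (f x)\<^sup>2 + (g x)\<^sup>2 + 2 * (f x * g x))"
    using assms L2_mult_integrable[OF assms] by (auto simp: L2_def)
  then show ?thesis by (simp add: L2_def power2_sum algebra_simps)
qed

lemma L2_diff: "L2 f \<Longrightarrow> L2 g \<Longrightarrow> L2 (\<lambda>x. f x - g x)"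
  using L2_add[OF _ L2_minus, of f g] by simp

lemma L2_bounded_mult:
  assumes "L2 f" and [measurable]: "m \<in> borel_measurable borel" and m: "\<And>x. \<bar>m x\<bar> \<le> K"
  shows "L2 (\<lambda>x. m x * f x)"
proof -
  note [measurable] = L2_meas[OF assms(1)]
  have "(m x * f x)\<^sup>2 \<le> K\<^sup>2 * (f x)\<^sup>2" for x
    using m[of x] power_mono[of "\<bar>m x\<bar>" K 2] by (simp add: power_mult_distrib mult_right_mono)
  moreover have "integrable lborel (\<lambda>x. K\<^sup>2 * (f x)\<^sup>2)" using assms(1) by (simp add: L2_def)
  ultimately show ?thesis by (intro L2_bound[of _ "\<lambda>x. K\<^sup>2 * (f x)\<^sup>2"]) auto
qed

lemma sqint_scale: "sqint (\<lambda>x. c * f x) = c\<^sup>2 * sqint f"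
  by (simp add: sqint_def power_mult_distrib)

lemma sqint_add:
  assumes "L2 f" "L2 g"
  shows "sqint (\<lambda>x. f x + g x) = sqint f + 2 * (\<integral>x. f x * g x \<partial>lborel) + sqint g"
proof -
  have "sqint (\<lambda>x. f x + g x) = (\<integral>x. (f x)\<^sup>2 + 2 * (f x * g x) + (g x)\<^sup>2 \<partial>lborel)"
    unfolding sqint_def by (intro Bochner_Integration.integral_cong) (auto simp: power2_sum)
  also have "\<dots> = sqint f + 2 * (\<integral>x. f x * g x \<partial>lborel) + sqint g"
    using assms L2_mult_integrable[OF assms] by (simp add: L2_def sqint_def)
  finally show ?thesis .
qed

lemma sqint_diff:
  assumes "L2 f" "L2 g"
  shows "sqint (\<lambda>x. f x - g x) = sqint f - 2 * (\<integral>x. f x * g x \<partial>lborel) + sqint g"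
  using sqint_add[OF assms(1) L2_minus[OF assms(2)]] by (simp add: sqint_def)

text \<open>The quadratic polynomial \<open>sqint (f + t g)\<close> in \<open>t\<close> is
  nonnegative; it is evaluated at its minimiser \<open>- ?b / sqint g\<close>, the degenerate case
  being separate.\<close>

lemma L2_Cauchy_Schwarz:
  assumes "L2 f" "L2 g"
  shows "(\<integral>x. f x * g x \<partial>lborel)\<^sup>2 \<le> sqint f * sqint g"
proof -
  let ?b = "\<integral>x. f x * g x \<partial>lborel"
  have q: "0 \<le> sqint f + 2 * (t * ?b) + t\<^sup>2 * sqint g" for t
  proof -
    have "0 \<le> sqint (\<lambda>x. f x + t * g x)" by (rule sqint_nonneg)
    also have "\<dots> = sqint f + 2 * (\<integral>x. f x * (t * g x) \<partial>lborel) + sqint (\<lambda>x. t * g x)"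
      using sqint_add[OF assms(1) L2_scale[OF assms(2)]] .
    also have "(\<integral>x. f x * (t * g x) \<partial>lborel) = t * ?b"
      by (subst integral_mult_right_zero[symmetric]) (simp add: mult_ac)
    finally show ?thesis by (simp add: sqint_scale)
  qed
  show ?thesis
  proof (cases "sqint g = 0")
    case True
    have "?b = 0"
    \<comment> \<open>With \<open>sqint g = 0\<close> the polynomial is affine in \<open>t\<close>.
      If its slope were nonzero, \<open>t = -(sqint f + 1) / ?b\<close> would give it the negative
      value \<open>- sqint f - 2\<close>.\<close>
    proof (rule ccontr)
      assume nz: "?b \<noteq> 0"
      have "0 \<le> sqint f + 2 * (-(sqint f + 1) / ?b * ?b)" using q[of "-(sqint f + 1) / ?b"] True by simp
      also have "\<dots> = - sqint f - 2" using nz by (simp add: field_simps)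
      finally show False using sqint_nonneg[of f] by simp
    qed
    then show ?thesis by (simp add: True)
  next
    case False
    then have g: "sqint g > 0" using sqint_nonneg[of g] by simp
    have "0 \<le> sqint f + 2 * (- ?b / sqint g * ?b) + (- ?b / sqint g)\<^sup>2 * sqint g" by (rule q)
    also have "\<dots> = sqint f - ?b\<^sup>2 / sqint g" using g by (simp add: field_simps power2_eq_square)
    finally show ?thesis using g by (simp add: field_simps)
  qed
qed

lemma L2_abs: "L2 f \<Longrightarrow> L2 (\<lambda>x. \<bar>f x\<bar>)"
  by (auto simp: L2_def intro: borel_measurable_abs)

lemma L2_Cauchy_Schwarz_abs:
  assumes "L2 f" "L2 g"
  shows "(\<integral>x. \<bar>f x * g x\<bar> \<partial>lborel) \<le> sqrt (sqint f) * sqrt (sqint g)"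
proof -
  have "(\<integral>x. \<bar>f x\<bar> * \<bar>g x\<bar> \<partial>lborel)\<^sup>2 \<le> sqint f * sqint g"
    using L2_Cauchy_Schwarz[OF L2_abs[OF assms(1)] L2_abs[OF assms(2)]] by (simp add: sqint_def)
  then show ?thesis
    using real_le_rsqrt real_sqrt_mult by (fastforce simp: abs_mult)
qed

text \<open>The parallelogram law with the difference dropped. Norms appear squared throughout, so
  this factor 2 stands in for the triangle inequality.\<close>

lemma sqint_add_le:
  assumes "L2 f" "L2 g"
  shows "sqint (\<lambda>x. f x + g x) \<le> 2 * sqint f + 2 * sqint g"
proof -
  have "0 \<le> sqint (\<lambda>x. f x - g x)" by (rule sqint_nonneg)
  then show ?thesis unfolding sqint_add[OF assms] sqint_diff[OF assms] by linarith
qed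

lemma sqint_diff_commute: "sqint (\<lambda>x. f x - g x) = sqint (\<lambda>x. g x - f x)"
  by (simp add: sqint_def power2_commute)

lemma sqint_dist_le:
  assumes "L2 f" "L2 g" "L2 h"
  shows "sqint (\<lambda>x. f x - h x) \<le> 2 * sqint (\<lambda>x. f x - g x) + 2 * sqint (\<lambda>x. g x - h x)"
  using sqint_add_le[OF L2_diff[OF assms(1,2)] L2_diff[OF assms(2,3)]] by simp

lemma sqint_eq_0_AE: "L2 f \<Longrightarrow> sqint f = 0 \<Longrightarrow> AE x in lborel. f x = 0"
  unfolding sqint_def L2_def by (subst (asm) integral_nonneg_eq_0_iff_AE) auto

lemma sqint_cong_AE:
  assumes "L2 f" "L2 g" "AE x in lborel. f x = g x" shows "sqint f = sqint g"
proof -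
  note [measurable] = L2_meas[OF assms(1)] L2_meas[OF assms(2)]
  show ?thesis unfolding sqint_def using assms(3) by (intro integral_cong_AE) auto
qed

text \<open>Membership of all terms and of the limit is bundled with the convergence, so that the
  rules below compose without separate integrability conditions.\<close>

definition L2lim :: "(nat \<Rightarrow> R3 \<Rightarrow> real) \<Rightarrow> (R3 \<Rightarrow> real) \<Rightarrow> bool" where
  "L2lim F f \<longleftrightarrow> (\<forall>k. L2 (F k)) \<and> L2 f \<and> (\<lambda>k. sqint (\<lambda>x. F k x - f x)) \<longlonglongrightarrow> 0"

lemma L2lim_const: "L2 f \<Longrightarrow> L2lim (\<lambda>k. f) f"
  by (simp add: L2lim_def sqint_def)

lemma L2lim_add:
  assumes "L2lim F f" "L2lim G g" shows "L2lim (\<lambda>k x. F k x + G k x) (\<lambda>x. f x + g x)"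
proof -
  have L: "\<And>k. L2 (F k)" "\<And>k. L2 (G k)" "L2 f" "L2 g" using assms by (auto simp: L2lim_def)
  have "(\<lambda>k. sqint (\<lambda>x. F k x + G k x - (f x + g x))) \<longlonglongrightarrow> 0"
  proof (rule tendsto_sandwich[of "\<lambda>_. 0"])
    show "\<forall>\<^sub>F k in sequentially. sqint (\<lambda>x. F k x + G k x - (f x + g x)) \<le>
        2 * sqint (\<lambda>x. F k x - f x) + 2 * sqint (\<lambda>x. G k x - g x)"
      using sqint_add_le[OF L2_diff[OF L(1,3)] L2_diff[OF L(2,4)]] by (simp add: algebra_simps)
    have "(\<lambda>k. 2 * sqint (\<lambda>x. F k x - f x) + 2 * sqint (\<lambda>x. G k x - g x)) \<longlonglongrightarrow> 2 * 0 + 2 * 0"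
      using assms unfolding L2lim_def by (intro tendsto_intros) auto
    then show "(\<lambda>k. 2 * sqint (\<lambda>x. F k x - f x) + 2 * sqint (\<lambda>x. G k x - g x)) \<longlonglongrightarrow> 0" by simp
  qed (auto simp: sqint_nonneg)
  then show ?thesis using L by (auto simp: L2lim_def intro: L2_add)
qed

lemma L2lim_bounded_mult:
  assumes "L2lim F f" and [measurable]: "m \<in> borel_measurable borel" and m: "\<And>x. \<bar>m x\<bar> \<le> K"
  shows "L2lim (\<lambda>k x. m x * F k x) (\<lambda>x. m x * f x)"
proof -
  have L: "\<And>k. L2 (F k)" "L2 f" using assms by (auto simp: L2lim_def)
  have "(\<lambda>k. sqint (\<lambda>x. m x * F k x - m x * f x)) \<longlonglongrightarrow> 0"
  proof (rule tendsto_sandwich[of "\<lambda>_. 0"])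
    have "sqint (\<lambda>x. m x * F k x - m x * f x) \<le> K\<^sup>2 * sqint (\<lambda>x. F k x - f x)" for k
    proof -
      note [measurable] = L2_meas[OF L(1)] L2_meas[OF L(2)]
      have "L2 (\<lambda>x. m x * (F k x - f x))"
        by (rule L2_bounded_mult[OF L2_diff[OF L] _ m]) simp
      then have "integrable lborel (\<lambda>x. (m x * (F k x - f x))\<^sup>2)" by (simp add: L2_def)
      moreover have "integrable lborel (\<lambda>x. K\<^sup>2 * (F k x - f x)\<^sup>2)" using L2_diff[OF L, of k] by (simp add: L2_def)
      moreover have "(m x * (F k x - f x))\<^sup>2 \<le> K\<^sup>2 * (F k x - f x)\<^sup>2" for x
        using m[of x] power_mono[of "\<bar>m x\<bar>" K 2] by (simp add: power_mult_distrib mult_right_mono)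
      ultimately have "(\<integral>x. (m x * (F k x - f x))\<^sup>2 \<partial>lborel) \<le> (\<integral>x. K\<^sup>2 * (F k x - f x)\<^sup>2 \<partial>lborel)"
        by (intro integral_mono) auto
      then show ?thesis by (simp add: sqint_def right_diff_distrib)
    qed
    then show "\<forall>\<^sub>F k in sequentially. sqint (\<lambda>x. m x * F k x - m x * f x) \<le> K\<^sup>2 * sqint (\<lambda>x. F k x - f x)" by simp
    have "(\<lambda>k. K\<^sup>2 * sqint (\<lambda>x. F k x - f x)) \<longlonglongrightarrow> K\<^sup>2 * 0"
      using assms unfolding L2lim_def by (intro tendsto_intros) auto
    then show "(\<lambda>k. K\<^sup>2 * sqint (\<lambda>x. F k x - f x)) \<longlonglongrightarrow> 0" by simp
  qed (auto simp: sqint_nonneg)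
  then show ?thesis using L2_bounded_mult[OF L(1) assms(2,3)] L2_bounded_mult[OF L(2) assms(2,3)]
    by (auto simp: L2lim_def)
qed

lemma L2lim_scale: "L2lim F f \<Longrightarrow> L2lim (\<lambda>k x. c * F k x) (\<lambda>x. c * f x)"
  by (rule L2lim_bounded_mult[where K="\<bar>c\<bar>"]) auto

lemma L2lim_diff:
  assumes "L2lim F f" "L2lim G g" shows "L2lim (\<lambda>k x. F k x - G k x) (\<lambda>x. f x - g x)"
  using L2lim_add[OF assms(1) L2lim_scale[OF assms(2), of "-1"]] by simp

text \<open>Write \<open>F G - f g\<close> as \<open>(F - f)(G - g) + (F - f) g + f (G - g)\<close>
  and apply the Cauchy-Schwarz inequality to each product. This is the continuity of all bilinear
  terms of the weak equation.\<close>

lemma L2lim_mult: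
  assumes "L2lim F f" "L2lim G g"
  shows "(\<lambda>k. \<integral>x. F k x * G k x \<partial>lborel) \<longlonglongrightarrow> (\<integral>x. f x * g x \<partial>lborel)"
proof -
  have L: "\<And>k. L2 (F k)" "\<And>k. L2 (G k)" "L2 f" "L2 g" using assms by (auto simp: L2lim_def)
  let ?a = "\<lambda>k. sqrt (sqint (\<lambda>x. F k x - f x))" and ?b = "\<lambda>k. sqrt (sqint (\<lambda>x. G k x - g x))"
  have a0: "?a \<longlonglongrightarrow> 0" "?b \<longlonglongrightarrow> 0"
    using tendsto_real_sqrt[of _ 0] assms by (auto simp: L2lim_def)
  have key: "\<bar>(\<integral>x. F k x * G k x \<partial>lborel) - (\<integral>x. f x * g x \<partial>lborel)\<bar>
      \<le> ?a k * ?b k + ?a k * sqrt (sqint g) + sqrt (sqint f) * ?b k" for k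
  proof -
    have i: "\<bar>\<integral>x. u x * v x \<partial>lborel\<bar> \<le> sqrt (sqint u) * sqrt (sqint v)" if "L2 u" "L2 v" for u v
      using L2_Cauchy_Schwarz[OF that] by (metis real_sqrt_abs real_sqrt_le_iff real_sqrt_mult)
    have "(\<integral>x. F k x * G k x \<partial>lborel) = (\<integral>x. (F k x - f x) * (G k x - g x) + (F k x - f x) * g x + f x * (G k x - g x) + f x * g x \<partial>lborel)"
      by (intro Bochner_Integration.integral_cong) (auto simp: algebra_simps)
    also have "\<dots> = (\<integral>x. (F k x - f x) * (G k x - g x) \<partial>lborel) + (\<integral>x. (F k x - f x) * g x \<partial>lborel)
       + (\<integral>x. f x * (G k x - g x) \<partial>lborel) + (\<integral>x. f x * g x \<partial>lborel)"
      using L by (simp add: L2_mult_integrable L2_diff)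
    finally show ?thesis
      using i[OF L2_diff[OF L(1,3), of k] L2_diff[OF L(2,4), of k]] i[OF L2_diff[OF L(1,3), of k] L(4)]
        i[OF L(3) L2_diff[OF L(2,4), of k]] by linarith
  qed
  have "(\<lambda>k. ?a k * ?b k + ?a k * sqrt (sqint g) + sqrt (sqint f) * ?b k) \<longlonglongrightarrow> 0 * 0 + 0 * sqrt (sqint g) + sqrt (sqint f) * 0"
    by (intro tendsto_intros a0)
  then have "(\<lambda>k. ?a k * ?b k + ?a k * sqrt (sqint g) + sqrt (sqint f) * ?b k) \<longlonglongrightarrow> 0"
    by (simp only: mult_zero_left mult_zero_right add_0_left)
  then have "(\<lambda>k. (\<integral>x. F k x * G k x \<partial>lborel) - (\<integral>x. f x * g x \<partial>lborel)) \<longlonglongrightarrow> 0"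
  proof (rule Lim_null_comparison[rotated])
    show "\<forall>\<^sub>F k in sequentially. norm ((\<integral>x. F k x * G k x \<partial>lborel) - (\<integral>x. f x * g x \<partial>lborel))
      \<le> ?a k * ?b k + ?a k * sqrt (sqint g) + sqrt (sqint f) * ?b k"
      unfolding real_norm_def by (intro always_eventually allI key)
  qed
  then show ?thesis by (simp add: LIM_zero_iff)
qed

lemma L2lim_sqint: "L2lim F f \<Longrightarrow> (\<lambda>k. sqint (F k)) \<longlonglongrightarrow> sqint f"
  using L2lim_mult[of F f F f] by (simp add: sqint_def power2_eq_square)

lemma L2lim_AE_subseq:
  assumes "L2lim F f"
  shows "\<exists>r. strict_mono r \<and> (AE x in lborel. (\<lambda>k. F (r k) x) \<longlonglongrightarrow> f x)"
proof -
  have "\<exists>r. strict_mono r \<and> (AE x in lborel. (\<lambda>k. (F (r k) x - f x)\<^sup>2) \<longlonglongrightarrow> 0)"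
    using assms L2_diff[of "F _" f]
    by (intro tendsto_L1_AE_subseq) (auto simp: L2lim_def L2_def sqint_def)
  then obtain r where r: "strict_mono r" "AE x in lborel. (\<lambda>k. (F (r k) x - f x)\<^sup>2) \<longlonglongrightarrow> 0" by auto
  have "AE x in lborel. (\<lambda>k. F (r k) x) \<longlonglongrightarrow> f x"
    using r(2)
  proof eventually_elim
    case (elim x)
    have "(\<lambda>k. sqrt ((F (r k) x - f x)\<^sup>2)) \<longlonglongrightarrow> sqrt 0" by (intro tendsto_intros elim)
    then have "(\<lambda>k. F (r k) x - f x) \<longlonglongrightarrow> 0" by (simp add: tendsto_rabs_zero_iff)
    then show ?case by (simp add: LIM_zero_iff)
  qed
  then show ?thesis using r by auto
qed

text \<open>Fatou's lemma is applied in the extended nonnegative reals, where the finite bound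
  \<open>B\<close> also yields integrability of the limit. Nonnegativity of \<open>f\<close> is
  known only almost everywhere, through the limit.\<close>

lemma Fatou_integral:
  fixes F :: "nat \<Rightarrow> R3 \<Rightarrow> real"
  assumes F: "\<And>k. integrable lborel (F k)" "\<And>k x. 0 \<le> F k x"
    and [measurable]: "f \<in> borel_measurable borel" and lim: "AE x in lborel. (\<lambda>k. F k x) \<longlonglongrightarrow> f x"
    and B: "\<forall>\<^sub>F k in sequentially. (\<integral>x. F k x \<partial>lborel) \<le> B"
  shows "integrable lborel f" "(\<integral>x. f x \<partial>lborel) \<le> B"
proof -
  note [measurable] = borel_measurable_integrable[OF F(1)]
  have f0: "AE x in lborel. 0 \<le> f x"
    using lim by eventually_elim (rule LIMSEQ_le_const, use F(2) in auto)
  obtain k where "(\<integral>x. F k x \<partial>lborel) \<le> B" using B by (auto simp: eventually_sequentially)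
  then have B0: "0 \<le> B" using Bochner_Integration.integral_nonneg[of lborel "F k"] F(2) by fastforce
  have le: "(\<integral>\<^sup>+x. ennreal (f x) \<partial>lborel) \<le> ennreal B"
  proof -
    have "(\<integral>\<^sup>+x. ennreal (f x) \<partial>lborel) = (\<integral>\<^sup>+x. liminf (\<lambda>k. ennreal (F k x)) \<partial>lborel)"
      using lim
    proof (intro nn_integral_cong_AE, eventually_elim)
      case (elim x)
      have "(\<lambda>k. ennreal (F k x)) \<longlonglongrightarrow> ennreal (f x)" by (intro tendsto_ennrealI elim)
      then show ?case using lim_imp_Liminf[of sequentially] by (simp add: lim_imp_Liminf)
    qed
    also have "\<dots> \<le> liminf (\<lambda>k. \<integral>\<^sup>+x. ennreal (F k x) \<partial>lborel)" by (rule nn_integral_liminf) simp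
    also have "\<dots> = liminf (\<lambda>k. ennreal (\<integral>x. F k x \<partial>lborel))"
      using F by (simp add: nn_integral_eq_integral)
    also have "\<dots> \<le> liminf (\<lambda>k::nat. ennreal B)"
      using B by (intro Liminf_mono) (auto elim!: eventually_mono intro: ennreal_leI)
    finally show ?thesis by (simp add: Liminf_const)
  qed
  have "(\<integral>\<^sup>+x. ennreal (norm (f x)) \<partial>lborel) = (\<integral>\<^sup>+x. ennreal (f x) \<partial>lborel)"
    using f0 by (intro nn_integral_cong_AE) auto
  then show i: "integrable lborel f"
    using le by (intro integrableI_bounded) (auto simp: le_less_trans[OF _ ennreal_less_top])
  show "(\<integral>x. f x \<partial>lborel) \<le> B"
    using le nn_integral_eq_integral[OF i f0] B0 by (simp add: ennreal_le_iff)
qed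

lemma L2_Fatou:
  assumes "\<And>k. L2 (F k)" "f \<in> borel_measurable borel" "AE x in lborel. (\<lambda>k. F k x) \<longlonglongrightarrow> f x"
    and "\<forall>\<^sub>F k in sequentially. sqint (F k) \<le> B"
  shows "L2 f" "sqint f \<le> B"
proof -
  have lim: "AE x in lborel. (\<lambda>k. (F k x)\<^sup>2) \<longlonglongrightarrow> (f x)\<^sup>2"
    using assms(3) by eventually_elim (intro tendsto_intros)
  have [measurable]: "f \<in> borel_measurable borel" by fact
  have m: "(\<lambda>x. (f x)\<^sup>2) \<in> borel_measurable borel" by simp
  show "L2 f" "sqint f \<le> B"
    using Fatou_integral[OF _ _ m lim, of B] assms by (auto simp: L2_def sqint_def)
qed

text \<open>Riesz-Fischer. A rapidly converging subsequence converges almost everywhere, and Fatou's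
  lemma for \<open>F m - F (M j)\<close> with growing \<open>j\<close> turns the Cauchy bound into a
  bound on the distance to the limit.\<close>

lemma L2_complete:
  assumes L: "\<And>k. L2 (F k)"
    and C: "\<And>\<epsilon>. \<epsilon> > 0 \<Longrightarrow> \<exists>N. \<forall>m\<ge>N. \<forall>n\<ge>N. sqint (\<lambda>x. F m x - F n x) < \<epsilon>"
  shows "\<exists>f. L2lim F f"
proof -
  have "\<exists>N. \<forall>j. (\<forall>m\<ge>N j. \<forall>n\<ge>N j. sqint (\<lambda>x. F m x - F n x) < (1/8)^j)"
    using C[of "(1/8)^_"] by (intro choice) auto
  then obtain N where N: "\<And>j m n. m \<ge> N j \<Longrightarrow> n \<ge> N j \<Longrightarrow> sqint (\<lambda>x. F m x - F n x) < (1/8)^j" by blast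
  \<comment> \<open>The maximum with \<open>Suc r\<close> makes \<open>M\<close> strictly increasing
    while keeping \<open>M j\<close> beyond the threshold \<open>N j\<close>.\<close>
  define M where "M = rec_nat (N 0) (\<lambda>j r. max (Suc r) (N (Suc j)))"
  have M: "N j \<le> M j" "M j < M (Suc j)" for j
  proof -
    have S: "M (Suc j) = max (Suc (M j)) (N (Suc j))" for j by (simp add: M_def)
    show "M j < M (Suc j)" unfolding S by linarith
    have "M 0 = N 0" by (simp add: M_def)
    then show "N j \<le> M j" using S by (cases j) (simp, metis max.cobounded2)
  qed
  have sm: "strict_mono M" using M(2) by (simp add: strict_mono_Suc_iff)
  define D where "D j x = F (M (Suc j)) x - F (M j) x" for j x
  have DL: "L2 (D j)" for j unfolding D_def by (intro L2_diff L)
  have Ds: "sqint (D j) < (1/8)^j" for j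
    unfolding D_def using N[of j "M (Suc j)" "M j"] M[of j] by auto
  note [measurable] = L2_meas[OF L] L2_meas[OF DL]
  \<comment> \<open>The weight \<open>4^j\<close> against \<open>(1/8)^j\<close> leaves a convergent
    series of integrals. Boundedness of \<open>4^j * (D j x)^2\<close> then gives a geometric bound
    of ratio 1/2 for \<open>D j x\<close> itself.\<close>
  have "AE x in lborel. summable (\<lambda>j. 4^j * (D j x)\<^sup>2)"
  proof -
    have "(\<integral>\<^sup>+x. (\<Sum>j. ennreal (4^j * (D j x)\<^sup>2)) \<partial>lborel) = (\<Sum>j. \<integral>\<^sup>+x. ennreal (4^j * (D j x)\<^sup>2) \<partial>lborel)"
      by (rule nn_integral_suminf) simp
    also have "\<dots> = (\<Sum>j. ennreal (4^j * sqint (D j)))"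
      using DL by (intro suminf_cong) (simp add: nn_integral_eq_integral L2_def sqint_def)
    also have "\<dots> \<le> (\<Sum>j. ennreal ((1/2)^j))"
    proof (intro suminf_le ennreal_leI)
      fix j have "4^j * sqint (D j) \<le> 4^j * (1/8)^j" by (rule mult_left_mono[OF less_imp_le[OF Ds]]) simp
      also have "\<dots> = (4 * (1/8::real))^j" by (simp only: power_mult_distrib)
      also have "\<dots> = (1/2)^j" by simp
      finally show "4^j * sqint (D j) \<le> (1/2)^j" .
    qed auto
    also have "\<dots> < \<infinity>"
    proof -
      have "summable (\<lambda>j. (1/2::real)^j)" by (rule summable_geometric) simp
      then have "(\<Sum>j. ennreal ((1/2)^j)) = ennreal (\<Sum>j. (1/2)^j)" by (intro suminf_ennreal2) auto
      then show ?thesis by simp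
    qed
    finally have "(\<integral>\<^sup>+x. (\<Sum>j. ennreal (4^j * (D j x)\<^sup>2)) \<partial>lborel) \<noteq> \<infinity>" by simp
    then have "AE x in lborel. (\<Sum>j. ennreal (4^j * (D j x)\<^sup>2)) \<noteq> \<infinity>"
      by (intro nn_integral_PInf_AE) auto
    then show ?thesis
      by eventually_elim (use summable_suminf_not_top in auto)
  qed
  then have conv: "AE x in lborel. convergent (\<lambda>j. F (M j) x)"
  proof eventually_elim
    case (elim x)
    have "(\<lambda>j. 4^j * (D j x)\<^sup>2) \<longlonglongrightarrow> 0" by (rule summable_LIMSEQ_zero[OF elim])
    then have "Bseq (\<lambda>j. 4^j * (D j x)\<^sup>2)" by (rule convergent_imp_Bseq[OF convergentI])
    then obtain K where K: "K > 0" "\<And>j. \<bar>4^j * (D j x)\<^sup>2\<bar> \<le> K" by (auto simp: Bseq_def)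
    have "summable (\<lambda>j. D j x)"
    proof (rule summable_comparison_test)
      show "\<exists>N. \<forall>n\<ge>N. norm (D n x) \<le> sqrt K * (1/2)^n"
      proof (intro exI allI impI)
        fix n
        have "(2^n * \<bar>D n x\<bar>)\<^sup>2 \<le> K"
        proof -
          have "(2^n * \<bar>D n x\<bar>)\<^sup>2 = (2^n)\<^sup>2 * (D n x)\<^sup>2" by (simp only: power_mult_distrib power2_abs)
          also have "(2^n)\<^sup>2 = (4::real)^n" by (simp add: power_even_eq[symmetric] power_mult)
          finally show ?thesis using K(2)[of n] by linarith
        qed
        then have "2^n * \<bar>D n x\<bar> \<le> sqrt K" by (rule real_le_rsqrt)
        then show "norm (D n x) \<le> sqrt K * (1/2)^n" by (simp add: field_simps power_divide)
      qed
      show "summable (\<lambda>n. sqrt K * (1/2)^n)" by (intro summable_mult summable_geometric) auto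
    qed
    then have "convergent (\<lambda>n. \<Sum>j<n. D j x)" by (simp add: summable_iff_convergent)
    moreover have "(\<Sum>j<n. D j x) = F (M n) x - F (M 0) x" for n
      by (induction n) (auto simp: D_def)
    ultimately have "convergent (\<lambda>n. F (M n) x - F (M 0) x)" by simp
    then have "convergent (\<lambda>n. F (M n) x - F (M 0) x + F (M 0) x)" by (intro convergent_add convergent_const)
    then show ?case by simp
  qed
  define f where "f x = lim (\<lambda>j. F (M j) x)" for x
  have [measurable]: "f \<in> borel_measurable borel" unfolding f_def by measurable
  have fl: "AE x in lborel. (\<lambda>j. F (M j) x) \<longlonglongrightarrow> f x"
    using conv by eventually_elim (simp add: f_def convergent_LIMSEQ_iff)
  have key: "L2 (\<lambda>x. F m x - f x) \<and> sqint (\<lambda>x. F m x - f x) \<le> \<epsilon>"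
    if "\<And>n. n \<ge> K \<Longrightarrow> sqint (\<lambda>x. F m x - F n x) < \<epsilon>" for m \<epsilon> K
  proof -
    have "AE x in lborel. (\<lambda>j. F m x - F (M j) x) \<longlonglongrightarrow> F m x - f x"
      using fl by eventually_elim (intro tendsto_intros)
    moreover have "\<forall>\<^sub>F j in sequentially. sqint (\<lambda>x. F m x - F (M j) x) \<le> \<epsilon>"
      using eventually_ge_at_top[of K]
      by eventually_elim (metis le_trans less_imp_le seq_suble sm that)
    ultimately show ?thesis
      using L2_Fatou[of "\<lambda>j x. F m x - F (M j) x" "\<lambda>x. F m x - f x" \<epsilon>] by (auto intro: L2_diff L)
  qed
  obtain N1 where "\<forall>m\<ge>N1. \<forall>n\<ge>N1. sqint (\<lambda>x. F m x - F n x) < 1" using C[of 1] by auto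
  then have "L2 (\<lambda>x. F N1 x - f x)" using key[of N1 N1 1] by auto
  then have fL: "L2 f" using L2_diff[OF L[of N1], of "\<lambda>x. F N1 x - f x"] by simp
  have "(\<lambda>k. sqint (\<lambda>x. F k x - f x)) \<longlonglongrightarrow> 0"
  proof (rule LIMSEQ_I)
    fix e :: real assume e: "0 < e"
    then obtain K where "\<forall>m\<ge>K. \<forall>n\<ge>K. sqint (\<lambda>x. F m x - F n x) < e/2" using C[of "e/2"] by auto
    then have "\<forall>k\<ge>K. sqint (\<lambda>x. F k x - f x) \<le> e/2" using key[of K _ "e/2"] by auto
    then show "\<exists>no. \<forall>n\<ge>no. norm (sqint (\<lambda>x. F n x - f x) - 0) < e"
      using e sqint_nonneg by (intro exI[of _ K]) (fastforce simp: abs_of_nonneg)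
  qed
  then show ?thesis using L fL by (auto simp: L2lim_def)
qed

section \<open>Smooth functions\<close>

text \<open>Smoothness is witnessed by the whole sequence of derivatives, so a proof exhibits that
  sequence instead of iterating a derivative operator.\<close>

definition smooth1 :: "(real \<Rightarrow> real) \<Rightarrow> bool" where
  "smooth1 G \<longleftrightarrow> (\<exists>D. D 0 = G \<and> (\<forall>n x. (D n has_real_derivative D (Suc n) x) (at x)))"

lemma smooth1_shift:
  assumes "smooth1 G"
  obtains G' where "smooth1 G'" "\<And>x. (G has_real_derivative G' x) (at x)"
proof -
  obtain D where D: "D 0 = G" "\<And>n x. (D n has_real_derivative D (Suc n) x) (at x)"
    using assms by (auto simp: smooth1_def)
  have "smooth1 (D 1)" unfolding smooth1_def
    by (rule exI[of _ "\<lambda>n. D (Suc n)"]) (use D in auto)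
  then show ?thesis using that[of "D 1"] D(2)[of 0] D(1) by auto
qed

lemma smooth1_exp: "smooth1 exp"
  unfolding smooth1_def by (rule exI[of _ "\<lambda>n. exp"]) (auto intro: DERIV_exp)

lemma pderiv3_eq: "(f has_derivative D) (at x) \<Longrightarrow> pderiv3 i f x = D (axis i 1)"
  unfolding pderiv3_def using frechet_derivative_at by metis

text \<open>\<open>smooth3\<close> speaks of all iterated partial derivatives at once; membership in
  a class of differentiable functions closed under \<open>pderiv3\<close> passes from each order to
  the next.\<close>

lemma smooth3_coinduct:
  assumes "P f" and step: "\<And>f. P f \<Longrightarrow> (\<forall>x. f differentiable at x) \<and> (\<forall>i. P (pderiv3 i f))"
  shows "smooth3 f"
proof -
  have "P (dd is f)" for "is" by (induction "is") (use assms in auto)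
  then show ?thesis using step by (auto simp: smooth3_def)
qed

lemma smooth3_differentiable: "smooth3 f \<Longrightarrow> f differentiable at x"
  unfolding smooth3_def by (metis dd.simps(1))

lemma dd_append: "dd (is @ js) f = dd is (dd js f)"
  by (induction "is") auto

lemma smooth3_pderiv3: "smooth3 f \<Longrightarrow> smooth3 (pderiv3 i f)"
  unfolding smooth3_def using dd_append[of _ "[i]" f] by (metis dd.simps)

lemma smooth3_continuous: "smooth3 f \<Longrightarrow> continuous_on A f"
  by (meson continuous_at_imp_continuous_on differentiable_imp_continuous_within smooth3_differentiable)

lemma smooth3_measurable: "smooth3 f \<Longrightarrow> f \<in> borel_measurable borel"
  by (intro borel_measurable_continuous_onI smooth3_continuous)

lemma smooth3_has_derivative:
  "smooth3 f \<Longrightarrow> (f has_derivative frechet_derivative f (at x)) (at x)"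
  using frechet_derivative_works smooth3_differentiable by blast

lemma smooth3_has_derivative_grad:
  assumes "smooth3 f"
  shows "(f has_derivative (\<lambda>h. grad3 f x \<bullet> h)) (at x)"
proof -
  let ?D = "frechet_derivative f (at x)"
  have D: "(f has_derivative ?D) (at x)" by (rule smooth3_has_derivative[OF assms])
  have lin: "linear ?D" using D has_derivative_linear by blast
  have "?D h = grad3 f x \<bullet> h" for h
  proof -
    have "?D h = ?D (\<Sum>i\<in>UNIV. h $ i *\<^sub>R axis i 1)" by (simp add: basis_expansion scalar_mult_eq_scaleR[symmetric])
    also have "\<dots> = (\<Sum>i\<in>UNIV. h $ i * ?D (axis i 1))"
      using lin by (simp add: linear_sum linear_scale)
    also have "\<dots> = grad3 f x \<bullet> h"
      by (simp add: grad3_def inner_vec_def pderiv3_def mult.commute)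
    finally show ?thesis .
  qed
  then have "?D = (\<lambda>h. grad3 f x \<bullet> h)" by auto
  then show ?thesis using D by simp
qed

lemma pderiv3_const: "pderiv3 i (\<lambda>x. c) = (\<lambda>x. 0)"
  using pderiv3_eq[OF has_derivative_const] by auto

lemma pderiv3_coord: "pderiv3 i (\<lambda>x. x $ j) = (\<lambda>x. if i = j then 1 else 0)"
proof
  fix x :: R3
  have "((\<lambda>x::R3. x $ j) has_derivative (\<lambda>h. h $ j)) (at x)"
    by (rule bounded_linear_imp_has_derivative) (rule bounded_linear_vec_nth)
  from pderiv3_eq[OF this, of i] show "pderiv3 i (\<lambda>x. x $ j) x = (if i = j then 1 else 0)"
    by (auto simp: axis_def)
qed

lemma pderiv3_add:
  assumes "smooth3 f" "smooth3 g"
  shows "pderiv3 i (\<lambda>x. f x + g x) = (\<lambda>x. pderiv3 i f x + pderiv3 i g x)"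
  using pderiv3_eq[OF has_derivative_add[OF smooth3_has_derivative[OF assms(1)] smooth3_has_derivative[OF assms(2)]]]
  by (auto simp: pderiv3_def)

lemma pderiv3_mult:
  assumes "smooth3 f" "smooth3 g"
  shows "pderiv3 i (\<lambda>x. f x * g x) = (\<lambda>x. f x * pderiv3 i g x + pderiv3 i f x * g x)"
  using pderiv3_eq[OF has_derivative_mult[OF smooth3_has_derivative[OF assms(1)] smooth3_has_derivative[OF assms(2)]]]
  by (auto simp: pderiv3_def)

lemma pderiv3_compose:
  assumes "\<And>x. (G has_real_derivative G' x) (at x)" "smooth3 f"
  shows "pderiv3 i (\<lambda>x. G (f x)) = (\<lambda>x. G' (f x) * pderiv3 i f x)"
proof
  fix x
  have "((\<lambda>x. G (f x)) has_derivative (\<lambda>h. G' (f x) * frechet_derivative f (at x) h)) (at x)"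
    by (rule has_derivative_compose[OF smooth3_has_derivative[OF assms(2)], of G "\<lambda>h. G' (f x) * h"])
       (use assms(1) in \<open>simp add: has_field_derivative_def\<close>)
  from pderiv3_eq[OF this] show "pderiv3 i (\<lambda>x. G (f x)) x = G' (f x) * pderiv3 i f x"
    by (simp add: pderiv3_def)
qed

lemma pderiv3_affine:
  assumes "smooth3 f"
  shows "pderiv3 i (\<lambda>x. f (a *\<^sub>R x + b)) = (\<lambda>x. a * pderiv3 i f (a *\<^sub>R x + b))"
proof
  fix x
  have 1: "((\<lambda>x. a *\<^sub>R x + b) has_derivative (\<lambda>h. a *\<^sub>R h)) (at x)"
    by (auto intro!: derivative_eq_intros)
  have "((\<lambda>x. f (a *\<^sub>R x + b)) has_derivative (\<lambda>h. grad3 f (a *\<^sub>R x + b) \<bullet> (a *\<^sub>R h))) (at x)"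
    using has_derivative_compose[OF 1 smooth3_has_derivative_grad[OF assms]] .
  from pderiv3_eq[OF this] show "pderiv3 i (\<lambda>x. f (a *\<^sub>R x + b)) x = a * pderiv3 i f (a *\<^sub>R x + b)"
    by (simp add: grad3_def inner_axis)
qed

text \<open>This class is closed under partial derivatives, hence consists of smooth functions.\<close>
inductive smooth_closure :: "(R3 \<Rightarrow> real) \<Rightarrow> bool" where
  base: "smooth3 f \<Longrightarrow> smooth_closure f"
| add: "smooth_closure f \<Longrightarrow> smooth_closure g \<Longrightarrow> smooth_closure (\<lambda>x. f x + g x)"
| mult: "smooth_closure f \<Longrightarrow> smooth_closure g \<Longrightarrow> smooth_closure (\<lambda>x. f x * g x)"
| comp: "smooth1 G \<Longrightarrow> smooth_closure f \<Longrightarrow> smooth_closure (\<lambda>x. G (f x))"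
| affine: "smooth_closure f \<Longrightarrow> smooth_closure (\<lambda>x. f (a *\<^sub>R x + b))"

lemma smooth3_const: "smooth3 (\<lambda>x. c)"
  by (rule smooth3_coinduct[of "\<lambda>f. \<exists>c. f = (\<lambda>x. c)"]) (auto simp: pderiv3_const)

lemma smooth_closure_pderiv3:
  "smooth_closure f \<Longrightarrow> (\<forall>x. f differentiable at x) \<and> (\<forall>i. smooth_closure (pderiv3 i f))"
proof (induction rule: smooth_closure.induct)
  case (base f)
  then show ?case by (auto intro: smooth_closure.base smooth3_pderiv3 smooth3_differentiable)
next
  case (add f g)
  have "pderiv3 i (\<lambda>x. f x + g x) = (\<lambda>x. pderiv3 i f x + pderiv3 i g x)" for i
    using add.IH pderiv3_eq[OF has_derivative_add[OF iffD1[OF frechet_derivative_works] iffD1[OF frechet_derivative_works]]]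
    by (auto simp: pderiv3_def)
  then show ?case using add by (auto intro: smooth_closure.intros)
next
  case (mult f g)
  have "pderiv3 i (\<lambda>x. f x * g x) = (\<lambda>x. f x * pderiv3 i g x + pderiv3 i f x * g x)" for i
    using mult.IH pderiv3_eq[OF has_derivative_mult[OF iffD1[OF frechet_derivative_works] iffD1[OF frechet_derivative_works]]]
    by (auto simp: pderiv3_def)
  moreover have "smooth_closure (\<lambda>x. f x * pderiv3 i g x + pderiv3 i f x * g x)" for i
    using smooth_closure.add[OF smooth_closure.mult smooth_closure.mult] mult by blast
  ultimately show ?case using mult by (auto intro: differentiable_mult)
next
  case (comp G f)
  obtain G' where G': "smooth1 G'" "\<And>x. (G has_real_derivative G' x) (at x)"
    using smooth1_shift[OF comp(1)] by blast
  have *: "((\<lambda>x. G (f x)) has_derivative (\<lambda>h. G' (f x) * frechet_derivative f (at x) h)) (at x)" for x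
    by (rule has_derivative_compose[of f "frechet_derivative f (at x)" x UNIV G "\<lambda>h. G' (f x) * h"])
       (use comp.IH G' frechet_derivative_works in \<open>auto simp: has_field_derivative_def\<close>)
  have "pderiv3 i (\<lambda>x. G (f x)) = (\<lambda>x. G' (f x) * pderiv3 i f x)" for i
    using pderiv3_eq[OF *] by (auto simp: pderiv3_def)
  moreover have "smooth_closure (\<lambda>x. G' (f x) * pderiv3 i f x)" for i
    using smooth_closure.mult[OF smooth_closure.comp] comp G'(1) by blast
  ultimately show ?case using * by (auto simp: differentiable_def)
next
  case (affine f a b)
  have 1: "((\<lambda>x. a *\<^sub>R x + b) has_derivative (\<lambda>h. a *\<^sub>R h)) (at x)" for x :: R3
    by (auto intro!: derivative_eq_intros)
  have *: "((\<lambda>x. f (a *\<^sub>R x + b)) has_derivative (\<lambda>h. frechet_derivative f (at (a *\<^sub>R x + b)) (a *\<^sub>R h))) (at x)" for x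
    by (rule has_derivative_compose[OF 1]) (use affine.IH frechet_derivative_works in blast)
  have "pderiv3 i (\<lambda>x. f (a *\<^sub>R x + b)) = (\<lambda>x. a * pderiv3 i f (a *\<^sub>R x + b))" for i
  proof
    fix x
    have "linear (frechet_derivative f (at (a *\<^sub>R x + b)))"
      using affine.IH frechet_derivative_works has_derivative_linear by blast
    then show "pderiv3 i (\<lambda>x. f (a *\<^sub>R x + b)) x = a * pderiv3 i f (a *\<^sub>R x + b)"
      unfolding pderiv3_eq[OF *] by (simp add: pderiv3_def linear_scale)
  qed
  moreover have "smooth_closure (\<lambda>x. a * pderiv3 i f (a *\<^sub>R x + b))" for i
    using smooth_closure.mult[OF smooth_closure.base[OF smooth3_const] smooth_closure.affine] affine.IH by blast
  ultimately show ?case using * by (auto simp: differentiable_def)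
qed

lemma smooth3_closure: "smooth_closure f \<Longrightarrow> smooth3 f"
  by (rule smooth3_coinduct[of smooth_closure]) (use smooth_closure_pderiv3 in auto)

lemma smooth3_add: "smooth3 f \<Longrightarrow> smooth3 g \<Longrightarrow> smooth3 (\<lambda>x. f x + g x)"
  by (rule smooth3_closure, rule smooth_closure.add; rule smooth_closure.base)

lemma smooth3_mult: "smooth3 f \<Longrightarrow> smooth3 g \<Longrightarrow> smooth3 (\<lambda>x. f x * g x)"
  by (rule smooth3_closure, rule smooth_closure.mult; rule smooth_closure.base)

lemma smooth3_compose: "smooth1 G \<Longrightarrow> smooth3 f \<Longrightarrow> smooth3 (\<lambda>x. G (f x))"
  by (rule smooth3_closure, rule smooth_closure.comp) (auto intro: smooth_closure.base)

lemma smooth3_affine: "smooth3 f \<Longrightarrow> smooth3 (\<lambda>x. f (a *\<^sub>R x + b))"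
  by (rule smooth3_closure, rule smooth_closure.affine) (auto intro: smooth_closure.base)

lemma smooth3_coord: "smooth3 (\<lambda>x. x $ j)"
proof (rule smooth3_coinduct[of "\<lambda>f. (\<exists>j. f = (\<lambda>x. x $ j)) \<or> smooth3 f"])
  fix f :: "R3 \<Rightarrow> real" assume "(\<exists>j. f = (\<lambda>x. x $ j)) \<or> smooth3 f"
  then show "(\<forall>x. f differentiable at x) \<and> (\<forall>i. (\<exists>j. pderiv3 i f = (\<lambda>x. x $ j)) \<or> smooth3 (pderiv3 i f))"
  proof
    assume "\<exists>j. f = (\<lambda>x. x $ j)"
    then obtain j where f: "f = (\<lambda>x. x $ j)" by blast
    show ?thesis unfolding f
      by (auto simp: pderiv3_coord smooth3_const intro!: bounded_linear_imp_differentiable bounded_linear_vec_nth)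
  qed (auto simp: smooth3_differentiable smooth3_pderiv3)
qed auto

lemma smooth3_scale: "smooth3 f \<Longrightarrow> smooth3 (\<lambda>x. c * f x)"
  using smooth3_mult[OF smooth3_const] .

lemma smooth3_diff: "smooth3 f \<Longrightarrow> smooth3 g \<Longrightarrow> smooth3 (\<lambda>x. f x - g x)"
  using smooth3_add[OF _ smooth3_scale[of g "-1"], of f] by simp

lemma smooth3_power: "smooth3 f \<Longrightarrow> smooth3 (\<lambda>x. f x ^ n)"
  by (induction n) (auto intro: smooth3_const smooth3_mult)

lemma pderiv3_scale: "smooth3 f \<Longrightarrow> pderiv3 i (\<lambda>x. c * f x) = (\<lambda>x. c * pderiv3 i f x)"
  using pderiv3_mult[OF smooth3_const] by (simp add: pderiv3_const)

lemma pderiv3_diff: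
  assumes "smooth3 f" "smooth3 g"
  shows "pderiv3 i (\<lambda>x. f x - g x) = (\<lambda>x. pderiv3 i f x - pderiv3 i g x)"
  using pderiv3_add[OF assms(1) smooth3_scale[OF assms(2), of "-1"], of i] pderiv3_scale[OF assms(2), of i "-1"] by simp

lemma pderiv3_power:
  assumes "smooth3 f"
  shows "pderiv3 i (\<lambda>x. f x ^ n) = (\<lambda>x. real n * f x ^ (n - 1) * pderiv3 i f x)"
  by (rule pderiv3_compose[OF _ assms]) (auto intro!: derivative_eq_intros)

text \<open>The functions \<open>P(1/s) exp(-1/s)\<close>, extended by zero, are closed under
  differentiation: with \<open>t = 1/s\<close> the derivative replaces \<open>P\<close> by
  \<open>t^2 (P - P')\<close>. All derivatives become explicit, including those at 0.\<close>

definition flat :: "real poly \<Rightarrow> real \<Rightarrow> real" where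
  "flat P s = (if 0 < s then poly P (1/s) * exp (-1/s) else 0)"

lemma poly_exp_tendsto_0: "((\<lambda>t. poly P t * exp (-t)) \<longlongrightarrow> (0::real)) at_top"
proof -
  have "((\<lambda>t. (\<Sum>i\<le>degree P. coeff P i * (t ^ i / exp t))) \<longlongrightarrow> (\<Sum>i\<le>degree P. coeff P i * 0)) at_top"
    by (intro tendsto_intros tendsto_power_div_exp_0)
  then show ?thesis
    by (simp add: poly_altdef sum_distrib_right exp_minus divide_inverse mult.assoc)
qed

lemma flat_tendsto_0: "((\<lambda>s. flat P s) \<longlongrightarrow> 0) (at 0)"
proof -
  have "((\<lambda>s. poly P (1/s) * exp (-(1/s))) \<longlongrightarrow> 0) (at_right (0::real))"
    by (rule filterlim_compose[OF poly_exp_tendsto_0])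
       (use filterlim_inverse_at_top_right in \<open>simp add: inverse_eq_divide\<close>)
  then have "((\<lambda>s. flat P s) \<longlongrightarrow> 0) (at_right 0)"
    by (rule Lim_transform_eventually) (auto simp: flat_def eventually_at_filter)
  moreover have "((\<lambda>s. flat P s) \<longlongrightarrow> 0) (at_left 0)"
    by (rule Lim_transform_eventually[OF tendsto_const]) (auto simp: flat_def eventually_at_filter)
  ultimately show ?thesis using filterlim_split_at by blast
qed

lemma flat_deriv:
  "(flat P has_real_derivative flat ([:0,0,1:] * (P - pderiv P)) s) (at s)"
proof (cases s "0::real" rule: linorder_cases)
  case less
  have "(flat P has_real_derivative 0) (at s)"
    by (rule has_field_derivative_transform_within_open[of "\<lambda>_. 0" _ _ "{..<0}"])
       (use less in \<open>auto simp: flat_def\<close>)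
  then show ?thesis using less by (simp add: flat_def)
next
  case greater
  have "((\<lambda>s. poly P (1/s) * exp (-1/s)) has_real_derivative flat ([:0,0,1:] * (P - pderiv P)) s) (at s)"
    using greater by (auto intro!: derivative_eq_intros simp: flat_def field_simps power2_eq_square)
  then show ?thesis
    by (rule has_field_derivative_transform_within_open[of _ _ _ "{0<..}"])
       (use greater in \<open>auto simp: flat_def\<close>)
next
  case equal
  \<comment> \<open>The difference quotient at 0 is again of this form, with \<open>P\<close>
    replaced by \<open>[:0,1:] * P\<close>.\<close>
  have "((\<lambda>h. flat ([:0,1:] * P) h) \<longlongrightarrow> 0) (at 0)" by (rule flat_tendsto_0)
  then have "((\<lambda>h. (flat P h - flat P 0) / (h - 0)) \<longlongrightarrow> 0) (at 0)"
    by (rule Lim_transform_eventually) (auto simp: flat_def eventually_at_filter)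
  then have "(flat P has_real_derivative 0) (at 0)"
    by (simp add: has_field_derivative_iff)
  then show ?thesis using equal by (simp add: flat_def)
qed

text \<open>A smooth convex substitute for the positive part: \<open>s exp(-1/s)\<close> for \<open>s > 0\<close>.\<close>
definition theta :: "real \<Rightarrow> real" where "theta s = s * flat 1 s"
text \<open>Differentiating \<open>s exp(-1/s)\<close> gives \<open>(1 + 1/s) exp(-1/s)\<close> and
  then \<open>s^(-3) exp(-1/s)\<close>; the sign of the latter is the convexity of
  \<open>theta\<close>.\<close>

definition theta' :: "real \<Rightarrow> real" where "theta' = flat [:1,1:]"
definition theta'' :: "real \<Rightarrow> real" where "theta'' = flat [:0,0,0,1:]"

lemma theta_deriv: "(theta has_real_derivative theta' s) (at s)"
proof -
  have "(theta has_real_derivative (1 * flat 1 s + flat ([:0,0,1:] * (1 - pderiv 1)) s * s)) (at s)"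
    unfolding theta_def[abs_def] by (intro DERIV_mult DERIV_ident flat_deriv)
  also have "1 * flat 1 s + flat ([:0,0,1:] * (1 - pderiv 1)) s * s = theta' s"
    by (auto simp: theta'_def flat_def field_simps pderiv_1)
  finally show ?thesis .
qed

lemma theta'_deriv: "(theta' has_real_derivative theta'' s) (at s)"
  using flat_deriv[of "[:1,1:]" s] by (simp add: theta'_def theta''_def pderiv_pCons)

lemma smooth1_flat: "smooth1 (flat P)"
  unfolding smooth1_def
  by (rule exI[of _ "\<lambda>n. flat (((\<lambda>P. [:0,0,1:] * (P - pderiv P)) ^^ n) P)"]) (auto intro: flat_deriv simp del: mult_pCons_left)

lemma smooth1_theta: "smooth1 theta"
proof -
  obtain D where "D 0 = theta'" "\<And>n x. (D n has_real_derivative D (Suc n) x) (at x)"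
    using smooth1_flat[of "[:1,1:]"] by (auto simp: smooth1_def theta'_def)
  then show ?thesis unfolding smooth1_def
    by (intro exI[of _ "\<lambda>n. case n of 0 \<Rightarrow> theta | Suc m \<Rightarrow> D m"]) (auto split: nat.split simp: theta_deriv)
qed

text \<open>\<open>theta\<close> imitates the positive part:
  \<open>theta s \<le> s * theta' s\<close> expresses convexity together with
  \<open>theta 0 = 0\<close>, and the identity \<open>s theta' s = (1 + 1/s) theta s\<close>
  measures the deviation, which is small for large \<open>s\<close>. The constant 1/3 comes from
  \<open>exp 1 \<le> 3\<close>.\<close>

lemma theta_props:
  "s \<le> 0 \<Longrightarrow> theta s = 0" "0 < s \<Longrightarrow> 0 < theta s" "0 \<le> theta s"
  "0 \<le> theta'' s" "0 \<le> theta' s" "s \<le> 0 \<Longrightarrow> theta' s = 0" "0 < s \<Longrightarrow> 0 < theta' s"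
  "theta s \<le> s * theta' s" "0 \<le> s \<Longrightarrow> theta s \<le> s"
  "0 < s \<Longrightarrow> theta' s = (1/s + 1/s^2) * theta s"
  "1 \<le> s \<Longrightarrow> s / 3 \<le> theta s"
proof -
  show "1 \<le> s \<Longrightarrow> s / 3 \<le> theta s"
  proof -
    assume s: "1 \<le> s"
    have "exp (-1) \<le> exp (-1/s)" using s by (simp add: field_simps)
    moreover have "1/3 \<le> exp (-1::real)" using exp_le by (simp add: exp_minus field_simps)
    ultimately have "1/3 \<le> exp (-1/s)" by linarith
    then have "s * (1/3) \<le> s * exp (-1/s)" using s by (intro mult_left_mono) auto
    then show ?thesis using s by (simp add: theta_def flat_def)
  qed
qed (auto simp: theta_def theta'_def theta''_def flat_def field_simps power2_eq_square add_pos_pos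
      intro!: mult_left_mono mult_right_le_one_le)

subsection \<open>Test functions\<close>

lemma test_funD: "test_fun \<Omega> \<phi> \<Longrightarrow> smooth3 \<phi>" by (simp add: test_fun_def)

lemma test_fun_mono: "test_fun A \<phi> \<Longrightarrow> A \<subseteq> B \<Longrightarrow> test_fun B \<phi>" by (auto simp: test_fun_def)

lemma tsupp_mem: "f x \<noteq> 0 \<Longrightarrow> x \<in> tsupp f"
  unfolding tsupp_def by (rule subsetD[OF closure_subset]) simp

lemma tsupp_subset: "closed K \<Longrightarrow> (\<And>x. x \<notin> K \<Longrightarrow> f x = 0) \<Longrightarrow> tsupp f \<subseteq> K"
  unfolding tsupp_def by (rule closure_minimal) auto

lemma test_fun_zero: "test_fun \<Omega> \<phi> \<Longrightarrow> x \<notin> \<Omega> \<Longrightarrow> \<phi> x = 0"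
  using tsupp_mem[of \<phi> x] by (auto simp: test_fun_def)

text \<open>Any compact set outside which the function vanishes will do, so the exact support never
  has to be computed.\<close>

lemma test_funI: "smooth3 \<phi> \<Longrightarrow> compact K \<Longrightarrow> K \<subseteq> \<Omega> \<Longrightarrow> (\<And>x. x \<notin> K \<Longrightarrow> \<phi> x = 0) \<Longrightarrow> test_fun \<Omega> \<phi>"
proof -
  assume a: "smooth3 \<phi>" "compact K" "K \<subseteq> \<Omega>" "\<And>x. x \<notin> K \<Longrightarrow> \<phi> x = 0"
  then have s: "tsupp \<phi> \<subseteq> K" by (intro tsupp_subset compact_imp_closed) auto
  moreover have "closed (tsupp \<phi>)" by (simp add: tsupp_def)
  ultimately have "compact (tsupp \<phi>)" using a(2) by (metis compact_Int_closed inf.absorb_iff2)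
  then show ?thesis using s a by (auto simp: test_fun_def)
qed

lemma pderiv3_tsupp:
  assumes "x \<notin> tsupp f" shows "pderiv3 i f x = 0"
proof -
  have "((\<lambda>_. 0) has_derivative (\<lambda>_. 0)) (at x)" by simp
  then have "(f has_derivative (\<lambda>_. 0)) (at x)"
    by (rule has_derivative_transform_within_open[of _ _ _ _ "- tsupp f"])
       (use assms tsupp_mem[of f] in \<open>auto simp: tsupp_def\<close>)
  from pderiv3_eq[OF this] show ?thesis by simp
qed

lemma test_fun_pderiv3: "test_fun \<Omega> \<phi> \<Longrightarrow> test_fun \<Omega> (pderiv3 i \<phi>)"
  by (rule test_funI[of _ "tsupp \<phi>"]) (auto simp: test_fun_def smooth3_pderiv3 pderiv3_tsupp)

lemma test_fun_mult: "test_fun \<Omega> \<phi> \<Longrightarrow> smooth3 f \<Longrightarrow> test_fun \<Omega> (\<lambda>x. f x * \<phi> x)"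
  by (rule test_funI[of _ "tsupp \<phi>"]) (use tsupp_mem[of \<phi>] in \<open>auto simp: test_fun_def smooth3_mult\<close>)

lemma test_fun_add: "test_fun \<Omega> \<phi> \<Longrightarrow> test_fun \<Omega> \<psi> \<Longrightarrow> test_fun \<Omega> (\<lambda>x. \<phi> x + \<psi> x)"
proof (rule test_funI[of _ "tsupp \<phi> \<union> tsupp \<psi>"])
  fix x assume "x \<notin> tsupp \<phi> \<union> tsupp \<psi>"
  then have "\<phi> x = 0" "\<psi> x = 0" using tsupp_mem by blast+
  then show "\<phi> x + \<psi> x = 0" by simp
qed (auto simp: test_fun_def smooth3_add compact_Un)

lemma test_fun_scale: "test_fun \<Omega> \<phi> \<Longrightarrow> test_fun \<Omega> (\<lambda>x. c * \<phi> x)"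
  by (rule test_fun_mult) (auto intro: smooth3_const)

lemma test_fun_diff: "test_fun \<Omega> \<phi> \<Longrightarrow> test_fun \<Omega> \<psi> \<Longrightarrow> test_fun \<Omega> (\<lambda>x. \<phi> x - \<psi> x)"
  using test_fun_add[OF _ test_fun_scale[of \<Omega> \<psi> "-1"]] by simp

lemma test_fun_power: "test_fun \<Omega> \<phi> \<Longrightarrow> 0 < n \<Longrightarrow> test_fun \<Omega> (\<lambda>x. \<phi> x ^ n)"
  by (rule test_funI[of _ "tsupp \<phi>"])
     (use tsupp_mem[of \<phi>] in \<open>auto simp: test_fun_def smooth3_power\<close>)

lemma test_fun_affine:
  assumes "test_fun \<Omega> \<phi>" "a \<noteq> 0" and sub: "\<And>x. a *\<^sub>R x + b \<in> \<Omega> \<Longrightarrow> x \<in> \<Omega>'"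
  shows "test_fun \<Omega>' (\<lambda>x. \<phi> (a *\<^sub>R x + b))"
proof (rule test_funI)
  let ?K = "(\<lambda>y. (1/a) *\<^sub>R (y - b)) ` tsupp \<phi>"
  show "smooth3 (\<lambda>x. \<phi> (a *\<^sub>R x + b))" using assms by (auto simp: test_fun_def intro: smooth3_affine)
  show "compact ?K" using assms(1)
    by (intro compact_continuous_image continuous_intros) (auto simp: test_fun_def)
  show "?K \<subseteq> \<Omega>'"
    using assms by (force simp: test_fun_def intro!: sub)
  fix x assume x: "x \<notin> ?K"
  have "x = (1/a) *\<^sub>R ((a *\<^sub>R x + b) - b)" using assms(2) by simp
  then have "a *\<^sub>R x + b \<notin> tsupp \<phi>" using x by (metis imageI)
  then show "\<phi> (a *\<^sub>R x + b) = 0" using tsupp_mem by metis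
qed

lemma test_fun_continuous: "test_fun \<Omega> \<phi> \<Longrightarrow> continuous_on A \<phi>"
  by (simp add: test_fun_def smooth3_continuous)

lemma test_fun_measurable: "test_fun \<Omega> \<phi> \<Longrightarrow> \<phi> \<in> borel_measurable borel"
  by (simp add: test_fun_def smooth3_measurable)

lemma test_fun_bounded:
  assumes "test_fun \<Omega> \<phi>" obtains K where "0 < K" "\<And>x. \<bar>\<phi> x\<bar> \<le> K"
proof -
  have "compact (\<phi> ` tsupp \<phi>)"
    using assms by (intro compact_continuous_image test_fun_continuous[OF assms]) (auto simp: test_fun_def)
  then obtain K where K: "0 < K" "\<And>y. y \<in> \<phi> ` tsupp \<phi> \<Longrightarrow> norm y \<le> K"
    using compact_imp_bounded bounded_pos by metis
  have "\<bar>\<phi> x\<bar> \<le> K" for x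
    using K tsupp_mem[of \<phi> x] by (cases "\<phi> x = 0") auto
  then show ?thesis using K(1) that by blast
qed

lemma test_fun_supp_ball:
  assumes "test_fun \<Omega> \<phi>" obtains M where "0 < M" "\<And>x. x \<notin> ball 0 M \<Longrightarrow> \<phi> x = 0"
proof -
  have "bounded (tsupp \<phi>)" using assms compact_imp_bounded by (auto simp: test_fun_def)
  then obtain M where "0 < M" "tsupp \<phi> \<subseteq> ball 0 M" using bounded_subset_ballD by blast
  then show ?thesis using tsupp_mem[of \<phi>] that by blast
qed

lemma integrable_bounded_ball:
  fixes f :: "R3 \<Rightarrow> real"
  assumes "f \<in> borel_measurable borel" "\<And>x. \<bar>f x\<bar> \<le> K" "\<And>x. x \<notin> ball 0 M \<Longrightarrow> f x = 0"
  shows "integrable lborel f"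
proof (rule Bochner_Integration.integrable_bound)
  have "emeasure lborel (ball (0::R3) M) < \<infinity>" by (rule emeasure_bounded_finite) simp
  then show "integrable lborel (\<lambda>x::R3. K * indicator (ball 0 M) x)" by simp
  show "AE x in lborel. norm (f x) \<le> norm (K * indicator (ball 0 M) x)"
    using assms(2,3) by (intro always_eventually) (auto simp: indicator_def split: if_splits intro: order_trans[OF assms(2)])
qed (use assms in auto)

lemma test_fun_integrable:
  assumes "test_fun \<Omega> \<phi>" shows "integrable lborel \<phi>"
  using integrable_bounded_ball test_fun_bounded[OF assms] test_fun_supp_ball[OF assms] test_fun_measurable[OF assms] by metis

lemma test_fun_L2:
  assumes "test_fun \<Omega> \<phi>" shows "L2 \<phi>"
  using test_fun_integrable[OF test_fun_power[OF assms, of 2]] test_fun_measurable[OF assms] by (simp add: L2_def)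

lemma test_fun_lipschitz:
  assumes "test_fun \<Omega> \<phi>" obtains K where "0 < K" "\<And>x y. \<bar>\<phi> x - \<phi> y\<bar> \<le> K * norm (x - y)"
proof -
  have "\<exists>K>0. \<forall>x. \<bar>pderiv3 i \<phi> x\<bar> \<le> K" for i
    using test_fun_bounded[OF test_fun_pderiv3[OF assms, of i]] by metis
  then obtain K where K: "\<And>i. 0 < K i" "\<And>i x. \<bar>pderiv3 i \<phi> x\<bar> \<le> K i" by metis
  have g: "norm (grad3 \<phi> x) \<le> (\<Sum>i\<in>UNIV. K i)" for x
    by (rule order_trans[OF norm_le_l1_cart]) (auto intro!: sum_mono K simp: grad3_def)
  have "\<bar>\<phi> x - \<phi> y\<bar> \<le> (\<Sum>i\<in>UNIV. K i) * norm (x - y)" for x y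
  proof -
    have "norm (\<phi> x - \<phi> y) \<le> (\<Sum>i\<in>UNIV. K i) * norm (x - y)"
    proof (rule differentiable_bound[of UNIV \<phi> "\<lambda>x h. grad3 \<phi> x \<bullet> h"])
      show "onorm ((\<bullet>) (grad3 \<phi> x)) \<le> sum K UNIV" for x
        using g[of x] by (intro onorm_bound) (auto intro!: order_trans[OF Cauchy_Schwarz_ineq2] mult_right_mono sum_nonneg less_imp_le[OF K(1)])
    qed (use smooth3_has_derivative_grad test_funD[OF assms] in auto)
    then show ?thesis by simp
  qed
  moreover have "0 < (\<Sum>i\<in>UNIV. K i)" using K(1) by (intro sum_pos) auto
  ultimately show ?thesis using that by blast
qed

section \<open>Integration by parts and the Sobolev inequality\<close>

text \<open>One change of variables covers translations (\<open>c = 1\<close>), reflections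
  (\<open>c = -1\<close>) and dilations; the cube is the Jacobian in three dimensions.\<close>

lemma integral_affine3:
  fixes f :: "R3 \<Rightarrow> real"
  assumes "c \<noteq> 0" and [measurable]: "f \<in> borel_measurable borel"
  shows "(\<integral>x. f x \<partial>lborel) = \<bar>c\<bar>^3 * (\<integral>x. f (c *\<^sub>R x + t) \<partial>lborel)"
    "integrable lborel f \<longleftrightarrow> integrable lborel (\<lambda>x. f (c *\<^sub>R x + t))"
proof -
  have *: "lborel = density (distr lborel borel (\<lambda>x::R3. t + c *\<^sub>R x)) (\<lambda>_. \<bar>c\<bar>^3)"
    using lborel_affine[OF assms(1), of t] by simp
  show "(\<integral>x. f x \<partial>lborel) = \<bar>c\<bar>^3 * (\<integral>x. f (c *\<^sub>R x + t) \<partial>lborel)"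
    by (subst *) (simp add: integral_density integral_distr add.commute)
  show "integrable lborel f \<longleftrightarrow> integrable lborel (\<lambda>x. f (c *\<^sub>R x + t))"
    using assms(1) by (subst *) (simp add: integrable_density integrable_distr_eq add.commute)
qed

lemma line_deriv:
  assumes "smooth3 f"
  shows "((\<lambda>t. f (x + t *\<^sub>R axis i 1)) has_real_derivative pderiv3 i f (x + t *\<^sub>R axis i 1)) (at t)"
proof -
  have 1: "((\<lambda>t. x + t *\<^sub>R axis i 1) has_derivative (\<lambda>h. h *\<^sub>R axis i 1)) (at t)"
    by (auto intro!: derivative_eq_intros)
  have "((\<lambda>t. f (x + t *\<^sub>R axis i 1)) has_derivative (\<lambda>h. grad3 f (x + t *\<^sub>R axis i 1) \<bullet> (h *\<^sub>R axis i 1))) (at t)"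
    using has_derivative_compose[OF 1 smooth3_has_derivative_grad[OF assms]] .
  moreover have "(\<lambda>h. grad3 f (x + t *\<^sub>R axis i 1) \<bullet> (h *\<^sub>R axis i 1)) = (*) (pderiv3 i f (x + t *\<^sub>R axis i 1))"
    by (auto simp: grad3_def inner_axis)
  ultimately show ?thesis by (simp add: has_field_derivative_def)
qed

text \<open>Translation invariance: difference quotients have integral zero.\<close>
lemma integral_pderiv3_test:
  assumes \<phi>: "test_fun \<Omega> \<phi>"
  shows "(\<integral>x. pderiv3 i \<phi> x \<partial>lborel) = 0"
proof -
  let ?e = "axis i 1 :: R3"
  define h where "h n = 1 / real (Suc n)" for n
  have h: "0 < h n" "h n \<le> 1" for n by (auto simp: h_def)
  have h0: "h \<longlonglongrightarrow> 0" unfolding h_def by (rule LIMSEQ_inverse_real_of_nat[unfolded inverse_eq_divide])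
  obtain K where K: "0 < K" "\<And>x y. \<bar>\<phi> x - \<phi> y\<bar> \<le> K * norm (x - y)" using test_fun_lipschitz[OF \<phi>] by metis
  obtain M where M: "0 < M" "\<And>x. x \<notin> ball 0 M \<Longrightarrow> \<phi> x = 0" using test_fun_supp_ball[OF \<phi>] by metis
  note [measurable] = test_fun_measurable[OF \<phi>] test_fun_measurable[OF test_fun_pderiv3[OF \<phi>]]
  define s where "s n x = (\<phi> (x + h n *\<^sub>R ?e) - \<phi> x) / h n" for n x
  have "(\<lambda>n. \<integral>x. s n x \<partial>lborel) \<longlonglongrightarrow> (\<integral>x. pderiv3 i \<phi> x \<partial>lborel)"
  \<comment> \<open>The steps \<open>h n\<close> are at most 1, so the difference quotients, bounded
    by the Lipschitz constant, all live in the ball of radius \<open>M + 1\<close>.\<close>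
  proof (rule integral_dominated_convergence[of _ _ _ "\<lambda>x. K * indicator (ball 0 (M + 1)) x"])
    have "emeasure lborel (ball (0::R3) (M + 1)) < \<infinity>" by (rule emeasure_bounded_finite) simp
    then show "integrable lborel (\<lambda>x::R3. K * indicator (ball 0 (M + 1)) x)" by simp
    show "AE x in lborel. (\<lambda>n. s n x) \<longlonglongrightarrow> pderiv3 i \<phi> x"
    proof (rule AE_I2)
      fix x
      have "((\<lambda>t. (\<phi> (x + t *\<^sub>R ?e) - \<phi> x) / t) \<longlongrightarrow> pderiv3 i \<phi> x) (at 0)"
        using line_deriv[OF test_funD[OF \<phi>], of x i 0] by (simp add: has_field_derivative_iff)
      then show "(\<lambda>n. s n x) \<longlonglongrightarrow> pderiv3 i \<phi> x"
        unfolding s_def by (rule filterlim_compose) (use h h0 in \<open>auto simp: filterlim_at eventually_sequentially less_imp_neq[symmetric]\<close>)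
    qed
    show "AE x in lborel. norm (s n x) \<le> K * indicator (ball 0 (M + 1)) x" for n
    proof (rule AE_I2)
      fix x :: R3
      have ne: "norm (h n *\<^sub>R ?e) = h n" using h[of n] by (simp add: norm_axis_1)
      show "norm (s n x) \<le> K * indicator (ball 0 (M + 1)) x"
      proof (cases "x \<in> ball 0 (M + 1)")
        case True
        have "\<bar>\<phi> (x + h n *\<^sub>R ?e) - \<phi> x\<bar> \<le> K * h n" using K(2)[of "x + h n *\<^sub>R ?e" x] ne by simp
        then show ?thesis using True h[of n] by (simp add: s_def field_simps)
      next
        case False
        have "norm x \<le> norm (x + h n *\<^sub>R ?e) + norm (h n *\<^sub>R ?e)" by (metis add_diff_cancel_right' norm_triangle_ineq4)
        then have "x + h n *\<^sub>R ?e \<notin> ball 0 M" "x \<notin> ball 0 M" using False h[of n] ne by auto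
        then show ?thesis using M(2) False by (simp add: s_def)
      qed
    qed
  qed (simp_all add: s_def)
  moreover have "(\<integral>x. s n x \<partial>lborel) = 0" for n
  proof -
    have i: "integrable lborel (\<lambda>x. \<phi> (1 *\<^sub>R x + h n *\<^sub>R ?e))"
      using integral_affine3(2)[of 1 \<phi> "h n *\<^sub>R ?e"] test_fun_integrable[OF \<phi>] by simp
    have "(\<integral>x. \<phi> (1 *\<^sub>R x + h n *\<^sub>R ?e) \<partial>lborel) = (\<integral>x. \<phi> x \<partial>lborel)"
      using integral_affine3(1)[of 1 \<phi> "h n *\<^sub>R ?e"] by simp
    then show ?thesis unfolding s_def
      using i test_fun_integrable[OF \<phi>] by simp
  qed
  ultimately show ?thesis by (simp add: LIMSEQ_const_iff)
qed

lemma test_fun_by_parts: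
  assumes \<phi>: "test_fun \<Omega> \<phi>" and f: "smooth3 f"
  shows "(\<integral>x. f x * pderiv3 i \<phi> x \<partial>lborel) = - (\<integral>x. pderiv3 i f x * \<phi> x \<partial>lborel)"
proof -
  have "(\<integral>x. f x * pderiv3 i \<phi> x + pderiv3 i f x * \<phi> x \<partial>lborel) = 0"
    using integral_pderiv3_test[OF test_fun_mult[OF \<phi> f], of i]
    by (simp add: pderiv3_mult[OF f test_funD[OF \<phi>]])
  moreover have "integrable lborel (\<lambda>x. f x * pderiv3 i \<phi> x)" "integrable lborel (\<lambda>x. pderiv3 i f x * \<phi> x)"
    by (intro test_fun_integrable[of \<Omega>] test_fun_mult test_fun_pderiv3 \<phi> f smooth3_pderiv3)+
  ultimately show ?thesis by simp
qed

lemma grad3_nth [simp]: "grad3 f x $ i = pderiv3 i f x"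
  by (simp add: grad3_def)

lemma has_weak_grad_test:
  assumes "test_fun \<Omega> \<phi>"
  shows "has_weak_grad \<phi> (grad3 \<phi>)"
  unfolding has_weak_grad_def
  using test_fun_L2[OF test_fun_pderiv3[OF assms]] test_fun_by_parts[OF _ test_funD[OF assms]] by simp

text \<open>The fundamental theorem of calculus along the line through \<open>x\<close>, started
  outside the support. Extending the integral to the whole line makes the bound independent of the
  i-th coordinate, which the Gagliardo argument requires.\<close>

lemma line_bound:
  assumes \<phi>: "test_fun \<Omega> \<phi>"
  shows "ennreal \<bar>\<phi> x\<bar> \<le> (\<integral>\<^sup>+s. ennreal \<bar>pderiv3 i \<phi> (x + s *\<^sub>R axis i 1)\<bar> \<partial>lborel)"
proof -
  let ?e = "axis i 1 :: R3"
  obtain M where M: "0 < M" "\<And>x. x \<notin> ball 0 M \<Longrightarrow> \<phi> x = 0" using test_fun_supp_ball[OF \<phi>] by metis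
  define L where "L = M + norm x"
  have L: "0 \<le> L" using M by (simp add: L_def)
  have "norm (x + (-L) *\<^sub>R ?e) \<ge> M"
  proof -
    have "norm (L *\<^sub>R ?e) \<le> norm (x + (-L) *\<^sub>R ?e) + norm x"
      using norm_triangle_ineq4[of x "x + (-L) *\<^sub>R ?e"] by (simp add: norm_minus_commute)
    then show ?thesis using L by (simp add: L_def norm_axis_1)
  qed
  then have z: "\<phi> (x + (-L) *\<^sub>R ?e) = 0" by (intro M(2)) auto
  let ?f = "\<lambda>s. pderiv3 i \<phi> (x + s *\<^sub>R ?e)"
  have cont: "continuous_on UNIV ?f"
    by (rule continuous_on_compose2[OF test_fun_continuous[OF test_fun_pderiv3[OF \<phi>], of UNIV i]])
       (auto intro!: continuous_intros)
  have "has_bochner_integral lborel (\<lambda>s. ?f s * indicator {-L..0} s) (\<phi> (x + 0 *\<^sub>R ?e) - \<phi> (x + (-L) *\<^sub>R ?e))"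
    by (rule has_bochner_integral_FTC_Icc_real[where F="\<lambda>s. \<phi> (x + s *\<^sub>R ?e)"])
       (use L cont line_deriv[OF test_funD[OF \<phi>], of x i] in \<open>auto simp: continuous_on_eq_continuous_at\<close>)
  then have I: "integrable lborel (\<lambda>s. ?f s * indicator {-L..0} s)" "(\<integral>s. ?f s * indicator {-L..0} s \<partial>lborel) = \<phi> x"
    using z by (auto simp: has_bochner_integral_iff)
  have "ennreal \<bar>\<phi> x\<bar> \<le> (\<integral>\<^sup>+s. ennreal (norm (?f s * indicator {-L..0} s)) \<partial>lborel)"
    using integral_norm_bound_ennreal[OF I(1)] I(2) by simp
  also have "\<dots> \<le> (\<integral>\<^sup>+s. ennreal \<bar>?f s\<bar> \<partial>lborel)"
    by (intro nn_integral_mono) (auto simp: indicator_def)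
  finally show ?thesis .
qed

section \<open>Coordinates and iterated integrals on three-space\<close>

definition vec3 :: "real \<Rightarrow> real \<Rightarrow> real \<Rightarrow> R3" where
  "vec3 a b c = a *\<^sub>R axis 1 1 + b *\<^sub>R axis 2 1 + c *\<^sub>R axis 3 1"

lemma vec3_nth [simp]: "vec3 a b c $ 1 = a" "vec3 a b c $ 2 = b" "vec3 a b c $ 3 = c"
  by (simp_all add: vec3_def axis_def)

lemma vec3_eta: "vec3 (x $ 1) (x $ 2) (x $ 3) = x"
  by (simp add: vec_eq_iff forall_3)

lemma vec3_shift:
  "vec3 a b c + s *\<^sub>R axis 1 1 = vec3 (a + s) b c"
  "vec3 a b c + s *\<^sub>R axis 2 1 = vec3 a (b + s) c"
  "vec3 a b c + s *\<^sub>R axis 3 1 = vec3 a b (c + s)"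
  by (simp_all add: vec3_def algebra_simps)

lemma prod_3: "(\<Prod>i\<in>(UNIV::3 set). f i) = f 1 * f 2 * (f 3 :: real)"
  unfolding UNIV_3 by (simp add: ac_simps)

lemma vec3_measurable: "(\<lambda>p. vec3 (fst p) (fst (snd p)) (snd (snd p))) \<in> borel_measurable borel"
  unfolding vec3_def by (intro borel_measurable_continuous_onI continuous_intros)

text \<open>Lebesgue measure is determined by its values on boxes, and the preimage of a box under
  the coordinate map is a product of three intervals.\<close>

lemma lborel_vec3:
  "distr lborel borel (\<lambda>p. vec3 (fst p) (fst (snd p)) (snd (snd p))) = lborel"
proof (rule lborel_eqI[symmetric])
  let ?v = "\<lambda>p. vec3 (fst p) (fst (snd p)) (snd (snd p))"
  fix l u :: R3
  assume le: "\<And>b. b \<in> Basis \<Longrightarrow> l \<bullet> b \<le> u \<bullet> b"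
  have le': "l $ i \<le> u $ i" for i using le[of "axis i 1"] by (auto simp: inner_axis Basis_vec_def)
  have box: "?v -` box l u = {l$1<..<u$1} \<times> ({l$2<..<u$2} \<times> {l$3<..<u$3})"
    by (auto simp: mem_box_cart forall_3)
  have B: "(Basis :: R3 set) = (\<lambda>i. axis i 1) ` UNIV" by (auto simp: Basis_vec_def)
  have inj: "inj (\<lambda>i::3. axis i (1::real))" by (auto simp: inj_on_def axis_eq_axis)
  have "(\<Prod>b\<in>(Basis :: R3 set). (u - l) \<bullet> b) = (\<Prod>i\<in>UNIV. (u - l) $ i)"
    unfolding B by (subst prod.reindex[OF inj]) (simp add: inner_axis)
  also have "\<dots> = (u$1-l$1) * (u$2-l$2) * (u$3-l$3)" by (simp add: prod_3)
  finally have P: "(\<Prod>b\<in>(Basis :: R3 set). (u - l) \<bullet> b) = (u$1-l$1) * (u$2-l$2) * (u$3-l$3)" .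
  have "emeasure (distr lborel borel ?v) (box l u) = emeasure lborel (?v -` box l u)"
  proof -
    have "?v \<in> measurable lborel borel" using vec3_measurable by simp
    then show ?thesis by (subst emeasure_distr) simp_all
  qed
  also have "\<dots> = emeasure (lborel \<Otimes>\<^sub>M lborel) ({l$1<..<u$1} \<times> ({l$2<..<u$2} \<times> {l$3<..<u$3}))"
    unfolding box by (simp add: lborel_prod)
  also have "\<dots> = emeasure lborel {l$1<..<u$1} * emeasure lborel ({l$2<..<u$2} \<times> {l$3<..<u$3})"
    by (rule lborel.emeasure_pair_measure_Times) (auto simp: borel_Times)
  also have "emeasure lborel ({l$2<..<u$2} \<times> {l$3<..<u$3}) = emeasure (lborel \<Otimes>\<^sub>M lborel) ({l$2<..<u$2} \<times> {l$3<..<u$3})"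
    by (simp add: lborel_prod)
  also have "\<dots> = emeasure lborel {l$2<..<u$2} * emeasure lborel {l$3<..<u$3}"
    by (rule lborel.emeasure_pair_measure_Times) auto
  also have "emeasure lborel {l$1<..<u$1} * (emeasure lborel {l$2<..<u$2} * emeasure lborel {l$3<..<u$3})
      = ennreal ((u$1-l$1) * (u$2-l$2) * (u$3-l$3))"
  proof -
    have "emeasure lborel {l$i<..<u$i} = ennreal (u$i - l$i)" for i using le'[of i] by simp
    then show ?thesis using le' by (simp add: ennreal_mult mult.assoc)
  qed
  finally show "emeasure (distr lborel borel ?v) (box l u) = ennreal (\<Prod>b\<in>Basis. (u - l) \<bullet> b)"
    unfolding P by simp
qed simp

lemma nn_pair:
  fixes f :: "'a::euclidean_space \<times> 'b::euclidean_space \<Rightarrow> ennreal"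
  assumes [measurable]: "f \<in> borel_measurable borel"
  shows "(\<integral>\<^sup>+p. f p \<partial>lborel) = (\<integral>\<^sup>+a. \<integral>\<^sup>+b. f (a, b) \<partial>lborel \<partial>lborel)"
  using lborel.nn_integral_fst[of f "lborel :: 'a measure"] assms
  by (simp add: lborel_prod)

lemma nn_swap:
  fixes f :: "'a::euclidean_space \<Rightarrow> 'b::euclidean_space \<Rightarrow> ennreal"
  assumes "(\<lambda>p. f (fst p) (snd p)) \<in> borel_measurable borel"
  shows "(\<integral>\<^sup>+a. \<integral>\<^sup>+b. f a b \<partial>lborel \<partial>lborel) = (\<integral>\<^sup>+b. \<integral>\<^sup>+a. f a b \<partial>lborel \<partial>lborel)"
  using lborel_pair.Fubini'[of f] assms by (simp add: lborel_prod split_beta')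

lemma nn_integral_R3:
  assumes [measurable]: "f \<in> borel_measurable borel"
  shows "(\<integral>\<^sup>+x. f x \<partial>lborel) = (\<integral>\<^sup>+a. \<integral>\<^sup>+b. \<integral>\<^sup>+c. f (vec3 a b c) \<partial>lborel \<partial>lborel \<partial>lborel)"
proof -
  let ?v = "\<lambda>p. vec3 (fst p) (fst (snd p)) (snd (snd p))"
  note [measurable] = vec3_measurable
  have "(\<integral>\<^sup>+x. f x \<partial>lborel) = (\<integral>\<^sup>+p. f (?v p) \<partial>lborel)"
    by (subst lborel_vec3[symmetric]) (simp add: nn_integral_distr)
  also have "\<dots> = (\<integral>\<^sup>+a. \<integral>\<^sup>+q. f (?v (a, q)) \<partial>lborel \<partial>lborel)"
    by (rule nn_pair) measurable
  also have "\<dots> = (\<integral>\<^sup>+a. \<integral>\<^sup>+b. \<integral>\<^sup>+c. f (?v (a, (b, c))) \<partial>lborel \<partial>lborel \<partial>lborel)"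
  proof (intro nn_integral_cong nn_pair)
    fix a :: real
    have "(\<lambda>q::real\<times>real. vec3 a (fst q) (snd q)) \<in> borel_measurable borel"
      unfolding vec3_def by (intro borel_measurable_continuous_onI continuous_intros)
    then show "(\<lambda>q. f (?v (a, q))) \<in> borel_measurable borel" by simp
  qed
  finally show ?thesis by simp
qed

definition gradsq :: "(R3 \<Rightarrow> R3) \<Rightarrow> real" where
  "gradsq g = (\<Sum>i\<in>UNIV. sqint (\<lambda>x. g x $ i))"

lemma gradsq_nonneg: "0 \<le> gradsq g"
  unfolding gradsq_def by (intro sum_nonneg sqint_nonneg)

lemma gradsq_ge: "sqint (\<lambda>x. g x $ i) \<le> gradsq g"
  unfolding gradsq_def by (rule member_le_sum) (auto intro: sqint_nonneg)

text \<open>A square root that is total on the extended nonnegative reals, so that line integrals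
  can be combined without first proving them finite.\<close>

definition esqrt :: "ennreal \<Rightarrow> ennreal" where
  "esqrt y = (if y = \<infinity> then \<infinity> else ennreal (sqrt (enn2real y)))"

lemma esqrt_sq: "esqrt y ^ 2 = y"
  by (cases y) (auto simp: esqrt_def ennreal_power)

lemma esqrt_measurable [measurable]: "esqrt \<in> borel_measurable borel"
  unfolding esqrt_def by measurable

lemma le_esqrt: "x ^ 2 \<le> y \<Longrightarrow> x \<le> esqrt y"
  by (cases x; cases y) (auto simp: esqrt_def ennreal_power real_le_rsqrt top_unique)

lemma borel_measurable_inner_integral:
  fixes f :: "'a::euclidean_space \<Rightarrow> 'b::euclidean_space \<Rightarrow> ennreal"
  assumes "(\<lambda>q. f (fst q) (snd q)) \<in> borel_measurable borel"
  shows "(\<lambda>x. \<integral>\<^sup>+y. f x y \<partial>lborel) \<in> borel_measurable borel"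
proof -
  have "(\<lambda>(x, y). f x y) \<in> borel_measurable (borel \<Otimes>\<^sub>M lborel)"
    using assms unfolding borel_prod[symmetric] split_beta'
    by (simp add: measurable_cong_sets[OF sets_pair_measure_cong[OF refl sets_lborel] refl])
  then show ?thesis by (rule lborel.borel_measurable_nn_integral)
qed

text \<open>Each factor omits one coordinate. Cauchy-Schwarz in \<open>c\<close> bounds
  \<open>H (a, b)\<close> squared by a function of \<open>b\<close> times a function of
  \<open>a\<close>; Cauchy-Schwarz in \<open>(a, b)\<close> against \<open>G3\<close> then leaves
  the integral of \<open>H^2\<close>, which factors.\<close>

lemma Loomis_Whitney:
  fixes G1 G2 G3 :: "real \<Rightarrow> real \<Rightarrow> ennreal"
  assumes m1: "(\<lambda>p. G1 (fst p) (snd p)) \<in> borel_measurable borel"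
    and m2: "(\<lambda>p. G2 (fst p) (snd p)) \<in> borel_measurable borel"
    and m3: "(\<lambda>p. G3 (fst p) (snd p)) \<in> borel_measurable borel"
  shows "(\<integral>\<^sup>+a. \<integral>\<^sup>+b. \<integral>\<^sup>+c. G1 b c * G2 a c * G3 a b \<partial>lborel \<partial>lborel \<partial>lborel)\<^sup>2
    \<le> (\<integral>\<^sup>+b. \<integral>\<^sup>+c. (G1 b c)\<^sup>2 \<partial>lborel \<partial>lborel) * (\<integral>\<^sup>+a. \<integral>\<^sup>+c. (G2 a c)\<^sup>2 \<partial>lborel \<partial>lborel)
      * (\<integral>\<^sup>+a. \<integral>\<^sup>+b. (G3 a b)\<^sup>2 \<partial>lborel \<partial>lborel)"
proof -
  have bp: "borel = (borel \<Otimes>\<^sub>M borel :: (real \<times> real) measure)" by (simp add: borel_prod)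
  note [measurable] = m1[unfolded bp] m2[unfolded bp] m3[unfolded bp]
  have s1: "(\<lambda>c. G1 b c) \<in> borel_measurable borel" for b
    using measurable_compose[OF measurable_Pair1' m1[unfolded bp], of b] by simp
  have s2: "(\<lambda>c. G2 b c) \<in> borel_measurable borel" for b
    using measurable_compose[OF measurable_Pair1' m2[unfolded bp], of b] by simp
  note [measurable] = s1 s2
  define H where "H p = (\<integral>\<^sup>+c. G1 (snd p) c * G2 (fst p) c \<partial>lborel)" for p :: "real \<times> real"
  have G1': "(\<lambda>q::(real\<times>real)\<times>real. G1 (snd (fst q)) (snd q)) \<in> borel_measurable borel"
  proof -
    have "(\<lambda>q::(real\<times>real)\<times>real. (snd (fst q), snd q)) \<in> borel_measurable borel"
      by (intro borel_measurable_continuous_onI continuous_intros)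
    from measurable_compose[OF this m1] show ?thesis by simp
  qed
  have G2': "(\<lambda>q::(real\<times>real)\<times>real. G2 (fst (fst q)) (snd q)) \<in> borel_measurable borel"
  proof -
    have "(\<lambda>q::(real\<times>real)\<times>real. (fst (fst q), snd q)) \<in> borel_measurable borel"
      by (intro borel_measurable_continuous_onI continuous_intros)
    from measurable_compose[OF this m2] show ?thesis by simp
  qed
  have Hb: "H \<in> borel_measurable borel"
    unfolding H_def by (rule borel_measurable_inner_integral) (intro borel_measurable_times_ennreal G1' G2')
  have H2: "H (a, b) ^ 2 \<le> (\<integral>\<^sup>+c. (G1 b c)\<^sup>2 \<partial>lborel) * (\<integral>\<^sup>+c. (G2 a c)\<^sup>2 \<partial>lborel)" for a b
    unfolding H_def fst_conv snd_conv by (rule Cauchy_Schwarz_nn_integral) auto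
  have "(\<integral>\<^sup>+a. \<integral>\<^sup>+b. \<integral>\<^sup>+c. G1 b c * G2 a c * G3 a b \<partial>lborel \<partial>lborel \<partial>lborel)
     = (\<integral>\<^sup>+a. \<integral>\<^sup>+b. H (a, b) * G3 a b \<partial>lborel \<partial>lborel)"
    unfolding H_def by (intro nn_integral_cong) (simp add: nn_integral_multc)
  also have "\<dots> = (\<integral>\<^sup>+p. H p * G3 (fst p) (snd p) \<partial>lborel)"
    using Hb m3 by (subst nn_pair) auto
  finally have "(\<integral>\<^sup>+a. \<integral>\<^sup>+b. \<integral>\<^sup>+c. G1 b c * G2 a c * G3 a b \<partial>lborel \<partial>lborel \<partial>lborel)\<^sup>2
     \<le> (\<integral>\<^sup>+p. (H p)\<^sup>2 \<partial>lborel) * (\<integral>\<^sup>+p. (G3 (fst p) (snd p))\<^sup>2 \<partial>lborel)"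
    using Cauchy_Schwarz_nn_integral[of H lborel "\<lambda>p. G3 (fst p) (snd p)"] Hb m3 by simp
  also have "(\<integral>\<^sup>+p. (G3 (fst p) (snd p))\<^sup>2 \<partial>lborel) = (\<integral>\<^sup>+a. \<integral>\<^sup>+b. (G3 a b)\<^sup>2 \<partial>lborel \<partial>lborel)"
    using m3 by (subst nn_pair) auto
  also have "(\<integral>\<^sup>+p. (H p)\<^sup>2 \<partial>lborel) = (\<integral>\<^sup>+a. \<integral>\<^sup>+b. (H (a, b))\<^sup>2 \<partial>lborel \<partial>lborel)"
    using Hb by (subst nn_pair) auto
  also have "\<dots> \<le> (\<integral>\<^sup>+a. \<integral>\<^sup>+b. (\<integral>\<^sup>+c. (G1 b c)\<^sup>2 \<partial>lborel) * (\<integral>\<^sup>+c. (G2 a c)\<^sup>2 \<partial>lborel) \<partial>lborel \<partial>lborel)"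
    by (intro nn_integral_mono H2)
  also have "\<dots> = (\<integral>\<^sup>+b. \<integral>\<^sup>+c. (G1 b c)\<^sup>2 \<partial>lborel \<partial>lborel) * (\<integral>\<^sup>+a. \<integral>\<^sup>+c. (G2 a c)\<^sup>2 \<partial>lborel \<partial>lborel)"
  proof -
    have q: "(\<lambda>b. \<integral>\<^sup>+c. (G1 b c)\<^sup>2 \<partial>lborel) \<in> borel_measurable borel"
      by (rule borel_measurable_inner_integral) (use m1 in simp)
    have q2: "(\<lambda>b. \<integral>\<^sup>+c. (G2 b c)\<^sup>2 \<partial>lborel) \<in> borel_measurable borel"
      by (rule borel_measurable_inner_integral) (use m2 in simp)
    show ?thesis using q q2 by (simp add: nn_integral_multc nn_integral_cmult)
  qed
  finally show ?thesis by (simp add: mult_right_mono)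
qed

lemma line_bound_coord:
  assumes \<phi>: "test_fun \<Omega> \<phi>"
  shows "ennreal \<bar>\<phi> (vec3 a b c)\<bar> \<le> (\<integral>\<^sup>+s. ennreal \<bar>pderiv3 1 \<phi> (vec3 s b c)\<bar> \<partial>lborel)"
    "ennreal \<bar>\<phi> (vec3 a b c)\<bar> \<le> (\<integral>\<^sup>+s. ennreal \<bar>pderiv3 2 \<phi> (vec3 a s c)\<bar> \<partial>lborel)"
    "ennreal \<bar>\<phi> (vec3 a b c)\<bar> \<le> (\<integral>\<^sup>+s. ennreal \<bar>pderiv3 3 \<phi> (vec3 a b s)\<bar> \<partial>lborel)"
proof -
  have t: "(\<integral>\<^sup>+s. f (t + s) \<partial>lborel) = (\<integral>\<^sup>+s. f s \<partial>lborel)" if "f \<in> borel_measurable borel" for f :: "real \<Rightarrow> ennreal" and t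
    using nn_integral_real_affine[OF that, of 1 t] by simp
  have m: "(\<lambda>s. ennreal \<bar>pderiv3 i \<phi> (vec3 (f s) (g s) (h s))\<bar>) \<in> borel_measurable borel"
    if "continuous_on UNIV f" "continuous_on UNIV g" "continuous_on UNIV h" for i and f g h :: "real \<Rightarrow> real"
  proof -
    have "(\<lambda>s. vec3 (f s) (g s) (h s)) \<in> borel_measurable borel"
      unfolding vec3_def by (intro borel_measurable_continuous_onI continuous_intros that)
    from measurable_compose[OF this test_fun_measurable[OF test_fun_pderiv3[OF \<phi>]]]
    show ?thesis by simp
  qed
  show "ennreal \<bar>\<phi> (vec3 a b c)\<bar> \<le> (\<integral>\<^sup>+s. ennreal \<bar>pderiv3 1 \<phi> (vec3 s b c)\<bar> \<partial>lborel)"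
    using line_bound[OF \<phi>, of "vec3 a b c" 1] t[OF m, of "\<lambda>s. s" "\<lambda>_. b" "\<lambda>_. c"] by (simp add: vec3_shift)
  show "ennreal \<bar>\<phi> (vec3 a b c)\<bar> \<le> (\<integral>\<^sup>+s. ennreal \<bar>pderiv3 2 \<phi> (vec3 a s c)\<bar> \<partial>lborel)"
    using line_bound[OF \<phi>, of "vec3 a b c" 2] t[OF m, of "\<lambda>_. a" "\<lambda>s. s" "\<lambda>_. c"] by (simp add: vec3_shift)
  show "ennreal \<bar>\<phi> (vec3 a b c)\<bar> \<le> (\<integral>\<^sup>+s. ennreal \<bar>pderiv3 3 \<phi> (vec3 a b s)\<bar> \<partial>lborel)"
    using line_bound[OF \<phi>, of "vec3 a b c" 3] t[OF m, of "\<lambda>_. a" "\<lambda>_. b" "\<lambda>s. s"] by (simp add: vec3_shift)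
qed

lemma slice_measurable:
  fixes f :: "R3 \<Rightarrow> ennreal"
  assumes f: "f \<in> borel_measurable borel"
  shows "(\<lambda>p. \<integral>\<^sup>+s. f (vec3 s (fst p) (snd p)) \<partial>lborel) \<in> borel_measurable borel"
    "(\<lambda>p. \<integral>\<^sup>+s. f (vec3 (fst p) s (snd p)) \<partial>lborel) \<in> borel_measurable borel"
    "(\<lambda>p. \<integral>\<^sup>+s. f (vec3 (fst p) (snd p) s) \<partial>lborel) \<in> borel_measurable borel"
proof -
  have m: "(\<lambda>x. f (vec3 (F x) (G x) (H x))) \<in> borel_measurable borel"
    if "continuous_on UNIV F" "continuous_on UNIV G" "continuous_on UNIV H" for F G H :: "(real \<times> real) \<times> real \<Rightarrow> real"
  proof -
    have "(\<lambda>s. vec3 (F s) (G s) (H s)) \<in> borel_measurable borel"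
      unfolding vec3_def by (intro borel_measurable_continuous_onI continuous_intros that)
    from measurable_compose[OF this f] show ?thesis .
  qed
  show "(\<lambda>p. \<integral>\<^sup>+s. f (vec3 s (fst p) (snd p)) \<partial>lborel) \<in> borel_measurable borel"
    "(\<lambda>p. \<integral>\<^sup>+s. f (vec3 (fst p) s (snd p)) \<partial>lborel) \<in> borel_measurable borel"
    "(\<lambda>p. \<integral>\<^sup>+s. f (vec3 (fst p) (snd p) s) \<partial>lborel) \<in> borel_measurable borel"
    by (intro borel_measurable_inner_integral m continuous_intros)+
qed

lemma nn_integral_R3_perm:
  fixes f :: "R3 \<Rightarrow> ennreal"
  assumes f: "f \<in> borel_measurable borel"
  shows "(\<integral>\<^sup>+b. \<integral>\<^sup>+c. \<integral>\<^sup>+a. f (vec3 a b c) \<partial>lborel \<partial>lborel \<partial>lborel) = (\<integral>\<^sup>+x. f x \<partial>lborel)"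
    "(\<integral>\<^sup>+a. \<integral>\<^sup>+c. \<integral>\<^sup>+b. f (vec3 a b c) \<partial>lborel \<partial>lborel \<partial>lborel) = (\<integral>\<^sup>+x. f x \<partial>lborel)"
proof -
  have m: "(\<lambda>p. f (vec3 (F p) (G p) (H p))) \<in> borel_measurable borel"
    if "continuous_on UNIV F" "continuous_on UNIV G" "continuous_on UNIV H" for F G H :: "real \<times> real \<Rightarrow> real"
  proof -
    have "(\<lambda>s. vec3 (F s) (G s) (H s)) \<in> borel_measurable borel"
      unfolding vec3_def by (intro borel_measurable_continuous_onI continuous_intros that)
    from measurable_compose[OF this f] show ?thesis .
  qed
  show "(\<integral>\<^sup>+a. \<integral>\<^sup>+c. \<integral>\<^sup>+b. f (vec3 a b c) \<partial>lborel \<partial>lborel \<partial>lborel) = (\<integral>\<^sup>+x. f x \<partial>lborel)"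
    unfolding nn_integral_R3[OF f]
    by (intro nn_integral_cong nn_swap m continuous_intros)
  have "(\<integral>\<^sup>+b. \<integral>\<^sup>+c. \<integral>\<^sup>+a. f (vec3 a b c) \<partial>lborel \<partial>lborel \<partial>lborel) =
        (\<integral>\<^sup>+b. \<integral>\<^sup>+a. \<integral>\<^sup>+c. f (vec3 a b c) \<partial>lborel \<partial>lborel \<partial>lborel)"
    by (intro nn_integral_cong nn_swap m continuous_intros)
  also have "\<dots> = (\<integral>\<^sup>+x. f x \<partial>lborel)"
    unfolding nn_integral_R3[OF f] by (rule nn_swap) (rule slice_measurable(3)[OF f, THEN measurable_compose[rotated], of "\<lambda>p. (snd p, fst p)", simplified],
      intro borel_measurable_continuous_onI continuous_intros)
  finally show "(\<integral>\<^sup>+b. \<integral>\<^sup>+c. \<integral>\<^sup>+a. f (vec3 a b c) \<partial>lborel \<partial>lborel \<partial>lborel) = (\<integral>\<^sup>+x. f x \<partial>lborel)" .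
qed

lemma nn_integral_pderiv_power:
  assumes \<phi>: "test_fun \<Omega> \<phi>" and n: "2 \<le> n"
  shows "(\<integral>\<^sup>+x. ennreal \<bar>pderiv3 i (\<lambda>x. \<phi> x ^ n) x\<bar> \<partial>lborel)
    \<le> ennreal (real n * sqrt (sqint (\<lambda>x. \<phi> x ^ (n - 1))) * sqrt (sqint (pderiv3 i \<phi>)))"
proof -
  have n1: "0 < n - 1" "0 < n" using n by auto
  have L: "L2 (\<lambda>x. \<phi> x ^ (n - 1))" "L2 (pderiv3 i \<phi>)"
    using test_fun_L2[OF test_fun_power[OF \<phi> n1(1)]] test_fun_L2[OF test_fun_pderiv3[OF \<phi>]] .
  have "(\<integral>\<^sup>+x. ennreal \<bar>pderiv3 i (\<lambda>x. \<phi> x ^ n) x\<bar> \<partial>lborel) = ennreal (\<integral>x. \<bar>pderiv3 i (\<lambda>x. \<phi> x ^ n) x\<bar> \<partial>lborel)"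
    by (rule nn_integral_eq_integral)
       (use test_fun_integrable[OF test_fun_pderiv3[OF test_fun_power[OF \<phi> n1(2)]]] in auto)
  also have "(\<integral>x. \<bar>pderiv3 i (\<lambda>x. \<phi> x ^ n) x\<bar> \<partial>lborel) = real n * (\<integral>x. \<bar>\<phi> x ^ (n - 1) * pderiv3 i \<phi> x\<bar> \<partial>lborel)"
    by (subst integral_mult_right_zero[symmetric]) (simp add: pderiv3_power[OF test_funD[OF \<phi>]] abs_mult mult.assoc)
  also have "\<dots> \<le> real n * (sqrt (sqint (\<lambda>x. \<phi> x ^ (n - 1))) * sqrt (sqint (pderiv3 i \<phi>)))"
    by (intro mult_left_mono L2_Cauchy_Schwarz_abs L) auto
  finally show ?thesis by (simp add: mult.assoc ennreal_leI)
qed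

text \<open>Gagliardo's proof applied to \<open>\<phi>^4\<close>: every line integral of a partial
  derivative dominates \<open>\<phi>^4\<close>, so \<open>\<phi>^6\<close>, bounded by a product of
  three square roots, falls under \<open>Loomis_Whitney\<close>. Since the derivative of
  \<open>\<phi>^4\<close> is \<open>4 \<phi>^3 D\<phi>\<close>, this yields
  \<open>X^2 \<le> (4 sqrt X sqrt A)^3\<close>, hence \<open>X \<le> 64^2 A^3\<close>.\<close>

lemma Sobolev_test:
  assumes \<phi>: "test_fun \<Omega> \<phi>"
  shows "(\<integral>x. \<phi> x ^ 6 \<partial>lborel) \<le> 4096 * gradsq (grad3 \<phi>) ^ 3"
proof -
  let ?X = "\<integral>x. \<phi> x ^ 6 \<partial>lborel" and ?A = "gradsq (grad3 \<phi>)"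
  let ?D = "\<lambda>i x. ennreal \<bar>pderiv3 i (\<lambda>x. \<phi> x ^ 4) x\<bar>"
  have \<phi>4: "test_fun \<Omega> (\<lambda>x. \<phi> x ^ 4)" by (rule test_fun_power[OF \<phi>]) simp
  have Dm: "?D i \<in> borel_measurable borel" for i
    using test_fun_measurable[OF test_fun_pderiv3[OF \<phi>4]] by simp
  define F1 where "F1 b c = (\<integral>\<^sup>+s. ?D 1 (vec3 s b c) \<partial>lborel)" for b c
  define F2 where "F2 a c = (\<integral>\<^sup>+s. ?D 2 (vec3 a s c) \<partial>lborel)" for a c
  define F3 where "F3 a b = (\<integral>\<^sup>+s. ?D 3 (vec3 a b s) \<partial>lborel)" for a b
  have Fm: "(\<lambda>p. F1 (fst p) (snd p)) \<in> borel_measurable borel" "(\<lambda>p. F2 (fst p) (snd p)) \<in> borel_measurable borel"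
    "(\<lambda>p. F3 (fst p) (snd p)) \<in> borel_measurable borel"
    unfolding F1_def F2_def F3_def by (rule slice_measurable[OF Dm])+
  have six: "test_fun \<Omega> (\<lambda>x. \<phi> x ^ 6)" by (rule test_fun_power[OF \<phi>]) simp
  have X: "ennreal ?X = (\<integral>\<^sup>+x. ennreal (\<phi> x ^ 6) \<partial>lborel)"
    by (rule nn_integral_eq_integral[symmetric]) (use test_fun_integrable[OF six] in auto)
  have X0: "0 \<le> ?X" by (rule integral_nonneg_AE) simp
  have A0: "0 \<le> ?A" by (rule gradsq_nonneg)
  have pt: "ennreal (\<phi> (vec3 a b c) ^ 6) \<le> esqrt (F1 b c) * esqrt (F2 a c) * esqrt (F3 a b)" for a b c
  proof -
    let ?z = "\<phi> (vec3 a b c)"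
    have e4: "ennreal (?z ^ 2) ^ 2 = ennreal \<bar>?z ^ 4\<bar>" by (simp add: ennreal_power flip: power_mult)
    have "ennreal (?z ^ 2) \<le> esqrt (F1 b c)" "ennreal (?z ^ 2) \<le> esqrt (F2 a c)" "ennreal (?z ^ 2) \<le> esqrt (F3 a b)"
      unfolding F1_def F2_def F3_def using line_bound_coord[OF \<phi>4, of a b c]
      by (intro le_esqrt; simp only: e4)+
    then have "ennreal (?z ^ 2) * ennreal (?z ^ 2) * ennreal (?z ^ 2) \<le> esqrt (F1 b c) * esqrt (F2 a c) * esqrt (F3 a b)"
      by (intro mult_mono) auto
    moreover have "ennreal (?z ^ 2) * ennreal (?z ^ 2) * ennreal (?z ^ 2) = ennreal (?z ^ 6)"
      by (simp add: ennreal_mult'[symmetric] power_add[symmetric])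
    ultimately show ?thesis by simp
  qed
  have "ennreal ?X \<le> (\<integral>\<^sup>+a. \<integral>\<^sup>+b. \<integral>\<^sup>+c. esqrt (F1 b c) * esqrt (F2 a c) * esqrt (F3 a b) \<partial>lborel \<partial>lborel \<partial>lborel)"
    unfolding X using test_fun_measurable[OF six]
    by (subst nn_integral_R3) (auto intro!: nn_integral_mono pt)
  then have "(ennreal ?X)\<^sup>2 \<le> (\<integral>\<^sup>+a. \<integral>\<^sup>+b. \<integral>\<^sup>+c. esqrt (F1 b c) * esqrt (F2 a c) * esqrt (F3 a b) \<partial>lborel \<partial>lborel \<partial>lborel)\<^sup>2"
    by (intro power_mono) auto
  also have "\<dots> \<le> (\<integral>\<^sup>+b. \<integral>\<^sup>+c. (esqrt (F1 b c))\<^sup>2 \<partial>lborel \<partial>lborel) * (\<integral>\<^sup>+a. \<integral>\<^sup>+c. (esqrt (F2 a c))\<^sup>2 \<partial>lborel \<partial>lborel)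
      * (\<integral>\<^sup>+a. \<integral>\<^sup>+b. (esqrt (F3 a b))\<^sup>2 \<partial>lborel \<partial>lborel)"
    by (rule Loomis_Whitney) (use Fm in measurable)
  also have "\<dots> = (\<integral>\<^sup>+x. ?D 1 x \<partial>lborel) * (\<integral>\<^sup>+x. ?D 2 x \<partial>lborel) * (\<integral>\<^sup>+x. ?D 3 x \<partial>lborel)"
    unfolding esqrt_sq F1_def F2_def F3_def
    using nn_integral_R3_perm[OF Dm] nn_integral_R3[OF Dm] by simp
  also have "\<dots> \<le> ennreal (4 * sqrt ?X * sqrt ?A) * ennreal (4 * sqrt ?X * sqrt ?A) * ennreal (4 * sqrt ?X * sqrt ?A)"
  proof -
    have "(\<integral>\<^sup>+x. ?D i x \<partial>lborel) \<le> ennreal (4 * sqrt ?X * sqrt ?A)" for i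
    proof -
      have "(\<integral>\<^sup>+x. ?D i x \<partial>lborel) \<le> ennreal (real 4 * sqrt (sqint (\<lambda>x. \<phi> x ^ (4-1))) * sqrt (sqint (pderiv3 i \<phi>)))"
        by (rule nn_integral_pderiv_power[OF \<phi>]) simp
      also have "sqint (\<lambda>x. \<phi> x ^ (4-1)) = ?X" by (simp add: sqint_def flip: power_mult)
      also have "ennreal (real 4 * sqrt ?X * sqrt (sqint (pderiv3 i \<phi>))) \<le> ennreal (4 * sqrt ?X * sqrt ?A)"
        using gradsq_ge[of "grad3 \<phi>" i] X0 by (intro ennreal_leI mult_mono) (auto simp: sqint_nonneg)
      finally show ?thesis .
    qed
    then show ?thesis by (intro mult_mono) auto
  qed
  also have "\<dots> = ennreal ((4 * sqrt ?X * sqrt ?A) ^ 3)"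
    using X0 A0 by (simp add: ennreal_mult'[symmetric] power3_eq_cube)
  finally have "?X\<^sup>2 \<le> (4 * sqrt ?X * sqrt ?A) ^ 3"
    using X0 A0 by (simp add: ennreal_power)
  then have le: "sqrt ?X ^ 4 \<le> 64 * sqrt ?X ^ 3 * sqrt ?A ^ 3"
  proof -
    have "sqrt ?X ^ 4 = ?X\<^sup>2" using X0 power_mult[of "sqrt ?X" 2 2] by simp
    moreover have "(4 * sqrt ?X * sqrt ?A) ^ 3 = 64 * sqrt ?X ^ 3 * sqrt ?A ^ 3" by (simp only: power_mult_distrib) simp
    ultimately show ?thesis using \<open>?X\<^sup>2 \<le> (4 * sqrt ?X * sqrt ?A) ^ 3\<close> by metis
  qed
  show ?thesis
  \<comment> \<open>The factor \<open>sqrt ?X ^ 3\<close> can be cancelled only when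
    \<open>?X\<close> is nonzero; its finiteness comes from the compact support.\<close>
  proof (cases "?X = 0")
    case True
    then show ?thesis using A0 by simp
  next
    case False
    then have "0 < sqrt ?X" using X0 by (simp only: real_sqrt_gt_0_iff less_le) auto
    then have "sqrt ?X \<le> 64 * sqrt ?A ^ 3" 
    proof -
      have "sqrt ?X ^ 3 * sqrt ?X \<le> sqrt ?X ^ 3 * (64 * sqrt ?A ^ 3)"
        using le by (simp only: power4_eq_xxxx power3_eq_cube mult_ac)
      then show ?thesis by (rule mult_le_cancel_left_pos[THEN iffD1, rotated]) (use \<open>0 < sqrt ?X\<close> in \<open>rule zero_less_power\<close>)
    qed
    then have "(sqrt ?X)\<^sup>2 \<le> (64 * sqrt ?A ^ 3)\<^sup>2" using X0 by (intro power_mono) auto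
    also have "\<dots> = 4096 * (sqrt ?A ^ 2) ^ 3" by (simp add: power_mult_distrib flip: power_mult)
    finally show ?thesis using X0 A0 by simp
  qed
qed

text \<open>The planar version of the same argument, for the mass of \<open>\<phi>\<close> on lines
  parallel to the third axis: it is bounded by a function of \<open>b\<close> and also by a function
  of \<open>a\<close>, so its square integrates to a product. For functions monotone in x_3 this
  becomes decay, see \<open>tail_bound\<close>.\<close>

lemma Ladyzhenskaya_test:
  assumes \<phi>: "test_fun \<Omega> \<phi>"
  shows "(\<integral>\<^sup>+a. \<integral>\<^sup>+b. (\<integral>\<^sup>+c. ennreal ((\<phi> (vec3 a b c))\<^sup>2) \<partial>lborel)\<^sup>2 \<partial>lborel \<partial>lborel)
     \<le> ennreal (4 * sqint \<phi> * gradsq (grad3 \<phi>))"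
proof -
  let ?D = "\<lambda>i x. ennreal \<bar>pderiv3 i (\<lambda>x. \<phi> x ^ 2) x\<bar>"
  have \<phi>2: "test_fun \<Omega> (\<lambda>x. \<phi> x ^ 2)" by (rule test_fun_power[OF \<phi>]) simp
  have Dm: "?D i \<in> borel_measurable borel" for i
    using test_fun_measurable[OF test_fun_pderiv3[OF \<phi>2]] by simp
  define K1 where "K1 b = (\<integral>\<^sup>+c. \<integral>\<^sup>+s. ?D 1 (vec3 s b c) \<partial>lborel \<partial>lborel)" for b
  define K2 where "K2 a = (\<integral>\<^sup>+c. \<integral>\<^sup>+s. ?D 2 (vec3 a s c) \<partial>lborel \<partial>lborel)" for a
  have Km: "K1 \<in> borel_measurable borel" "K2 \<in> borel_measurable borel"
    unfolding K1_def K2_def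
    by (rule borel_measurable_inner_integral[where f="\<lambda>b c. \<integral>\<^sup>+s. f b c s \<partial>lborel" for f], rule slice_measurable[OF Dm])+
  have I1: "(\<integral>\<^sup>+c. ennreal ((\<phi> (vec3 a b c))\<^sup>2) \<partial>lborel) \<le> K1 b" and
    I2: "(\<integral>\<^sup>+c. ennreal ((\<phi> (vec3 a b c))\<^sup>2) \<partial>lborel) \<le> K2 a" for a b
    unfolding K1_def K2_def using line_bound_coord[OF \<phi>2]
    by (intro nn_integral_mono; simp)+
  have "(\<integral>\<^sup>+a. \<integral>\<^sup>+b. (\<integral>\<^sup>+c. ennreal ((\<phi> (vec3 a b c))\<^sup>2) \<partial>lborel)\<^sup>2 \<partial>lborel \<partial>lborel)
    \<le> (\<integral>\<^sup>+a. \<integral>\<^sup>+b. K1 b * K2 a \<partial>lborel \<partial>lborel)"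
    unfolding power2_eq_square by (intro nn_integral_mono mult_mono I1[unfolded power2_eq_square] I2[unfolded power2_eq_square]) auto
  also have "\<dots> = (\<integral>\<^sup>+b. K1 b \<partial>lborel) * (\<integral>\<^sup>+a. K2 a \<partial>lborel)"
    using Km by (simp add: nn_integral_multc nn_integral_cmult)
  also have "\<dots> = (\<integral>\<^sup>+x. ?D 1 x \<partial>lborel) * (\<integral>\<^sup>+x. ?D 2 x \<partial>lborel)"
    unfolding K1_def K2_def nn_integral_R3_perm[OF Dm] ..
  also have "\<dots> \<le> ennreal (2 * sqrt (sqint \<phi>) * sqrt (gradsq (grad3 \<phi>))) * ennreal (2 * sqrt (sqint \<phi>) * sqrt (gradsq (grad3 \<phi>)))"
  proof -
    have "(\<integral>\<^sup>+x. ?D i x \<partial>lborel) \<le> ennreal (2 * sqrt (sqint \<phi>) * sqrt (gradsq (grad3 \<phi>)))" for i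
    proof -
      have "(\<integral>\<^sup>+x. ?D i x \<partial>lborel) \<le> ennreal (real 2 * sqrt (sqint (\<lambda>x. \<phi> x ^ (2-1))) * sqrt (sqint (pderiv3 i \<phi>)))"
        by (rule nn_integral_pderiv_power[OF \<phi>]) simp
      also have "\<dots> \<le> ennreal (2 * sqrt (sqint \<phi>) * sqrt (gradsq (grad3 \<phi>)))"
        using gradsq_ge[of "grad3 \<phi>" i] by (intro ennreal_leI mult_mono) (auto simp: sqint_nonneg)
      finally show ?thesis .
    qed
    then show ?thesis by (intro mult_mono) auto
  qed
  also have "\<dots> = ennreal (4 * sqint \<phi> * gradsq (grad3 \<phi>))"
  proof -
    have "(2 * sqrt (sqint \<phi>) * sqrt (gradsq (grad3 \<phi>))) * (2 * sqrt (sqint \<phi>) * sqrt (gradsq (grad3 \<phi>)))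
        = 4 * (sqrt (sqint \<phi>))\<^sup>2 * (sqrt (gradsq (grad3 \<phi>)))\<^sup>2" by algebra
    also have "\<dots> = 4 * sqint \<phi> * gradsq (grad3 \<phi>)" by (simp add: sqint_nonneg gradsq_nonneg)
    finally show ?thesis by (subst ennreal_mult'[symmetric]) (auto simp: sqint_nonneg gradsq_nonneg)
  qed
  finally show ?thesis .
qed

section \<open>Mollification\<close>

lemma L2lim_dominated:
  assumes F: "\<And>k. F k \<in> borel_measurable borel" and f: "f \<in> borel_measurable borel"
    and lim: "AE x in lborel. (\<lambda>k. F k x) \<longlonglongrightarrow> f x"
    and bd: "\<And>k. AE x in lborel. \<bar>F k x\<bar> \<le> w x" and w: "L2 w"
  shows "L2lim F f"
proof -
  note [measurable] = F f L2_meas[OF w]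
  have bdf: "AE x in lborel. \<bar>f x\<bar> \<le> w x"
  proof -
    have "AE x in lborel. \<forall>k. \<bar>F k x\<bar> \<le> w x" using bd by (simp add: AE_all_countable)
    then show ?thesis using lim
    proof eventually_elim
      case (elim x)
      from elim(2) have "(\<lambda>k. \<bar>F k x\<bar>) \<longlonglongrightarrow> \<bar>f x\<bar>" by (rule tendsto_rabs)
      then show ?case using elim(1) by (intro LIMSEQ_le_const2) auto
    qed
  qed
  have sq: "a\<^sup>2 \<le> b\<^sup>2" if "\<bar>a\<bar> \<le> b" for a b :: real
    using power_mono[OF that, of 2] by simp
  have L: "L2 (F k)" for k
    by (rule L2_bound[OF F L2_sq[OF w]]) (use bd[of k] in eventually_elim, rule sq)
  have Lf: "L2 f"
    by (rule L2_bound[OF f L2_sq[OF w]]) (use bdf in eventually_elim, rule sq)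
  have "(\<lambda>k. \<integral>x. (F k x - f x)\<^sup>2 \<partial>lborel) \<longlonglongrightarrow> (\<integral>x. 0 \<partial>(lborel :: R3 measure))"
  proof (rule integral_dominated_convergence[of _ _ _ "\<lambda>x. 4 * (w x)\<^sup>2"])
    show "AE x in lborel. (\<lambda>k. (F k x - f x)\<^sup>2) \<longlonglongrightarrow> 0"
      using lim
    proof eventually_elim
      case (elim x)
      then have "(\<lambda>k. (F k x - f x)\<^sup>2) \<longlonglongrightarrow> (f x - f x)\<^sup>2" by (intro tendsto_intros)
      then show ?case by simp
    qed
    show "AE x in lborel. norm ((F k x - f x)\<^sup>2) \<le> 4 * (w x)\<^sup>2" for k
      using bd[of k] bdf
    proof eventually_elim
      case (elim x)
      then have "\<bar>F k x - f x\<bar> \<le> 2 * w x" by linarith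
      from sq[OF this] show ?case by (simp add: power_mult_distrib)
    qed
    show "integrable lborel (\<lambda>x. 4 * (w x)\<^sup>2)" using w by (simp add: L2_def)
  qed auto
  then show ?thesis using L Lf by (simp add: L2lim_def sqint_def)
qed

lemma L2_indicator_ball: "L2 (\<lambda>x. c * indicator (ball 0 M) x)"
proof -
  have "emeasure lborel (ball (0::R3) M) < \<infinity>" by (rule emeasure_bounded_finite) simp
  then have "integrable lborel (\<lambda>x::R3. c\<^sup>2 * indicator (ball 0 M) x)" by simp
  moreover have "(c * indicator (ball 0 M) x)\<^sup>2 = c\<^sup>2 * indicator (ball 0 M) x" for x :: R3
    by (auto simp: indicator_def)
  moreover have "(\<lambda>x::R3. c * indicator (ball 0 M) x) \<in> borel_measurable lborel"
    by (intro borel_measurable_times borel_measurable_indicator) auto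
  ultimately show ?thesis unfolding L2_def by (intro conjI) simp_all
qed

lemma L2_bounded_ball:
  assumes "f \<in> borel_measurable borel" "\<And>x. \<bar>f x\<bar> \<le> K" "\<And>x. x \<notin> ball 0 M \<Longrightarrow> f x = 0"
  shows "L2 f"
proof (rule L2_bound[OF assms(1) L2_sq[OF L2_indicator_ball[of K M]]], rule AE_I2)
  fix x show "(f x)\<^sup>2 \<le> (K * indicator (ball 0 M) x)\<^sup>2"
    using assms(2)[of x] assms(3)[of x] power_mono[of "\<bar>f x\<bar>" K 2] by (cases "x \<in> ball 0 M") auto
qed

text \<open>Lebesgue measurable functions are almost everywhere limits of continuous ones.\<close>
lemma L2_approx_continuous:
  assumes f: "L2 f" and e: "0 < e"
  obtains g M K where "continuous_on UNIV g" "\<And>x. x \<notin> ball 0 M \<Longrightarrow> g x = 0" "\<And>x. \<bar>g x\<bar> \<le> K"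
    "sqint (\<lambda>x. f x - g x) < e"
proof -
  define F where "F k x = (if norm x < real k \<and> \<bar>f x\<bar> \<le> real k then f x else 0)" for k x
  note [measurable] = L2_meas[OF f]
  have Fm: "F k \<in> borel_measurable borel" for k unfolding F_def by measurable
  have "L2lim F f"
  proof (rule L2lim_dominated[OF Fm _ _ _ L2_abs[OF f]])
    show "AE x in lborel. (\<lambda>k. F k x) \<longlonglongrightarrow> f x"
    proof (rule AE_I2)
      fix x
      obtain N :: nat where N: "norm x + \<bar>f x\<bar> < N" using reals_Archimedean2 by blast
      have "F k x = f x" if "k \<ge> N" for k
      proof -
        have "real N \<le> real k" using that by simp
        then have "norm x < real k \<and> \<bar>f x\<bar> \<le> real k" using N norm_ge_zero[of x] abs_ge_zero[of "f x"] by linarith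
        then show ?thesis by (simp add: F_def)
      qed
      then show "(\<lambda>k. F k x) \<longlonglongrightarrow> f x"
        by (intro tendsto_eventually eventually_sequentiallyI[of N]) auto
    qed
  qed (auto simp: F_def)
  then have "(\<lambda>k. sqint (\<lambda>x. F k x - f x)) \<longlonglongrightarrow> 0" and FL: "\<And>k. L2 (F k)" by (auto simp: L2lim_def)
  then obtain k where k: "sqint (\<lambda>x. F k x - f x) < e/4"
    using order_tendstoD(2)[of _ 0 sequentially "e/4"] e by (fastforce simp: eventually_sequentially)
  have "F k measurable_on UNIV"
    by (rule lebesgue_measurable_imp_measurable_on) (use measurable_completion[of "F k" lborel borel] Fm in auto)
  then obtain N g where N: "negligible N" "\<And>n. continuous_on UNIV (g n)"
    "\<And>x. x \<notin> N \<Longrightarrow> (\<lambda>n. g n x) \<longlonglongrightarrow> F k x"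
    unfolding measurable_on_def by auto
  \<comment> \<open>Clipping the values at \<open>real k\<close> and multiplying by a ramp that
    vanishes beyond radius \<open>real k + 1\<close> leaves the limit \<open>F k\<close> unchanged,
    as \<open>F k\<close> obeys both bounds already.\<close>
  define G where "G n x = max (- real k) (min (real k) (g n x)) * max 0 (min 1 (real k + 1 - norm x))" for n x
  have Gc: "continuous_on UNIV (G n)" for n unfolding G_def by (intro continuous_intros N)
  have G0: "G n x = 0" if "x \<notin> ball 0 (real k + 1)" for n x using that by (simp add: G_def)
  have GK: "\<bar>G n x\<bar> \<le> real k" for n x
  proof -
    have "\<bar>G n x\<bar> = \<bar>max (- real k) (min (real k) (g n x))\<bar> * \<bar>max 0 (min 1 (real k + 1 - norm x))\<bar>"
      by (simp add: G_def abs_mult)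
    also have "\<dots> \<le> real k * 1" by (intro mult_mono) auto
    finally show ?thesis by simp
  qed
  have "L2lim G (F k)"
  proof (rule L2lim_dominated[OF _ Fm _ _ L2_indicator_ball[of "real k" "real k + 1"]])
    show "G n \<in> borel_measurable borel" for n by (rule borel_measurable_continuous_onI[OF Gc])
    have "N \<in> null_sets lebesgue" using N(1) by (simp add: negligible_iff_null_sets)
    then have "AE x in lebesgue. x \<notin> N" by (rule AE_not_in)
    then have "AE x in lborel. x \<notin> N" by (simp add: AE_completion_iff)
    then show "AE x in lborel. (\<lambda>n. G n x) \<longlonglongrightarrow> F k x"
    proof eventually_elim
      case (elim x)
      have "(\<lambda>n. G n x) \<longlonglongrightarrow> max (- real k) (min (real k) (F k x)) * max 0 (min 1 (real k + 1 - norm x))"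
        unfolding G_def by (intro tendsto_intros N(3)[OF elim])
      moreover have "max (- real k) (min (real k) (F k x)) * max 0 (min 1 (real k + 1 - norm x)) = F k x"
        by (auto simp: F_def)
      ultimately show ?case by simp
    qed
    show "AE x in lborel. \<bar>G n x\<bar> \<le> real k * indicator (ball 0 (real k + 1)) x" for n
      using GK G0 by (intro AE_I2) (auto simp: indicator_def)
  qed
  then have "(\<lambda>n. sqint (\<lambda>x. G n x - F k x)) \<longlonglongrightarrow> 0" and GL: "\<And>n. L2 (G n)" by (auto simp: L2lim_def)
  then obtain n where n: "sqint (\<lambda>x. G n x - F k x) < e/4"
    using order_tendstoD(2)[of _ 0 sequentially "e/4"] e by (fastforce simp: eventually_sequentially)
  have "sqint (\<lambda>x. f x - G n x) \<le> 2 * sqint (\<lambda>x. f x - F k x) + 2 * sqint (\<lambda>x. F k x - G n x)"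
    by (rule sqint_dist_le[OF f FL GL])
  also have "\<dots> < e" using k n sqint_diff_commute[of f "F k"] sqint_diff_commute[of "F k" "G n"] by linarith
  finally show thesis by (intro that[of "G n" "real k + 1" "real k"] Gc G0 GK)
qed

lemma L2_translate:
  assumes "L2 f" shows "L2 (\<lambda>x. f (x - y))" "sqint (\<lambda>x. f (x - y)) = sqint f"
proof -
  note [measurable] = L2_meas[OF assms]
  show "L2 (\<lambda>x. f (x - y))" "sqint (\<lambda>x. f (x - y)) = sqint f"
    using integral_affine3[of 1 "\<lambda>x. (f x)\<^sup>2" "-y"] assms by (simp_all add: L2_def sqint_def)
qed

text \<open>For continuous functions of bounded support this is dominated convergence; density
  transfers it to \<open>L2\<close>, translations being isometries.\<close>

lemma translation_continuous:
  assumes f: "L2 f" and e: "0 < e"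
  obtains d where "0 < d" "\<And>y. norm y < d \<Longrightarrow> sqint (\<lambda>x. f (x - y) - f x) < e"
proof -
  have "((\<lambda>y. sqint (\<lambda>x. f (x - y) - f x)) \<longlongrightarrow> 0) (at 0)"
    unfolding tendsto_at_iff_sequentially
  proof (intro allI impI)
    fix Y :: "nat \<Rightarrow> R3" assume "\<forall>i. Y i \<in> UNIV - {0}" and Y: "Y \<longlonglongrightarrow> 0"
    obtain B where B: "0 < B" "\<And>n. norm (Y n) \<le> B"
      using convergent_imp_Bseq[OF convergentI[OF Y]] by (auto simp: Bseq_def)
    have "(\<lambda>n. sqint (\<lambda>x. f (x - Y n) - f x)) \<longlonglongrightarrow> 0"
    proof (rule LIMSEQ_I)
      fix r :: real assume r: "0 < r"
      \<comment> \<open>Two uses of \<open>sqint_dist_le\<close> weight the three errors by 2, 4 and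
        4, so twelfths of \<open>r\<close> leave a total below \<open>r\<close>.\<close>
      obtain g M K where g: "continuous_on UNIV g" "\<And>x. x \<notin> ball 0 M \<Longrightarrow> g x = 0" "\<And>x. \<bar>g x\<bar> \<le> K"
        "sqint (\<lambda>x. f x - g x) < r/12" using L2_approx_continuous[OF f, of "r/12"] r by auto
      have gm: "g \<in> borel_measurable borel" by (rule borel_measurable_continuous_onI[OF g(1)])
      have gL: "L2 g" by (rule L2_bounded_ball[OF gm g(3) g(2)])
      have "L2lim (\<lambda>n x. g (x - Y n)) g"
      proof (rule L2lim_dominated[OF _ gm _ _ L2_indicator_ball[of K "M + B"]])
        show "(\<lambda>x. g (x - Y n)) \<in> borel_measurable borel" for n
          using measurable_compose[OF _ gm, of "\<lambda>x. x - Y n" borel] by simp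
        show "AE x in lborel. (\<lambda>n. g (x - Y n)) \<longlonglongrightarrow> g x"
        proof (rule AE_I2)
          fix x
          have "(\<lambda>n. x - Y n) \<longlonglongrightarrow> x - 0" by (intro tendsto_intros Y)
          then have "(\<lambda>n. g (x - Y n)) \<longlonglongrightarrow> g (x - 0)"
            using g(1) continuous_on_tendsto_compose[of UNIV g] by auto
          then show "(\<lambda>n. g (x - Y n)) \<longlonglongrightarrow> g x" by simp
        qed
        show "AE x in lborel. \<bar>g (x - Y n)\<bar> \<le> K * indicator (ball 0 (M + B)) x" for n
        proof (rule AE_I2)
          fix x :: R3
          have "x - Y n \<notin> ball 0 M" if "x \<notin> ball 0 (M + B)"
            using that B(2)[of n] norm_triangle_sub[of x "Y n"] by auto
          then show "\<bar>g (x - Y n)\<bar> \<le> K * indicator (ball 0 (M + B)) x"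
            using g(2,3) by (cases "x \<in> ball 0 (M + B)") auto
        qed
      qed
      then have "(\<lambda>n. sqint (\<lambda>x. g (x - Y n) - g x)) \<longlonglongrightarrow> 0" by (simp add: L2lim_def)
      then obtain n0 where n0: "\<And>n. n \<ge> n0 \<Longrightarrow> sqint (\<lambda>x. g (x - Y n) - g x) < r/12"
        using order_tendstoD(2)[of _ 0 sequentially "r/12"] r by (fastforce simp: eventually_sequentially)
      have "sqint (\<lambda>x. f (x - Y n) - f x) < r" if "n \<ge> n0" for n
      proof -
        have "sqint (\<lambda>x. f (x - Y n) - f x) \<le> 2 * sqint (\<lambda>x. f (x - Y n) - g (x - Y n)) + 2 * sqint (\<lambda>x. g (x - Y n) - f x)"
          by (rule sqint_dist_le) (intro L2_translate f gL)+
        moreover have "sqint (\<lambda>x. f (x - Y n) - g (x - Y n)) = sqint (\<lambda>x. f x - g x)"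
          by (rule L2_translate(2)[OF L2_diff[OF f gL]])
        moreover have "sqint (\<lambda>x. g (x - Y n) - f x) \<le> 2 * sqint (\<lambda>x. g (x - Y n) - g x) + 2 * sqint (\<lambda>x. g x - f x)"
          by (rule sqint_dist_le) (intro L2_translate f gL)+
        ultimately show ?thesis using n0[OF that] g(4) r sqint_diff_commute[of g f] by linarith
      qed
      then show "\<exists>no. \<forall>n\<ge>no. norm (sqint (\<lambda>x. f (x - Y n) - f x) - 0) < r"
        by (intro exI[of _ n0]) (simp add: sqint_nonneg)
    qed
    then show "((\<lambda>y. sqint (\<lambda>x. f (x - y) - f x)) \<circ> Y) \<longlonglongrightarrow> 0" by (simp add: o_def)
  qed
  from order_tendstoD(2)[OF this e] obtain d where d: "0 < d"
    "\<And>y. y \<noteq> 0 \<Longrightarrow> dist y 0 < d \<Longrightarrow> sqint (\<lambda>x. f (x - y) - f x) < e"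
    by (auto simp: eventually_at)
  have "sqint (\<lambda>x. f (x - y) - f x) < e" if "norm y < d" for y
    using d that e by (cases "y = 0") (auto simp: sqint_def)
  then show ?thesis using d(1) that by blast
qed

section \<open>Convolution with test functions\<close>

definition conv3 :: "(R3 \<Rightarrow> real) \<Rightarrow> (R3 \<Rightarrow> real) \<Rightarrow> R3 \<Rightarrow> real" where
  "conv3 f \<phi> x = (\<integral>y. f y * \<phi> (x - y) \<partial>lborel)"

lemma test_fun_reflect:
  assumes "test_fun UNIV \<phi>"
  shows "test_fun UNIV (\<lambda>y. \<phi> (x - y))" "pderiv3 i (\<lambda>y. \<phi> (x - y)) y = - pderiv3 i \<phi> (x - y)"
  using test_fun_affine[OF assms, of "-1" x UNIV] pderiv3_affine[OF test_funD[OF assms], of i "-1" x]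
  by (auto simp: fun_eq_iff add.commute[of "- _"])

text \<open>Differentiation under the integral sign, for the total derivative at once: along any
  sequence converging to \<open>x\<close> the remainder quotients of \<open>\<phi>\<close> are
  bounded, supported in a common ball and pointwise convergent to zero.\<close>

lemma conv3_deriv:
  assumes f: "L2 f" and \<phi>: "test_fun UNIV \<phi>"
  shows "(conv3 f \<phi> has_derivative (\<lambda>h. (\<chi> i. conv3 f (pderiv3 i \<phi>) x) \<bullet> h)) (at x)"
proof -
  let ?D = "\<lambda>h. (\<chi> i. conv3 f (pderiv3 i \<phi>) x) \<bullet> h"
  have int: "integrable lborel (\<lambda>y. f y * \<psi> (z - y))" if "test_fun UNIV \<psi>" for \<psi> z
    by (rule L2_mult_integrable[OF f test_fun_L2[OF test_fun_reflect(1)[OF that]]])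
  have Dh: "?D h = (\<integral>y. f y * (grad3 \<phi> (x - y) \<bullet> h) \<partial>lborel)" for h
  proof -
    have "(\<integral>y. f y * (grad3 \<phi> (x - y) \<bullet> h) \<partial>lborel) = (\<integral>y. (\<Sum>i\<in>UNIV. f y * pderiv3 i \<phi> (x - y) * h $ i) \<partial>lborel)"
      by (simp add: inner_vec_def sum_distrib_left mult.assoc)
    also have "\<dots> = (\<Sum>i\<in>UNIV. \<integral>y. f y * pderiv3 i \<phi> (x - y) * h $ i \<partial>lborel)"
      by (intro Bochner_Integration.integral_sum) (use int test_fun_pderiv3[OF \<phi>] in auto)
    also have "\<dots> = ?D h" by (simp add: inner_vec_def conv3_def)
    finally show ?thesis ..
  qed
  have Dint: "integrable lborel (\<lambda>y. f y * (grad3 \<phi> (x - y) \<bullet> h))" for h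
    using int[OF test_fun_pderiv3[OF \<phi>]]
    by (auto simp: inner_vec_def sum_distrib_left mult.assoc[symmetric] intro!: Bochner_Integration.integrable_sum)
  obtain K where K: "0 < K" "\<And>x y. \<bar>\<phi> x - \<phi> y\<bar> \<le> K * norm (x - y)" using test_fun_lipschitz[OF \<phi>] by metis
  obtain M where M: "0 < M" "\<And>x. x \<notin> ball 0 M \<Longrightarrow> \<phi> x = 0" using test_fun_supp_ball[OF \<phi>] by metis
  have "\<exists>C>0. \<forall>x. \<bar>pderiv3 i \<phi> x\<bar> \<le> C" for i
    using test_fun_bounded[OF test_fun_pderiv3[OF \<phi>, of i]] by metis
  then obtain C where C: "\<And>i. 0 < C i" "\<And>i x. \<bar>pderiv3 i \<phi> x\<bar> \<le> C i" by metis
  define S where "S = (\<Sum>i\<in>UNIV. C i)"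
  have S: "norm (grad3 \<phi> x) \<le> S" for x unfolding S_def
    by (rule order_trans[OF norm_le_l1_cart]) (auto intro!: sum_mono C)
  have g0: "grad3 \<phi> z = 0" if "z \<notin> ball 0 (M + 1)" for z
  proof -
    have "z \<notin> tsupp \<phi>"
    proof
      assume "z \<in> tsupp \<phi>"
      then have "z \<in> closure (ball 0 M)" unfolding tsupp_def
        using M(2) closure_mono[of "{x. \<phi> x \<noteq> 0}" "ball 0 M"] by blast
      then show False using that M(1) by auto
    qed
    then show ?thesis by (simp add: vec_eq_iff pderiv3_tsupp)
  qed
  note [measurable] = L2_meas[OF f] test_fun_measurable[OF \<phi>] test_fun_measurable[OF test_fun_pderiv3[OF \<phi>]]
  have "((\<lambda>z. (conv3 f \<phi> z - conv3 f \<phi> x - ?D (z - x)) /\<^sub>R norm (z - x)) \<longlongrightarrow> 0) (at x)"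
    unfolding tendsto_at_iff_sequentially
  proof (intro allI impI)
    fix X :: "nat \<Rightarrow> R3" assume "\<forall>i. X i \<in> UNIV - {x}" and X: "X \<longlonglongrightarrow> x"
    then have Xn: "X n \<noteq> x" for n by auto
    obtain B where B: "0 < B" "\<And>n. norm (X n) \<le> B"
      using convergent_imp_Bseq[OF convergentI[OF X]] by (auto simp: Bseq_def)
    have Bx: "norm x \<le> B"
      by (rule LIMSEQ_le_const2[OF tendsto_norm[OF X]]) (use B in auto)
    define q where "q n y = (\<phi> (X n - y) - \<phi> (x - y) - grad3 \<phi> (x - y) \<bullet> (X n - x)) / norm (X n - x)" for n y
    have qbd: "\<bar>q n y\<bar> \<le> (K + S) * indicator (ball 0 (M + 1 + B)) y" for n y
    proof (cases "y \<in> ball 0 (M + 1 + B)")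
      case True
      have "\<bar>\<phi> (X n - y) - \<phi> (x - y)\<bar> \<le> K * norm (X n - x)" using K(2)[of "X n - y" "x - y"] by simp
      moreover have "\<bar>grad3 \<phi> (x - y) \<bullet> (X n - x)\<bar> \<le> S * norm (X n - x)"
        by (rule order_trans[OF Cauchy_Schwarz_ineq2]) (intro mult_right_mono S norm_ge_zero)
      ultimately have "\<bar>\<phi> (X n - y) - \<phi> (x - y) - grad3 \<phi> (x - y) \<bullet> (X n - x)\<bar> \<le> (K + S) * norm (X n - x)"
        unfolding distrib_right by linarith
      then show ?thesis using True Xn[of n] by (simp add: q_def divide_le_eq)
    next
      case False
      have "norm y \<le> norm (X n - y) + norm (X n)" "norm y \<le> norm (x - y) + norm x"
        using norm_triangle_ineq4[of "X n" "X n - y"] norm_triangle_ineq4[of x "x - y"] by auto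
      then have "X n - y \<notin> ball 0 M" "x - y \<notin> ball 0 M" "x - y \<notin> ball 0 (M + 1)"
        using False B(2)[of n] Bx by auto
      then show ?thesis using M(2) g0 False by (simp add: q_def)
    qed
    have qlim: "(\<lambda>n. q n y) \<longlonglongrightarrow> 0" for y
    proof -
      have "((\<lambda>z. (\<phi> z - \<phi> (x - y) - grad3 \<phi> (x - y) \<bullet> (z - (x - y))) /\<^sub>R norm (z - (x - y))) \<longlongrightarrow> 0) (at (x - y))"
        using smooth3_has_derivative_grad[OF test_funD[OF \<phi>], of "x - y"]
        by (simp add: has_derivative_def Lim_ident_at)
      moreover have "filterlim (\<lambda>n. X n - y) (at (x - y)) sequentially"
        using X Xn by (auto simp: filterlim_at intro!: tendsto_intros)
      ultimately have "(\<lambda>n. (\<phi> (X n - y) - \<phi> (x - y) - grad3 \<phi> (x - y) \<bullet> ((X n - y) - (x - y))) /\<^sub>R norm ((X n - y) - (x - y))) \<longlonglongrightarrow> 0"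
        by (rule filterlim_compose)
      then show ?thesis by (simp add: q_def divide_inverse mult.commute)
    qed
    have "(\<lambda>n. \<integral>y. f y * q n y \<partial>lborel) \<longlonglongrightarrow> (\<integral>y. 0 \<partial>(lborel :: R3 measure))"
    proof (rule integral_dominated_convergence[of _ _ _ "\<lambda>y. \<bar>f y\<bar> * ((K + S) * indicator (ball 0 (M + 1 + B)) y)"])
      show "integrable lborel (\<lambda>y. \<bar>f y\<bar> * ((K + S) * indicator (ball 0 (M + 1 + B)) y))"
        by (rule L2_mult_integrable[OF L2_abs[OF f] L2_indicator_ball])
      show "AE y in lborel. (\<lambda>n. f y * q n y) \<longlonglongrightarrow> 0"
        using tendsto_mult_right_zero[OF qlim] by (intro AE_I2)
      show "AE y in lborel. norm (f y * q n y) \<le> \<bar>f y\<bar> * ((K + S) * indicator (ball 0 (M + 1 + B)) y)" for n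
        using qbd by (intro AE_I2) (auto simp: abs_mult intro!: mult_left_mono)
    qed (simp_all add: q_def inner_vec_def)
    moreover have "(\<integral>y. f y * q n y \<partial>lborel) = (conv3 f \<phi> (X n) - conv3 f \<phi> x - ?D (X n - x)) /\<^sub>R norm (X n - x)" for n
    proof -
      have "(\<integral>y. f y * q n y \<partial>lborel) =
          (\<integral>y. (f y * \<phi> (X n - y) - f y * \<phi> (x - y) - f y * (grad3 \<phi> (x - y) \<bullet> (X n - x))) / norm (X n - x) \<partial>lborel)"
        by (intro Bochner_Integration.integral_cong) (auto simp: q_def algebra_simps)
      also have "\<dots> = (conv3 f \<phi> (X n) - conv3 f \<phi> x - (\<integral>y. f y * (grad3 \<phi> (x - y) \<bullet> (X n - x)) \<partial>lborel)) / norm (X n - x)"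
        using int[OF \<phi>] Dint by (simp add: conv3_def)
      finally show ?thesis unfolding Dh by (simp add: divide_inverse)
    qed
    ultimately show "((\<lambda>z. (conv3 f \<phi> z - conv3 f \<phi> x - ?D (z - x)) /\<^sub>R norm (z - x)) \<circ> X) \<longlonglongrightarrow> 0"
      by (simp add: o_def)
  qed
  then show ?thesis
    unfolding has_derivative_def by (simp add: Lim_ident_at bounded_linear_inner_right)
qed

lemma conv3_pderiv3:
  assumes "L2 f" "test_fun UNIV \<phi>"
  shows "pderiv3 i (conv3 f \<phi>) = conv3 f (pderiv3 i \<phi>)"
  using pderiv3_eq[OF conv3_deriv[OF assms]] by (auto simp: inner_axis)

text \<open>Partial derivatives fall on the test function, so the convolutions of a fixed
  \<open>f\<close> with test functions form a class closed under \<open>pderiv3\<close>.\<close>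

lemma conv3_smooth:
  assumes "L2 f" "test_fun UNIV \<phi>" shows "smooth3 (conv3 f \<phi>)"
proof (rule smooth3_coinduct[of "\<lambda>h. \<exists>\<phi>. test_fun UNIV \<phi> \<and> h = conv3 f \<phi>"])
  fix h assume "\<exists>\<phi>. test_fun UNIV \<phi> \<and> h = conv3 f \<phi>"
  then obtain \<phi> where \<phi>: "test_fun UNIV \<phi>" "h = conv3 f \<phi>" by blast
  show "(\<forall>x. h differentiable at x) \<and> (\<forall>i. \<exists>\<phi>. test_fun UNIV \<phi> \<and> pderiv3 i h = conv3 f \<phi>)"
    using conv3_deriv[OF assms(1) \<phi>(1)] conv3_pderiv3[OF assms(1) \<phi>(1)] test_fun_pderiv3[OF \<phi>(1)] \<phi>(2)
    unfolding differentiable_def by blast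
qed (use assms in blast)

text \<open>The weak gradient is tested with the reflected and translated \<open>\<phi>\<close>,
  whose derivative contributes the second minus sign.\<close>

lemma conv3_weak_grad:
  assumes "has_weak_grad u g" "test_fun UNIV \<phi>"
  shows "conv3 u (pderiv3 i \<phi>) = conv3 (\<lambda>x. g x $ i) \<phi>"
proof
  fix x
  have "(\<integral>y. u y * pderiv3 i (\<lambda>y. \<phi> (x - y)) y \<partial>lborel) = - (\<integral>y. g y $ i * \<phi> (x - y) \<partial>lborel)"
    using assms test_fun_reflect(1)[OF assms(2)] unfolding has_weak_grad_def by blast
  then show "conv3 u (pderiv3 i \<phi>) x = conv3 (\<lambda>x. g x $ i) \<phi> x"
    by (simp add: test_fun_reflect(2)[OF assms(2)] conv3_def)
qed

text \<open>Stated with coordinates rather than with the norm, so that smoothness follows from the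
  closure rules for sums, powers and \<open>theta\<close>.\<close>

definition bump0 :: "R3 \<Rightarrow> real" where
  "bump0 x = theta (1 - ((x $ 1)\<^sup>2 + (x $ 2)\<^sup>2 + (x $ 3)\<^sup>2))"

lemma norm_R3: "(norm (x::R3))\<^sup>2 = (x $ 1)\<^sup>2 + (x $ 2)\<^sup>2 + (x $ 3)\<^sup>2"
  by (simp add: norm_vec_def L2_set_def sum_3 real_sqrt_pow2)

lemma bump0_eq: "bump0 x = theta (1 - (norm x)\<^sup>2)"
  by (simp add: bump0_def norm_R3)

lemma bump0_outside: "1 \<le> norm x \<Longrightarrow> bump0 x = 0"
  unfolding bump0_eq by (intro theta_props(1)) (simp add: one_le_power)

lemma bump0_test: "test_fun UNIV bump0"
proof (rule test_funI[of _ "cball 0 1"])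
  show "smooth3 bump0" unfolding bump0_def[abs_def]
    by (rule smooth3_compose[OF smooth1_theta], rule smooth3_diff[OF smooth3_const])
       (intro smooth3_add smooth3_power smooth3_coord)
qed (auto simp: bump0_outside)

lemma bump0_nonneg: "0 \<le> bump0 x" unfolding bump0_def by (rule theta_props(3))

lemma bump0_0: "0 < bump0 0" unfolding bump0_def by (rule theta_props(2)) simp

lemma bump0_integral_pos: "0 < (\<integral>x. bump0 x \<partial>lborel)"
proof -
  have "(\<integral>x. bump0 x \<partial>lborel) \<noteq> 0"
  proof
    assume "(\<integral>x. bump0 x \<partial>lborel) = 0"
    then have "AE x in lborel. bump0 x = 0"
      using integral_nonneg_eq_0_iff_AE[OF test_fun_integrable[OF bump0_test]] bump0_nonneg by auto
    then have ae: "AE x in lborel. x \<notin> ball (0::R3) 1"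
    proof eventually_elim
      case (elim x)
      have "0 < bump0 x" if "norm x < 1"
        unfolding bump0_eq by (rule theta_props(2)) (use that power_strict_mono[of "norm x" 1 2] in auto)
      then show ?case using elim by auto
    qed
    have "emeasure lborel (ball (0::R3) 1) = 0"
      using ae AE_iff_null_sets[of "ball (0::R3) 1" lborel] by auto
    moreover have "0 < emeasure lborel (ball (0::R3) 1)"
      using content_ball_pos[of 1 "0::R3"] by (simp add: measure_def enn2real_positive_iff)
    ultimately show False by simp
  qed
  moreover have "0 \<le> (\<integral>x. bump0 x \<partial>lborel)" using bump0_nonneg by simp
  ultimately show ?thesis by simp
qed

text \<open>\<open>Suc k\<close> keeps the scale positive at \<open>k = 0\<close>; the prefactor
  normalises the integral to 1 without the value of the integral of \<open>bump0\<close> being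
  known.\<close>

definition mollifier :: "nat \<Rightarrow> R3 \<Rightarrow> real" where
  "mollifier k x = real (Suc k) ^ 3 / (\<integral>x. bump0 x \<partial>lborel) * bump0 (real (Suc k) *\<^sub>R x)"

lemma mollifier_test: "test_fun UNIV (mollifier k)"
proof -
  have "test_fun UNIV (\<lambda>x. bump0 (real (Suc k) *\<^sub>R x + 0))"
    by (rule test_fun_affine[OF bump0_test]) auto
  from test_fun_scale[OF this] show ?thesis unfolding mollifier_def[abs_def] by (simp only: add_0_right)
qed

lemma mollifier_nonneg: "0 \<le> mollifier k x"
  unfolding mollifier_def using bump0_integral_pos bump0_nonneg by (auto intro!: mult_nonneg_nonneg)

lemma mollifier_integral: "(\<integral>x. mollifier k x \<partial>lborel) = 1"
proof -
  have "(\<integral>x. bump0 x \<partial>lborel) = real (Suc k) ^ 3 * (\<integral>x. bump0 (real (Suc k) *\<^sub>R x) \<partial>lborel)"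
    using integral_affine3(1)[of "real (Suc k)" bump0 0] test_fun_measurable[OF bump0_test] by simp
  moreover from this have "(\<integral>x. bump0 (real (Suc k) *\<^sub>R x) \<partial>lborel) \<noteq> 0" using bump0_integral_pos by auto
  ultimately show ?thesis unfolding mollifier_def by (simp del: of_nat_Suc)
qed

lemma mollifier_outside: "1 / real (Suc k) \<le> norm x \<Longrightarrow> mollifier k x = 0"
proof -
  assume "1 / real (Suc k) \<le> norm x"
  then have "1 \<le> norm (real (Suc k) *\<^sub>R x)" by (simp add: field_simps del: of_nat_Suc)
  from bump0_outside[OF this] show ?thesis by (simp add: mollifier_def del: of_nat_Suc)
qed

lemma conv3_flip:
  assumes "L2 f" "test_fun UNIV \<phi>"
  shows "conv3 f \<phi> x = (\<integral>z. f (x - z) * \<phi> z \<partial>lborel)" "integrable lborel (\<lambda>z. f (x - z) * \<phi> z)"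
proof -
  note [measurable] = L2_meas[OF assms(1)] test_fun_measurable[OF assms(2)]
  have int: "integrable lborel (\<lambda>y. f y * \<phi> (x - y))"
    by (rule L2_mult_integrable[OF assms(1) test_fun_L2[OF test_fun_reflect(1)[OF assms(2)]]])
  show "conv3 f \<phi> x = (\<integral>z. f (x - z) * \<phi> z \<partial>lborel)" "integrable lborel (\<lambda>z. f (x - z) * \<phi> z)"
    using integral_affine3[of "-1" "\<lambda>y. f y * \<phi> (x - y)" x] int
    by (simp_all add: conv3_def add.commute[of "- _"])
qed

text \<open>Jensen's inequality and Tonelli bound the mollification error by the modulus of continuity of translations.\<close>
lemma conv3_L2lim:
  assumes f: "L2 f"
  shows "L2lim (\<lambda>k. conv3 f (mollifier k)) f"
proof -
  note [measurable] = L2_meas[OF f]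
  have key: "(\<integral>\<^sup>+x. ennreal ((conv3 f (mollifier k) x - f x)\<^sup>2) \<partial>lborel) \<le> ennreal e"
    if e: "0 < e" and d: "\<And>y. norm y < 1 / real (Suc k) \<Longrightarrow> sqint (\<lambda>x. f (x - y) - f x) < e" for k e
  proof -
    let ?\<eta> = "mollifier k"
    note \<eta> = mollifier_test[of k]
    note [measurable] = test_fun_measurable[OF \<eta>]
    obtain K where K: "\<And>x. \<bar>?\<eta> x\<bar> \<le> K" using test_fun_bounded[OF \<eta>] by metis
    have \<eta>i: "integrable lborel ?\<eta>" by (rule test_fun_integrable[OF \<eta>])
    have pt: "ennreal ((conv3 f ?\<eta> x - f x)\<^sup>2) \<le> (\<integral>\<^sup>+z. ennreal ((f (x - z) - f x)\<^sup>2 * ?\<eta> z) \<partial>lborel)" for x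
    proof -
      define m where "m = conv3 f ?\<eta> x - f x"
      have i1: "integrable lborel (\<lambda>z. f (x - z) * ?\<eta> z)" by (rule conv3_flip(2)[OF f \<eta>])
      have i2: "integrable lborel (\<lambda>z. (f (x - z))\<^sup>2 * ?\<eta> z)"
      proof (rule Bochner_Integration.integrable_bound)
        show "integrable lborel (\<lambda>z. K * (f (x - z))\<^sup>2)"
          using integral_affine3(2)[of "-1" "\<lambda>y. (f y)\<^sup>2" x] L2_sq[OF f] by (simp add: add.commute[of "- _"])
        show "AE z in lborel. norm ((f (x - z))\<^sup>2 * ?\<eta> z) \<le> norm (K * (f (x - z))\<^sup>2)"
        proof (rule AE_I2)
          fix z
          have "\<bar>?\<eta> z\<bar> * (f (x - z))\<^sup>2 \<le> \<bar>K\<bar> * (f (x - z))\<^sup>2"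
            by (rule mult_right_mono[OF order_trans[OF K abs_ge_self]]) simp
          then show "norm ((f (x - z))\<^sup>2 * ?\<eta> z) \<le> norm (K * (f (x - z))\<^sup>2)"
            by (simp add: abs_mult mult.commute)
        qed
      qed simp
      have i3: "integrable lborel (\<lambda>z. (f (x - z) - f x)\<^sup>2 * ?\<eta> z)"
      proof -
        have "integrable lborel (\<lambda>z. (f (x - z))\<^sup>2 * ?\<eta> z - 2 * f x * (f (x - z) * ?\<eta> z) + (f x)\<^sup>2 * ?\<eta> z)"
          using i1 i2 \<eta>i by simp
        then show ?thesis by (simp add: power2_diff algebra_simps)
      qed
      have m: "(\<integral>z. (f (x - z) - f x) * ?\<eta> z \<partial>lborel) = m"
        using i1 \<eta>i by (simp add: m_def conv3_flip(1)[OF f \<eta>] left_diff_distrib mollifier_integral)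
      have i4: "integrable lborel (\<lambda>z. (f (x - z) - f x) * ?\<eta> z)"
        using i1 \<eta>i by (simp add: left_diff_distrib)
      \<comment> \<open>Jensen's inequality for the probability density \<open>mollifier k\<close>,
        in the form that a variance is nonnegative.\<close>
      have "0 \<le> (\<integral>z. (f (x - z) - f x - m)\<^sup>2 * ?\<eta> z \<partial>lborel)"
        using mollifier_nonneg by (intro Bochner_Integration.integral_nonneg) auto
      also have "\<dots> = (\<integral>z. (f (x - z) - f x)\<^sup>2 * ?\<eta> z - 2 * m * ((f (x - z) - f x) * ?\<eta> z) + m\<^sup>2 * ?\<eta> z \<partial>lborel)"
        by (intro Bochner_Integration.integral_cong) (auto simp: power2_eq_square algebra_simps)
      also have "\<dots> = (\<integral>z. (f (x - z) - f x)\<^sup>2 * ?\<eta> z \<partial>lborel) - m\<^sup>2"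
        using i3 i4 \<eta>i m by (simp add: mollifier_integral power2_eq_square)
      finally have "ennreal (m\<^sup>2) \<le> ennreal (\<integral>z. (f (x - z) - f x)\<^sup>2 * ?\<eta> z \<partial>lborel)" by (intro ennreal_leI) simp
      then show ?thesis using i3 mollifier_nonneg
        by (subst nn_integral_eq_integral) (auto simp: m_def)
    qed
    have "(\<integral>\<^sup>+x. ennreal ((conv3 f ?\<eta> x - f x)\<^sup>2) \<partial>lborel) \<le> (\<integral>\<^sup>+x. \<integral>\<^sup>+z. ennreal ((f (x - z) - f x)\<^sup>2 * ?\<eta> z) \<partial>lborel \<partial>lborel)"
      by (intro nn_integral_mono pt)
    also have "\<dots> = (\<integral>\<^sup>+z. \<integral>\<^sup>+x. ennreal ((f (x - z) - f x)\<^sup>2 * ?\<eta> z) \<partial>lborel \<partial>lborel)"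
    proof (rule nn_swap)
      have "(\<lambda>p::R3\<times>R3. fst p - snd p) \<in> borel_measurable borel" "(\<lambda>p::R3\<times>R3. fst p) \<in> borel_measurable borel"
        "(\<lambda>p::R3\<times>R3. snd p) \<in> borel_measurable borel"
        by (intro borel_measurable_continuous_onI continuous_intros)+
      note this[THEN measurable_compose, OF L2_meas[OF f]] this[THEN measurable_compose, OF test_fun_measurable[OF \<eta>]]
      then show "(\<lambda>p. ennreal ((f (fst p - snd p) - f (fst p))\<^sup>2 * ?\<eta> (snd p))) \<in> borel_measurable borel" by simp
    qed
    also have "\<dots> \<le> (\<integral>\<^sup>+z. ennreal (e * ?\<eta> z) \<partial>lborel)"
    proof (rule nn_integral_mono)
      fix z
      have L: "L2 (\<lambda>x. f (x - z) - f x)" by (intro L2_diff L2_translate f)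
      have "(\<integral>\<^sup>+x. ennreal ((f (x - z) - f x)\<^sup>2 * ?\<eta> z) \<partial>lborel) = ennreal (sqint (\<lambda>x. f (x - z) - f x) * ?\<eta> z)"
        using L2_sq[OF L] mollifier_nonneg[of k z] by (subst nn_integral_eq_integral) (auto simp: sqint_def)
      also have "\<dots> \<le> ennreal (e * ?\<eta> z)"
      proof (cases "norm z < 1 / real (Suc k)")
        case True
        then show ?thesis by (intro ennreal_leI mult_right_mono less_imp_le[OF d] mollifier_nonneg)
      next
        case False
        then show ?thesis using mollifier_outside[of k z] by simp
      qed
      finally show "(\<integral>\<^sup>+x. ennreal ((f (x - z) - f x)\<^sup>2 * ?\<eta> z) \<partial>lborel) \<le> ennreal (e * ?\<eta> z)" .
    qed
    also have "\<dots> = ennreal (\<integral>z. e * ?\<eta> z \<partial>lborel)"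
      using \<eta>i e mollifier_nonneg by (intro nn_integral_eq_integral) auto
    also have "\<dots> = ennreal e" by (simp add: mollifier_integral)
    finally show ?thesis .
  qed
  have cm: "conv3 f (mollifier k) \<in> borel_measurable borel" for k
    by (rule smooth3_measurable[OF conv3_smooth[OF f mollifier_test]])
  have ev: "L2 (\<lambda>x. conv3 f (mollifier k) x - f x) \<and> sqint (\<lambda>x. conv3 f (mollifier k) x - f x) \<le> e"
    if e: "0 < e" and d: "\<And>y. norm y < 1 / real (Suc k) \<Longrightarrow> sqint (\<lambda>x. f (x - y) - f x) < e" for k e
  proof -
    note [measurable] = cm[of k]
    have kk: "(\<integral>\<^sup>+x. ennreal ((conv3 f (mollifier k) x - f x)\<^sup>2) \<partial>lborel) \<le> ennreal e"
      by (rule key[OF e]) (rule d)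
    have i: "integrable lborel (\<lambda>x. (conv3 f (mollifier k) x - f x)\<^sup>2)"
      by (rule integrableI_bounded) (use le_less_trans[OF kk ennreal_less_top] in auto)
    have "ennreal (sqint (\<lambda>x. conv3 f (mollifier k) x - f x)) \<le> ennreal e"
      using kk nn_integral_eq_integral[OF i] by (simp add: sqint_def)
    then show ?thesis using i e by (simp add: L2_def ennreal_le_iff)
  qed
  have L: "L2 (conv3 f (mollifier k))" for k
  proof -
    \<comment> \<open>A crude bound valid at every scale puts each mollification into
      \<open>L2\<close>; the added 1 makes the inequality strict.\<close>
    have "sqint (\<lambda>x. f (x - y) - f x) < 4 * sqint f + 1" for y
      using sqint_add_le[OF L2_translate(1)[OF f, of y] L2_minus[OF f]] L2_translate(2)[OF f, of y]
      by (simp add: sqint_def)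
    then have "L2 (\<lambda>x. conv3 f (mollifier k) x - f x)"
      using ev[of "4 * sqint f + 1" k] sqint_nonneg[of f] by auto
    from L2_add[OF this f] show ?thesis by simp
  qed
  have "(\<lambda>k. sqint (\<lambda>x. conv3 f (mollifier k) x - f x)) \<longlonglongrightarrow> 0"
  proof (rule LIMSEQ_I)
    fix r :: real assume r: "0 < r"
    obtain d where d: "0 < d" "\<And>y. norm y < d \<Longrightarrow> sqint (\<lambda>x. f (x - y) - f x) < r/2"
      using translation_continuous[OF f, of "r/2"] r by auto
    obtain k0 where k0: "1 / real (Suc k0) < d" using nat_approx_posE[OF d(1)] by blast
    have "sqint (\<lambda>x. conv3 f (mollifier k) x - f x) < r" if "k \<ge> k0" for k
    proof -
      have "1 / real (Suc k) \<le> 1 / real (Suc k0)" using that by (simp add: field_simps)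
      then have "sqint (\<lambda>x. conv3 f (mollifier k) x - f x) \<le> r/2"
        using ev[of "r/2" k] d(2) k0 r by auto
      then show ?thesis using r by simp
    qed
    then show "\<exists>no. \<forall>k\<ge>no. norm (sqint (\<lambda>x. conv3 f (mollifier k) x - f x) - 0) < r"
      by (intro exI[of _ k0]) (simp add: sqint_nonneg)
  qed
  then show ?thesis using L f by (simp add: L2lim_def)
qed

text \<open>Mollifications of \<open>f\<close> are integrals of \<open>f\<close> against reflected
  test functions, hence vanish, and they converge to \<open>f\<close>.\<close>

lemma fundamental_lemma:
  assumes f: "L2 f" and 0: "\<And>\<phi>. test_fun UNIV \<phi> \<Longrightarrow> (\<integral>x. f x * \<phi> x \<partial>lborel) = 0"
  shows "AE x in lborel. f x = 0"
proof -
  have "conv3 f (mollifier k) x = 0" for k x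
    unfolding conv3_def by (rule 0[OF test_fun_reflect(1)[OF mollifier_test]])
  then have "conv3 f (mollifier k) = (\<lambda>x. 0)" for k by auto
  then have "L2lim (\<lambda>k x. 0) f" using conv3_L2lim[OF f] by simp
  then have "sqint f = 0" by (simp add: L2lim_def sqint_def LIMSEQ_const_iff)
  then show ?thesis by (rule sqint_eq_0_AE[OF f])
qed

lemma weak_grad_unique:
  assumes u: "L2 u" and g: "has_weak_grad u g" and h: "has_weak_grad u h"
  shows "AE x in lborel. g x $ i = h x $ i"
proof -
  have L: "L2 (\<lambda>x. g x $ i)" "L2 (\<lambda>x. h x $ i)" using g h by (auto simp: has_weak_grad_def)
  have "AE x in lborel. g x $ i - h x $ i = 0"
  proof (rule fundamental_lemma[OF L2_diff[OF L]])
    fix \<phi> assume \<phi>: "test_fun UNIV \<phi>"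
    have "(\<integral>x. g x $ i * \<phi> x \<partial>lborel) = (\<integral>x. h x $ i * \<phi> x \<partial>lborel)"
    proof -
      have "(\<integral>x. u x * pderiv3 i \<phi> x \<partial>lborel) = - (\<integral>x. g x $ i * \<phi> x \<partial>lborel)"
        using g \<phi> unfolding has_weak_grad_def by blast
      moreover have "(\<integral>x. u x * pderiv3 i \<phi> x \<partial>lborel) = - (\<integral>x. h x $ i * \<phi> x \<partial>lborel)"
        using h \<phi> unfolding has_weak_grad_def by blast
      ultimately show ?thesis by linarith
    qed
    then show "(\<integral>x. (g x $ i - h x $ i) * \<phi> x \<partial>lborel) = 0"
      using L2_mult_integrable[OF L(1) test_fun_L2[OF \<phi>]] L2_mult_integrable[OF L(2) test_fun_L2[OF \<phi>]]
      by (simp add: left_diff_distrib)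
  qed
  then show ?thesis by simp
qed

text \<open>The product rule for the square of a weakly differentiable function. Mollifying one of
  the two factors makes its product with \<open>\<phi>\<close> an admissible test function, and
  \<open>L2lim_mult\<close> passes to the limit.\<close>

lemma weak_grad_square:
  assumes w: "L2 w" and g: "has_weak_grad w g" and \<phi>: "test_fun UNIV \<phi>"
  shows "(\<integral>x. (w x)\<^sup>2 * pderiv3 i \<phi> x \<partial>lborel) = - 2 * (\<integral>x. w x * g x $ i * \<phi> x \<partial>lborel)"
proof -
  have gi: "L2 (\<lambda>x. g x $ i)" using g by (simp add: has_weak_grad_def)
  let ?w = "\<lambda>k. conv3 w (mollifier k)" and ?g = "\<lambda>k. conv3 (\<lambda>x. g x $ i) (mollifier k)"
  obtain K where K: "\<And>x. \<bar>\<phi> x\<bar> \<le> K" using test_fun_bounded[OF \<phi>] by metis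
  obtain K' where K': "\<And>x. \<bar>pderiv3 i \<phi> x\<bar> \<le> K'" using test_fun_bounded[OF test_fun_pderiv3[OF \<phi>]] by metis
  have L1: "L2 (\<lambda>x. pderiv3 i \<phi> x * w x)" by (rule L2_bounded_mult[OF w test_fun_measurable[OF test_fun_pderiv3[OF \<phi>]] K'])
  have L4: "L2 (\<lambda>x. \<phi> x * w x)" by (rule L2_bounded_mult[OF w test_fun_measurable[OF \<phi>] K])
  have L3: "L2 (\<lambda>x. \<phi> x * g x $ i)" by (rule L2_bounded_mult[OF gi test_fun_measurable[OF \<phi>] K])
  have cw: "L2lim ?w w" and cg: "L2lim ?g (\<lambda>x. g x $ i)" by (intro conv3_L2lim w gi)+
  then have Lk: "L2 (?w k)" "L2 (?g k)" for k by (auto simp: L2lim_def)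
  have id: "(\<integral>x. (pderiv3 i \<phi> x * w x) * ?w k x \<partial>lborel) + (\<integral>x. (\<phi> x * w x) * ?g k x \<partial>lborel)
    + (\<integral>x. (\<phi> x * g x $ i) * ?w k x \<partial>lborel) = 0" for k
  proof -
    have sw: "smooth3 (?w k)" by (rule conv3_smooth[OF w mollifier_test])
    have "(\<integral>x. w x * pderiv3 i (\<lambda>x. ?w k x * \<phi> x) x \<partial>lborel) = - (\<integral>x. g x $ i * (?w k x * \<phi> x) \<partial>lborel)"
      using g test_fun_mult[OF \<phi> sw] unfolding has_weak_grad_def by blast
    moreover have "pderiv3 i (\<lambda>x. ?w k x * \<phi> x) = (\<lambda>x. ?w k x * pderiv3 i \<phi> x + ?g k x * \<phi> x)"
      unfolding pderiv3_mult[OF sw test_funD[OF \<phi>]] conv3_pderiv3[OF w mollifier_test] conv3_weak_grad[OF g mollifier_test] ..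
    ultimately have "(\<integral>x. (pderiv3 i \<phi> x * w x) * ?w k x + (\<phi> x * w x) * ?g k x \<partial>lborel) = - (\<integral>x. (\<phi> x * g x $ i) * ?w k x \<partial>lborel)"
      by (simp add: algebra_simps)
    then show ?thesis using L2_mult_integrable[OF L1 Lk(1)[of k]] L2_mult_integrable[OF L4 Lk(2)[of k]] by simp
  qed
  have "(\<lambda>k. (\<integral>x. (pderiv3 i \<phi> x * w x) * ?w k x \<partial>lborel) + (\<integral>x. (\<phi> x * w x) * ?g k x \<partial>lborel)
    + (\<integral>x. (\<phi> x * g x $ i) * ?w k x \<partial>lborel)) \<longlonglongrightarrow>
    (\<integral>x. (pderiv3 i \<phi> x * w x) * w x \<partial>lborel) + (\<integral>x. (\<phi> x * w x) * g x $ i \<partial>lborel)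
    + (\<integral>x. (\<phi> x * g x $ i) * w x \<partial>lborel)"
    by (intro tendsto_add L2lim_mult L2lim_const L1 L4 L3 cw cg)
  then have "(\<integral>x. (pderiv3 i \<phi> x * w x) * w x \<partial>lborel) + (\<integral>x. (\<phi> x * w x) * g x $ i \<partial>lborel)
    + (\<integral>x. (\<phi> x * g x $ i) * w x \<partial>lborel) = 0"
    unfolding id by (simp add: LIMSEQ_const_iff)
  then show ?thesis by (simp add: power2_eq_square mult_ac)
qed

text \<open>The one-dimensional oscillator bound, or uncertainty principle: as x_i has i-th
  derivative 1, \<open>sqint w\<close> equals minus twice the integral of
  \<open>x_i w D_i w\<close>, and completing the square finishes. Testing \<open>w^2\<close> with
  x_i itself requires the cutoffs \<open>\<zeta> k\<close>.\<close>

lemma harmonic_weak: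
  assumes w: "L2 w" and g: "has_weak_grad w g" and xw: "L2 (\<lambda>x. x $ i * w x)"
  shows "sqint w \<le> sqint (\<lambda>x. g x $ i) + sqint (\<lambda>x. x $ i * w x)"
proof -
  have gi: "L2 (\<lambda>x. g x $ i)" using g by (simp add: has_weak_grad_def)
  define c where "c = 1 / bump0 0"
  define a where "a k = 1 / real (Suc k)" for k
  define \<zeta> where "\<zeta> k x = c * bump0 (a k *\<^sub>R x)" for k x
  have c: "0 < c" using bump0_0 by (simp add: c_def)
  have a0: "a \<longlonglongrightarrow> 0" unfolding a_def by (rule LIMSEQ_inverse_real_of_nat[unfolded inverse_eq_divide])
  have a: "0 < a k" for k by (simp add: a_def)
  have \<zeta>t: "test_fun UNIV (\<zeta> k)" for k
    unfolding \<zeta>_def[abs_def] using test_fun_scale[OF test_fun_affine[OF bump0_test, of "a k" 0 UNIV]] a[of k] by simp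
  \<comment> \<open>The derivative of the cutoff, multiplied by \<open>x $ i\<close>, is
    \<open>c * y (a k *\<^sub>R x)\<close>: bounded uniformly in \<open>k\<close> by scale
    invariance, and pointwise convergent to \<open>c * y 0 = 0\<close>.\<close>
  define y where "y x = x $ i * pderiv3 i bump0 x" for x :: R3
  have yt: "test_fun UNIV y" unfolding y_def[abs_def]
    by (intro test_fun_mult test_fun_pderiv3 bump0_test smooth3_coord)
  obtain K1 where K1: "\<And>x. \<bar>bump0 x\<bar> \<le> K1" using test_fun_bounded[OF bump0_test] by metis
  obtain K2 where K2: "\<And>x. \<bar>y x\<bar> \<le> K2" using test_fun_bounded[OF yt] by metis
  have pd: "pderiv3 i (\<lambda>x. x $ i * \<zeta> k x) x = \<zeta> k x + c * y (a k *\<^sub>R x)" for k x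
  proof -
    have "pderiv3 i (\<zeta> k) x = c * (a k * pderiv3 i bump0 (a k *\<^sub>R x))"
      unfolding \<zeta>_def[abs_def]
      using pderiv3_scale[OF smooth3_affine[OF test_funD[OF bump0_test], of "a k" 0], of i c]
        pderiv3_affine[OF test_funD[OF bump0_test], of i "a k" 0] by simp
    then show ?thesis
      unfolding pderiv3_mult[OF smooth3_coord test_funD[OF \<zeta>t]] by (simp add: pderiv3_coord y_def)
  qed
  have id: "(\<integral>x. (w x)\<^sup>2 * (\<zeta> k x + c * y (a k *\<^sub>R x)) \<partial>lborel) = - 2 * (\<integral>x. (x $ i * w x) * g x $ i * \<zeta> k x \<partial>lborel)" for k
    using weak_grad_square[OF w g test_fun_mult[OF \<zeta>t[of k] smooth3_coord[of i]], of i] by (simp add: pd mult_ac)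
  have b0: "continuous (at 0) bump0" "continuous (at 0) y"
    using test_fun_continuous[OF bump0_test, of UNIV] test_fun_continuous[OF yt, of UNIV] by (auto simp: continuous_on_eq_continuous_at)
  have ax: "(\<lambda>k. a k *\<^sub>R x) \<longlonglongrightarrow> 0" for x :: R3 using tendsto_scaleR[OF a0 tendsto_const, of x] by simp
  have \<zeta>1: "(\<lambda>k. \<zeta> k x) \<longlonglongrightarrow> 1" for x
  proof -
    have "(\<lambda>k. c * bump0 (a k *\<^sub>R x)) \<longlonglongrightarrow> c * bump0 0"
      by (intro tendsto_intros isCont_tendsto_compose[OF b0(1) ax])
    then show ?thesis using bump0_0 by (simp add: \<zeta>_def c_def)
  qed
  have y1: "(\<lambda>k. c * y (a k *\<^sub>R x)) \<longlonglongrightarrow> 0" for x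
  proof -
    have "(\<lambda>k. c * y (a k *\<^sub>R x)) \<longlonglongrightarrow> c * y 0"
      by (intro tendsto_intros isCont_tendsto_compose[OF b0(2) ax])
    then show ?thesis by (simp add: y_def)
  qed
  have \<zeta>b: "\<bar>\<zeta> k x\<bar> \<le> c * K1" and yb: "\<bar>c * y (a k *\<^sub>R x)\<bar> \<le> c * K2" for k x
    using K1 K2 c by (auto simp: \<zeta>_def abs_mult intro!: mult_left_mono)
  have am: "(\<lambda>x::R3. a k *\<^sub>R x) \<in> borel_measurable borel" for k by simp
  note [measurable] = L2_meas[OF w] L2_meas[OF gi] test_fun_measurable[OF \<zeta>t] measurable_compose[OF am test_fun_measurable[OF yt]]
  have l1: "(\<lambda>k. \<integral>x. (w x)\<^sup>2 * (\<zeta> k x + c * y (a k *\<^sub>R x)) \<partial>lborel) \<longlonglongrightarrow> (\<integral>x. (w x)\<^sup>2 * (1 + 0) \<partial>lborel)"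
  proof (rule integral_dominated_convergence[of _ _ _ "\<lambda>x. (w x)\<^sup>2 * (c * K1 + c * K2)"])
    show "AE x in lborel. (\<lambda>k. (w x)\<^sup>2 * (\<zeta> k x + c * y (a k *\<^sub>R x))) \<longlonglongrightarrow> (w x)\<^sup>2 * (1 + 0)"
      by (intro AE_I2 tendsto_intros \<zeta>1 y1)
    show "AE x in lborel. norm ((w x)\<^sup>2 * (\<zeta> k x + c * y (a k *\<^sub>R x))) \<le> (w x)\<^sup>2 * (c * K1 + c * K2)" for k
      by (intro AE_I2) (auto simp: abs_mult intro!: mult_left_mono order_trans[OF abs_triangle_ineq] add_mono \<zeta>b yb)
    show "integrable lborel (\<lambda>x. (w x)\<^sup>2 * (c * K1 + c * K2))" using L2_sq[OF w] by simp
  qed simp_all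
  have l2: "(\<lambda>k. \<integral>x. (x $ i * w x) * g x $ i * \<zeta> k x \<partial>lborel) \<longlonglongrightarrow> (\<integral>x. (x $ i * w x) * g x $ i * 1 \<partial>lborel)"
  proof (rule integral_dominated_convergence[of _ _ _ "\<lambda>x. \<bar>(x $ i * w x) * g x $ i\<bar> * (c * K1)"])
    show "AE x in lborel. (\<lambda>k. (x $ i * w x) * g x $ i * \<zeta> k x) \<longlonglongrightarrow> (x $ i * w x) * g x $ i * 1"
      by (intro AE_I2 tendsto_intros \<zeta>1)
    show "AE x in lborel. norm ((x $ i * w x) * g x $ i * \<zeta> k x) \<le> \<bar>(x $ i * w x) * g x $ i\<bar> * (c * K1)" for k
    proof (rule AE_I2)
      fix x
      have "\<bar>(x $ i * w x) * g x $ i\<bar> * \<bar>\<zeta> k x\<bar> \<le> \<bar>(x $ i * w x) * g x $ i\<bar> * (c * K1)"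
        by (rule mult_left_mono[OF \<zeta>b]) simp
      then show "norm ((x $ i * w x) * g x $ i * \<zeta> k x) \<le> \<bar>(x $ i * w x) * g x $ i\<bar> * (c * K1)"
        by (simp only: real_norm_def abs_mult[symmetric])
    qed
    show "integrable lborel (\<lambda>x. \<bar>(x $ i * w x) * g x $ i\<bar> * (c * K1))"
      using L2_mult_integrable[OF xw gi] by (intro integrable_mult_left integrable_abs) auto
  qed (use L2_meas[OF xw] in simp_all)
  have "(\<lambda>k. \<integral>x. (w x)\<^sup>2 * (\<zeta> k x + c * y (a k *\<^sub>R x)) \<partial>lborel) \<longlonglongrightarrow> - 2 * (\<integral>x. (x $ i * w x) * g x $ i * 1 \<partial>lborel)"
    unfolding id by (intro tendsto_intros l2)
  from LIMSEQ_unique[OF l1 this] have "sqint w = - 2 * (\<integral>x. g x $ i * (x $ i * w x) \<partial>lborel)"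
    by (simp add: sqint_def mult_ac)
  moreover have "0 \<le> sqint (\<lambda>x. g x $ i + x $ i * w x)" by (rule sqint_nonneg)
  ultimately show ?thesis unfolding sqint_add[OF gi xw] by linarith
qed

section \<open>Sobolev functions\<close>

lemma L2_cong_AE:
  assumes f: "L2 f" and [measurable]: "g \<in> borel_measurable borel" and eq: "AE x in lborel. f x = g x"
  shows "L2 g"
proof -
  have "AE x in lborel. (g x)\<^sup>2 \<le> (f x)\<^sup>2" using eq by eventually_elim simp
  then show ?thesis by (rule L2_bound[OF assms(2) L2_sq[OF f]])
qed

lemma V_nonneg: "0 \<le> V x" by (simp add: V_def)

lemma V_measurable [measurable]: "V \<in> borel_measurable borel"
  unfolding V_def[abs_def] by (intro borel_measurable_continuous_onI continuous_intros)

lemma V_le_norm: "V x \<le> (norm x)\<^sup>2"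
  by (simp add: V_def norm_R3)

lemma has_weak_grad_L2: "has_weak_grad u g \<Longrightarrow> L2 (\<lambda>x. g x $ i)"
  by (simp add: has_weak_grad_def)

lemma has_weak_grad_eq:
  "has_weak_grad u g \<Longrightarrow> test_fun UNIV \<phi> \<Longrightarrow> (\<integral>x. u x * pderiv3 i \<phi> x \<partial>lborel) = - (\<integral>x. g x $ i * \<phi> x \<partial>lborel)"
  by (simp add: has_weak_grad_def)

lemma has_weak_grad_wgrad: "has_weak_grad u g \<Longrightarrow> has_weak_grad u (wgrad u)"
  unfolding wgrad_def by (metis someI_ex)

lemma has_weak_grad_lincomb:
  assumes u: "L2 u" and g: "has_weak_grad u g" and v: "L2 v" and h: "has_weak_grad v h"
  shows "has_weak_grad (\<lambda>x. a * u x + b * v x) (\<lambda>x. a *\<^sub>R g x + b *\<^sub>R h x)"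
  unfolding has_weak_grad_def
proof (intro conjI allI impI)
  show "L2 (\<lambda>x. (a *\<^sub>R g x + b *\<^sub>R h x) $ i)" for i
    using L2_add[OF L2_scale[OF has_weak_grad_L2[OF g]] L2_scale[OF has_weak_grad_L2[OF h]]] by simp
  fix \<phi> :: "R3 \<Rightarrow> real" and i assume \<phi>: "test_fun UNIV \<phi>"
  have I: "integrable lborel (\<lambda>x. u x * pderiv3 i \<phi> x)" "integrable lborel (\<lambda>x. v x * pderiv3 i \<phi> x)"
    "integrable lborel (\<lambda>x. g x $ i * \<phi> x)" "integrable lborel (\<lambda>x. h x $ i * \<phi> x)"
    by (intro L2_mult_integrable u v has_weak_grad_L2[OF g] has_weak_grad_L2[OF h] test_fun_L2[OF \<phi>] test_fun_L2[OF test_fun_pderiv3[OF \<phi>]])+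
  have "(\<integral>x. (a * u x + b * v x) * pderiv3 i \<phi> x \<partial>lborel) = (\<integral>x. a * (u x * pderiv3 i \<phi> x) + b * (v x * pderiv3 i \<phi> x) \<partial>lborel)"
    by (intro Bochner_Integration.integral_cong) (auto simp: algebra_simps)
  also have "\<dots> = - (\<integral>x. a * (g x $ i * \<phi> x) + b * (h x $ i * \<phi> x) \<partial>lborel)"
    using I has_weak_grad_eq[OF g \<phi>] has_weak_grad_eq[OF h \<phi>] by simp
  also have "(\<integral>x. a * (g x $ i * \<phi> x) + b * (h x $ i * \<phi> x) \<partial>lborel) = (\<integral>x. (a *\<^sub>R g x + b *\<^sub>R h x) $ i * \<phi> x \<partial>lborel)"
    by (intro Bochner_Integration.integral_cong) (auto simp: algebra_simps)
  finally show "(\<integral>x. (a * u x + b * v x) * pderiv3 i \<phi> x \<partial>lborel) = - (\<integral>x. (a *\<^sub>R g x + b *\<^sub>R h x) $ i * \<phi> x \<partial>lborel)" .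
qed

lemma has_weak_grad_diff:
  assumes "L2 u" "has_weak_grad u g" "L2 v" "has_weak_grad v h"
  shows "has_weak_grad (\<lambda>x. u x - v x) (\<lambda>x. g x - h x)"
  using has_weak_grad_lincomb[OF assms, of 1 "-1"] by simp

lemma has_weak_grad_scale:
  assumes "L2 u" "has_weak_grad u g"
  shows "has_weak_grad (\<lambda>x. c * u x) (\<lambda>x. c *\<^sub>R g x)"
  using has_weak_grad_lincomb[OF assms assms, of c 0] by simp

text \<open>\<open>wgrad\<close> is an arbitrary choice of weak gradient; since weak gradients agree
  almost everywhere, integrals of it can be computed with any convenient \<open>g\<close>.\<close>

lemma gradsq_wgrad:
  assumes u: "L2 u" and g: "has_weak_grad u g"
  shows "integrable lborel (\<lambda>x. (norm (wgrad u x))\<^sup>2)" "(\<integral>x. (norm (wgrad u x))\<^sup>2 \<partial>lborel) = gradsq g"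
    "AE x in lborel. wgrad u x = g x"
proof -
  note w = has_weak_grad_wgrad[OF g]
  have n: "(norm (wgrad u x))\<^sup>2 = (\<Sum>i\<in>UNIV. (wgrad u x $ i)\<^sup>2)" for x
    by (simp add: norm_R3 sum_3)
  show "integrable lborel (\<lambda>x. (norm (wgrad u x))\<^sup>2)"
    unfolding n by (intro Bochner_Integration.integrable_sum L2_sq has_weak_grad_L2[OF w])
  have ae: "AE x in lborel. wgrad u x $ i = g x $ i" for i by (rule weak_grad_unique[OF u w g])
  have "(\<integral>x. (norm (wgrad u x))\<^sup>2 \<partial>lborel) = gradsq (wgrad u)"
    unfolding n gradsq_def sqint_def by (intro Bochner_Integration.integral_sum L2_sq has_weak_grad_L2[OF w])
  also have "\<dots> = gradsq g"
    unfolding gradsq_def by (intro sum.cong refl sqint_cong_AE has_weak_grad_L2[OF w] has_weak_grad_L2[OF g] ae)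
  finally show "(\<integral>x. (norm (wgrad u x))\<^sup>2 \<partial>lborel) = gradsq g" .
  show "AE x in lborel. wgrad u x = g x"
    using ae[of 1] ae[of 2] ae[of 3] by eventually_elim (simp add: vec_eq_iff forall_3)
qed

lemma H1_norm_eq:
  assumes u: "L2 u" and g: "has_weak_grad u g"
  shows "H1_norm u = sqrt (gradsq g + sqint u)"
  unfolding H1_norm_def sqint_def using gradsq_wgrad[OF assms] L2_sq[OF u] by simp

lemma H_norm_eq:
  assumes u: "L2 u" and g: "has_weak_grad u g" and V: "integrable lborel (\<lambda>x. V x * (u x)\<^sup>2)"
  shows "H_norm u = sqrt (gradsq g + (\<integral>x. V x * (u x)\<^sup>2 \<partial>lborel) + sqint u)"
  unfolding H_norm_def sqint_def using gradsq_wgrad[OF u g] L2_sq[OF u] V by (simp add: distrib_right)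

lemma gradsq_diff_commute: "gradsq (\<lambda>x. g x - h x) = gradsq (\<lambda>x. h x - g x)"
  unfolding gradsq_def vector_minus_component by (rule sum.cong[OF refl sqint_diff_commute])

lemma gradsq_scale: "gradsq (\<lambda>x. c *\<^sub>R g x) = c\<^sup>2 * gradsq g"
  unfolding gradsq_def by (simp add: sqint_scale sum_distrib_left)

lemma V_integrable:
  assumes u: "L2 u" and V: "integrable lborel (\<lambda>x. V x * (u x)\<^sup>2)"
  shows "i \<noteq> 3 \<Longrightarrow> L2 (\<lambda>x. x $ i * u x)"
    "(\<integral>x. V x * (u x)\<^sup>2 \<partial>lborel) = sqint (\<lambda>x. x $ 1 * u x) + sqint (\<lambda>x. x $ 2 * u x)"
proof -
  note [measurable] = L2_meas[OF u]
  have c: "(\<lambda>x::R3. x $ i) \<in> borel_measurable borel" for i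
    by (intro borel_measurable_continuous_onI continuous_intros)
  note [measurable] = c
  have L: "L2 (\<lambda>x. x $ i * u x)" if "i \<noteq> 3" for i
  proof -
    have "i = 1 \<or> i = 2" using that exhaust_3[of i] by auto
    then have "(x $ i * u x)\<^sup>2 \<le> V x * (u x)\<^sup>2" for x
      by (auto simp: V_def power_mult_distrib intro!: mult_right_mono)
    then show ?thesis by (intro L2_bound[OF _ V]) auto
  qed
  show "i \<noteq> 3 \<Longrightarrow> L2 (\<lambda>x. x $ i * u x)" by (rule L)
  have "integrable lborel (\<lambda>x. (x $ 1 * u x)\<^sup>2)" "integrable lborel (\<lambda>x. (x $ 2 * u x)\<^sup>2)"
    using L2_sq[OF L[of 1]] L2_sq[OF L[of 2]] by auto
  then show "(\<integral>x. V x * (u x)\<^sup>2 \<partial>lborel) = sqint (\<lambda>x. x $ 1 * u x) + sqint (\<lambda>x. x $ 2 * u x)"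
    unfolding sqint_def V_def by (subst Bochner_Integration.integral_add[symmetric]) (auto simp: algebra_simps power_mult_distrib)
qed

text \<open>The sum of the oscillator bounds in the first two coordinates; the derivative in the
  third is discarded, as no potential acts there. The constant 2 is the threshold against which the
  multipliers are compared.\<close>

lemma harmonic_H:
  assumes u: "L2 u" and g: "has_weak_grad u g" and V: "integrable lborel (\<lambda>x. V x * (u x)\<^sup>2)"
  shows "2 * sqint u \<le> gradsq g + (\<integral>x. V x * (u x)\<^sup>2 \<partial>lborel)"
proof -
  have "sqint u \<le> sqint (\<lambda>x. g x $ 1) + sqint (\<lambda>x. x $ 1 * u x)" "sqint u \<le> sqint (\<lambda>x. g x $ 2) + sqint (\<lambda>x. x $ 2 * u x)"
    by (intro harmonic_weak u g V_integrable(1)[OF u V]; simp)+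
  moreover have "gradsq g = sqint (\<lambda>x. g x $ 1) + sqint (\<lambda>x. g x $ 2) + sqint (\<lambda>x. g x $ 3)"
    by (simp add: gradsq_def sum_3)
  moreover have "0 \<le> sqint (\<lambda>x. g x $ 3)" by (rule sqint_nonneg)
  ultimately show ?thesis unfolding V_integrable(2)[OF u V] by linarith
qed

text \<open>\<open>H0 R u g\<close>: \<open>u\<close> lies in \<open>H\<^sup>1\<^sub>0(B\<^sub>R)\<close> with gradient \<open>g\<close>.\<close>
definition H0 :: "real \<Rightarrow> (R3 \<Rightarrow> real) \<Rightarrow> (R3 \<Rightarrow> R3) \<Rightarrow> bool" where
  "H0 R u g \<longleftrightarrow> (\<exists>\<phi>. (\<forall>k. test_fun (ball 0 R) (\<phi> k)) \<and> L2lim \<phi> u \<and>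
     (\<forall>i. L2lim (\<lambda>k. pderiv3 i (\<phi> k)) (\<lambda>x. g x $ i)))"

lemma H0E:
  assumes "H0 R u g"
  obtains \<phi> where "\<And>k. test_fun (ball 0 R) (\<phi> k)" "L2lim \<phi> u" "\<And>i. L2lim (\<lambda>k. pderiv3 i (\<phi> k)) (\<lambda>x. g x $ i)"
  using assms unfolding H0_def by blast

lemma H0_L2: "H0 R u g \<Longrightarrow> L2 u" "H0 R u g \<Longrightarrow> L2 (\<lambda>x. g x $ i)"
  unfolding H0_def L2lim_def by blast+

lemma H0_weak_grad:
  assumes "H0 R u g" shows "has_weak_grad u g"
  unfolding has_weak_grad_def
proof (intro conjI allI impI)
  show "L2 (\<lambda>x. g x $ i)" for i by (rule H0_L2(2)[OF assms])
  fix \<psi> :: "R3 \<Rightarrow> real" and i assume \<psi>: "test_fun UNIV \<psi>"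
  obtain \<phi> where \<phi>: "\<And>k. test_fun (ball 0 R) (\<phi> k)" "L2lim \<phi> u" "\<And>i. L2lim (\<lambda>k. pderiv3 i (\<phi> k)) (\<lambda>x. g x $ i)"
    using H0E[OF assms] by blast
  have "(\<lambda>k. \<integral>x. \<phi> k x * pderiv3 i \<psi> x \<partial>lborel) \<longlonglongrightarrow> (\<integral>x. u x * pderiv3 i \<psi> x \<partial>lborel)"
    by (intro L2lim_mult \<phi> L2lim_const test_fun_L2[OF test_fun_pderiv3[OF \<psi>]])
  moreover have "(\<lambda>k. \<integral>x. \<phi> k x * pderiv3 i \<psi> x \<partial>lborel) \<longlonglongrightarrow> - (\<integral>x. g x $ i * \<psi> x \<partial>lborel)"
    unfolding test_fun_by_parts[OF \<psi> test_funD[OF \<phi>(1)]]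
    by (intro tendsto_minus L2lim_mult \<phi> L2lim_const test_fun_L2[OF \<psi>])
  ultimately show "(\<integral>x. u x * pderiv3 i \<psi> x \<partial>lborel) = - (\<integral>x. g x $ i * \<psi> x \<partial>lborel)" by (rule LIMSEQ_unique)
qed

lemma H0_test: "test_fun (ball 0 R) \<phi> \<Longrightarrow> H0 R \<phi> (grad3 \<phi>)"
  unfolding H0_def by (rule exI[of _ "\<lambda>k. \<phi>"]) (auto intro!: L2lim_const test_fun_L2 test_fun_pderiv3)

lemma H0_mono: "H0 R u g \<Longrightarrow> R \<le> R' \<Longrightarrow> H0 R' u g"
  unfolding H0_def by (meson test_fun_mono subset_ball)

lemma H0_diff:
  assumes "H0 R u g" "H0 R v h" shows "H0 R (\<lambda>x. u x - v x) (\<lambda>x. g x - h x)"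
proof -
  obtain \<phi> where \<phi>: "\<And>k. test_fun (ball 0 R) (\<phi> k)" "L2lim \<phi> u" "\<And>i. L2lim (\<lambda>k. pderiv3 i (\<phi> k)) (\<lambda>x. g x $ i)"
    using H0E[OF assms(1)] by blast
  obtain \<psi> where \<psi>: "\<And>k. test_fun (ball 0 R) (\<psi> k)" "L2lim \<psi> v" "\<And>i. L2lim (\<lambda>k. pderiv3 i (\<psi> k)) (\<lambda>x. h x $ i)"
    using H0E[OF assms(2)] by blast
  show ?thesis unfolding H0_def
  proof (rule exI[of _ "\<lambda>k x. \<phi> k x - \<psi> k x"], intro conjI allI)
    show "test_fun (ball 0 R) (\<lambda>x. \<phi> k x - \<psi> k x)" for k by (intro test_fun_diff \<phi> \<psi>)
    show "L2lim (\<lambda>k x. \<phi> k x - \<psi> k x) (\<lambda>x. u x - v x)" by (intro L2lim_diff \<phi> \<psi>)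
    show "L2lim (\<lambda>k. pderiv3 i (\<lambda>x. \<phi> k x - \<psi> k x)) (\<lambda>x. (g x - h x) $ i)" for i
      using L2lim_diff[OF \<phi>(3)[of i] \<psi>(3)[of i]] by (simp add: pderiv3_diff[OF test_funD[OF \<phi>(1)] test_funD[OF \<psi>(1)]])
  qed
qed

lemma L2lim_dilate:
  assumes "L2lim F f" and t: "t > 0" shows "L2lim (\<lambda>k x. F k (t *\<^sub>R x)) (\<lambda>x. f (t *\<^sub>R x))"
    "sqint (\<lambda>x. f (t *\<^sub>R x)) = sqint f / t^3" "L2 (\<lambda>x. f (t *\<^sub>R x))"
proof -
  have D: "L2 (\<lambda>x. h (t *\<^sub>R x)) \<and> sqint (\<lambda>x. h (t *\<^sub>R x)) = sqint h / t^3" if "L2 h" for h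
  proof -
    note [measurable] = L2_meas[OF that]
    show ?thesis using integral_affine3[of t "\<lambda>x. (h x)\<^sup>2" 0] that t by (simp add: L2_def sqint_def)
  qed
  have L: "\<And>k. L2 (F k)" "L2 f" using assms by (auto simp: L2lim_def)
  show "sqint (\<lambda>x. f (t *\<^sub>R x)) = sqint f / t^3" "L2 (\<lambda>x. f (t *\<^sub>R x))" using D[OF L(2)] by auto
  have "(\<lambda>k. sqint (\<lambda>x. F k x - f x) / t^3) \<longlonglongrightarrow> 0 / t^3"
    using assms by (intro tendsto_intros) (auto simp: L2lim_def)
  then show "L2lim (\<lambda>k x. F k (t *\<^sub>R x)) (\<lambda>x. f (t *\<^sub>R x))"
    unfolding L2lim_def using D L D[OF L2_diff[OF L], THEN conjunct2] by simp
qed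

text \<open>For \<open>t \<ge> 1\<close> the support moves towards the origin and stays in the ball,
  which is why the Pohozaev argument varies \<open>t\<close> on one side of 1.\<close>

lemma H0_dilate:
  assumes "H0 R u g" and t: "t \<ge> 1"
  shows "H0 R (\<lambda>x. u (t *\<^sub>R x)) (\<lambda>x. t *\<^sub>R g (t *\<^sub>R x))"
proof -
  obtain \<phi> where \<phi>: "\<And>k. test_fun (ball 0 R) (\<phi> k)" "L2lim \<phi> u" "\<And>i. L2lim (\<lambda>k. pderiv3 i (\<phi> k)) (\<lambda>x. g x $ i)"
    using H0E[OF assms(1)] by blast
  have t0: "t > 0" using t by simp
  show ?thesis unfolding H0_def
  proof (rule exI[of _ "\<lambda>k x. \<phi> k (t *\<^sub>R x)"], intro conjI allI)
    have "x \<in> ball 0 R" if "t *\<^sub>R x + 0 \<in> ball 0 R" for x :: R3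
    proof -
      have "1 * norm x \<le> t * norm x" by (intro mult_right_mono t) auto
      then show ?thesis using that t0 by simp
    qed
    then show "test_fun (ball 0 R) (\<lambda>x. \<phi> k (t *\<^sub>R x))" for k
      using test_fun_affine[OF \<phi>(1)[of k], of t 0 "ball 0 R"] t0 by simp
    show "L2lim (\<lambda>k x. \<phi> k (t *\<^sub>R x)) (\<lambda>x. u (t *\<^sub>R x))" by (rule L2lim_dilate(1)[OF \<phi>(2) t0])
    show "L2lim (\<lambda>k. pderiv3 i (\<lambda>x. \<phi> k (t *\<^sub>R x))) (\<lambda>x. (t *\<^sub>R g (t *\<^sub>R x)) $ i)" for i
      using L2lim_scale[OF L2lim_dilate(1)[OF \<phi>(3)[of i] t0], where c=t] pderiv3_affine[OF test_funD[OF \<phi>(1)], where i=i and a=t and b=0]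
      by simp
  qed
qed

text \<open>The bridge from the norm in the definition of \<open>H10_ball\<close> to componentwise
  \<open>L2\<close> convergence: the squared norm is a sum of nonnegative terms, each of which must
  tend to zero.\<close>

lemma H10_ball_H0:
  assumes "u \<in> H10_ball R"
  shows "L2 u" "has_weak_grad u (wgrad u)" "H0 R u (wgrad u)"
proof -
  from assms obtain g where u: "L2 u" and g: "has_weak_grad u g" by (auto simp: H10_ball_def H1_def)
  show "L2 u" by fact
  show w: "has_weak_grad u (wgrad u)" by (rule has_weak_grad_wgrad[OF g])
  from assms obtain \<phi> where \<phi>: "\<And>k. test_fun (ball 0 R) (\<phi> k)" and
    lim: "(\<lambda>k. H1_norm (\<lambda>x. \<phi> k x - u x)) \<longlonglongrightarrow> 0" by (auto simp: H10_ball_def)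
  have L: "L2 (\<phi> k)" "L2 (pderiv3 i (\<phi> k))" for k i using \<phi> by (auto intro: test_fun_L2 test_fun_pderiv3)
  let ?N = "\<lambda>k. gradsq (\<lambda>x. grad3 (\<phi> k) x - wgrad u x) + sqint (\<lambda>x. \<phi> k x - u x)"
  have eq: "H1_norm (\<lambda>x. \<phi> k x - u x) = sqrt (?N k)" for k
    by (rule H1_norm_eq[OF L2_diff[OF L(1) u] has_weak_grad_diff[OF L(1) has_weak_grad_test[OF \<phi>] u w]])
  have "(\<lambda>k. (H1_norm (\<lambda>x. \<phi> k x - u x))\<^sup>2) \<longlonglongrightarrow> 0\<^sup>2" by (intro tendsto_intros lim)
  then have N0: "?N \<longlonglongrightarrow> 0" unfolding eq by (simp add: gradsq_nonneg sqint_nonneg)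
  have 1: "(\<lambda>k. sqint (\<lambda>x. \<phi> k x - u x)) \<longlonglongrightarrow> 0"
    by (rule tendsto_sandwich[OF _ _ tendsto_const N0]) (auto simp: gradsq_nonneg sqint_nonneg)
  have 2: "(\<lambda>k. sqint (\<lambda>x. pderiv3 i (\<phi> k) x - wgrad u x $ i)) \<longlonglongrightarrow> 0" for i
  proof (rule tendsto_sandwich[OF _ _ tendsto_const N0])
    show "\<forall>\<^sub>F k in sequentially. sqint (\<lambda>x. pderiv3 i (\<phi> k) x - wgrad u x $ i) \<le> ?N k"
      using gradsq_ge[of "\<lambda>x. grad3 (\<phi> _) x - wgrad u x" i] sqint_nonneg
      by (intro always_eventually allI) (simp add: add_increasing2)
  qed (auto simp: sqint_nonneg)
  show "H0 R u (wgrad u)" unfolding H0_def L2lim_def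
    using \<phi> L u has_weak_grad_L2[OF w] 1 2 by (intro exI[of _ \<phi>]) blast
qed

text \<open>A subsequence of the approximating test functions converges almost everywhere, and all
  its members vanish off the ball.\<close>

lemma H0_outside:
  assumes "H0 R u g"
  shows "AE x in lborel. x \<notin> ball 0 R \<longrightarrow> u x = 0"
proof -
  obtain \<phi> where \<phi>: "\<And>k. test_fun (ball 0 R) (\<phi> k)" "L2lim \<phi> u" by (rule H0E[OF assms]) metis
  obtain r where "AE x in lborel. (\<lambda>k. \<phi> (r k) x) \<longlonglongrightarrow> u x" using L2lim_AE_subseq[OF \<phi>(2)] by blast
  then show ?thesis
  proof eventually_elim
    case (elim x)
    show ?case
    proof
      assume "x \<notin> ball 0 R"
      then have "(\<lambda>k. \<phi> (r k) x) = (\<lambda>k. 0)" using test_fun_zero[OF \<phi>(1)] by blast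
      then show "u x = 0" using elim LIMSEQ_unique[OF tendsto_const] by metis
    qed
  qed
qed

lemma H0_grad_outside:
  assumes "H0 R u g"
  shows "AE x in lborel. x \<notin> ball 0 R \<longrightarrow> g x = 0"
proof -
  obtain \<phi> where \<phi>: "\<And>k. test_fun (ball 0 R) (\<phi> k)" "\<And>i. L2lim (\<lambda>k. pderiv3 i (\<phi> k)) (\<lambda>x. g x $ i)"
    by (rule H0E[OF assms]) metis
  have "AE x in lborel. x \<notin> ball 0 R \<longrightarrow> g x $ i = 0" for i
  proof -
    obtain r where "AE x in lborel. (\<lambda>k. pderiv3 i (\<phi> (r k)) x) \<longlonglongrightarrow> g x $ i" using L2lim_AE_subseq[OF \<phi>(2)] by blast
    then show ?thesis
    proof eventually_elim
      case (elim x)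
      show ?case
      proof
        assume "x \<notin> ball 0 R"
        then have "(\<lambda>k. pderiv3 i (\<phi> (r k)) x) = (\<lambda>k. 0)" using test_fun_zero[OF test_fun_pderiv3[OF \<phi>(1)]] by blast
        then show "g x $ i = 0" using elim LIMSEQ_unique[OF tendsto_const] by metis
      qed
    qed
  qed
  from this[of 1] this[of 2] this[of 3] show ?thesis by eventually_elim (auto simp: vec_eq_iff forall_3)
qed

text \<open>On the ball the potential is at most \<open>R\<^sup>2\<close>, so for functions
  vanishing outside it the weight costs no integrability.\<close>

lemma H0_V:
  assumes "H0 R u g"
  shows "L2 (\<lambda>x. V x * u x)" "integrable lborel (\<lambda>x. V x * (u x)\<^sup>2)"
proof -
  note u = H0_L2(1)[OF assms]
  note [measurable] = L2_meas[OF u]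
  let ?m = "\<lambda>x. V x * indicator (ball 0 R) x"
  have "\<bar>?m x\<bar> \<le> R\<^sup>2" for x
  proof (cases "x \<in> ball 0 R")
    case True
    then have "(norm x)\<^sup>2 \<le> R\<^sup>2" by (intro power_mono) auto
    then show ?thesis using V_le_norm[of x] V_nonneg[of x] True by simp
  qed simp
  then have m: "L2 (\<lambda>x. ?m x * u x)" by (rule L2_bounded_mult[OF u, rotated]) (auto intro!: borel_measurable_times borel_measurable_indicator)
  show *: "L2 (\<lambda>x. V x * u x)"
  proof (rule L2_cong_AE[OF m])
    show "AE x in lborel. ?m x * u x = V x * u x"
      using H0_outside[OF assms] by eventually_elim (auto simp: indicator_def)
  qed simp
  from L2_mult_integrable[OF * u] show "integrable lborel (\<lambda>x. V x * (u x)\<^sup>2)"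
    by (simp add: power2_eq_square mult.assoc)
qed

lemma H0_gradsq_lim:
  assumes "\<And>i. L2lim (\<lambda>k. pderiv3 i (\<phi> k)) (\<lambda>x. g x $ i)"
  shows "(\<lambda>k. gradsq (grad3 (\<phi> k))) \<longlonglongrightarrow> gradsq g"
  unfolding gradsq_def grad3_nth by (intro tendsto_sum L2lim_sqint assms)

text \<open>Fatou's lemma along an almost everywhere convergent subsequence of test functions. The
  bounds only converge to the stated one, whence the detour through an arbitrary
  \<open>e\<close>.\<close>

lemma H0_Sobolev:
  assumes "H0 R u g"
  shows "integrable lborel (\<lambda>x. u x ^ 6)" "(\<integral>x. u x ^ 6 \<partial>lborel) \<le> 4096 * gradsq g ^ 3"
proof -
  obtain \<phi> where \<phi>: "\<And>k. test_fun (ball 0 R) (\<phi> k)" "L2lim \<phi> u" "\<And>i. L2lim (\<lambda>k. pderiv3 i (\<phi> k)) (\<lambda>x. g x $ i)"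
    using H0E[OF assms] by blast
  obtain r where r: "strict_mono r" "AE x in lborel. (\<lambda>k. \<phi> (r k) x) \<longlonglongrightarrow> u x" using L2lim_AE_subseq[OF \<phi>(2)] by blast
  have [measurable]: "u \<in> borel_measurable borel" using H0_L2(1)[OF assms] by (rule L2_meas)
  have lim: "(\<lambda>k. 4096 * gradsq (grad3 (\<phi> (r k))) ^ 3) \<longlonglongrightarrow> 4096 * gradsq g ^ 3"
    using LIMSEQ_subseq_LIMSEQ[OF H0_gradsq_lim[OF \<phi>(3)] r(1)] by (intro tendsto_intros) (simp add: o_def)
  have ae: "AE x in lborel. (\<lambda>k. \<phi> (r k) x ^ 6) \<longlonglongrightarrow> u x ^ 6"
    using r(2) by eventually_elim (intro tendsto_intros)
  have F: "integrable lborel (\<lambda>x. u x ^ 6) \<and> (\<integral>x. u x ^ 6 \<partial>lborel) \<le> 4096 * gradsq g ^ 3 + e" if e: "0 < e" for e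
  proof -
    have "\<forall>\<^sub>F k in sequentially. 4096 * gradsq (grad3 (\<phi> (r k))) ^ 3 < 4096 * gradsq g ^ 3 + e"
      by (rule order_tendstoD(2)[OF lim]) (use e in simp)
    then have "\<forall>\<^sub>F k in sequentially. (\<integral>x. \<phi> (r k) x ^ 6 \<partial>lborel) \<le> 4096 * gradsq g ^ 3 + e"
      by eventually_elim (rule order_trans[OF Sobolev_test[OF \<phi>(1)] less_imp_le])
    moreover have "integrable lborel (\<lambda>x. \<phi> (r k) x ^ 6)" for k
      using test_fun_integrable[OF test_fun_power[OF \<phi>(1), of 6]] by simp
    moreover have m: "(\<lambda>x. u x ^ 6) \<in> borel_measurable borel" by simp
    moreover have p: "0 \<le> \<phi> (r k) x ^ 6" for k x by simp
    ultimately show ?thesis using Fatou_integral[of "\<lambda>k x. \<phi> (r k) x ^ 6", OF _ p m ae] by blast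
  qed
  show "integrable lborel (\<lambda>x. u x ^ 6)" using F[of 1] by simp
  show "(\<integral>x. u x ^ 6 \<partial>lborel) \<le> 4096 * gradsq g ^ 3" by (rule field_le_epsilon) (use F in auto)
qed

lemma AE_R3:
  assumes "AE x in lborel. P x"
  shows "AE a in lborel. AE b in lborel. AE c in lborel. P (vec3 a b c)"
proof -
  let ?v = "\<lambda>p. vec3 (fst p) (fst (snd p)) (snd (snd p))"
  have "AE x in distr lborel borel ?v. P x" unfolding lborel_vec3 by (rule assms)
  then have "AE p in lborel. P (?v p)" using vec3_measurable by (intro AE_distrD[of ?v]) auto
  then have "AE a in lborel. AE q in lborel. P (?v (a, q))"
    unfolding lborel_prod[symmetric, where 'a=real and 'b="real \<times> real"] by (rule lborel_pair.AE_pair)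
  then show ?thesis
  proof eventually_elim
    case (elim a)
    from lborel_pair.AE_pair[OF elim[unfolded lborel_prod[symmetric, where 'a=real and 'b=real]]] show ?case by simp
  qed
qed

lemma H0_Ladyzhenskaya:
  assumes "H0 R u g"
  shows "(\<integral>\<^sup>+a. \<integral>\<^sup>+b. (\<integral>\<^sup>+c. ennreal ((u (vec3 a b c))\<^sup>2) \<partial>lborel)\<^sup>2 \<partial>lborel \<partial>lborel) \<le> ennreal (4 * sqint u * gradsq g)"
proof -
  obtain \<phi> where \<phi>: "\<And>k. test_fun (ball 0 R) (\<phi> k)" "L2lim \<phi> u" "\<And>i. L2lim (\<lambda>k. pderiv3 i (\<phi> k)) (\<lambda>x. g x $ i)"
    using H0E[OF assms] by blast
  obtain r where r: "strict_mono r" "AE x in lborel. (\<lambda>k. \<phi> (r k) x) \<longlonglongrightarrow> u x" using L2lim_AE_subseq[OF \<phi>(2)] by blast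
  have [measurable]: "u \<in> borel_measurable borel" using H0_L2(1)[OF assms] by (rule L2_meas)
  define f where "f k x = ennreal ((\<phi> (r k) x)\<^sup>2)" for k x
  have fm [measurable]: "f k \<in> borel_measurable borel" for k
    unfolding f_def using test_fun_measurable[OF \<phi>(1)] by simp
  have vm: "(\<lambda>c. vec3 a b c) \<in> borel_measurable borel" for a b
    unfolding vec3_def by (intro borel_measurable_continuous_onI continuous_intros)
  have fm1 [measurable]: "(\<lambda>c. f k (vec3 a b c)) \<in> borel_measurable borel" for k a b
    by (rule measurable_compose[OF vm fm])
  have um1 [measurable]: "(\<lambda>c. u (vec3 a b c)) \<in> borel_measurable borel" for a b
    by (rule measurable_compose[OF vm]) simp
  have AE: "AE x in lborel. (\<lambda>k. f k x) \<longlonglongrightarrow> ennreal ((u x)\<^sup>2)"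
    unfolding f_def using r(2) by eventually_elim (intro tendsto_ennrealI tendsto_intros)
  define I where "I k a b = (\<integral>\<^sup>+c. f k (vec3 a b c) \<partial>lborel)" for k a b
  have Im: "(\<lambda>p. I k (fst p) (snd p)) \<in> borel_measurable borel" for k
    unfolding I_def by (rule slice_measurable(3)[OF fm])
  \<comment> \<open>The square of the inner integral is written as a double integral, so that
    Fatou's lemma in two variables gives the lower limit of the squares directly.\<close>
  have step: "(\<integral>\<^sup>+c. ennreal ((u (vec3 a b c))\<^sup>2) \<partial>lborel)\<^sup>2 \<le> liminf (\<lambda>k. (I k a b)\<^sup>2)"
    if ae: "AE c in lborel. (\<lambda>k. f k (vec3 a b c)) \<longlonglongrightarrow> ennreal ((u (vec3 a b c))\<^sup>2)" for a b
  proof -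
    let ?U = "\<lambda>c. ennreal ((u (vec3 a b c))\<^sup>2)" and ?f = "\<lambda>k c. f k (vec3 a b c)"
    have "(\<integral>\<^sup>+c. ?U c \<partial>lborel)\<^sup>2 = (\<integral>\<^sup>+c. \<integral>\<^sup>+c'. ?U c * ?U c' \<partial>lborel \<partial>lborel)"
      by (simp add: nn_integral_cmult nn_integral_multc power2_eq_square)
    also have "\<dots> \<le> (\<integral>\<^sup>+c. liminf (\<lambda>k. \<integral>\<^sup>+c'. ?f k c * ?f k c' \<partial>lborel) \<partial>lborel)"
      using ae
    proof (intro nn_integral_mono_AE, eventually_elim)
      case (elim c)
      have "(\<integral>\<^sup>+c'. ?U c * ?U c' \<partial>lborel) = (\<integral>\<^sup>+c'. liminf (\<lambda>k. ?f k c * ?f k c') \<partial>lborel)"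
        using ae
      proof (intro nn_integral_cong_AE, eventually_elim)
        case e2: (elim c')
        have "(\<lambda>k. ?f k c * ?f k c') \<longlonglongrightarrow> ?U c * ?U c'"
          by (intro tendsto_mult_ennreal elim e2) auto
        then show ?case by (simp add: lim_imp_Liminf)
      qed
      also have "\<dots> \<le> liminf (\<lambda>k. \<integral>\<^sup>+c'. ?f k c * ?f k c' \<partial>lborel)" by (rule nn_integral_liminf) simp
      finally show ?case .
    qed
    also have "\<dots> \<le> liminf (\<lambda>k. \<integral>\<^sup>+c. \<integral>\<^sup>+c'. ?f k c * ?f k c' \<partial>lborel \<partial>lborel)"
      by (rule nn_integral_liminf) (simp add: nn_integral_cmult)
    also have "\<dots> = liminf (\<lambda>k. (I k a b)\<^sup>2)"
      by (simp add: nn_integral_cmult nn_integral_multc power2_eq_square I_def)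
    finally show ?thesis .
  qed
  have "(\<integral>\<^sup>+a. \<integral>\<^sup>+b. (\<integral>\<^sup>+c. ennreal ((u (vec3 a b c))\<^sup>2) \<partial>lborel)\<^sup>2 \<partial>lborel \<partial>lborel)
     \<le> (\<integral>\<^sup>+a. \<integral>\<^sup>+b. liminf (\<lambda>k. (I k a b)\<^sup>2) \<partial>lborel \<partial>lborel)"
    using AE_R3[OF AE]
  proof (intro nn_integral_mono_AE, eventually_elim)
    case (elim a)
    then show ?case by (intro nn_integral_mono_AE, eventually_elim) (rule step)
  qed
  also have "\<dots> \<le> (\<integral>\<^sup>+a. liminf (\<lambda>k. \<integral>\<^sup>+b. (I k a b)\<^sup>2 \<partial>lborel) \<partial>lborel)"
  proof (rule nn_integral_mono)
    fix a
    have "(\<lambda>b. I k a b) \<in> borel_measurable borel" for k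
      using measurable_compose[OF _ Im, of "\<lambda>b. (a, b)" borel k]
      by (simp add: borel_measurable_continuous_onI continuous_intros)
    then show "(\<integral>\<^sup>+b. liminf (\<lambda>k. (I k a b)\<^sup>2) \<partial>lborel) \<le> liminf (\<lambda>k. \<integral>\<^sup>+b. (I k a b)\<^sup>2 \<partial>lborel)"
      by (intro nn_integral_liminf) simp
  qed
  also have "\<dots> \<le> liminf (\<lambda>k. \<integral>\<^sup>+a. \<integral>\<^sup>+b. (I k a b)\<^sup>2 \<partial>lborel \<partial>lborel)"
  proof (rule nn_integral_liminf)
    fix k
    have "(\<lambda>a. \<integral>\<^sup>+b. (I k a b)\<^sup>2 \<partial>lborel) \<in> borel_measurable borel"
      by (rule borel_measurable_inner_integral) (use Im in simp)
    then show "(\<lambda>a. \<integral>\<^sup>+b. (I k a b)\<^sup>2 \<partial>lborel) \<in> borel_measurable lborel" by simp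
  qed
  also have "\<dots> \<le> liminf (\<lambda>k. ennreal (4 * sqint (\<phi> (r k)) * gradsq (grad3 (\<phi> (r k)))))"
    unfolding I_def f_def by (intro Liminf_mono always_eventually allI Ladyzhenskaya_test[OF \<phi>(1)])
  also have "\<dots> = ennreal (4 * sqint u * gradsq g)"
  proof -
    have "(\<lambda>k. ennreal (4 * sqint (\<phi> (r k)) * gradsq (grad3 (\<phi> (r k))))) \<longlonglongrightarrow> ennreal (4 * sqint u * gradsq g)"
      using LIMSEQ_subseq_LIMSEQ[OF H0_gradsq_lim[OF \<phi>(3)] r(1)] LIMSEQ_subseq_LIMSEQ[OF L2lim_sqint[OF \<phi>(2)] r(1)]
      by (intro tendsto_ennrealI tendsto_intros) (simp_all add: o_def)
    then show ?thesis by (simp add: lim_imp_Liminf)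
  qed
  finally show ?thesis .
qed

text \<open>Integrate the derivative along the ray from \<open>x\<close> to
  \<open>t *\<^sub>R x\<close>. Cauchy-Schwarz in \<open>s\<close> and the final integration over
  \<open>s\<close> contribute one factor \<open>t - 1\<close> each, the norm of \<open>x\<close> is
  below \<open>R\<close>, and \<open>s \<ge> 1\<close> makes dilated gradients no larger. Being
  quadratic in \<open>t - 1\<close>, the error disappears from the derivative at 1 in
  \<open>Pohozaev_inequality\<close>.\<close>

lemma test_dilation_diff:
  assumes \<phi>: "test_fun (ball 0 R) \<phi>" and t: "1 \<le> t"
  shows "sqint (\<lambda>x. \<phi> (t *\<^sub>R x) - \<phi> x) \<le> (t - 1)\<^sup>2 * R\<^sup>2 * gradsq (grad3 \<phi>)"
proof -
  let ?G = "\<lambda>x. (norm (grad3 \<phi> x))\<^sup>2"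
  have G: "?G x = (\<Sum>i\<in>UNIV. (pderiv3 i \<phi> x)\<^sup>2)" for x by (simp add: norm_R3 sum_3)
  have Gi: "integrable lborel ?G" and Gint: "(\<integral>x. ?G x \<partial>lborel) = gradsq (grad3 \<phi>)"
    unfolding G gradsq_def sqint_def grad3_nth using L2_sq[OF test_fun_L2[OF test_fun_pderiv3[OF \<phi>]]]
    by (auto intro!: Bochner_Integration.integral_sum)
  have Gm [measurable]: "?G \<in> borel_measurable borel" using Gi by auto
  note [measurable] = test_fun_measurable[OF \<phi>]
  have inball: "s *\<^sub>R x \<notin> ball 0 R" if "x \<notin> ball 0 R" "1 \<le> s" for x :: R3 and s
    using that mult_right_mono[of 1 s "norm x"] by auto
  have pt: "ennreal ((\<phi> (t *\<^sub>R x) - \<phi> x)\<^sup>2) \<le> ennreal ((t - 1) * R\<^sup>2) * (\<integral>\<^sup>+s. ennreal (?G (s *\<^sub>R x) * indicator {1..t} s) \<partial>lborel)" for x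
  proof (cases "x \<in> ball 0 R")
    case False
    then show ?thesis using test_fun_zero[OF \<phi>] inball[OF False t] by simp
  next
    case True
    let ?f = "\<lambda>s. grad3 \<phi> (s *\<^sub>R x) \<bullet> x"
    have cg: "continuous_on UNIV (\<lambda>s. grad3 \<phi> (s *\<^sub>R x))" for x
      unfolding grad3_def
      by (intro continuous_on_vec_lambda continuous_on_compose2[OF test_fun_continuous[OF test_fun_pderiv3[OF \<phi>], of UNIV]]) (auto intro!: continuous_intros)
    then have cont: "continuous_on UNIV ?f" by (intro continuous_intros)
    have d: "((\<lambda>s. \<phi> (s *\<^sub>R x)) has_real_derivative ?f s) (at s)" for s
    proof -
      have 1: "((\<lambda>s. s *\<^sub>R x) has_derivative (\<lambda>h. h *\<^sub>R x)) (at s)" by (auto intro!: derivative_eq_intros)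
      have "((\<lambda>s. \<phi> (s *\<^sub>R x)) has_derivative (\<lambda>h. grad3 \<phi> (s *\<^sub>R x) \<bullet> (h *\<^sub>R x))) (at s)"
        using has_derivative_compose[OF 1 smooth3_has_derivative_grad[OF test_funD[OF \<phi>]]] .
      moreover have "(\<lambda>h. grad3 \<phi> (s *\<^sub>R x) \<bullet> (h *\<^sub>R x)) = (*) (?f s)" by (auto simp: mult.commute)
      ultimately show ?thesis by (simp add: has_field_derivative_def)
    qed
    have "has_bochner_integral lborel (\<lambda>s. ?f s * indicator {1..t} s) (\<phi> (t *\<^sub>R x) - \<phi> (1 *\<^sub>R x))"
      by (rule has_bochner_integral_FTC_Icc_real[where F="\<lambda>s. \<phi> (s *\<^sub>R x)"])
         (use t cont d in \<open>auto simp: continuous_on_eq_continuous_at\<close>)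
    then have I: "integrable lborel (\<lambda>s. ?f s * indicator {1..t} s)"
      "(\<integral>s. ?f s * indicator {1..t} s \<partial>lborel) = \<phi> (t *\<^sub>R x) - \<phi> x" by (auto simp: has_bochner_integral_iff)
    have fm [measurable]: "?f \<in> borel_measurable borel" by (rule borel_measurable_continuous_onI[OF cont])
    have "ennreal \<bar>\<phi> (t *\<^sub>R x) - \<phi> x\<bar> \<le> (\<integral>\<^sup>+s. ennreal (norm (?f s * indicator {1..t} s)) \<partial>lborel)"
      using integral_norm_bound_ennreal[OF I(1)] I(2) by simp
    also have "\<dots> = (\<integral>\<^sup>+s. ennreal (\<bar>?f s\<bar> * indicator {1..t} s) * indicator {1..t} s \<partial>lborel)"
      by (intro nn_integral_cong) (auto simp: indicator_def)
    finally have "(ennreal \<bar>\<phi> (t *\<^sub>R x) - \<phi> x\<bar>)\<^sup>2 \<le> (\<integral>\<^sup>+s. ennreal (\<bar>?f s\<bar> * indicator {1..t} s) * indicator {1..t} s \<partial>lborel)\<^sup>2"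
      by (intro power_mono) auto
    also have "\<dots> \<le> (\<integral>\<^sup>+s. (ennreal (\<bar>?f s\<bar> * indicator {1..t} s))\<^sup>2 \<partial>lborel) * (\<integral>\<^sup>+s. (indicator {1..t} s)\<^sup>2 \<partial>lborel)"
      by (rule Cauchy_Schwarz_nn_integral) auto
    also have "(\<integral>\<^sup>+s. (indicator {1..t} s)\<^sup>2 \<partial>lborel) = (\<integral>\<^sup>+s. indicator {1..t} s \<partial>lborel)"
      by (intro nn_integral_cong) (auto simp: indicator_def)
    also have "\<dots> = ennreal (t - 1)" using t by simp
    also have "(\<integral>\<^sup>+s. (ennreal (\<bar>?f s\<bar> * indicator {1..t} s))\<^sup>2 \<partial>lborel) \<le> (\<integral>\<^sup>+s. ennreal (R\<^sup>2) * ennreal (?G (s *\<^sub>R x) * indicator {1..t} s) \<partial>lborel)"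
    proof (rule nn_integral_mono)
      fix s
      have "\<bar>?f s\<bar> \<le> norm (grad3 \<phi> (s *\<^sub>R x)) * norm x" by (rule Cauchy_Schwarz_ineq2)
      also have "\<dots> \<le> norm (grad3 \<phi> (s *\<^sub>R x)) * R" using True by (intro mult_left_mono) auto
      finally have "\<bar>?f s\<bar>\<^sup>2 \<le> (norm (grad3 \<phi> (s *\<^sub>R x)) * R)\<^sup>2" by (intro power_mono) auto
      then have "\<bar>?f s\<bar>\<^sup>2 \<le> R\<^sup>2 * ?G (s *\<^sub>R x)" by (simp add: power_mult_distrib mult.commute)
      then have "ennreal (\<bar>?f s\<bar>\<^sup>2) \<le> ennreal (R\<^sup>2 * ?G (s *\<^sub>R x))" by (rule ennreal_leI)
      then show "(ennreal (\<bar>?f s\<bar> * indicator {1..t} s))\<^sup>2 \<le> ennreal (R\<^sup>2) * ennreal (?G (s *\<^sub>R x) * indicator {1..t} s)"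
        by (cases "s \<in> {1..t}") (auto simp: ennreal_power ennreal_mult'[symmetric])
    qed
    finally have "(ennreal \<bar>\<phi> (t *\<^sub>R x) - \<phi> x\<bar>)\<^sup>2 \<le> (\<integral>\<^sup>+s. ennreal (R\<^sup>2) * ennreal (?G (s *\<^sub>R x) * indicator {1..t} s) \<partial>lborel) * ennreal (t - 1)"
      by (simp add: mult_right_mono)
    also have "(\<integral>\<^sup>+s. ennreal (R\<^sup>2) * ennreal (?G (s *\<^sub>R x) * indicator {1..t} s) \<partial>lborel) = ennreal (R\<^sup>2) * (\<integral>\<^sup>+s. ennreal (?G (s *\<^sub>R x) * indicator {1..t} s) \<partial>lborel)"
    proof (rule nn_integral_cmult)
      have "(\<lambda>s. s *\<^sub>R x) \<in> borel_measurable borel" by simp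
      from measurable_compose[OF this Gm] show "(\<lambda>s. ennreal (?G (s *\<^sub>R x) * indicator {1..t} s)) \<in> borel_measurable lborel" by simp
    qed
    finally show ?thesis using t by (simp add: ennreal_power ennreal_mult' mult_ac)
  qed
  have "(\<integral>\<^sup>+x. ennreal ((\<phi> (t *\<^sub>R x) - \<phi> x)\<^sup>2) \<partial>lborel)
     \<le> (\<integral>\<^sup>+x. ennreal ((t - 1) * R\<^sup>2) * (\<integral>\<^sup>+s. ennreal (?G (s *\<^sub>R x) * indicator {1..t} s) \<partial>lborel) \<partial>lborel)"
    by (intro nn_integral_mono pt)
  have meas: "(\<lambda>p::R3 \<times> real. ennreal (?G (snd p *\<^sub>R fst p) * indicator {1..t} (snd p))) \<in> borel_measurable borel"
  proof -
    have "(\<lambda>p::R3 \<times> real. snd p *\<^sub>R fst p) \<in> borel_measurable borel" "(\<lambda>p::R3 \<times> real. snd p) \<in> borel_measurable borel"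
      by (intro borel_measurable_continuous_onI continuous_intros)+
    note measurable_compose[OF this(1) Gm] measurable_compose[OF this(2), of "indicator {1..t} :: real \<Rightarrow> real" borel]
    then show ?thesis by simp
  qed
  note \<open>(\<integral>\<^sup>+x. ennreal ((\<phi> (t *\<^sub>R x) - \<phi> x)\<^sup>2) \<partial>lborel)
     \<le> (\<integral>\<^sup>+x. ennreal ((t - 1) * R\<^sup>2) * (\<integral>\<^sup>+s. ennreal (?G (s *\<^sub>R x) * indicator {1..t} s) \<partial>lborel) \<partial>lborel)\<close>
  also have "(\<integral>\<^sup>+x. ennreal ((t - 1) * R\<^sup>2) * (\<integral>\<^sup>+s. ennreal (?G (s *\<^sub>R x) * indicator {1..t} s) \<partial>lborel) \<partial>lborel)
     = ennreal ((t - 1) * R\<^sup>2) * (\<integral>\<^sup>+x. (\<integral>\<^sup>+s. ennreal (?G (s *\<^sub>R x) * indicator {1..t} s) \<partial>lborel) \<partial>lborel)"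
    using borel_measurable_inner_integral[OF meas[unfolded split_beta', of ]] by (intro nn_integral_cmult) simp
  also have "(\<integral>\<^sup>+x. (\<integral>\<^sup>+s. ennreal (?G (s *\<^sub>R x) * indicator {1..t} s) \<partial>lborel) \<partial>lborel)
     = (\<integral>\<^sup>+s. (\<integral>\<^sup>+x. ennreal (?G (s *\<^sub>R x) * indicator {1..t} s) \<partial>lborel) \<partial>lborel)"
    by (rule nn_swap[OF meas])
  also have "\<dots> \<le> (\<integral>\<^sup>+s. ennreal (gradsq (grad3 \<phi>)) * indicator {1..t} s \<partial>lborel)"
  proof (rule nn_integral_mono)
    fix s :: real
    show "(\<integral>\<^sup>+x. ennreal (?G (s *\<^sub>R x) * indicator {1..t} s) \<partial>lborel) \<le> ennreal (gradsq (grad3 \<phi>)) * indicator {1..t} s"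
    proof (cases "s \<in> {1..t}")
      case True
      have s3: "1 \<le> s^3" using True by (simp add: one_le_power)
      have a: "gradsq (grad3 \<phi>) = s^3 * (\<integral>x. ?G (s *\<^sub>R x) \<partial>lborel)" "integrable lborel (\<lambda>x. ?G (s *\<^sub>R x))"
        using integral_affine3[of s ?G 0] True Gi Gint by auto
      have i0: "0 \<le> (\<integral>x. ?G (s *\<^sub>R x) \<partial>lborel)" by simp
      have "(\<integral>\<^sup>+x. ennreal (?G (s *\<^sub>R x)) \<partial>lborel) = ennreal (\<integral>x. ?G (s *\<^sub>R x) \<partial>lborel)"
        using a(2) by (intro nn_integral_eq_integral) auto
      also have "\<dots> \<le> ennreal (gradsq (grad3 \<phi>))"
        unfolding a(1) using mult_right_mono[OF s3 i0] by (intro ennreal_leI) simp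
      finally show ?thesis using True by simp
    qed simp
  qed
  also have "\<dots> = ennreal (gradsq (grad3 \<phi>)) * ennreal (t - 1)" using t by (simp add: nn_integral_cmult)
  finally have "(\<integral>\<^sup>+x. ennreal ((\<phi> (t *\<^sub>R x) - \<phi> x)\<^sup>2) \<partial>lborel) \<le> ennreal ((t - 1) * R\<^sup>2) * (ennreal (gradsq (grad3 \<phi>)) * ennreal (t - 1))"
    by (simp add: mult_left_mono)
  also have "\<dots> = ennreal ((t - 1)\<^sup>2 * R\<^sup>2 * gradsq (grad3 \<phi>))"
    using t gradsq_nonneg[of "grad3 \<phi>"]
  proof -
    have "0 \<le> (t - 1) * R\<^sup>2" "0 \<le> gradsq (grad3 \<phi>) * (t - 1)"
      using t gradsq_nonneg[of "grad3 \<phi>"] by (auto intro!: mult_nonneg_nonneg)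
    then have "ennreal ((t - 1) * R\<^sup>2) * ennreal (gradsq (grad3 \<phi>) * (t - 1)) = ennreal ((t - 1) * R\<^sup>2 * (gradsq (grad3 \<phi>) * (t - 1)))"
      by (simp only: ennreal_mult)
    moreover have "ennreal (gradsq (grad3 \<phi>)) * ennreal (t - 1) = ennreal (gradsq (grad3 \<phi>) * (t - 1))"
      using t gradsq_nonneg[of "grad3 \<phi>"] by (simp add: ennreal_mult)
    moreover have "(t - 1) * R\<^sup>2 * (gradsq (grad3 \<phi>) * (t - 1)) = (t - 1)\<^sup>2 * R\<^sup>2 * gradsq (grad3 \<phi>)"
      by (simp add: power2_eq_square)
    ultimately show ?thesis by simp
  qed
  also have "(\<integral>\<^sup>+x. ennreal ((\<phi> (t *\<^sub>R x) - \<phi> x)\<^sup>2) \<partial>lborel) = ennreal (sqint (\<lambda>x. \<phi> (t *\<^sub>R x) - \<phi> x))"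
    unfolding sqint_def
    by (rule nn_integral_eq_integral[OF L2_sq[OF L2_diff[OF L2lim_dilate(3)[OF L2lim_const] test_fun_L2[OF \<phi>]]]])
       (use t test_fun_L2[OF \<phi>] in auto)
  finally show ?thesis using gradsq_nonneg[of "grad3 \<phi>"] by (simp add: ennreal_le_iff)
qed

lemma H0_dilation_diff:
  assumes "H0 R u g" and t: "1 \<le> t"
  shows "sqint (\<lambda>x. u (t *\<^sub>R x) - u x) \<le> (t - 1)\<^sup>2 * R\<^sup>2 * gradsq g"
proof -
  obtain \<phi> where \<phi>: "\<And>k. test_fun (ball 0 R) (\<phi> k)" "L2lim \<phi> u" "\<And>i. L2lim (\<lambda>k. pderiv3 i (\<phi> k)) (\<lambda>x. g x $ i)"
    using H0E[OF assms(1)] by blast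
  have "(\<lambda>k. sqint (\<lambda>x. \<phi> k (t *\<^sub>R x) - \<phi> k x)) \<longlonglongrightarrow> sqint (\<lambda>x. u (t *\<^sub>R x) - u x)"
    by (rule L2lim_sqint[OF L2lim_diff[OF L2lim_dilate(1)[OF \<phi>(2)] \<phi>(2)]]) (use t in simp)
  moreover have "(\<lambda>k. (t - 1)\<^sup>2 * R\<^sup>2 * gradsq (grad3 (\<phi> k))) \<longlonglongrightarrow> (t - 1)\<^sup>2 * R\<^sup>2 * gradsq g"
    by (intro tendsto_intros H0_gradsq_lim \<phi>(3))
  ultimately show ?thesis
    by (rule LIMSEQ_le) (use test_dilation_diff[OF \<phi>(1) t] in auto)
qed

section \<open>The equation and the Pohozaev inequality\<close>

lemma powr_interp:
  fixes s q :: real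
  assumes "2 \<le> q" "q \<le> 6" "0 \<le> s"
  shows "s powr q \<le> s^2 + s^6"
proof (cases "s = 0")
  case False
  then have s: "0 < s" using assms by simp
  have 2: "s powr 2 = s^2" "s powr 6 = s^6" using s powr_realpow[of s 2] powr_realpow[of s 6] by auto
  show ?thesis
  proof (cases "s \<le> 1")
    case True
    have "s powr q \<le> s powr 2" using powr_mono'[OF assms(1)] s True by simp
    then show ?thesis using 2 zero_le_power[of s 6] s by linarith
  next
    case False
    have "s powr q \<le> s powr 6" using powr_mono[OF assms(2)] False by simp
    then show ?thesis using 2 zero_le_power[of s 2] s by linarith
  qed
qed simp

lemma powr_pred_mult:
  fixes x q :: real
  assumes "0 \<le> x" shows "x powr (q - 1) * x = x powr q"
proof (cases "x = 0")
  case False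
  have "x powr q = x powr (q - 1) * x powr 1" using powr_add[of x "q - 1" 1] by simp
  then show ?thesis using assms by simp
qed simp

text \<open>Young's inequality with a small parameter, by comparing \<open>y\<close> with
  \<open>e * x\<close>: in either case one of the two terms alone suffices.\<close>

lemma powr_young:
  fixes x y q e :: real
  assumes q: "1 < q" and e: "0 < e" and x: "0 \<le> x" and y: "0 \<le> y"
  shows "x powr (q - 1) * y \<le> e * x powr q + e powr (-(q - 1)) * y powr q"
proof (cases "y \<le> e * x")
  case True
  have "x powr (q - 1) * y \<le> x powr (q - 1) * (e * x)" by (intro mult_left_mono True) simp
  also have "\<dots> = e * x powr q" using powr_pred_mult[OF x, of q] by (simp add: mult.left_commute mult.assoc)
  finally show ?thesis by (simp add: add_increasing2)
next
  case False
  then have "x \<le> y / e" using e by (simp add: field_simps)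
  then have "x powr (q - 1) \<le> (y / e) powr (q - 1)" using q x by (intro powr_mono2) auto
  then have "x powr (q - 1) * y \<le> (y / e) powr (q - 1) * y" using y by (intro mult_right_mono)
  also have "(y / e) powr (q - 1) * y = e powr (-(q - 1)) * (y powr (q - 1) * y)"
    unfolding powr_divide powr_minus_divide by simp
  also have "\<dots> = e powr (-(q - 1)) * y powr q" using powr_pred_mult[OF y, of q] by simp
  finally show ?thesis using e by (simp add: add_increasing)
qed

lemma Lq_integrable:
  assumes d: "L2 d" and 6: "integrable lborel (\<lambda>x. d x ^ 6)" and q: "2 \<le> q" "q \<le> 6"
  shows "integrable lborel (\<lambda>x. \<bar>d x\<bar> powr q)" "(\<integral>x. \<bar>d x\<bar> powr q \<partial>lborel) \<le> sqint d + (\<integral>x. d x ^ 6 \<partial>lborel)"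
proof -
  note [measurable] = L2_meas[OF d]
  have le: "\<bar>d x\<bar> powr q \<le> (d x)\<^sup>2 + d x ^ 6" for x
    using powr_interp[OF q, of "\<bar>d x\<bar>"] by (simp add: power_even_abs)
  have i: "integrable lborel (\<lambda>x. (d x)\<^sup>2 + d x ^ 6)" using L2_sq[OF d] 6 by simp
  show j: "integrable lborel (\<lambda>x. \<bar>d x\<bar> powr q)"
  proof (rule Bochner_Integration.integrable_bound[OF i])
    show "AE x in lborel. norm (\<bar>d x\<bar> powr q) \<le> norm ((d x)\<^sup>2 + d x ^ 6)"
      using le by (intro AE_I2) (simp add: order_trans[OF _ abs_ge_self])
  qed simp
  have "(\<integral>x. \<bar>d x\<bar> powr q \<partial>lborel) \<le> (\<integral>x. (d x)\<^sup>2 + d x ^ 6 \<partial>lborel)"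
    by (rule integral_mono[OF j i le])
  then show "(\<integral>x. \<bar>d x\<bar> powr q \<partial>lborel) \<le> sqint d + (\<integral>x. d x ^ 6 \<partial>lborel)"
    using L2_sq[OF d] 6 by (simp add: sqint_def)
qed

lemma nonlinear_bound:
  fixes u d :: "R3 \<Rightarrow> real" and q e :: real
  assumes um: "u \<in> borel_measurable borel" and u0: "\<And>x. 0 \<le> u x" and dm: "d \<in> borel_measurable borel" and q: "1 < q"
    and u: "integrable lborel (\<lambda>x. u x powr q)" and d: "integrable lborel (\<lambda>x. \<bar>d x\<bar> powr q)" and e: "0 < e"
  shows "integrable lborel (\<lambda>x. u x powr (q - 1) * d x)"
    "\<bar>\<integral>x. u x powr (q - 1) * d x \<partial>lborel\<bar> \<le> e * (\<integral>x. u x powr q \<partial>lborel) + e powr (-(q - 1)) * (\<integral>x. \<bar>d x\<bar> powr q \<partial>lborel)"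
proof -
  note [measurable] = um dm
  have le: "\<bar>u x powr (q - 1) * d x\<bar> \<le> e * u x powr q + e powr (-(q - 1)) * \<bar>d x\<bar> powr q" for x
    using powr_young[OF q e u0, of "\<bar>d x\<bar>" x] by (simp add: abs_mult)
  have i: "integrable lborel (\<lambda>x. e * u x powr q + e powr (-(q - 1)) * \<bar>d x\<bar> powr q)" using u d by simp
  show j: "integrable lborel (\<lambda>x. u x powr (q - 1) * d x)"
  proof (rule Bochner_Integration.integrable_bound[OF i])
    show "AE x in lborel. norm (u x powr (q - 1) * d x) \<le> norm (e * u x powr q + e powr (-(q - 1)) * \<bar>d x\<bar> powr q)"
      using le by (intro AE_I2) (simp add: order_trans[OF _ abs_ge_self])
  qed simp
  have "\<bar>\<integral>x. u x powr (q - 1) * d x \<partial>lborel\<bar> \<le> (\<integral>x. \<bar>u x powr (q - 1) * d x\<bar> \<partial>lborel)"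
    by (rule integral_abs_bound)
  also have "\<dots> \<le> (\<integral>x. e * u x powr q + e powr (-(q - 1)) * \<bar>d x\<bar> powr q \<partial>lborel)"
    by (rule integral_mono[OF integrable_abs[OF j] i le])
  also have "\<dots> = e * (\<integral>x. u x powr q \<partial>lborel) + e powr (-(q - 1)) * (\<integral>x. \<bar>d x\<bar> powr q \<partial>lborel)"
    using u d by simp
  finally show "\<bar>\<integral>x. u x powr (q - 1) * d x \<partial>lborel\<bar> \<le> e * (\<integral>x. u x powr q \<partial>lborel) + e powr (-(q - 1)) * (\<integral>x. \<bar>d x\<bar> powr q \<partial>lborel)" .
qed

text \<open>Plays the role of Hoelder's inequality: \<open>\<delta>\<close> depends on
  \<open>q\<close>, \<open>e\<close> and \<open>C\<close> alone, hence is uniform along a bounded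
  sequence.\<close>

lemma Lq_small_imp_nonlinear_small:
  fixes e :: real
  assumes q: "1 < q" and e: "0 < e" and C: "0 \<le> C"
  obtains \<delta> where "0 < \<delta>" "\<And>(u :: R3 \<Rightarrow> real) d. u \<in> borel_measurable borel \<Longrightarrow> (\<And>x. 0 \<le> u x) \<Longrightarrow> d \<in> borel_measurable borel \<Longrightarrow>
    integrable lborel (\<lambda>x. u x powr q) \<Longrightarrow> integrable lborel (\<lambda>x. \<bar>d x\<bar> powr q) \<Longrightarrow>
    (\<integral>x. u x powr q \<partial>lborel) \<le> C \<Longrightarrow> (\<integral>x. \<bar>d x\<bar> powr q \<partial>lborel) < \<delta> \<Longrightarrow>
    \<bar>\<integral>x. u x powr (q - 1) * d x \<partial>lborel\<bar> < e"
proof -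
  \<comment> \<open>\<open>k\<close> makes the term with \<open>u\<close> smaller than
    \<open>e / 2\<close>, and \<open>\<delta>\<close> then keeps the other below
    \<open>e / 2\<close>; the added 1 admits \<open>C = 0\<close>.\<close>
  define k where "k = e / (2 * (C + 1))"
  have k: "0 < k" using e C by (simp add: k_def)
  have kC: "k * C < e / 2" using e C by (simp add: k_def field_simps)
  define \<delta> where "\<delta> = e / (2 * k powr (-(q - 1)))"
  have d0: "0 < \<delta>" using e k by (simp add: \<delta>_def)
  show ?thesis
  proof (rule that[OF d0])
    fix u d :: "R3 \<Rightarrow> real"
    assume a: "u \<in> borel_measurable borel" "\<And>x. 0 \<le> u x" "d \<in> borel_measurable borel"
      "integrable lborel (\<lambda>x. u x powr q)" "integrable lborel (\<lambda>x. \<bar>d x\<bar> powr q)"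
      "(\<integral>x. u x powr q \<partial>lborel) \<le> C" "(\<integral>x. \<bar>d x\<bar> powr q \<partial>lborel) < \<delta>"
    have "\<bar>\<integral>x. u x powr (q - 1) * d x \<partial>lborel\<bar> \<le> k * (\<integral>x. u x powr q \<partial>lborel) + k powr (-(q - 1)) * (\<integral>x. \<bar>d x\<bar> powr q \<partial>lborel)"
      by (rule nonlinear_bound(2)[OF a(1,2,3) q a(4,5) k])
    moreover have "k * (\<integral>x. u x powr q \<partial>lborel) \<le> k * C" using k a(6) by (intro mult_left_mono) auto
    moreover have "k powr (-(q - 1)) * (\<integral>x. \<bar>d x\<bar> powr q \<partial>lborel) < k powr (-(q - 1)) * \<delta>"
      using k a(7) by (intro mult_strict_left_mono) auto
    moreover have "k powr (-(q - 1)) * \<delta> = e / 2" using k by (simp add: \<delta>_def del: minus_diff_eq)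
    ultimately show "\<bar>\<integral>x. u x powr (q - 1) * d x \<partial>lborel\<bar> < e" using kC by linarith
  qed
qed

section \<open>The weak equation and its admissible test functions\<close>

definition gip :: "(R3 \<Rightarrow> R3) \<Rightarrow> (R3 \<Rightarrow> R3) \<Rightarrow> real" where
  "gip g h = (\<Sum>i\<in>UNIV. \<integral>x. g x $ i * h x $ i \<partial>lborel)"

lemma gip_same: "gip g g = gradsq g"
  by (simp add: gip_def gradsq_def sqint_def power2_eq_square)

lemma gradsq_diff:
  assumes "\<And>i. L2 (\<lambda>x. g x $ i)" "\<And>i. L2 (\<lambda>x. h x $ i)"
  shows "gradsq (\<lambda>x. g x - h x) = gradsq g - 2 * gip g h + gradsq h"
  unfolding gradsq_def gip_def vector_minus_component
  using sqint_diff[OF assms] by (simp add: sum.distrib sum_subtractf sum_distrib_left)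

lemma H0_Lq:
  assumes "H0 R u g" "2 \<le> q" "q \<le> 6"
  shows "integrable lborel (\<lambda>x. \<bar>u x\<bar> powr q)" "(\<integral>x. \<bar>u x\<bar> powr q \<partial>lborel) \<le> sqint u + 4096 * gradsq g ^ 3"
  using Lq_integrable[OF H0_L2(1)[OF assms(1)] H0_Sobolev(1)[OF assms(1)] assms(2,3)] H0_Sobolev(2)[OF assms(1)] by auto

lemma smooth3_V: "smooth3 V"
  unfolding V_def[abs_def] by (intro smooth3_add smooth3_power smooth3_coord)

lemma weak_form_split:
  assumes u: "L2 u" and g: "has_weak_grad u g" and \<phi>: "test_fun \<Omega> \<phi>"
  shows "(\<integral>x. wgrad u x \<bullet> grad3 \<phi> x + V x * u x * \<phi> x + lam * u x * \<phi> x \<partial>lborel)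
     = gip g (grad3 \<phi>) + (\<integral>x. u x * (V x * \<phi> x) \<partial>lborel) + lam * (\<integral>x. u x * \<phi> x \<partial>lborel)"
proof -
  note w = has_weak_grad_wgrad[OF g]
  note \<phi>L = test_fun_L2[OF \<phi>] test_fun_L2[OF test_fun_pderiv3[OF \<phi>]]
  have gi: "integrable lborel (\<lambda>x. wgrad u x $ i * pderiv3 i \<phi> x)" for i
    by (intro L2_mult_integrable has_weak_grad_L2[OF w] \<phi>L)
  have gs: "integrable lborel (\<lambda>x. wgrad u x \<bullet> grad3 \<phi> x)" "(\<integral>x. wgrad u x \<bullet> grad3 \<phi> x \<partial>lborel) = gip (wgrad u) (grad3 \<phi>)"
    unfolding inner_vec_def gip_def using gi by (auto intro!: Bochner_Integration.integral_sum Bochner_Integration.integrable_sum)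
  have "gip (wgrad u) (grad3 \<phi>) = gip g (grad3 \<phi>)"
    unfolding gip_def
  proof (intro sum.cong refl integral_cong_AE)
    fix i
    show "AE x in lborel. wgrad u x $ i * grad3 \<phi> x $ i = g x $ i * grad3 \<phi> x $ i"
      using gradsq_wgrad(3)[OF u g] by eventually_elim simp
    show "(\<lambda>x. wgrad u x $ i * grad3 \<phi> x $ i) \<in> borel_measurable lborel" "(\<lambda>x. g x $ i * grad3 \<phi> x $ i) \<in> borel_measurable lborel"
      using L2_mult_integrable[OF has_weak_grad_L2[OF w] \<phi>L(2)] L2_mult_integrable[OF has_weak_grad_L2[OF g] \<phi>L(2)]
      by (auto intro: borel_measurable_integrable)
  qed
  moreover have "integrable lborel (\<lambda>x. u x * (V x * \<phi> x))" "integrable lborel (\<lambda>x. u x * \<phi> x)"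
    by (intro L2_mult_integrable u test_fun_L2[OF test_fun_mult[OF \<phi> smooth3_V]] \<phi>L)+
  moreover have "(\<integral>x. wgrad u x \<bullet> grad3 \<phi> x + V x * u x * \<phi> x + lam * u x * \<phi> x \<partial>lborel)
    = (\<integral>x. wgrad u x \<bullet> grad3 \<phi> x + u x * (V x * \<phi> x) + lam * (u x * \<phi> x) \<partial>lborel)"
    by (intro Bochner_Integration.integral_cong) (auto simp: mult_ac)
  ultimately show ?thesis using gs by simp
qed

lemma weak_sol_split:
  assumes w: "weak_sol p lam \<Omega> u" and u: "L2 u" "has_weak_grad u g" and u0: "\<And>x. 0 \<le> u x" and \<phi>: "test_fun \<Omega> \<phi>"
  shows "gip g (grad3 \<phi>) + (\<integral>x. u x * (V x * \<phi> x) \<partial>lborel) + lam * (\<integral>x. u x * \<phi> x \<partial>lborel)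
     = (\<integral>x. u x powr p * \<phi> x \<partial>lborel)"
proof -
  have "\<bar>u x\<bar> powr (p-1) * u x = u x powr p" for x using powr_pred_mult[OF u0] u0 by simp
  then have e: "(\<integral>x. \<bar>u x\<bar> powr (p-1) * u x * \<phi> x \<partial>lborel) = (\<integral>x. u x powr p * \<phi> x \<partial>lborel)" by simp
  show ?thesis
    unfolding weak_form_split[OF u \<phi>, symmetric] e[symmetric] by (rule w[unfolded weak_sol_def, rule_format, OF \<phi>])
qed

text \<open>Density extends the equation from smooth test functions to all of \<open>H0 R\<close>.
  The linear terms are continuous in \<open>L2\<close>; the nonlinear one is continuous in
  \<open>L^(p+1)\<close>, which Sobolev's inequality controls as
  \<open>p + 1 \<le> 6\<close>.\<close>

lemma weak_sol_H0:
  assumes p: "1 < p" "p < 5" and w: "weak_sol p lam (ball 0 R) u" and u: "H0 R u (wgrad u)" and u0: "\<And>x. 0 \<le> u x"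
    and \<psi>: "H0 R \<psi> h"
  shows "gip (wgrad u) h + (\<integral>x. V x * u x * \<psi> x \<partial>lborel) + lam * (\<integral>x. u x * \<psi> x \<partial>lborel)
     = (\<integral>x. u x powr p * \<psi> x \<partial>lborel)"
proof -
  obtain \<phi> where \<phi>: "\<And>k. test_fun (ball 0 R) (\<phi> k)" "L2lim \<phi> \<psi>" "\<And>i. L2lim (\<lambda>k. pderiv3 i (\<phi> k)) (\<lambda>x. h x $ i)"
    using H0E[OF \<psi>] by blast
  have q: "1 < p + 1" "2 \<le> p + 1" "p + 1 \<le> 6" using p by auto
  note uL = H0_L2(1)[OF u]
  have um: "u \<in> borel_measurable borel" by (rule L2_meas[OF uL])
  have uq: "integrable lborel (\<lambda>x. u x powr (p + 1))" using H0_Lq(1)[OF u q(2,3)] u0 by simp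
  have 1: "(\<lambda>k. gip (wgrad u) (grad3 (\<phi> k)) + (\<integral>x. V x * u x * \<phi> k x \<partial>lborel) + lam * (\<integral>x. u x * \<phi> k x \<partial>lborel))
     \<longlonglongrightarrow> gip (wgrad u) h + (\<integral>x. V x * u x * \<psi> x \<partial>lborel) + lam * (\<integral>x. u x * \<psi> x \<partial>lborel)"
    unfolding gip_def grad3_nth
    by (intro tendsto_intros L2lim_mult L2lim_const \<phi> H0_L2[OF u] H0_V(1)[OF u])
  have 2: "(\<lambda>k. \<integral>x. u x powr p * \<phi> k x \<partial>lborel) \<longlonglongrightarrow> (\<integral>x. u x powr p * \<psi> x \<partial>lborel)"
  proof (rule LIMSEQ_I)
    fix r :: real assume r: "0 < r"
    obtain \<delta> where \<delta>: "0 < \<delta>" "\<And>d. d \<in> borel_measurable borel \<Longrightarrow> integrable lborel (\<lambda>x. \<bar>d x\<bar> powr (p + 1)) \<Longrightarrow>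
      (\<integral>x. \<bar>d x\<bar> powr (p + 1) \<partial>lborel) < \<delta> \<Longrightarrow> \<bar>\<integral>x. u x powr (p + 1 - 1) * d x \<partial>lborel\<bar> < r"
    proof (rule Lq_small_imp_nonlinear_small[OF q(1) r, of "\<integral>x. u x powr (p + 1) \<partial>lborel"])
      show "0 \<le> (\<integral>x. u x powr (p + 1) \<partial>lborel)" by simp
    qed (use um u0 uq that in blast)
    have H: "H0 R (\<lambda>x. \<phi> k x - \<psi> x) (\<lambda>x. grad3 (\<phi> k) x - h x)" for k by (rule H0_diff[OF H0_test[OF \<phi>(1)] \<psi>])
    have "(\<lambda>k. gradsq (\<lambda>x. grad3 (\<phi> k) x - h x)) \<longlonglongrightarrow> (\<Sum>i\<in>(UNIV::3 set). 0)"
      unfolding gradsq_def vector_minus_component grad3_nth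
      using \<phi>(3) by (intro tendsto_sum) (simp add: L2lim_def)
    then have "(\<lambda>k. sqint (\<lambda>x. \<phi> k x - \<psi> x) + 4096 * gradsq (\<lambda>x. grad3 (\<phi> k) x - h x) ^ 3) \<longlonglongrightarrow> 0 + 4096 * 0 ^ 3"
      using \<phi>(2) by (intro tendsto_intros) (auto simp: L2lim_def)
    then have "\<forall>\<^sub>F k in sequentially. sqint (\<lambda>x. \<phi> k x - \<psi> x) + 4096 * gradsq (\<lambda>x. grad3 (\<phi> k) x - h x) ^ 3 < \<delta>"
      using order_tendstoD(2) \<delta>(1) by fastforce
    then have "\<forall>\<^sub>F k in sequentially. norm ((\<integral>x. u x powr p * \<phi> k x \<partial>lborel) - (\<integral>x. u x powr p * \<psi> x \<partial>lborel)) < r"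
    proof eventually_elim
      case (elim k)
      have "(\<integral>x. \<bar>\<phi> k x - \<psi> x\<bar> powr (p + 1) \<partial>lborel) < \<delta>"
        using H0_Lq(2)[OF H q(2,3), of k] elim by linarith
      then have "\<bar>\<integral>x. u x powr (p + 1 - 1) * (\<phi> k x - \<psi> x) \<partial>lborel\<bar> < r"
        using \<delta>(2)[OF L2_meas[OF H0_L2(1)[OF H]] H0_Lq(1)[OF H q(2,3)]] by simp
      moreover have "integrable lborel (\<lambda>x. u x powr p * \<phi> k x)" "integrable lborel (\<lambda>x. u x powr p * \<psi> x)"
        using nonlinear_bound(1)[OF um u0 _ q(1) uq _ zero_less_one] L2_meas[OF H0_L2(1)] H0_Lq(1)[OF _ q(2,3)] \<psi> H0_test[OF \<phi>(1), of k]
        by auto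
      ultimately show ?case by (simp add: right_diff_distrib)
    qed
    then show "\<exists>no. \<forall>n\<ge>no. norm ((\<integral>x. u x powr p * \<phi> n x \<partial>lborel) - (\<integral>x. u x powr p * \<psi> x \<partial>lborel)) < r"
      by (simp add: eventually_sequentially)
  qed
  have "gip (wgrad u) (grad3 (\<phi> k)) + (\<integral>x. V x * u x * \<phi> k x \<partial>lborel) + lam * (\<integral>x. u x * \<phi> k x \<partial>lborel)
     = (\<integral>x. u x powr p * \<phi> k x \<partial>lborel)" for k
    using weak_sol_split[OF w uL H0_weak_grad[OF u] u0 \<phi>(1)] by (simp add: mult_ac)
  then show ?thesis using LIMSEQ_unique[OF 1] 2 by simp
qed

text \<open>Young's inequality with exponents 3/2 and 3, by comparing \<open>a\<close> with
  \<open>\<sigma> * y^4\<close>. In \<open>absorb\<close> it separates the large part of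
  \<open>u^(p-1)\<close>, taken in \<open>L^(3/2)\<close>, from \<open>d^2\<close>, taken in
  \<open>L^3\<close>.\<close>

lemma split_ineq:
  fixes a y \<sigma> :: real
  assumes a: "0 \<le> a" and \<sigma>: "0 < \<sigma>"
  shows "a * y^2 \<le> \<sigma> * y^6 + \<sigma> powr (-1/2) * a powr (3/2)"
proof (cases "a \<le> \<sigma> * y^4")
  case True
  have "a * y^2 \<le> (\<sigma> * y^4) * y^2" by (intro mult_right_mono True) simp
  also have "\<dots> = \<sigma> * y^6" by (simp add: power_add[symmetric])
  finally show ?thesis by (simp add: add_increasing2)
next
  case False
  then have "y^4 \<le> a / \<sigma>" using \<sigma> by (simp add: field_simps)
  then have "y^2 \<le> sqrt (a / \<sigma>)" by (intro real_le_rsqrt) simp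
  then have "a * y^2 \<le> a * sqrt (a / \<sigma>)" using a by (intro mult_left_mono)
  also have "a * sqrt (a / \<sigma>) = \<sigma> powr (-1/2) * a powr (3/2)"
  proof (cases "a = 0")
    case False
    then have a': "0 < a" using a by simp
    have "sqrt (a / \<sigma>) = a powr (1/2) * \<sigma> powr (-1/2)"
      using a' \<sigma> by (simp add: powr_half_sqrt real_sqrt_divide powr_minus_divide)
    moreover have "a * a powr (1/2) = a powr (3/2)" using a' powr_add[of a 1 "1/2"] by simp
    ultimately show ?thesis by (simp add: mult_ac)
  qed simp
  finally show ?thesis using \<sigma> by (simp add: add_increasing)
qed

text \<open>Since \<open>u\<^sup>p\<^sup>-\<^sup>1\<close> lies in \<open>L\<^sup>s\<close> with \<open>s > 3/2\<close>, its large part is absorbed by the Dirichlet form through the Sobolev inequality.\<close>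
lemma absorb:
  fixes p :: real
  assumes p: "1 < p" "p < 5" and um: "u \<in> borel_measurable borel" and u0: "\<And>x. 0 \<le> u x"
    and u6: "integrable lborel (\<lambda>x. u x ^ 6)"
  obtains K where "0 \<le> K" "\<And>R d g. H0 R d g \<Longrightarrow> integrable lborel (\<lambda>x. u x powr (p - 1) * (d x)\<^sup>2) \<and>
     p * (\<integral>x. u x powr (p - 1) * (d x)\<^sup>2 \<partial>lborel) \<le> 1/2 * gradsq g + K * sqint d"
proof -
  define I where "I = (\<integral>x. u x ^ 6 \<partial>lborel)"
  have I0: "0 \<le> I" unfolding I_def using u0 by (intro Bochner_Integration.integral_nonneg) simp
  define \<sigma> where "\<sigma> = 1 / (64 * p)"
  have \<sigma>: "0 < \<sigma>" using p by (simp add: \<sigma>_def)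
  define c where "c = \<sigma> powr (-1/2)"
  have c: "0 < c" using \<sigma> by (simp add: c_def)
  \<comment> \<open>Positive exactly when \<open>p < 5\<close>: where \<open>u > T\<close>, the
    power \<open>u^(3(p-1)/2)\<close> is at most \<open>T^(-m) u^6\<close>, which is small for large
    \<open>T\<close>.\<close>
  define m where "m = 6 - 3 * (p - 1) / 2"
  have m: "0 < m" using p by (simp add: m_def)
  define T where "T = max 1 ((64 * p * c * (I + 1)) powr (1/m))"
  have T1: "1 \<le> T" by (simp add: T_def)
  have Tm: "64 * p * c * (I + 1) \<le> T powr m"
  proof -
    have pos: "0 < 64 * p * c * (I + 1)" using p c I0 by simp
    have "64 * p * c * (I + 1) = ((64 * p * c * (I + 1)) powr (1/m)) powr m" using pos m by (simp add: powr_powr)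
    also have "\<dots> \<le> T powr m" using m by (intro powr_mono2) (auto simp: T_def)
    finally show ?thesis .
  qed
  note [measurable] = um
  define a where "a x = (if T < u x then u x powr (p - 1) else 0)" for x
  have a0: "0 \<le> a x" for x by (simp add: a_def)
  have ua: "u x powr (p - 1) \<le> T powr (p - 1) + a x" for x
    using p u0 T1 by (auto simp: a_def intro!: powr_mono2)
  have a32: "a x powr (3/2) \<le> T powr (-m) * u x ^ 6" for x
  proof (cases "T < u x")
    case True
    have ux: "0 < u x" using True T1 by linarith
    have "a x powr (3/2) = u x powr (6 - m)" using True by (simp add: a_def powr_powr m_def mult.commute)
    also have "\<dots> = u x powr (-m) * u x ^ 6" using ux powr_realpow[of "u x" 6] powr_add[of "u x" "-m" 6] by simp
    also have "\<dots> \<le> T powr (-m) * u x ^ 6"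
      using True T1 m ux by (intro mult_right_mono powr_mono2') auto
    finally show ?thesis .
  next
    case False
    then show ?thesis using u0 by (simp add: a_def)
  qed
  show ?thesis
  proof (rule that[of "p * T powr (p - 1)"])
    show "0 \<le> p * T powr (p - 1)" using p by simp
    fix R d g assume H: "H0 R d g"
    note dL = H0_L2(1)[OF H]
    note [measurable] = L2_meas[OF dL]
    define D where "D = gradsq g"
    have D0: "0 \<le> D" by (simp add: D_def gradsq_nonneg)
    have d6: "integrable lborel (\<lambda>x. d x ^ 6)" "(\<integral>x. d x ^ 6 \<partial>lborel) \<le> 4096 * D ^ 3"
      using H0_Sobolev[OF H] by (auto simp: D_def)
    have bound: "u x powr (p - 1) * (d x)\<^sup>2 \<le> T powr (p - 1) * (d x)\<^sup>2 + a x * (d x)\<^sup>2" for x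
      using mult_right_mono[OF ua[of x], of "(d x)\<^sup>2"] by (simp add: distrib_right)
    \<comment> \<open>The parameter \<open>n\<close> comes from applying \<open>split_ineq\<close>
      to \<open>d x / sqrt n\<close>; it balances the cubic Sobolev bound in \<open>D\<close>
      against a term without \<open>D\<close>.\<close>
    have scale: "a x * (d x)\<^sup>2 \<le> \<sigma> / n^2 * d x ^ 6 + n * c * T powr (-m) * u x ^ 6" if n: "0 < n" for n x
    proof -
      have sn: "(d x / sqrt n)^2 = (d x)^2 / n" "(d x / sqrt n)^6 = d x ^ 6 / n^3"
        using n power_mult[of "sqrt n" 2 3] by (simp_all add: power_divide)
      have "a x * (d x / sqrt n)^2 \<le> \<sigma> * (d x / sqrt n)^6 + c * (a x) powr (3/2)"
        unfolding c_def by (rule split_ineq[OF a0 \<sigma>])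
      also have "\<dots> \<le> \<sigma> * (d x / sqrt n)^6 + c * (T powr (-m) * u x ^ 6)"
        using c a32[of x] by simp
      finally have "n * (a x * ((d x)^2 / n)) \<le> n * (\<sigma> * (d x ^ 6 / n^3) + c * (T powr (-m) * u x ^ 6))"
        unfolding sn using n by (intro mult_left_mono) auto
      moreover have "n * (a x * ((d x)^2 / n)) = a x * (d x)\<^sup>2" using n by simp
      moreover have "n * (\<sigma> * (d x ^ 6 / n^3) + c * (T powr (-m) * u x ^ 6)) = \<sigma> / n^2 * d x ^ 6 + n * c * T powr (-m) * u x ^ 6"
        using n by (simp add: field_simps power2_eq_square power3_eq_cube)
      ultimately show ?thesis by simp
    qed
    have adi: "integrable lborel (\<lambda>x. a x * (d x)\<^sup>2)"
    proof (rule Bochner_Integration.integrable_bound)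
      show "integrable lborel (\<lambda>x. \<sigma> / 1^2 * d x ^ 6 + 1 * c * T powr (-m) * u x ^ 6)" using d6 u6 by simp
      show "AE x in lborel. norm (a x * (d x)\<^sup>2) \<le> norm (\<sigma> / 1^2 * d x ^ 6 + 1 * c * T powr (-m) * u x ^ 6)"
      proof (rule AE_I2)
        fix x
        have "norm (a x * (d x)\<^sup>2) = a x * (d x)\<^sup>2" using a0 by simp
        also have "\<dots> \<le> \<sigma> / 1^2 * d x ^ 6 + 1 * c * T powr (-m) * u x ^ 6" by (rule scale) simp
        finally show "norm (a x * (d x)\<^sup>2) \<le> norm (\<sigma> / 1^2 * d x ^ 6 + 1 * c * T powr (-m) * u x ^ 6)" by simp
      qed
    qed (simp add: a_def)
    have i: "integrable lborel (\<lambda>x. T powr (p - 1) * (d x)\<^sup>2 + a x * (d x)\<^sup>2)" using adi L2_sq[OF dL] by simp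
    have j: "integrable lborel (\<lambda>x. u x powr (p - 1) * (d x)\<^sup>2)"
    proof (rule Bochner_Integration.integrable_bound[OF i])
      show "AE x in lborel. norm (u x powr (p - 1) * (d x)\<^sup>2) \<le> norm (T powr (p - 1) * (d x)\<^sup>2 + a x * (d x)\<^sup>2)"
        using bound a0 by (intro AE_I2) (simp add: order_trans[OF _ abs_ge_self])
    qed simp
    have aint: "(\<integral>x. a x * (d x)\<^sup>2 \<partial>lborel) \<le> \<sigma> / n^2 * (4096 * D^3) + n * c * T powr (-m) * I" if n: "0 < n" for n
    proof -
      have "(\<integral>x. a x * (d x)\<^sup>2 \<partial>lborel) \<le> (\<integral>x. \<sigma> / n^2 * d x ^ 6 + n * c * T powr (-m) * u x ^ 6 \<partial>lborel)"
        using d6 u6 by (intro integral_mono adi scale n) simp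
      also have "\<dots> = \<sigma> / n^2 * (\<integral>x. d x ^ 6 \<partial>lborel) + n * c * T powr (-m) * I"
        using d6 u6 by (simp add: I_def)
      also have "\<dots> \<le> \<sigma> / n^2 * (4096 * D^3) + n * c * T powr (-m) * I"
        using \<sigma> d6 by (intro add_right_mono mult_left_mono) auto
      finally show ?thesis .
    qed
    have cI: "c * T powr (-m) * I \<le> 1 / (64 * p)"
    proof -
      have "64 * p * c * I \<le> 64 * p * c * (I + 1)" using p c by (intro mult_left_mono) auto
      then have "64 * p * c * I \<le> T powr m" using Tm by linarith
      then have "(64 * p * c * I) * T powr (-m) \<le> T powr m * T powr (-m)" by (intro mult_right_mono) auto
      also have "\<dots> = 1" using T1 by (simp add: powr_add[symmetric])
      finally show ?thesis using p by (simp add: field_simps)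
    qed
    have fin: "p * (\<integral>x. a x * (d x)\<^sup>2 \<partial>lborel) \<le> 1/2 * D"
    proof (cases "D = 0")
      case True
      have le: "(\<integral>x. a x * (d x)\<^sup>2 \<partial>lborel) \<le> 0"
      \<comment> \<open>With \<open>D = 0\<close> there is no balancing \<open>n\<close>; an
        arbitrarily small one shows that the integral is not positive.\<close>
      proof (rule field_le_epsilon)
        fix e :: real assume e: "0 < e"
        have "(\<integral>x. a x * (d x)\<^sup>2 \<partial>lborel) \<le> e * (64 * p) * (c * T powr (-m) * I)"
          using aint[of "e * (64 * p)"] True e p by (simp add: mult.assoc)
        also have "\<dots> \<le> e * (64 * p) * (1 / (64 * p))" using e p by (intro mult_left_mono cI) auto
        finally show "(\<integral>x. a x * (d x)\<^sup>2 \<partial>lborel) \<le> 0 + e" using p by simp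
      qed
      then show ?thesis using True p by (simp add: mult_nonneg_nonpos)
    next
      case False
      then have D: "0 < D" using D0 by simp
      \<comment> \<open>\<open>n = 16 * D\<close> is the balancing choice:
        \<open>4096 / 16^2 = 16\<close>, so each of the two terms is at most
        \<open>16 * D / (64 * p) = D / (4 * p)\<close>.\<close>
      have "(\<integral>x. a x * (d x)\<^sup>2 \<partial>lborel) \<le> \<sigma> / (16 * D)^2 * (4096 * D^3) + 16 * D * (c * T powr (-m) * I)"
        using aint[of "16 * D"] D by (simp add: mult.assoc)
      also have "\<sigma> / (16 * D)^2 * (4096 * D^3) = 16 * D * \<sigma>" using D by (simp add: field_simps power2_eq_square power3_eq_cube)
      also have "16 * D * \<sigma> + 16 * D * (c * T powr (-m) * I) \<le> 16 * D * \<sigma> + 16 * D * (1 / (64 * p))"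
        using D by (intro add_left_mono mult_left_mono cI) auto
      also have "\<dots> = D / (2 * p)" using p by (simp add: \<sigma>_def field_simps)
      finally show ?thesis using p by (simp add: field_simps)
    qed
    have "(\<integral>x. u x powr (p - 1) * (d x)\<^sup>2 \<partial>lborel) \<le> (\<integral>x. T powr (p - 1) * (d x)\<^sup>2 + a x * (d x)\<^sup>2 \<partial>lborel)"
      by (rule integral_mono[OF j i bound])
    also have "\<dots> = T powr (p - 1) * sqint d + (\<integral>x. a x * (d x)\<^sup>2 \<partial>lborel)"
      using adi L2_sq[OF dL] by (simp add: sqint_def)
    finally have "p * (\<integral>x. u x powr (p - 1) * (d x)\<^sup>2 \<partial>lborel) \<le> p * (T powr (p - 1) * sqint d + (\<integral>x. a x * (d x)\<^sup>2 \<partial>lborel))"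
      using p by (intro mult_left_mono) auto
    then show "integrable lborel (\<lambda>x. u x powr (p - 1) * (d x)\<^sup>2) \<and>
      p * (\<integral>x. u x powr (p - 1) * (d x)\<^sup>2 \<partial>lborel) \<le> 1/2 * gradsq g + p * T powr (p - 1) * sqint d"
      using j fin by (simp add: distrib_left D_def mult.assoc)
  qed
qed

text \<open>The interval may start at 0, so the derivative is taken at interior points, which are
  positive, and continuity serves at the ends.\<close>

lemma powr_mvt:
  fixes a b r :: real
  assumes b: "0 \<le> b" and lt: "b < a" and r: "1 < r"
  shows "\<exists>\<xi>. b \<le> \<xi> \<and> \<xi> \<le> a \<and> a powr r - b powr r = r * \<xi> powr (r - 1) * (a - b)"
proof -
  have der: "((\<lambda>x. x powr r) has_real_derivative r * x powr (r - 1)) (at x)" if "b < x" for x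
    using that b by (auto intro!: derivative_eq_intros)
  have "\<exists>l z. b < z \<and> z < a \<and> ((\<lambda>x. x powr r) has_real_derivative l) (at z) \<and> a powr r - b powr r = (a - b) * l"
  proof (rule MVT[OF lt])
    show "continuous_on {b..a} (\<lambda>x. x powr r)"
      using b r by (intro continuous_on_powr' continuous_intros) auto
    show "(\<lambda>x. x powr r) differentiable (at x)" if "b < x" "x < a" for x
      using der[OF that(1)] real_differentiable_def by blast
  qed
  then obtain l z where z: "b < z" "z < a" "((\<lambda>x. x powr r) has_real_derivative l) (at z)" "a powr r - b powr r = (a - b) * l"
    by blast
  have "l = r * z powr (r - 1)" using DERIV_unique[OF z(3) der[OF z(1)]] .
  then show ?thesis using z by (intro exI[of _ z]) (auto simp: mult_ac)
qed

lemma powr_diff_le: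
  fixes a b r :: real
  assumes ab: "0 \<le> a" "0 \<le> b" and r: "1 < r"
  shows "\<bar>a powr r - b powr r\<bar> \<le> r * (a powr (r - 1) * \<bar>a - b\<bar> + b powr (r - 1) * \<bar>a - b\<bar>)"
proof -
  have *: "\<bar>x powr r - y powr r\<bar> \<le> r * (x powr (r - 1) * \<bar>x - y\<bar>)" if xy: "0 \<le> y" "y < x" for x y :: real
  proof -
    obtain z where z: "y \<le> z" "z \<le> x" "x powr r - y powr r = r * z powr (r - 1) * (x - y)"
      using powr_mvt[OF xy r] by blast
    have "z powr (r - 1) * \<bar>x - y\<bar> \<le> x powr (r - 1) * \<bar>x - y\<bar>"
      using z xy r by (intro mult_right_mono powr_mono2) auto
    then have "r * (z powr (r - 1) * \<bar>x - y\<bar>) \<le> r * (x powr (r - 1) * \<bar>x - y\<bar>)"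
      using r by (intro mult_left_mono) auto
    then show ?thesis using z xy r by (simp add: abs_mult mult.assoc)
  qed
  have p: "0 \<le> r * (a powr (r - 1) * \<bar>a - b\<bar>)" "0 \<le> r * (b powr (r - 1) * \<bar>a - b\<bar>)" using r by auto
  show ?thesis
  proof (cases a b rule: linorder_cases)
    case less
    then show ?thesis using *[OF ab(1) less] p by (simp add: distrib_left abs_minus_commute)
  next
    case greater
    then show ?thesis using *[OF ab(2) greater] p by (simp add: distrib_left)
  qed simp
qed

text \<open>A Taylor estimate at \<open>a\<close> for the primitive of \<open>s^p\<close>: one mean
  value removes the linear term, a second produces the square, and its intermediate point lies below
  \<open>a\<close>. The bound involves \<open>a\<close> alone because \<open>b\<close> is the
  smaller point.\<close>

lemma convex_remainder:
  fixes a b p :: real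
  assumes p: "1 < p" and b: "0 \<le> b" and ab: "b \<le> a"
  shows "b powr (p+1) / (p+1) - a powr (p+1) / (p+1) + a powr p * (a - b) \<le> p * a powr (p - 1) * (a - b)\<^sup>2"
proof -
  show ?thesis
  proof (cases "a = b")
    case False
    then have lt: "b < a" using ab by simp
    obtain \<xi> where x: "b \<le> \<xi>" "\<xi> \<le> a" "a powr (p+1) - b powr (p+1) = (p+1) * \<xi> powr (p+1-1) * (a - b)"
      using powr_mvt[OF b lt, of "p+1"] p by auto
    obtain \<zeta> where z: "b \<le> \<zeta>" "\<zeta> \<le> a" "a powr p - b powr p = p * \<zeta> powr (p - 1) * (a - b)"
      using powr_mvt[OF b lt p] by auto
    have "b powr p \<le> \<xi> powr p" using x b p by (intro powr_mono2) auto
    then have 1: "b powr p * (a - b) \<le> \<xi> powr p * (a - b)" using ab by (intro mult_right_mono) auto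
    have "(a powr (p+1) - b powr (p+1)) / (p+1) = \<xi> powr p * (a - b)" using x(3) p by simp
    then have 2: "b powr (p+1) / (p+1) - a powr (p+1) / (p+1) = - (\<xi> powr p * (a - b))" by (simp add: diff_divide_distrib)
    have "b powr (p+1) / (p+1) - a powr (p+1) / (p+1) + a powr p * (a - b) \<le> (a powr p - b powr p) * (a - b)"
      unfolding 2 using 1 by (simp add: left_diff_distrib)
    also have "\<dots> = p * \<zeta> powr (p - 1) * (a - b)\<^sup>2" unfolding z(3) by (simp add: power2_eq_square)
    also have "\<dots> \<le> p * a powr (p - 1) * (a - b)\<^sup>2"
      using z b p by (intro mult_right_mono mult_left_mono powr_mono2) auto
    finally show ?thesis .
  qed simp
qed

section \<open>Energy terms under dilation and the Pohozaev inequality\<close>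

lemma dilate_powr:
  assumes "t > 0" "u \<in> borel_measurable borel" "integrable lborel (\<lambda>x. u x powr q)"
  shows "integrable lborel (\<lambda>x::R3. u (t *\<^sub>R x) powr q)" "(\<integral>x. u (t *\<^sub>R x) powr q \<partial>lborel) = (\<integral>x. u x powr q \<partial>lborel) / t^3"
proof -
  note [measurable] = assms(2)
  show "integrable lborel (\<lambda>x. u (t *\<^sub>R x) powr q)" "(\<integral>x. u (t *\<^sub>R x) powr q \<partial>lborel) = (\<integral>x. u x powr q \<partial>lborel) / t^3"
    using integral_affine3[of t "\<lambda>x. u x powr q" 0] assms by simp_all
qed

lemma dilate_V:
  assumes t: "t > 0" and [measurable]: "u \<in> borel_measurable borel" and i: "integrable lborel (\<lambda>x. V x * (u x)\<^sup>2)"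
  shows "(\<integral>x. V x * (u (t *\<^sub>R x))\<^sup>2 \<partial>lborel) = (\<integral>x. V x * (u x)\<^sup>2 \<partial>lborel) / t^5"
proof -
  have "(\<integral>x. V x * (u x)\<^sup>2 \<partial>lborel) = t^3 * (\<integral>x. V (t *\<^sub>R x) * (u (t *\<^sub>R x))\<^sup>2 \<partial>lborel)"
    using integral_affine3(1)[of t "\<lambda>x. V x * (u x)\<^sup>2" 0] t by simp
  also have "(\<lambda>x. V (t *\<^sub>R x) * (u (t *\<^sub>R x))\<^sup>2) = (\<lambda>x. t^2 * (V x * (u (t *\<^sub>R x))\<^sup>2))"
    by (auto simp: V_def algebra_simps power_mult_distrib)
  also have "t^3 * (\<integral>x. t^2 * (V x * (u (t *\<^sub>R x))\<^sup>2) \<partial>lborel) = t^5 * (\<integral>x. V x * (u (t *\<^sub>R x))\<^sup>2 \<partial>lborel)"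
  proof -
    have "t^3 * (t^2 * X) = t^5 * X" for X by (simp add: mult.assoc[symmetric] power_add[symmetric])
    then show ?thesis unfolding integral_mult_right_zero .
  qed
  finally show ?thesis using t by simp
qed

lemma integral_mult_polarize:
  assumes "L2 f" "L2 g"
  shows "(\<integral>x. f x * g x \<partial>lborel) = (sqint f + sqint g - sqint (\<lambda>x. g x - f x)) / 2"
  unfolding sqint_diff[OF assms(2,1)] by (simp add: mult.commute)

text \<open>Pohozaev's identity with its boundary term replaced by an inequality. The competitor \<open>u(t\<cdot>)\<close> with
  \<open>t > 1\<close> is admissible in the ball, and \<open>J(u(t\<cdot>)) - J(u) \<ge> - K (t - 1)\<^sup>2\<close> for the action \<open>J\<close>
  because \<open>u\<close> is a critical point of \<open>J\<close>; no regularity up to the boundary is needed.\<close>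
lemma Pohozaev_inequality:
  assumes p: "1 < p" "p < 5" and w: "weak_sol p lam (ball 0 R) u" and u: "H0 R u (wgrad u)" and u0: "\<And>x. 0 \<le> u x"
    and decr: "\<And>t x. 1 \<le> t \<Longrightarrow> u (t *\<^sub>R x) \<le> u x"
  defines "A \<equiv> gradsq (wgrad u)" and "B \<equiv> (\<integral>x. V x * (u x)\<^sup>2 \<partial>lborel)" and "C \<equiv> (\<integral>x. u x powr (p + 1) \<partial>lborel)"
  shows "A + B + lam * sqint u = C" "0 \<le> A - B - 3 * (p - 1) / (2 * (p + 1)) * C"
proof -
  have q: "1 < p + 1" "2 \<le> p + 1" "p + 1 \<le> 6" using p by auto
  note uL = H0_L2(1)[OF u] and gL = H0_L2(2)[OF u]
  have um: "u \<in> borel_measurable borel" by (rule L2_meas[OF uL])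
  note [measurable] = um
  have uq: "integrable lborel (\<lambda>x. u x powr (p + 1))" using H0_Lq(1)[OF u q(2,3)] u0 by simp
  have pp: "u x powr p * u x = u x powr (p + 1)" for x using powr_pred_mult[OF u0, where q="p+1"] by simp
  define M where "M = sqint u"
  have B_eq: "(\<integral>x. V x * u x * u x \<partial>lborel) = B" by (simp add: B_def power2_eq_square mult.assoc)
  have M_eq: "(\<integral>x. u x * u x \<partial>lborel) = M" by (simp add: M_def sqint_def power2_eq_square)
  show id: "A + B + lam * sqint u = C"
    using weak_sol_H0[OF p w u u0 u] B_eq M_eq unfolding gip_same A_def M_def by (simp add: C_def pp)
  obtain K where K: "0 \<le> K" "\<And>R d g. H0 R d g \<Longrightarrow> integrable lborel (\<lambda>x. u x powr (p - 1) * (d x)\<^sup>2) \<and>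
     p * (\<integral>x. u x powr (p - 1) * (d x)\<^sup>2 \<partial>lborel) \<le> 1/2 * gradsq g + K * sqint d"
    using absorb[OF p um u0 H0_Sobolev(1)[OF u]] by blast
  \<comment> \<open>The constant may depend on \<open>R\<close> and \<open>u\<close>: it multiplies
    the square of \<open>t - 1\<close> and disappears in the derivative at 1.\<close>
  define K' where "K' = (K + \<bar>lam\<bar> / 2) * (R\<^sup>2 * A)"
  \<comment> \<open>The action of the dilated function minus that of \<open>u\<close>, computed
    exactly from the homogeneity of each term, of degrees -1, -5, -3 and -3 in
    \<open>t\<close>.\<close>
  define f where "f t = A / 2 * (1/t - 1) + B / 2 * (1/t^5 - 1) + lam * M / 2 * (1/t^3 - 1) - C / (p + 1) * (1/t^3 - 1)" for t
  have main: "- K' * (t - 1)\<^sup>2 \<le> f t" if t: "1 \<le> t" for t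
  proof -
    have t0: "0 < t" using t by simp
    let ?w = "\<lambda>x. u (t *\<^sub>R x)" and ?gw = "\<lambda>x. t *\<^sub>R wgrad u (t *\<^sub>R x)"
    let ?d = "\<lambda>x. ?w x - u x"
    have wH: "H0 R ?w ?gw" by (rule H0_dilate[OF u t])
    have dH: "H0 R ?d (\<lambda>x. ?gw x - wgrad u x)" by (rule H0_diff[OF wH u])
    note wL = H0_L2(1)[OF wH]
    have wm: "?w \<in> borel_measurable borel" by (rule L2_meas[OF wL])
    have Aw: "gradsq ?gw = A / t"
    proof -
      have "sqint (\<lambda>x. wgrad u (t *\<^sub>R x) $ i) = sqint (\<lambda>x. wgrad u x $ i) / t^3" for i
        by (rule L2lim_dilate(2)[OF L2lim_const[OF gL] t0])
      then have "gradsq (\<lambda>x. wgrad u (t *\<^sub>R x)) = A / t^3" unfolding A_def gradsq_def by (simp add: sum_divide_distrib)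
      then show ?thesis unfolding gradsq_scale using t0 by (simp add: power2_eq_square power3_eq_cube)
    qed
    have Mw: "sqint ?w = M / t^3" unfolding M_def by (rule L2lim_dilate(2)[OF L2lim_const[OF uL] t0])
    have Bw: "(\<integral>x. V x * (?w x)\<^sup>2 \<partial>lborel) = B / t^5" unfolding B_def by (rule dilate_V[OF t0 um H0_V(2)[OF u]])
    have Cw: "integrable lborel (\<lambda>x. ?w x powr (p + 1))" "(\<integral>x. ?w x powr (p + 1) \<partial>lborel) = C / t^3"
      unfolding C_def by (rule dilate_powr[OF t0 um uq])+
    define D1 D2 D3 where "D1 = gradsq (\<lambda>x. ?gw x - wgrad u x)" and "D2 = (\<integral>x. V x * (?d x)\<^sup>2 \<partial>lborel)" and "D3 = sqint ?d"
    have D2: "0 \<le> D2" unfolding D2_def using V_nonneg by (intro Bochner_Integration.integral_nonneg) auto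
    have D3: "0 \<le> D3" "D3 \<le> (t - 1)\<^sup>2 * R\<^sup>2 * A"
      unfolding D3_def A_def using H0_dilation_diff[OF u t] sqint_nonneg by auto
    have g1: "gip (wgrad u) ?gw = (A / t + A - D1) / 2"
      using gradsq_diff[OF H0_L2(2)[OF wH] gL] Aw unfolding D1_def A_def
      by (simp add: gip_def mult.commute)
    have g3: "(\<integral>x. u x * ?w x \<partial>lborel) = (M / t^3 + M - D3) / 2"
      using integral_mult_polarize[OF uL wL] Mw unfolding D3_def M_def by simp
    have g2: "(\<integral>x. V x * u x * ?w x \<partial>lborel) = (B / t^5 + B - D2) / 2"
    proof -
      have i: "integrable lborel (\<lambda>x. V x * (u x)\<^sup>2)" "integrable lborel (\<lambda>x. V x * (?w x)\<^sup>2)" "integrable lborel (\<lambda>x. V x * u x * ?w x)"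
        using H0_V(2)[OF u] H0_V(2)[OF wH] L2_mult_integrable[OF H0_V(1)[OF u] wL] by auto
      have "D2 = (\<integral>x. V x * (?w x)\<^sup>2 - 2 * (V x * u x * ?w x) + V x * (u x)\<^sup>2 \<partial>lborel)"
        unfolding D2_def by (intro Bochner_Integration.integral_cong) (auto simp: power2_eq_square algebra_simps)
      also have "\<dots> = B / t^5 - 2 * (\<integral>x. V x * u x * ?w x \<partial>lborel) + B" using i Bw by (simp add: B_def)
      finally show ?thesis by simp
    qed
    have pwi: "integrable lborel (\<lambda>x. u x powr p * ?w x)"
      using nonlinear_bound(1)[OF um u0 wm q(1) uq _ zero_less_one] Cw(1) u0 by simp
    have eq: "(A / t + A - D1) / 2 + (B / t^5 + B - D2) / 2 + lam * ((M / t^3 + M - D3) / 2) = (\<integral>x. u x powr p * ?w x \<partial>lborel)"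
      using weak_sol_H0[OF p w u u0 wH] unfolding g1 g2 g3 .
    have N: "p * (\<integral>x. u x powr (p - 1) * (?d x)\<^sup>2 \<partial>lborel) \<le> 1/2 * D1 + K * D3" "integrable lborel (\<lambda>x. u x powr (p - 1) * (?d x)\<^sup>2)"
      using K(2)[OF dH] unfolding D1_def D3_def by auto
    \<comment> \<open>\<open>decr\<close> gives \<open>?w \<le> u\<close> pointwise, so
      \<open>convex_remainder\<close> applies and only \<open>u^(p-1)\<close> enters, which
      \<open>absorb\<close> controls by the Dirichlet form.\<close>
    have rem: "C / t^3 / (p+1) - C / (p+1) + (C - (\<integral>x. u x powr p * ?w x \<partial>lborel)) \<le> p * (\<integral>x. u x powr (p - 1) * (?d x)\<^sup>2 \<partial>lborel)"
    proof -
      have le: "?w x powr (p+1) / (p+1) - u x powr (p+1) / (p+1) + (u x powr (p + 1) - u x powr p * ?w x) \<le> p * (u x powr (p - 1) * (?d x)\<^sup>2)" for x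
        using convex_remainder[OF p(1) u0[of "t *\<^sub>R x"] decr[OF t, of x]] pp[of x]
        by (simp add: right_diff_distrib power2_commute mult.assoc)
      have "(\<integral>x. ?w x powr (p+1) / (p+1) - u x powr (p+1) / (p+1) + (u x powr (p + 1) - u x powr p * ?w x) \<partial>lborel)
         \<le> (\<integral>x. p * (u x powr (p - 1) * (?d x)\<^sup>2) \<partial>lborel)"
        using Cw uq pwi N(2) by (intro integral_mono le) auto
      then show ?thesis using Cw uq pwi N(2) by (simp add: C_def)
    qed
    have l3: "- (\<bar>lam\<bar> * D3) \<le> lam * D3"
      using mult_right_mono[of "- \<bar>lam\<bar>" lam D3] D3 by auto
    \<comment> \<open>The gradient error \<open>D1\<close> occurs with factor 1/2 on both sides and
      cancels, \<open>D2\<close> has the favourable sign, and only \<open>D3\<close>, of second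
      order in \<open>t - 1\<close>, remains.\<close>
    have "- (K + \<bar>lam\<bar> / 2) * D3 \<le> f t"
    proof -
      have ft: "f t = A / t / 2 - A / 2 + B / t^5 / 2 - B / 2 + lam * (M / t^3) / 2 - lam * M / 2 - (C / t^3 / (p+1) - C / (p+1))"
        unfolding f_def by (simp add: right_diff_distrib left_diff_distrib diff_divide_distrib mult.commute)
      have e2: "lam * ((M / t^3 + M - D3) / 2) = (lam * (M / t^3) + lam * M - lam * D3) / 2"
        by (simp add: distrib_left right_diff_distrib)
      have e3: "- (K + \<bar>lam\<bar> / 2) * D3 = - (K * D3) - \<bar>lam\<bar> * D3 / 2" by (simp add: algebra_simps)
      have arith: "- KD - lD / 2 \<le> a1 / 2 - A' / 2 + b5 / 2 - B' / 2 + L3 / 2 - L / 2 - (c3 - c1)"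
        if "(a1 + A' - D1) / 2 + (b5 + B' - D2) / 2 + (L3 + L - LD) / 2 = P" "c3 - c1 + (C' - P) \<le> N" "N \<le> 1/2 * D1 + KD"
          "0 \<le> D2" "- lD \<le> LD" "A' + B' + L = C'" for a1 A' D1 b5 B' D2 L3 L LD P c3 c1 C' N KD lD :: real
        using that by argo
      show ?thesis unfolding ft e3 by (rule arith[OF eq[unfolded e2] rem N(1) D2 l3 id[folded M_def]])
    qed
    moreover have "(K + \<bar>lam\<bar> / 2) * D3 \<le> K' * (t - 1)\<^sup>2"
      unfolding K'_def using mult_left_mono[OF D3(2), of "K + \<bar>lam\<bar> / 2"] K(1) by (simp add: mult_ac)
    ultimately show ?thesis unfolding minus_mult_left[symmetric] by linarith
  qed
  \<comment> \<open>As \<open>f 1 = 0\<close>, dividing the lower bound by \<open>t - 1\<close> and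
    letting \<open>t\<close> decrease to 1 shows this derivative to be nonnegative.\<close>
  have "(f has_real_derivative - A / 2 - 5 * B / 2 - 3 * lam * M / 2 + 3 * C / (p + 1)) (at 1)"
  proof -
    have "((\<lambda>t. A / 2 * (1/t - 1) + B / 2 * (1/t^5 - 1) + lam * M / 2 * (1/t^3 - 1) - c * (1/t^3 - 1))
      has_real_derivative - A / 2 - 5 * B / 2 - 3 * lam * M / 2 + 3 * c) (at 1)" for c
      by (auto intro!: derivative_eq_intros simp: field_simps)
    from this[of "C / (p + 1)"] show ?thesis unfolding f_def[abs_def] by simp
  qed
  then have "((\<lambda>t. (f t - f 1) / (t - 1)) \<longlongrightarrow> - A / 2 - 5 * B / 2 - 3 * lam * M / 2 + 3 * C / (p + 1)) (at_right 1)"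
    unfolding has_field_derivative_iff by (rule tendsto_within_subset) simp
  moreover have "((\<lambda>t. - K' * (t - 1)) \<longlongrightarrow> - K' * (1 - 1)) (at_right 1)" by (intro tendsto_intros)
  ultimately have "- K' * (1 - 1) \<le> - A / 2 - 5 * B / 2 - 3 * lam * M / 2 + 3 * C / (p + 1)"
  proof (rule tendsto_le[OF trivial_limit_at_right_real])
    show "\<forall>\<^sub>F t in at_right 1. - K' * (t - 1) \<le> (f t - f 1) / (t - 1)"
    proof (rule eventually_at_rightI[of 1 2])
      fix t :: real assume "t \<in> {1<..<2}"
      then have t: "1 < t" by simp
      have "- K' * (t - 1) * (t - 1) \<le> f t - f 1" using main[of t] t by (simp add: f_def power2_eq_square mult.assoc)
      then show "- K' * (t - 1) \<le> (f t - f 1) / (t - 1)" using t by (simp add: pos_le_divide_eq)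
    qed simp
  qed
  \<comment> \<open>The multiplier is eliminated through the tested equation; what remains involves
    the three energy terms only.\<close>
  moreover have "lam * M = C - A - B" using id by (simp add: M_def)
  then have "3 * lam * M / 2 = 3 / 2 * (C - A - B)" by simp
  ultimately have "0 \<le> - A / 2 - 5 * B / 2 - 3 / 2 * (C - A - B) + 3 * C / (p + 1)" by simp
  moreover have "- A / 2 - 5 * B / 2 - 3 / 2 * (C - A - B) + 3 * C / (p + 1) = A - B - 3 * (p - 1) / (2 * (p + 1)) * C"
    using p by (simp add: field_simps)
  ultimately show "0 \<le> A - B - 3 * (p - 1) / (2 * (p + 1)) * C" by simp
qed

section \<open>Subsolutions\<close>

definition lap :: "(R3 \<Rightarrow> real) \<Rightarrow> R3 \<Rightarrow> real" where
  "lap f x = (\<Sum>i\<in>UNIV. pderiv3 i (pderiv3 i f) x)"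

lemma lap_test: "test_fun \<Omega> \<phi> \<Longrightarrow> test_fun \<Omega> (lap \<phi>)"
  unfolding lap_def[abs_def] sum_3 by (intro test_fun_add test_fun_pderiv3)

text \<open>Both derivatives end up on the test function, so that a differential inequality for
  smooth \<open>\<phi>\<close> can be used against a merely weak solution.\<close>

lemma gip_grad3_lap:
  assumes u: "L2 u" and g: "has_weak_grad u g" and \<phi>: "test_fun UNIV \<phi>"
  shows "gip g (grad3 \<phi>) = - (\<integral>x. u x * lap \<phi> x \<partial>lborel)"
proof -
  have i: "integrable lborel (\<lambda>x. u x * pderiv3 i (pderiv3 i \<phi>) x)" for i
    by (intro L2_mult_integrable u test_fun_L2[of UNIV] test_fun_pderiv3 \<phi>)
  have "(\<integral>x. u x * lap \<phi> x \<partial>lborel) = (\<Sum>i\<in>UNIV. \<integral>x. u x * pderiv3 i (pderiv3 i \<phi>) x \<partial>lborel)"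
    unfolding lap_def sum_distrib_left by (intro Bochner_Integration.integral_sum i)
  also have "\<dots> = (\<Sum>i\<in>UNIV. - (\<integral>x. g x $ i * pderiv3 i \<phi> x \<partial>lborel))"
    by (intro sum.cong refl has_weak_grad_eq[OF g] test_fun_pderiv3 \<phi>)
  finally show ?thesis by (simp add: gip_def sum_negf)
qed

section \<open>Gaussian barriers, cut off smoothly\<close>

definition quad :: "(3 \<Rightarrow> real) \<Rightarrow> R3 \<Rightarrow> R3 \<Rightarrow> real" where
  "quad a y x = (\<Sum>i\<in>UNIV. a i * (x $ i - y $ i)\<^sup>2)"

definition gauss :: "(3 \<Rightarrow> real) \<Rightarrow> R3 \<Rightarrow> R3 \<Rightarrow> real" where
  "gauss a y x = exp (- quad a y x)"

text \<open>A smooth version of the positive part of \<open>gauss a y x - c\<close>: the level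
  \<open>c\<close> fixes the support and \<open>k\<close> is the scale of the smoothing.\<close>

definition cutgauss :: "(3 \<Rightarrow> real) \<Rightarrow> R3 \<Rightarrow> real \<Rightarrow> real \<Rightarrow> R3 \<Rightarrow> real" where
  "cutgauss a y c k x = k * theta ((gauss a y x - c) / k)"

lemma smooth3_shift_coord: "smooth3 (\<lambda>x. x $ i - y)"
  by (rule smooth3_diff[OF smooth3_coord smooth3_const])

lemma smooth3_gauss: "smooth3 (gauss a y)"
proof -
  have "smooth3 (quad a y)"
    unfolding quad_def[abs_def] sum_3 by (intro smooth3_add smooth3_scale smooth3_power smooth3_shift_coord)
  from smooth3_compose[OF smooth1_exp smooth3_scale[OF this, of "-1"]] show ?thesis
    by (simp add: gauss_def[abs_def])
qed

lemma gauss_pderiv3: "pderiv3 i (gauss a y) x = (- 2 * a i * (x $ i - y $ i)) * gauss a y x"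
proof -
  have d: "((\<lambda>x. (x $ j - y $ j)\<^sup>2) has_derivative (\<lambda>h. 2 * (x $ j - y $ j) * h $ j)) (at x)" for j
  proof -
    have "((\<lambda>x::R3. x $ j - y $ j) has_derivative (\<lambda>h. h $ j - 0)) (at x)"
      by (intro has_derivative_diff has_derivative_const bounded_linear_imp_has_derivative bounded_linear_vec_nth)
    from has_derivative_power[OF this, of 2] show ?thesis by (simp add: mult_ac)
  qed
  have "(quad a y has_derivative (\<lambda>h. \<Sum>j\<in>UNIV. a j * (2 * (x $ j - y $ j) * h $ j))) (at x)"
    unfolding quad_def[abs_def] by (intro has_derivative_sum has_derivative_mult_right d)
  then have "(gauss a y has_derivative (\<lambda>h. - (\<Sum>j\<in>UNIV. a j * (2 * (x $ j - y $ j) * h $ j)) * exp (- quad a y x))) (at x)"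
    unfolding gauss_def[abs_def] by (intro has_derivative_exp has_derivative_minus)
  from pderiv3_eq[OF this, of i] show ?thesis
    by (simp add: axis_def gauss_def if_distrib[of "(*) _"] sum.delta cong: if_cong)
qed

lemma gauss_pderiv3_2:
  "pderiv3 i (pderiv3 i (gauss a y)) x = (4 * (a i)\<^sup>2 * (x $ i - y $ i)\<^sup>2 - 2 * a i) * gauss a y x"
proof -
  define P where "P x = - 2 * a i * (x $ i - y $ i)" for x :: R3
  have sP: "smooth3 P" unfolding P_def[abs_def] by (rule smooth3_scale[OF smooth3_shift_coord])
  have eq: "pderiv3 i (gauss a y) = (\<lambda>x. P x * gauss a y x)"
    by (simp add: gauss_pderiv3 P_def fun_eq_iff)
  have "pderiv3 i P = (\<lambda>x. - 2 * a i * (1 - 0))" unfolding P_def[abs_def]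
    using pderiv3_scale[OF smooth3_shift_coord, of i "- 2 * a i" i "y $ i"]
      pderiv3_diff[OF smooth3_coord smooth3_const, of i i "y $ i"]
    by (simp add: pderiv3_coord pderiv3_const)
  then have "pderiv3 i (\<lambda>x. P x * gauss a y x) x = P x * (P x * gauss a y x) + (- 2 * a i) * gauss a y x"
    using fun_cong[OF pderiv3_mult[OF sP smooth3_gauss], of i a y x] by (simp add: eq)
  then show ?thesis unfolding eq by (simp add: P_def algebra_simps power2_eq_square)
qed

lemma smooth3_cutgauss_arg: "smooth3 (\<lambda>x. (gauss a y x - c) / k)"
  using smooth3_scale[OF smooth3_diff[OF smooth3_gauss smooth3_const], of "1/k" a y c] by simp

lemma pderiv3_cutgauss_arg: "pderiv3 i (\<lambda>x. (gauss a y x - c) / k) = (\<lambda>x. pderiv3 i (gauss a y) x / k)"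
  using pderiv3_scale[OF smooth3_diff[OF smooth3_gauss smooth3_const], of i "1/k" a y c]
    pderiv3_diff[OF smooth3_gauss smooth3_const, of i a y c]
  by (simp add: pderiv3_const)

text \<open>Convexity of \<open>theta\<close> gives \<open>\<Delta>(\<theta>(h)) \<ge> \<theta>'(h) \<Delta>h\<close>.\<close>
lemma lap_cutgauss:
  assumes k: "0 < k"
  shows "theta' ((gauss a y x - c) / k) * gauss a y x * (\<Sum>i\<in>UNIV. 4 * (a i)\<^sup>2 * (x $ i - y $ i)\<^sup>2 - 2 * a i) \<le> lap (cutgauss a y c k) x"
    "gauss a y x \<le> c \<Longrightarrow> lap (cutgauss a y c k) x = 0"
proof -
  let ?s = "\<lambda>x. (gauss a y x - c) / k"
  have s': "smooth1 theta'" unfolding theta'_def by (rule smooth1_flat)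
  have 1: "pderiv3 i (cutgauss a y c k) = (\<lambda>x. theta' (?s x) * pderiv3 i (gauss a y) x)" for i
    unfolding cutgauss_def[abs_def]
    using pderiv3_scale[OF smooth3_compose[OF smooth1_theta smooth3_cutgauss_arg], of i k a y c k] k
      pderiv3_compose[OF theta_deriv smooth3_cutgauss_arg, of i a y c k]
    by (simp add: pderiv3_cutgauss_arg)
  have 2: "pderiv3 i (pderiv3 i (cutgauss a y c k)) x
      = theta' (?s x) * pderiv3 i (pderiv3 i (gauss a y)) x + theta'' (?s x) / k * (pderiv3 i (gauss a y) x)\<^sup>2" for i
    unfolding 1
    using pderiv3_mult[OF smooth3_compose[OF s' smooth3_cutgauss_arg] smooth3_pderiv3[OF smooth3_gauss], of i a y c k i a y]
      pderiv3_compose[OF theta'_deriv smooth3_cutgauss_arg, of i a y c k]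
    by (simp add: pderiv3_cutgauss_arg power2_eq_square)
  have "theta' (?s x) * gauss a y x * (\<Sum>i\<in>UNIV. 4 * (a i)\<^sup>2 * (x $ i - y $ i)\<^sup>2 - 2 * a i)
      = (\<Sum>i\<in>UNIV. theta' (?s x) * pderiv3 i (pderiv3 i (gauss a y)) x)"
    by (simp add: gauss_pderiv3_2 sum_distrib_left mult_ac)
  also have "\<dots> \<le> lap (cutgauss a y c k) x"
    unfolding lap_def 2 using k theta_props(4) by (intro sum_mono) (simp add: divide_nonneg_pos)
  finally show "theta' (?s x) * gauss a y x * (\<Sum>i\<in>UNIV. 4 * (a i)\<^sup>2 * (x $ i - y $ i)\<^sup>2 - 2 * a i) \<le> lap (cutgauss a y c k) x" .
  assume "gauss a y x \<le> c"
  then have "?s x \<le> 0" using k by (simp add: divide_nonpos_pos)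
  then show "lap (cutgauss a y c k) x = 0"
    unfolding lap_def 2 by (simp add: theta'_def theta''_def flat_def)
qed

lemma quad_ge:
  assumes "\<And>i. m \<le> a i" shows "m * (norm (x - y))\<^sup>2 \<le> quad a y x"
  unfolding quad_def norm_R3 using assms by (simp add: sum_3 distrib_left add_mono mult_right_mono)

lemma cutgauss_test:
  assumes k: "0 < k" and c: "0 < c" and m: "0 < m" "\<And>i. m \<le> a i"
  shows "test_fun UNIV (cutgauss a y c k)"
proof (rule test_funI[of _ "cball y (sqrt (\<bar>ln c\<bar> / m))"])
  show "smooth3 (cutgauss a y c k)" unfolding cutgauss_def[abs_def]
    by (intro smooth3_scale smooth3_compose[OF smooth1_theta smooth3_cutgauss_arg])
  fix x assume "x \<notin> cball y (sqrt (\<bar>ln c\<bar> / m))"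
  then have "sqrt (\<bar>ln c\<bar> / m) < norm (x - y)" by (simp add: dist_norm norm_minus_commute)
  then have "(sqrt (\<bar>ln c\<bar> / m))\<^sup>2 < (norm (x - y))\<^sup>2" using m by (intro power_strict_mono) auto
  then have "\<bar>ln c\<bar> / m < (norm (x - y))\<^sup>2" using m by simp
  then have "\<bar>ln c\<bar> < m * (norm (x - y))\<^sup>2" using m by (simp add: field_simps)
  also have "\<dots> \<le> quad a y x" by (rule quad_ge[OF m(2)])
  finally have "- quad a y x \<le> ln c" by linarith
  then have "gauss a y x \<le> exp (ln c)" unfolding gauss_def by (simp only: exp_le_cancel_iff)
  then have "(gauss a y x - c) / k \<le> 0" using c k by (simp add: divide_nonpos_pos)
  then show "cutgauss a y c k x = 0" unfolding cutgauss_def by (simp add: theta_props(1))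
qed auto

text \<open>The last item carries the precise comparison: with
  \<open>s = (gauss a y x - c) / k\<close> it is the relation between \<open>s theta' s\<close> and
  \<open>theta s\<close>, where \<open>1 / s = k / (gauss a y x - c)\<close>.\<close>

lemma cutgauss_props:
  assumes k: "0 < k" and c: "0 < c"
  shows "0 \<le> cutgauss a y c k x" "cutgauss a y c k x \<le> gauss a y x" "gauss a y x \<le> c \<Longrightarrow> cutgauss a y c k x = 0"
    "c < gauss a y x \<Longrightarrow> 0 < cutgauss a y c k x"
    "cutgauss a y c k x \<le> theta' ((gauss a y x - c) / k) * gauss a y x"
    "c + k \<le> gauss a y x \<Longrightarrow> (gauss a y x - c) / 3 \<le> cutgauss a y c k x"
    "c < gauss a y x \<Longrightarrow> theta' ((gauss a y x - c) / k) * (gauss a y x - c) = (1 + k / (gauss a y x - c)) * cutgauss a y c k x"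
proof -
  let ?s = "(gauss a y x - c) / k"
  have g0: "0 < gauss a y x" by (simp add: gauss_def)
  show "0 \<le> cutgauss a y c k x" unfolding cutgauss_def using k theta_props(3) by simp
  show z: "gauss a y x \<le> c \<Longrightarrow> cutgauss a y c k x = 0"
    unfolding cutgauss_def using k by (simp add: theta_props(1) divide_nonpos_pos)
  show "c < gauss a y x \<Longrightarrow> 0 < cutgauss a y c k x"
    unfolding cutgauss_def using k theta_props(2)[of ?s] by simp
  show "cutgauss a y c k x \<le> gauss a y x"
  proof (cases "gauss a y x \<le> c")
    case True
    then show ?thesis using z g0 by simp
  next
    case False
    then have "theta ?s \<le> ?s" using k by (intro theta_props(9)) simp
    then have "k * theta ?s \<le> k * ?s" using k by (intro mult_left_mono) auto
    then show ?thesis using k c by (simp add: cutgauss_def)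
  qed
  show "cutgauss a y c k x \<le> theta' ?s * gauss a y x"
  proof -
    have "k * theta ?s \<le> k * (?s * theta' ?s)" by (rule mult_left_mono[OF theta_props(8)]) (use k in simp)
    also have "\<dots> = theta' ?s * (gauss a y x - c)" using k by simp
    also have "\<dots> \<le> theta' ?s * gauss a y x" using c theta_props(5) by (intro mult_left_mono) auto
    finally show ?thesis by (simp add: cutgauss_def)
  qed
  show "c + k \<le> gauss a y x \<Longrightarrow> (gauss a y x - c) / 3 \<le> cutgauss a y c k x"
  proof -
    assume "c + k \<le> gauss a y x"
    then have "1 \<le> ?s" using k by (simp add: field_simps)
    then have "?s / 3 \<le> theta ?s" by (rule theta_props(11))
    then have "k * (?s / 3) \<le> k * theta ?s" using k by (intro mult_left_mono) auto
    then show ?thesis using k by (simp add: cutgauss_def)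
  qed
  show "c < gauss a y x \<Longrightarrow> theta' ?s * (gauss a y x - c) = (1 + k / (gauss a y x - c)) * cutgauss a y c k x"
  proof -
    assume "c < gauss a y x"
    then have s: "0 < gauss a y x - c" by simp
    then have "theta' ?s = (1/?s + 1/?s^2) * theta ?s" using k by (intro theta_props(10)) simp
    moreover have "T * s = (1 + k / s) * (k * \<theta>)" if "T = (1 / (s / k) + 1 / (s / k)^2) * \<theta>" "0 < s" for T s \<theta>
      using that k by (simp add: field_simps power2_eq_square)
    ultimately show ?thesis using s unfolding cutgauss_def by blast
  qed
qed

text \<open>Hopf's barrier \<open>exp(-\<alpha> |x-y|^2) - exp(-\<alpha> r^2)\<close>, passed
  through \<open>theta\<close> to become a test function on the whole space. Convexity of
  \<open>theta\<close> preserves the strict differential inequality in the annulus.\<close>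

lemma Hopf_subsolution:
  assumes r: "0 < r0" "r0 < r" and M: "0 \<le> M"
  obtains \<psi> where "test_fun UNIV \<psi>" "\<And>x. 0 \<le> \<psi> x" "\<And>x. x \<notin> ball y r \<Longrightarrow> \<psi> x = 0 \<and> lap \<psi> x = 0"
    "\<And>x. r0 \<le> dist y x \<Longrightarrow> dist y x < r \<Longrightarrow> - lap \<psi> x + M * \<psi> x < 0"
proof -
  \<comment> \<open>The Laplacian of the Gaussian is
    \<open>4 \<alpha>^2 |x-y|^2 - 6 \<alpha>\<close> times the Gaussian; this
    \<open>\<alpha>\<close> makes the factor exceed \<open>M\<close> at every distance of at least
    \<open>r0\<close>.\<close>
  define \<alpha> where "\<alpha> = (6 + M) / (4 * r0\<^sup>2) + 1"
  have \<alpha>1: "1 \<le> \<alpha>" using M by (simp add: \<alpha>_def)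
  then have \<alpha>: "0 < \<alpha>" by simp
  have big: "6 * \<alpha> + M < 4 * \<alpha>\<^sup>2 * r0\<^sup>2"
  proof -
    have "4 * \<alpha> * r0\<^sup>2 = 6 + M + 4 * r0\<^sup>2" unfolding \<alpha>_def using r by (simp add: field_simps)
    then have "6 + M < 4 * \<alpha> * r0\<^sup>2" using r by simp
    then have "\<alpha> * (6 + M) < \<alpha> * (4 * \<alpha> * r0\<^sup>2)" using \<alpha> by (intro mult_strict_left_mono)
    moreover have "1 * M \<le> \<alpha> * M" using \<alpha>1 M by (intro mult_right_mono)
    ultimately show ?thesis by (simp add: algebra_simps power2_eq_square)
  qed
  define c where "c = exp (- \<alpha> * r\<^sup>2)"
  let ?a = "\<lambda>i::3. \<alpha>"
  let ?\<psi> = "cutgauss ?a y c 1"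
  have c: "0 < c" by (simp add: c_def)
  have q: "quad ?a y x = \<alpha> * (norm (x - y))\<^sup>2" for x by (simp add: quad_def norm_R3 sum_3 distrib_left)
  have gc: "c < gauss ?a y x \<longleftrightarrow> dist y x < r" for x
  proof -
    have "c < gauss ?a y x \<longleftrightarrow> (norm (x - y))\<^sup>2 < r\<^sup>2" unfolding c_def gauss_def q using \<alpha> by simp
    also have "\<dots> \<longleftrightarrow> norm (x - y) < r"
      using r power_strict_mono[of "norm (x - y)" r 2] power_mono[of r "norm (x - y)" 2] by (meson less_imp_le norm_ge_zero not_le order_less_trans pos2)
    finally show ?thesis by (simp add: dist_norm norm_minus_commute)
  qed
  show ?thesis
  proof (rule that[of ?\<psi>])
    show "test_fun UNIV ?\<psi>" by (rule cutgauss_test[of _ _ \<alpha>]) (use c \<alpha> in auto)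
    show "0 \<le> ?\<psi> x" for x by (rule cutgauss_props(1)) (use c in auto)
    show "?\<psi> x = 0 \<and> lap ?\<psi> x = 0" if "x \<notin> ball y r" for x
      using cutgauss_props(3)[of 1 c ?a y x] lap_cutgauss(2)[of 1 ?a y x c] c gc[of x] that by auto
    fix x assume x: "r0 \<le> dist y x" "dist y x < r"
    let ?t = "theta' ((gauss ?a y x - c) / 1)"
    have g: "c < gauss ?a y x" using gc x by simp
    have t0: "0 < ?t" using g by (intro theta_props(7)) simp
    have r0x: "r0\<^sup>2 \<le> (norm (x - y))\<^sup>2" using x r by (intro power_mono) (auto simp: dist_norm norm_minus_commute)
    have s: "(\<Sum>i\<in>UNIV. 4 * (?a i)\<^sup>2 * (x $ i - y $ i)\<^sup>2 - 2 * ?a i) = 4 * \<alpha>\<^sup>2 * (norm (x - y))\<^sup>2 - 6 * \<alpha>"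
      by (simp add: sum_3 norm_R3 distrib_left)
    have "4 * \<alpha>\<^sup>2 * r0\<^sup>2 \<le> 4 * \<alpha>\<^sup>2 * (norm (x - y))\<^sup>2" using r0x by (intro mult_left_mono) auto
    then have "M < 4 * \<alpha>\<^sup>2 * (norm (x - y))\<^sup>2 - 6 * \<alpha>" using big by linarith
    moreover have tg: "0 < ?t * gauss ?a y x" using t0 g c by simp
    ultimately have "?t * gauss ?a y x * M < ?t * gauss ?a y x * (4 * \<alpha>\<^sup>2 * (norm (x - y))\<^sup>2 - 6 * \<alpha>)"
      by (intro mult_strict_left_mono)
    also have "\<dots> \<le> lap ?\<psi> x" using lap_cutgauss(1)[of 1 ?a y x c] unfolding s by simp
    finally have "?t * gauss ?a y x * M < lap ?\<psi> x" .
    moreover have "M * ?\<psi> x \<le> M * (?t * gauss ?a y x)"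
      using cutgauss_props(5)[of 1 c ?a y x] c M by (intro mult_left_mono) auto
    ultimately show "- lap ?\<psi> x + M * ?\<psi> x < 0" by (simp add: mult.commute)
  qed
qed

text \<open>The exponent 1/2 belongs to the oscillator ground state \<open>exp(-t^2/2)\<close> in
  each confined direction; \<open>\<eta>\<close> is a free small parameter along x_3.\<close>

definition osc :: "real \<Rightarrow> 3 \<Rightarrow> real" where
  "osc \<eta> i = (if i = 3 then \<eta> else 1/2)"

lemma osc_simps: "osc \<eta> 1 = 1/2" "osc \<eta> 2 = 1/2" "osc \<eta> 3 = \<eta>"
  by (simp_all add: osc_def)

text \<open>The ground state of \<open>-\<Delta> + V\<close> in \<open>(x\<^sub>1,x\<^sub>2)\<close>, times a slowly decaying Gaussian in \<open>x\<^sub>3\<close>, cut off by \<open>theta\<close>.\<close>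
lemma oscillator_subsolution:
  assumes \<eta>: "0 < \<eta>" "\<eta> \<le> 1" and b: "0 < b"
  obtains \<psi> where "test_fun UNIV \<psi>" "\<And>x. 0 \<le> \<psi> x" "\<And>x. \<psi> x \<le> gauss (osc \<eta>) 0 x"
    "\<And>x. - lap \<psi> x + V x * \<psi> x \<le> (2 + 3 * \<eta>) * \<psi> x"
    "\<And>x. b \<le> gauss (osc \<eta>) 0 x \<Longrightarrow> gauss (osc \<eta>) 0 x / 4 \<le> \<psi> x" "0 < \<psi> 0"
proof -
  let ?h = "gauss (osc \<eta>) 0"
  \<comment> \<open>An upper bound for the exponent on the region
    \<open>W x < 2 + 2 * \<eta>\<close>, the one where replacing the Gaussian by its cut-off spoils
    the inequality. There the Gaussian is at least \<open>exp (- q0)\<close>.\<close>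
  define q0 where "q0 = (1 + \<eta>) + (1 + \<eta>) / (2 * \<eta>)"
  \<comment> \<open>Chosen so that \<open>4 * e * (2 + 2 * \<eta>) = \<eta>\<close>: the relative
    error \<open>4 * e\<close> of the cut-off then fits between \<open>2 + 2 * \<eta>\<close> and
    \<open>2 + 3 * \<eta>\<close>.\<close>
  define e where "e = \<eta> / (8 * (1 + \<eta>))"
  have e: "0 < e" "e \<le> 1/8" using \<eta> by (auto simp: e_def field_simps)
  \<comment> \<open>The level is at most a fraction \<open>e\<close> of \<open>b\<close> and of
    \<open>exp (- q0)\<close>: the first preserves a fixed share of the Gaussian where it is at
    least \<open>b\<close>, the second controls the error in the critical region.\<close>
  define c where "c = e * min b (exp (- q0))"
  have c: "0 < c" using e b by (simp add: c_def)
  have cb: "c \<le> e * b" "c \<le> e * exp (- q0)" using e by (auto simp: c_def intro!: mult_left_mono)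
  have q00: "0 \<le> q0" unfolding q0_def using \<eta> by (intro add_nonneg_nonneg divide_nonneg_nonneg) auto
  have quad: "quad (osc \<eta>) 0 x = V x / 2 + \<eta> * (x $ 3)\<^sup>2" for x
    by (simp add: quad_def sum_3 osc_simps V_def add_divide_distrib)
  define W where "W x = V x + 4 * \<eta>\<^sup>2 * (x $ 3)\<^sup>2" for x :: R3
  have S: "(\<Sum>i\<in>UNIV. 4 * (osc \<eta> i)\<^sup>2 * (x $ i - 0 $ i)\<^sup>2 - 2 * osc \<eta> i) = W x - (2 + 2 * \<eta>)" for x
    by (simp add: sum_3 osc_simps W_def V_def power_divide)
  have WV: "V x \<le> W x" for x by (simp add: W_def)
  let ?\<psi> = "cutgauss (osc \<eta>) 0 c c"
  note props = cutgauss_props[OF c c, of "osc \<eta>" 0]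
  have main: "- lap ?\<psi> x + V x * ?\<psi> x \<le> (2 + 3 * \<eta>) * ?\<psi> x" for x
  proof (cases "?h x \<le> c")
    case True
    then show ?thesis using props(3)[of x] lap_cutgauss(2)[OF c, of "osc \<eta>" 0 x c] by simp
  next
    case False
    then have g: "c < ?h x" by simp
    let ?t = "theta' ((?h x - c) / c)"
    have P0: "0 \<le> ?\<psi> x" by (rule props(1))
    have "?t * ?h x * (W x - (2 + 2 * \<eta>)) \<le> lap ?\<psi> x"
      using lap_cutgauss(1)[OF c, of "osc \<eta>" 0 x c] unfolding S .
    then have l: "- lap ?\<psi> x \<le> ?t * ?h x * (2 + 2 * \<eta> - W x)" by (simp add: algebra_simps)
    have "?t * ?h x * (2 + 2 * \<eta> - W x) \<le> (2 + 3 * \<eta> - W x) * ?\<psi> x"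
    \<comment> \<open>Where \<open>W\<close> is large the coefficient is nonpositive and the
      convexity bound \<open>props(5)\<close> points the right way; elsewhere the exact relation
      \<open>props(7)\<close> is needed.\<close>
    proof (cases "2 + 2 * \<eta> \<le> W x")
      case True
      have "?t * ?h x * (2 + 2 * \<eta> - W x) \<le> ?\<psi> x * (2 + 2 * \<eta> - W x)"
        using True props(5)[of x] by (intro mult_right_mono_neg) auto
      also have "\<dots> \<le> ?\<psi> x * (2 + 3 * \<eta> - W x)" using \<eta> P0 by (intro mult_left_mono) auto
      finally show ?thesis by (simp add: mult.commute)
    next
      case False
      then have Wl: "W x < 2 + 2 * \<eta>" by simp
      have W0: "0 \<le> W x" using V_nonneg[of x] by (simp add: W_def)
      have "quad (osc \<eta>) 0 x \<le> q0"
      proof -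
        have "V x \<le> 2 + 2 * \<eta>" using WV[of x] Wl by linarith
        moreover have "4 * \<eta>\<^sup>2 * (x $ 3)\<^sup>2 \<le> 2 + 2 * \<eta>" using Wl V_nonneg[of x] by (simp add: W_def)
        then have "\<eta> * (x $ 3)\<^sup>2 \<le> (1 + \<eta>) / (2 * \<eta>)" using \<eta> by (simp add: field_simps power2_eq_square)
        ultimately show ?thesis unfolding quad q0_def by linarith
      qed
      then have "exp (- q0) \<le> ?h x" by (simp add: gauss_def)
      then have ce: "c \<le> e * ?h x" using cb(2) e by (meson mult_left_mono less_imp_le order_trans)
      define s where "s = ?h x - c"
      have s: "0 < s" using g by (simp add: s_def)
      have h: "?h x = s + c" by (simp add: s_def)
      have sc: "c * (1 - e) \<le> e * s" using ce unfolding h by (simp add: algebra_simps)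
      \<comment> \<open>With \<open>k = c\<close>, one factor \<open>1 + \<rho>\<close> comes from
        \<open>theta'\<close> and another from writing the Gaussian as
        \<open>s * (1 + \<rho>)\<close>.\<close>
      define \<rho> where "\<rho> = c / s"
      have \<rho>: "0 \<le> \<rho>" "\<rho> * (1 - e) \<le> e" using s c sc by (auto simp: \<rho>_def field_simps)
      have \<rho>2: "(1 + \<rho>) * (1 + \<rho>) \<le> 1 + 4 * e"
      proof -
        have "(1 + \<rho>) * (1 - e) \<le> 1" using \<rho>(2) by (simp add: algebra_simps)
        then have "1 + \<rho> \<le> 1 / (1 - e)" using e by (simp add: field_simps)
        then have "(1 + \<rho>) * (1 + \<rho>) \<le> (1 / (1 - e)) * (1 / (1 - e))" using \<rho> e by (intro mult_mono) auto
        also have "\<dots> \<le> 1 + 4 * e"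
        proof -
          have "(1 + 4 * e) * ((1 - e) * (1 - e)) = 1 + e * (2 - 7 * e + 4 * e\<^sup>2)" by (simp add: algebra_simps power2_eq_square power3_eq_cube)
          moreover have "0 \<le> e * (2 - 7 * e + 4 * e\<^sup>2)" using e by (intro mult_nonneg_nonneg) (auto simp: add_nonneg_nonneg)
          ultimately have "1 \<le> (1 + 4 * e) * ((1 - e) * (1 - e))" by linarith
          then show ?thesis using e by (simp add: divide_le_eq)
        qed
        finally show ?thesis .
      qed
      have "?t * ?h x = (1 + \<rho>) * (1 + \<rho>) * ?\<psi> x"
      proof -
        have "?h x = s * (1 + \<rho>)" using s by (simp add: h \<rho>_def field_simps)
        then have "?t * ?h x = (?t * s) * (1 + \<rho>)" by simp
        also have "?t * s = (1 + \<rho>) * ?\<psi> x" using props(7)[OF g] by (simp add: s_def \<rho>_def)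
        finally show ?thesis by simp
      qed
      then have "?t * ?h x * (2 + 2 * \<eta> - W x) = (1 + \<rho>) * (1 + \<rho>) * (?\<psi> x * (2 + 2 * \<eta> - W x))" by simp
      also have "\<dots> \<le> (1 + 4 * e) * (?\<psi> x * (2 + 2 * \<eta> - W x))"
        using Wl P0 by (intro mult_right_mono \<rho>2) auto
      also have "\<dots> = ?\<psi> x * ((2 + 2 * \<eta> - W x) + 4 * e * (2 + 2 * \<eta> - W x))" by (simp add: algebra_simps)
      also have "\<dots> \<le> ?\<psi> x * ((2 + 2 * \<eta> - W x) + \<eta>)"
      proof -
        have "4 * e * (2 + 2 * \<eta> - W x) \<le> 4 * e * (2 + 2 * \<eta>)" using e W0 by (intro mult_left_mono) auto
        also have "\<dots> = \<eta>" using \<eta> by (simp add: e_def field_simps)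
        finally show ?thesis using P0 by (intro mult_left_mono) auto
      qed
      finally show ?thesis by (simp add: algebra_simps)
    qed
    moreover have "V x * ?\<psi> x \<le> W x * ?\<psi> x" using WV P0 by (intro mult_right_mono)
    ultimately show ?thesis using l by (simp add: algebra_simps)
  qed
  show ?thesis
  proof (rule that[of ?\<psi>])
    show "test_fun UNIV ?\<psi>"
      by (rule cutgauss_test[of _ _ "min \<eta> (1/2)"]) (use c \<eta> in \<open>auto simp: osc_def\<close>)
    show "0 < ?\<psi> 0"
    proof (rule props(4))
      have "c \<le> e * exp (- q0)" by (rule cb)
      also have "\<dots> \<le> 1/8 * 1" using e \<eta> by (intro mult_mono) (auto simp: q00)
      finally have "c < 1" by simp
      then show "c < ?h 0" by (simp add: gauss_def quad_def)
    qed
    fix x assume bx: "b \<le> ?h x"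
    have "c \<le> e * ?h x" using cb(1) e bx by (meson mult_left_mono less_imp_le order_trans)
    also have "\<dots> \<le> 1/8 * ?h x" using e bx b by (intro mult_right_mono) auto
    finally have c8: "c \<le> ?h x / 8" by simp
    have h0: "0 < ?h x" using b bx by linarith
    have "(?h x - c) / 3 \<le> ?\<psi> x" by (rule props(6)) (use c8 h0 in linarith)
    then show "?h x / 4 \<le> ?\<psi> x" using c8 h0 by argo
  qed (use props main in auto)
qed

text \<open>For \<open>\<eta> \<le> 1/2\<close> all exponents are at least \<open>\<eta>\<close>, so
  a dilation by \<open>sqrt \<eta>\<close> gives a comparison with a fixed Gaussian. What matters is
  the power: the norm is of order at most \<open>\<eta>^(-3/4)\<close>, which is beaten by a factor
  \<open>\<eta>\<close>.\<close>

lemma gauss_sqint_bound: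
  obtains G where "0 \<le> G" "\<And>\<eta>. 0 < \<eta> \<Longrightarrow> \<eta> \<le> 1/2 \<Longrightarrow> L2 (gauss (osc \<eta>) 0) \<and> sqint (gauss (osc \<eta>) 0) \<le> G / (sqrt \<eta>) ^ 3"
proof -
  define f where "f x = exp (- 2 * (norm x)\<^sup>2)" for x :: R3
  \<comment> \<open>A one-dimensional majorant with an elementary primitive:
    \<open>exp (-2 t^2) \<le> 1 / (1 + t^2)\<close>, whose integral is \<open>pi\<close>.\<close>
  define g where "g x = 1 / (1 + x\<^sup>2)" for x :: real
  have fm [measurable]: "f \<in> borel_measurable borel" unfolding f_def by measurable
  have gm [measurable]: "g \<in> borel_measurable borel" unfolding g_def by measurable
  have half: "(\<integral>\<^sup>+x. ennreal (g x) * indicator {0..} x \<partial>lborel) = ennreal (pi / 2 - arctan 0)"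
    by (rule nn_integral_FTC_atLeast)
       (auto simp: g_def add_pos_nonneg inverse_eq_divide intro!: derivative_eq_intros tendsto_arctan_at_top[THEN filterlim_compose] filterlim_ident add_nonneg_nonneg)
  have half': "(\<integral>\<^sup>+x. ennreal (g x) * indicator {0..} (-x) \<partial>lborel) = ennreal (pi / 2)"
    using nn_integral_real_affine[of "\<lambda>x. ennreal (g x) * indicator {0..} x" "-1" 0] half by (simp add: g_def)
  have G: "(\<integral>\<^sup>+x. ennreal (g x) \<partial>lborel) \<le> ennreal pi"
  proof -
    have "(\<integral>\<^sup>+x. ennreal (g x) \<partial>lborel) \<le> (\<integral>\<^sup>+x. ennreal (g x) * indicator {0..} x + ennreal (g x) * indicator {0..} (-x) \<partial>lborel)"
      by (intro nn_integral_mono) (auto simp: indicator_def)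
    also have "\<dots> = ennreal (pi / 2) + ennreal (pi / 2)" using half half' by (simp add: nn_integral_add)
    also have "\<dots> = ennreal pi" by (subst ennreal_plus[symmetric]) auto
    finally show ?thesis .
  qed
  have fg: "ennreal (f (vec3 a b c)) \<le> ennreal (g a) * (ennreal (g b) * ennreal (g c))" for a b c
  proof -
    have e: "exp (- 2 * t\<^sup>2) \<le> g t" for t
    proof -
      have "1 + t\<^sup>2 \<le> exp (t\<^sup>2)" by (rule exp_ge_add_one_self)
      also have "\<dots> \<le> exp (2 * t\<^sup>2)" by simp
      finally have "1 / exp (2 * t\<^sup>2) \<le> 1 / (1 + t\<^sup>2)" by (intro divide_left_mono) (auto simp: add_pos_nonneg)
      then show ?thesis by (simp add: g_def exp_minus divide_inverse)
    qed
    have "f (vec3 a b c) = exp (- 2 * a\<^sup>2) * (exp (- 2 * b\<^sup>2) * exp (- 2 * c\<^sup>2))"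
      by (simp add: f_def norm_R3 exp_add[symmetric] algebra_simps)
    also have "\<dots> \<le> g a * (g b * g c)" by (intro mult_mono e mult_nonneg_nonneg) (auto simp: g_def add_nonneg_nonneg)
    finally have "ennreal (f (vec3 a b c)) \<le> ennreal (g a * (g b * g c))" by (rule ennreal_leI)
    also have "\<dots> = ennreal (g a) * (ennreal (g b) * ennreal (g c))"
    proof -
      have "0 \<le> g t" for t by (simp add: g_def add_nonneg_nonneg)
      then show ?thesis by (simp add: ennreal_mult)
    qed
    finally show ?thesis .
  qed
  have "(\<integral>\<^sup>+x. ennreal (f x) \<partial>lborel) \<le> (\<integral>\<^sup>+a. \<integral>\<^sup>+b. \<integral>\<^sup>+c. ennreal (g a) * (ennreal (g b) * ennreal (g c)) \<partial>lborel \<partial>lborel \<partial>lborel)"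
    by (subst nn_integral_R3) (auto intro!: nn_integral_mono fg)
  also have "\<dots> = (\<integral>\<^sup>+x. ennreal (g x) \<partial>lborel) * ((\<integral>\<^sup>+x. ennreal (g x) \<partial>lborel) * (\<integral>\<^sup>+x. ennreal (g x) \<partial>lborel))"
    by (simp add: nn_integral_cmult nn_integral_multc)
  also have "\<dots> \<le> ennreal pi * (ennreal pi * ennreal pi)" by (intro mult_mono G) auto
  also have "\<dots> < \<infinity>" by (simp add: ennreal_mult_less_top)
  finally have fi: "integrable lborel f"
    by (intro integrableI_bounded) (auto simp: f_def)
  define I where "I = (\<integral>x. f x \<partial>lborel)"
  have I0: "0 \<le> I" unfolding I_def f_def by simp
  show ?thesis
  proof (rule that[OF I0])
    fix \<eta> :: real assume \<eta>: "0 < \<eta>" "\<eta> \<le> 1/2"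
    have s: "0 < sqrt \<eta>" using \<eta> by simp
    have sc: "integrable lborel (\<lambda>x. f (sqrt \<eta> *\<^sub>R x))" "(\<integral>x. f (sqrt \<eta> *\<^sub>R x) \<partial>lborel) = I / (sqrt \<eta>) ^ 3"
      using integral_affine3[of "sqrt \<eta>" f 0] s fi by (auto simp: I_def)
    have gm: "gauss (osc \<eta>) 0 \<in> borel_measurable borel" by (rule smooth3_measurable[OF smooth3_gauss])
    have le: "(gauss (osc \<eta>) 0 x)\<^sup>2 \<le> f (sqrt \<eta> *\<^sub>R x)" for x
    proof -
      have "\<eta> * (norm (x - 0))\<^sup>2 \<le> quad (osc \<eta>) 0 x" by (rule quad_ge) (use \<eta> in \<open>simp add: osc_def\<close>)
      then have "exp (- 2 * quad (osc \<eta>) 0 x) \<le> exp (- 2 * (\<eta> * (norm x)\<^sup>2))" by simp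
      moreover have "(gauss (osc \<eta>) 0 x)\<^sup>2 = exp (- 2 * quad (osc \<eta>) 0 x)"
        by (simp add: gauss_def power2_eq_square exp_add[symmetric])
      ultimately show ?thesis using \<eta> by (simp add: f_def power_mult_distrib)
    qed
    have L: "L2 (gauss (osc \<eta>) 0)" by (rule L2_bound[OF gm sc(1)]) (use le in auto)
    have "sqint (gauss (osc \<eta>) 0) \<le> (\<integral>x. f (sqrt \<eta> *\<^sub>R x) \<partial>lborel)"
      unfolding sqint_def by (rule integral_mono[OF L2_sq[OF L] sc(1) le])
    then show "L2 (gauss (osc \<eta>) 0) \<and> sqint (gauss (osc \<eta>) 0) \<le> I / (sqrt \<eta>) ^ 3" using L sc(2) by simp
  qed
qed

section \<open>Compactness of coordinatewise decreasing sequences\<close>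

text \<open>Off the coordinate planes, a null set, monotonicity compares \<open>u x\<close> with the
  values on a box of positive volume.\<close>

definition nondeg :: "R3 \<Rightarrow> bool" where "nondeg x \<longleftrightarrow> (\<forall>i. x $ i \<noteq> 0)"

lemma AE_nondeg: "AE x in lborel. nondeg x"
proof -
  have "AE x in lborel. (x::R3) $ i \<noteq> 0" for i
  proof -
    have "{x::R3. x $ i = 0} \<in> null_sets lebesgue"
      using negligible_hyperplane[of "axis i 1 :: R3" 0] by (simp add: negligible_iff_null_sets inner_axis' axis_eq_0_iff)
    then have "AE x in lebesgue. x \<notin> {x::R3. x $ i = 0}" by (rule AE_not_in)
    then show ?thesis by (simp add: AE_completion_iff)
  qed
  from this[of 1] this[of 2] this[of 3] show ?thesis
    by eventually_elim (auto simp: nondeg_def forall_3)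
qed

text \<open>The common form in which the two monotonicity hypotheses are used; comparing in both
  directions gives evenness in each coordinate.\<close>

definition coord_decr :: "(R3 \<Rightarrow> real) \<Rightarrow> bool" where
  "coord_decr u \<longleftrightarrow> (\<forall>x y. (\<forall>i. \<bar>x $ i\<bar> \<le> \<bar>y $ i\<bar>) \<longrightarrow> u y \<le> u x)"

lemma coord_decrD: "coord_decr u \<Longrightarrow> (\<And>i. \<bar>x $ i\<bar> \<le> \<bar>y $ i\<bar>) \<Longrightarrow> u y \<le> u x"
  by (auto simp: coord_decr_def)

text \<open>A nonempty open set is not null. Combined with monotonicity this upgrades statements
  from almost every point to every nondegenerate one.\<close>

lemma AE_obtain_open:
  assumes P: "AE x in lborel. P x" and S: "open S" "S \<noteq> {}"
  obtains x :: R3 where "x \<in> S" "P x"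
proof (rule ccontr)
  assume "\<not> thesis"
  then have no: "\<not> (x \<in> S \<and> P x)" for x using that by blast
  have "AE x in lborel. x \<notin> S" using P by eventually_elim (use no in blast)
  then have "S \<in> null_sets lborel" using S(1) AE_iff_null_sets[of S lborel] by simp
  then have "negligible S" by (auto simp: negligible_iff_null_sets null_sets_def)
  then show False using open_not_negligible[OF S] by blast
qed

lemma integral_pos_open:
  fixes f :: "R3 \<Rightarrow> real"
  assumes i: "integrable lborel f" and 0: "\<And>x. 0 \<le> f x" and S: "open S" "S \<noteq> {}" and pos: "\<And>x. x \<in> S \<Longrightarrow> 0 < f x"
  shows "0 < (\<integral>x. f x \<partial>lborel)"
proof (rule ccontr)
  assume "\<not> 0 < (\<integral>x. f x \<partial>lborel)"
  then have "(\<integral>x. f x \<partial>lborel) = 0"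
    using Bochner_Integration.integral_nonneg[of lborel f] 0 by fastforce
  then have "AE x in lborel. f x = 0" using integral_nonneg_eq_0_iff_AE[OF i] 0 by auto
  then obtain x where "x \<in> S" "f x = 0" by (rule AE_obtain_open[OF _ S])
  then show False using pos[of x] by simp
qed

definition box_within :: "R3 \<Rightarrow> R3 set" where
  "box_within x = {y. \<forall>i. \<bar>y $ i\<bar> < \<bar>x $ i\<bar>}"

lemma box_within_coord_decr: "coord_decr u \<Longrightarrow> y \<in> box_within x \<Longrightarrow> u x \<le> u y"
  by (rule coord_decrD) (auto simp: box_within_def intro: less_imp_le)

lemma box_within:
  assumes "nondeg x"
  shows "open (box_within x)" "box_within x \<noteq> {}" "box_within x \<subseteq> cball 0 (norm x)"
    "box_within x \<in> sets borel" "emeasure lborel (box_within x) < \<infinity>" "0 < measure lborel (box_within x)"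
proof -
  have "open {y::R3. \<bar>y $ i\<bar> < \<bar>x $ i\<bar>}" for i by (intro open_Collect_less continuous_intros)
  then show op: "open (box_within x)" by (simp add: box_within_def forall_3 Collect_conj_eq open_Int)
  have "0 \<in> box_within x" using assms by (simp add: box_within_def nondeg_def)
  then show ne: "box_within x \<noteq> {}" by blast
  show sub: "box_within x \<subseteq> cball 0 (norm x)"
  proof
    fix y assume "y \<in> box_within x"
    then have "norm y \<le> norm x" by (intro norm_le_componentwise_cart) (auto simp: box_within_def intro: less_imp_le)
    then show "y \<in> cball 0 (norm x)" by simp
  qed
  show Bm: "box_within x \<in> sets borel" using op by simp
  show fin: "emeasure lborel (box_within x) < \<infinity>"
    by (rule emeasure_bounded_finite) (use sub bounded_subset bounded_cball in blast)
  have "integrable lborel (\<lambda>y. indicator (box_within x) y :: real)" using Bm fin by simp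
  then have "0 < (\<integral>y. indicator (box_within x) y \<partial>lborel :: real)"
    by (rule integral_pos_open[OF _ _ op ne]) (auto simp: indicator_def)
  then show "0 < measure lborel (box_within x)" using Bm by simp
qed

text \<open>An estimate of radial lemma type: on the whole box spanned by \<open>x\<close> the
  function is at least \<open>u x\<close>, so the mass controls the value.\<close>

lemma coord_decr_bound:
  assumes x: "nondeg x" and u: "coord_decr u" "\<And>x. 0 \<le> u x" "L2 u"
  shows "(u x)\<^sup>2 * measure lborel (box_within x) \<le> sqint u"
proof -
  note B = box_within(4,5)[OF x]
  have "(\<integral>y. (u x)\<^sup>2 * indicator (box_within x) y \<partial>lborel) \<le> (\<integral>y. (u y)\<^sup>2 \<partial>lborel)"
  proof (rule integral_mono)
    show "integrable lborel (\<lambda>y. (u x)\<^sup>2 * indicator (box_within x) y)" using B by simp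
    show "(u x)\<^sup>2 * indicator (box_within x) y \<le> (u y)\<^sup>2" for y
      using box_within_coord_decr[OF u(1), of y x] u(2)[of x] by (cases "y \<in> box_within x") (simp_all add: power_mono)
  qed (rule L2_sq[OF u(3)])
  then show ?thesis using B by (simp add: sqint_def)
qed

text \<open>Points with rational coordinates are countable, and at each of them the values stay in a
  compact interval, so a diagonal subsequence converges at all of them.\<close>

lemma Helly_subsequence:
  fixes w :: "nat \<Rightarrow> R3 \<Rightarrow> real"
  assumes w: "\<And>n x. 0 \<le> w n x" "\<And>n x. w n x \<le> 1"
  shows "\<exists>r. strict_mono r \<and> (\<forall>q. (\<forall>i. q $ i \<in> \<rat>) \<longrightarrow> convergent (\<lambda>n. w (r n) q))"
proof -
  define Q where "Q = {q :: R3. \<forall>i. q $ i \<in> \<rat>}"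
  have "Q \<subseteq> (\<lambda>(a, b, c). vec3 a b c) ` (\<rat> \<times> \<rat> \<times> \<rat>)"
  proof
    fix q assume "q \<in> Q"
    then show "q \<in> (\<lambda>(a, b, c). vec3 a b c) ` (\<rat> \<times> \<rat> \<times> \<rat>)"
      by (intro image_eqI[of _ _ "(q $ 1, q $ 2, q $ 3)"]) (auto simp: Q_def vec3_eta)
  qed
  then have cQ: "countable Q" using countable_subset countable_image countable_SIGMA countable_rat by metis
  have "0 \<in> Q" by (simp add: Q_def)
  then have Qne: "Q \<noteq> {}" by auto
  define e where "e = from_nat_into Q"
  have e: "range e = Q" unfolding e_def by (rule range_from_nat_into[OF Qne cQ])
  interpret subseqs "\<lambda>k s. convergent (\<lambda>n. w (s n) (e k))"
  proof
    fix k and s :: "nat \<Rightarrow> nat" assume "strict_mono s"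
    have "bounded (range (\<lambda>n. w (s n) (e k)))"
      unfolding bounded_iff using w by (intro exI[of _ 1]) auto
    then obtain l r where "strict_mono r" "((\<lambda>n. w (s n) (e k)) \<circ> r) \<longlonglongrightarrow> l"
      using bounded_imp_convergent_subsequence by blast
    then show "\<exists>r'. strict_mono r' \<and> convergent (\<lambda>n. w ((s \<circ> r') n) (e k))"
      by (intro exI[of _ r]) (auto simp: o_def convergent_def)
  qed
  have "convergent (\<lambda>n. w (diagseq n) (e k))" for k
  proof -
    have "convergent (\<lambda>n. w ((diagseq \<circ> (+) (Suc k)) n) (e k))"
    proof (rule diagseq_holds)
      fix r s :: "nat \<Rightarrow> nat" and n
      assume r: "strict_mono r" and c: "convergent (\<lambda>m. w (s m) (e n))"
      from c obtain l where "(\<lambda>m. w (s m) (e n)) \<longlonglongrightarrow> l" by (auto simp: convergent_def)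
      from LIMSEQ_subseq_LIMSEQ[OF this r] show "convergent (\<lambda>m. w ((s \<circ> r) m) (e n))"
        by (auto simp: o_def convergent_def)
    qed
    then obtain l where "(\<lambda>n. w (diagseq (n + Suc k)) (e k)) \<longlonglongrightarrow> l" by (auto simp: convergent_def add.commute)
    then have "(\<lambda>n. w (diagseq n) (e k)) \<longlonglongrightarrow> l" by (rule LIMSEQ_offset)
    then show ?thesis by (auto simp: convergent_def)
  qed
  moreover have "\<exists>k. q = e k" if "\<forall>i. q $ i \<in> \<rat>" for q
  proof -
    have "q \<in> range e" unfolding e using that by (simp add: Q_def)
    then show ?thesis by blast
  qed
  ultimately show ?thesis using subseq_diagseq by (intro exI[of _ diagseq]) blast
qed

text \<open>Monotone functions are continuous almost everywhere: here \<open>limsup w\<^sub>n(tx) \<le> liminf w\<^sub>n(x)\<close> for every \<open>t > 1\<close>,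
  and comparing the integrals of both sides through scaling lets \<open>t \<rightarrow> 1\<close>.\<close>
lemma Helly_AE_limit:
  fixes w :: "nat \<Rightarrow> R3 \<Rightarrow> real"
  assumes w: "\<And>n x. 0 \<le> w n x" "\<And>n x. w n x \<le> 1" and wm [measurable]: "\<And>n. w n \<in> borel_measurable borel"
    and decr: "\<And>n. coord_decr (w n)"
    and conv: "\<And>q. (\<And>i. q $ i \<in> \<rat>) \<Longrightarrow> convergent (\<lambda>n. w n q)"
  obtains a where "a \<in> borel_measurable borel" "coord_decr a" "\<And>x. 0 \<le> a x" "AE x in lborel. (\<lambda>n. w n x) \<longlonglongrightarrow> a x"
proof -
  \<comment> \<open>Upper and lower limits are taken in \<open>ennreal\<close>, where they always
    exist, and converted back to reals afterwards.\<close>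
  define F where "F x = limsup (\<lambda>n. ennreal (w n x))" for x
  define f where "f x = liminf (\<lambda>n. ennreal (w n x))" for x
  have [measurable]: "F \<in> borel_measurable borel" "f \<in> borel_measurable borel"
    unfolding F_def f_def by measurable
  have fF: "f x \<le> F x" for x unfolding f_def F_def by (rule Liminf_le_Limsup) simp
  have F1: "F x \<le> 1" for x unfolding F_def
  proof (rule Limsup_bounded)
    show "\<forall>\<^sub>F n in sequentially. ennreal (w n x) \<le> 1" using w(2) by (auto simp: ennreal_le_1)
  qed
  define a where "a x = enn2real (F x)" for x
  define b where "b x = enn2real (f x)" for x
  have [measurable]: "a \<in> borel_measurable borel" "b \<in> borel_measurable borel" unfolding a_def b_def by measurable
  have Ffin: "F x < \<infinity>" "f x < \<infinity>" for x using F1[of x] fF[of x] by (auto simp: le_less_trans[OF _ ennreal_one_less_top] intro: order_trans)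
  have ab: "0 \<le> b x" "b x \<le> a x" "a x \<le> 1" for x
    using fF[of x] F1[of x] Ffin[of x] enn2real_mono[OF F1, of x] by (auto simp: a_def b_def enn2real_mono)
  have da: "coord_decr a" unfolding coord_decr_def
  proof (intro allI impI)
    fix x y :: R3 assume le: "\<forall>i. \<bar>x $ i\<bar> \<le> \<bar>y $ i\<bar>"
    have "F y \<le> F x" unfolding F_def
      by (intro Limsup_mono always_eventually allI ennreal_leI coord_decrD[OF decr]) (use le in auto)
    then show "a y \<le> a x" unfolding a_def using Ffin by (intro enn2real_mono) auto
  qed
  \<comment> \<open>A rational point fits strictly between \<open>x\<close> and
    \<open>t *\<^sub>R x\<close> in every coordinate; convergence there links the upper limit at the
    farther point to the lower limit at the nearer one.\<close>
  have step: "a (t *\<^sub>R x) \<le> b x" if x: "nondeg x" and t: "1 < t" for x t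
  proof -
    have "\<exists>q\<in>\<rat>. \<bar>x $ i\<bar> < q \<and> q < t * \<bar>x $ i\<bar>" for i
      using x t by (intro Rats_dense_in_real) (simp add: nondeg_def)
    then obtain Q where Q: "\<And>i. Q i \<in> \<rat>" "\<And>i. \<bar>x $ i\<bar> < Q i" "\<And>i. Q i < t * \<bar>x $ i\<bar>" by metis
    define q :: R3 where "q = vec3 (Q 1) (Q 2) (Q 3)"
    have qi: "q $ i = Q i" for i using exhaust_3[of i] by (auto simp: q_def)
    have Q0: "0 \<le> Q i" for i using Q(2)[of i] by linarith
    have 1: "w n (t *\<^sub>R x) \<le> w n q" for n
      by (rule coord_decrD[OF decr]) (use Q(3) Q0 t in \<open>simp add: qi abs_mult less_imp_le\<close>)
    have 2: "w n q \<le> w n x" for n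
      by (rule coord_decrD[OF decr]) (use Q(2) Q0 in \<open>simp add: qi less_imp_le\<close>)
    obtain l where "(\<lambda>n. w n q) \<longlonglongrightarrow> l" using conv[of q] Q(1) by (auto simp: convergent_def qi)
    then have l: "(\<lambda>n. ennreal (w n q)) \<longlonglongrightarrow> ennreal l" by (rule tendsto_ennrealI)
    have "F (t *\<^sub>R x) \<le> limsup (\<lambda>n. ennreal (w n q))" unfolding F_def by (intro Limsup_mono always_eventually allI ennreal_leI 1)
    also have "\<dots> = liminf (\<lambda>n. ennreal (w n q))" using lim_imp_Limsup[OF _ l] lim_imp_Liminf[OF _ l] by simp
    also have "\<dots> \<le> f x" unfolding f_def by (intro Liminf_mono always_eventually allI ennreal_leI 2)
    finally show ?thesis unfolding a_def b_def using Ffin by (intro enn2real_mono) auto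
  qed
  have eqM: "AE x in lborel. x \<in> ball 0 (real M) \<longrightarrow> a x = b x" for M :: nat
  proof -
    let ?I = "\<lambda>x::R3. indicator (ball 0 (real M)) x :: real"
    have Im [measurable]: "?I \<in> borel_measurable borel" by (intro borel_measurable_indicator) auto
    have bI: "integrable lborel (\<lambda>x. h x * ?I x)" if "h \<in> borel_measurable borel" "\<And>x. 0 \<le> h x" "\<And>x. h x \<le> 1" for h
      by (rule integrable_bounded_ball[of _ 1 "real M"]) (use that in \<open>auto simp: indicator_def\<close>)
    have ai: "integrable lborel (\<lambda>x. a x * ?I x)" and bi: "integrable lborel (\<lambda>x. b x * ?I x)"
      using ab by (auto intro!: bI intro: order_trans)
    define J where "J = (\<integral>x. a x * ?I x \<partial>lborel)"
    \<comment> \<open>Dilation changes the integral by the factor \<open>1 / t^3\<close>, so the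
      integral of \<open>a - b\<close> over the ball is at most \<open>1 - 1 / t^3\<close> times
      that of \<open>a\<close>.\<close>
    have le: "(\<integral>x. a x * ?I x - b x * ?I x \<partial>lborel) \<le> (1 - 1 / t^3) * J" if t: "1 < t" for t
    proof -
      have tm: "(\<lambda>x::R3. t *\<^sub>R x) \<in> borel_measurable borel" by simp
      note [measurable] = measurable_compose[OF tm, of a borel]
      have ati: "integrable lborel (\<lambda>x. a (t *\<^sub>R x) * ?I x)"
        using ab by (intro bI) (auto intro: order_trans)
      have atI: "integrable lborel (\<lambda>x. a (t *\<^sub>R x) * ?I (t *\<^sub>R x))" "(\<integral>x. a (t *\<^sub>R x) * ?I (t *\<^sub>R x) \<partial>lborel) = J / t^3"
        using integral_affine3[of t "\<lambda>x. a x * ?I x" 0] t ai by (auto simp: J_def)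
      have "(\<integral>x. a (t *\<^sub>R x) * ?I (t *\<^sub>R x) \<partial>lborel) \<le> (\<integral>x. a (t *\<^sub>R x) * ?I x \<partial>lborel)"
      proof (rule integral_mono[OF atI(1) ati])
        fix x :: R3
        have "?I (t *\<^sub>R x) \<le> ?I x" using t mult_right_mono[of 1 t "norm x"] by (auto simp: indicator_def)
        then show "a (t *\<^sub>R x) * ?I (t *\<^sub>R x) \<le> a (t *\<^sub>R x) * ?I x" using ab[of "t *\<^sub>R x"] by (intro mult_left_mono) auto
      qed
      also have "\<dots> \<le> (\<integral>x. b x * ?I x \<partial>lborel)"
        using AE_nondeg step[OF _ t]
        by (intro integral_mono_AE ati bi) (auto elim!: eventually_mono simp: mult_right_mono)
      finally show ?thesis using ai bi atI(2) by (simp add: J_def left_diff_distrib)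
    qed
    have "((\<lambda>t. (1 - 1 / t^3) * J) \<longlongrightarrow> (1 - 1 / 1^3) * J) (at_right 1)" by (intro tendsto_intros) auto
    then have "(\<integral>x. a x * ?I x - b x * ?I x \<partial>lborel) \<le> (1 - 1 / 1^3) * J"
      by (rule tendsto_lowerbound) (auto simp: eventually_at_filter le)
    then have z: "(\<integral>x. a x * ?I x - b x * ?I x \<partial>lborel) \<le> 0" by simp
    have nn: "0 \<le> a x * ?I x - b x * ?I x" for x using ab[of x] by (simp add: indicator_def)
    have "(\<integral>x. a x * ?I x - b x * ?I x \<partial>lborel) = 0"
      using z Bochner_Integration.integral_nonneg[of lborel "\<lambda>x. a x * ?I x - b x * ?I x"] nn by (simp add: order_antisym)
    then have "AE x in lborel. a x * ?I x - b x * ?I x = 0"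
      using integral_nonneg_eq_0_iff_AE[of lborel "\<lambda>x. a x * ?I x - b x * ?I x"] ai bi nn by auto
    then show ?thesis by eventually_elim auto
  qed
  have "AE x in lborel. \<forall>M::nat. x \<in> ball 0 (real M) \<longrightarrow> a x = b x" unfolding AE_all_countable using eqM by blast
  then have "AE x in lborel. (\<lambda>n. w n x) \<longlonglongrightarrow> a x"
  proof eventually_elim
    case (elim x)
    obtain M :: nat where "norm x < M" using reals_Archimedean2 by blast
    then have "a x = b x" using elim by auto
    then have "F x = f x" unfolding a_def b_def using Ffin[of x] by (metis ennreal_enn2real_if less_irrefl infinity_ennreal_def)
    then have "(\<lambda>n. ennreal (w n x)) \<longlonglongrightarrow> F x"
      using Liminf_eq_Limsup[of sequentially "\<lambda>n. ennreal (w n x)" "F x"] by (simp add: F_def f_def)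
    then have "(\<lambda>n. ennreal (w n x)) \<longlonglongrightarrow> ennreal (a x)" unfolding a_def using Ffin[of x] by simp
    then show ?case using w(1) ab[of x] by (subst (asm) tendsto_ennreal_iff) auto
  qed
  then show ?thesis using that[of a] da ab by (auto intro: order_trans)
qed

text \<open>The increasing map \<open>s / (1 + s)\<close> brings unbounded values into the unit
  interval and is inverted on the limit; the mass bound keeps that limit away from 1 off the
  coordinate planes.\<close>

lemma Helly_selection_decr:
  fixes u :: "nat \<Rightarrow> R3 \<Rightarrow> real"
  assumes u0: "\<And>n x. 0 \<le> u n x" and decr: "\<And>n. coord_decr (u n)" and L: "\<And>n. L2 (u n)" and \<mu>: "\<And>n. sqint (u n) \<le> \<mu>"
  obtains r v where "strict_mono r" "v \<in> borel_measurable borel" "\<And>x. 0 \<le> v x" "AE x in lborel. (\<lambda>n. u (r n) x) \<longlonglongrightarrow> v x"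
    "\<And>x y. nondeg x \<Longrightarrow> (\<And>i. \<bar>x $ i\<bar> \<le> \<bar>y $ i\<bar>) \<Longrightarrow> v y \<le> v x"
proof -
  note [measurable] = L2_meas[OF L]
  define w where "w n x = u n x / (1 + u n x)" for n x
  have w: "0 \<le> w n x" "w n x \<le> 1" for n x using u0[of n x] by (auto simp: w_def)
  have mono: "s / (1 + s) \<le> t / (1 + t)" if "0 \<le> s" "s \<le> t" for s t :: real
    using that by (simp add: frac_le_eq divide_nonpos_pos field_simps)
  have dw: "coord_decr (w n)" for n
    unfolding coord_decr_def w_def using coord_decrD[OF decr] u0 by (auto intro!: mono)
  obtain r where r: "strict_mono r" "\<And>q. (\<And>i. q $ i \<in> \<rat>) \<Longrightarrow> convergent (\<lambda>n. w (r n) q)"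
    using Helly_subsequence[of w] w by blast
  have wm: "w n \<in> borel_measurable borel" for n unfolding w_def by measurable
  obtain a where a: "a \<in> borel_measurable borel" "coord_decr a" "\<And>x. 0 \<le> a x" "AE x in lborel. (\<lambda>n. w (r n) x) \<longlonglongrightarrow> a x"
    using Helly_AE_limit[of "\<lambda>n. w (r n)"] w wm dw r(2) by blast
  note [measurable] = a(1)
  have bnd: "\<exists>k<1. \<forall>n. w n x \<le> k" if x: "nondeg x" for x
  proof -
    define m where "m = measure lborel (box_within x)"
    have m: "0 < m" using box_within(6)[OF x] by (simp add: m_def)
    define b where "b = sqrt (\<bar>\<mu>\<bar> / m)"
    have b0: "0 \<le> b" using m by (simp add: b_def)
    have "u n x \<le> b" for n
    proof -
      have "(u n x)\<^sup>2 * m \<le> \<bar>\<mu>\<bar>" using coord_decr_bound[OF x decr u0 L, of n] \<mu>[of n] unfolding m_def by linarith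
      then have "(u n x)\<^sup>2 \<le> \<bar>\<mu>\<bar> / m" using m by (simp add: field_simps)
      then show ?thesis unfolding b_def by (rule real_le_rsqrt)
    qed
    then have "w n x \<le> b / (1 + b)" for n unfolding w_def using u0 by (intro mono)
    moreover have "b / (1 + b) < 1" using b0 by simp
    ultimately show ?thesis by blast
  qed
  \<comment> \<open>The default 0 can be taken only on the coordinate planes, where the sequence may
    be unbounded; this is why monotonicity of \<open>v\<close> is claimed for nondegenerate
    \<open>x\<close>.\<close>
  define v where "v x = (if a x < 1 then a x / (1 - a x) else 0)" for x
  have ae1: "AE x in lborel. a x < 1"
    using a(4) AE_nondeg
  proof eventually_elim
    case (elim x)
    obtain k where k: "k < 1" "\<And>n. w n x \<le> k" using bnd[OF elim(2)] by blast
    have "a x \<le> k" by (rule LIMSEQ_le_const2[OF elim(1)]) (use k in auto)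
    then show ?case using k by simp
  qed
  \<comment> \<open>The box spanned by \<open>x\<close> contains a point where the almost everywhere
    statement holds, and \<open>a x\<close> is at most the value there.\<close>
  have nd1: "a x < 1" if x: "nondeg x" for x
  proof -
    obtain y where "y \<in> box_within x" "a y < 1" using AE_obtain_open[OF ae1 box_within(1,2)[OF x]] by blast
    then show ?thesis using box_within_coord_decr[OF a(2), of y x] by simp
  qed
  show ?thesis
  proof (rule that[OF r(1)])
    show "v \<in> borel_measurable borel" unfolding v_def by measurable
    show "0 \<le> v x" for x using a(3)[of x] by (simp add: v_def)
    show "AE x in lborel. (\<lambda>n. u (r n) x) \<longlonglongrightarrow> v x"
      using a(4) AE_nondeg
    proof eventually_elim
      case (elim x)
      have a1: "a x < 1" by (rule nd1[OF elim(2)])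
      have "(\<lambda>n. w (r n) x / (1 - w (r n) x)) \<longlonglongrightarrow> a x / (1 - a x)"
        by (intro tendsto_intros elim(1)) (use a1 in simp)
      moreover have "w n x / (1 - w n x) = u n x" for n using u0[of n x] by (simp add: w_def field_simps)
      ultimately show ?case using a1 by (simp add: v_def)
    qed
    fix x y :: R3 assume x: "nondeg x" and xy: "\<And>i. \<bar>x $ i\<bar> \<le> \<bar>y $ i\<bar>"
    have "a y \<le> a x" by (rule coord_decrD[OF a(2) xy])
    moreover have "a x < 1" by (rule nd1[OF x])
    moreover have "0 \<le> a y" by (rule a(3))
    ultimately show "v y \<le> v x" by (simp add: v_def frac_le)
  qed
qed

text \<open>If |x_3| exceeds \<open>L\<close>, then \<open>u^2\<close> is at most its average over
  [-L, L] on the same vertical line, hence at most \<open>I a b / (2 * L)\<close>. Integrating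
  \<open>u^4 \<le> u^2 * I / (2 * L)\<close> leaves the square of \<open>I\<close>, which
  \<open>H0_Ladyzhenskaya\<close> bounds. The decay obtained along x_3 is thus of \<open>L^4\<close>
  type.\<close>

lemma tail_bound:
  assumes H: "H0 R u g" and u0: "\<And>x. 0 \<le> u x" and decr: "coord_decr u" and L: "0 < L"
  shows "integrable lborel (\<lambda>x. u x ^ 4 * indicator {x. L < \<bar>x $ 3\<bar>} x)"
    "(\<integral>x. u x ^ 4 * indicator {x. L < \<bar>x $ 3\<bar>} x \<partial>lborel) \<le> 2 * sqint u * gradsq g / L"
proof -
  note uL = H0_L2(1)[OF H]
  note [measurable] = L2_meas[OF uL]
  have op: "open {x::R3. L < \<bar>x $ 3\<bar>}" by (intro open_Collect_less continuous_intros)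
  let ?f = "\<lambda>x. u x ^ 4 * indicator {x. L < \<bar>x $ 3\<bar>} x"
  have indm [measurable]: "indicator {x::R3. L < \<bar>x $ 3\<bar>} \<in> borel_measurable borel" using op by (intro borel_measurable_indicator) auto
  have fm [measurable]: "?f \<in> borel_measurable borel" by measurable
  define I where "I a b = (\<integral>\<^sup>+c. ennreal ((u (vec3 a b c))\<^sup>2) \<partial>lborel)" for a b
  have vm: "(\<lambda>c. vec3 a b c) \<in> borel_measurable borel" for a b
    unfolding vec3_def by (intro borel_measurable_continuous_onI continuous_intros)
  have um1 [measurable]: "(\<lambda>c. u (vec3 a b c)) \<in> borel_measurable borel" for a b
    by (rule measurable_compose[OF vm]) simp
  have pt: "ennreal (?f (vec3 a b c)) \<le> ennreal ((u (vec3 a b c))\<^sup>2) * (ennreal (1 / (2 * L)) * I a b)" for a b c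
  proof (cases "L < \<bar>c\<bar>")
    case True
    let ?z = "(u (vec3 a b c))\<^sup>2"
    have "ennreal ?z * ennreal (2 * L) = (\<integral>\<^sup>+s. ennreal ?z * indicator {-L..L} s \<partial>lborel)"
      using L by (simp add: nn_integral_cmult)
    also have "\<dots> \<le> I a b" unfolding I_def
    proof (rule nn_integral_mono)
      fix s
      have "u (vec3 a b c) \<le> u (vec3 a b s)" if "\<bar>s\<bar> \<le> L"
        by (rule coord_decrD[OF decr]) (use that True exhaust_3 in \<open>auto simp: vec3_def axis_def\<close>)
      then have "?z \<le> (u (vec3 a b s))\<^sup>2" if "\<bar>s\<bar> \<le> L" using that u0 by (intro power_mono) auto
      then show "ennreal ?z * indicator {-L..L} s \<le> ennreal ((u (vec3 a b s))\<^sup>2)"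
        by (auto simp: indicator_def intro!: ennreal_leI)
    qed
    finally have "ennreal (1 / (2 * L)) * (ennreal ?z * ennreal (2 * L)) \<le> ennreal (1 / (2 * L)) * I a b" by (intro mult_left_mono) auto
    moreover have "ennreal (1 / (2 * L)) * (ennreal ?z * ennreal (2 * L)) = ennreal ?z"
      using L by (simp add: ennreal_mult'[symmetric] ennreal_mult''[symmetric])
    ultimately have "ennreal ?z * ennreal ?z \<le> ennreal ?z * (ennreal (1 / (2 * L)) * I a b)" by (intro mult_left_mono) auto
    moreover have "ennreal (?f (vec3 a b c)) = ennreal ?z * ennreal ?z"
      using True by (simp add: ennreal_mult'[symmetric] power_add[symmetric])
    ultimately show ?thesis by simp
  qed simp
  have Im: "(\<lambda>p. I (fst p) (snd p)) \<in> borel_measurable borel"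
    unfolding I_def by (rule slice_measurable(3)) simp
  have Im1 [measurable]: "(\<lambda>b. I a b) \<in> borel_measurable borel" for a
    using measurable_compose[OF _ Im, of "\<lambda>b. (a, b)" borel]
    by (simp add: borel_measurable_continuous_onI continuous_intros)
  have "(\<integral>\<^sup>+x. ennreal (?f x) \<partial>lborel) \<le> (\<integral>\<^sup>+a. \<integral>\<^sup>+b. \<integral>\<^sup>+c. ennreal ((u (vec3 a b c))\<^sup>2) * (ennreal (1 / (2 * L)) * I a b) \<partial>lborel \<partial>lborel \<partial>lborel)"
    by (subst nn_integral_R3) (auto intro!: nn_integral_mono pt)
  also have "\<dots> = (\<integral>\<^sup>+a. \<integral>\<^sup>+b. ennreal (1 / (2 * L)) * (I a b)\<^sup>2 \<partial>lborel \<partial>lborel)"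
  proof (intro nn_integral_cong)
    fix a b
    have "(\<integral>\<^sup>+c. ennreal ((u (vec3 a b c))\<^sup>2) * (ennreal (1 / (2 * L)) * I a b) \<partial>lborel) = I a b * (ennreal (1 / (2 * L)) * I a b)"
      by (subst nn_integral_multc) (simp_all add: I_def)
    then show "(\<integral>\<^sup>+c. ennreal ((u (vec3 a b c))\<^sup>2) * (ennreal (1 / (2 * L)) * I a b) \<partial>lborel) = ennreal (1 / (2 * L)) * (I a b)\<^sup>2"
      by (simp add: power2_eq_square mult.left_commute)
  qed
  also have "\<dots> = ennreal (1 / (2 * L)) * (\<integral>\<^sup>+a. \<integral>\<^sup>+b. (I a b)\<^sup>2 \<partial>lborel \<partial>lborel)"
  proof -
    have "(\<lambda>a. \<integral>\<^sup>+b. (I a b)\<^sup>2 \<partial>lborel) \<in> borel_measurable borel"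
      by (rule borel_measurable_inner_integral) (use Im in simp)
    then show ?thesis by (simp add: nn_integral_cmult)
  qed
  also have "\<dots> \<le> ennreal (1 / (2 * L)) * ennreal (4 * sqint u * gradsq g)"
    unfolding I_def by (intro mult_left_mono H0_Ladyzhenskaya[OF H]) auto
  also have "\<dots> = ennreal (2 * sqint u * gradsq g / L)"
    using L by (subst ennreal_mult'[symmetric]) (auto simp: sqint_nonneg gradsq_nonneg field_simps)
  finally have le: "(\<integral>\<^sup>+x. ennreal (?f x) \<partial>lborel) \<le> ennreal (2 * sqint u * gradsq g / L)" .
  show i: "integrable lborel ?f"
    using le by (intro integrableI_nonneg) (auto simp: le_less_trans[OF le ennreal_less_top])
  show "(\<integral>x. ?f x \<partial>lborel) \<le> 2 * sqint u * gradsq g / L"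
    using le L nn_integral_eq_integral[OF i] by (simp add: ennreal_le_iff sqint_nonneg gradsq_nonneg)
qed

text \<open>One splitting per region of \<open>compactness\<close>: the \<open>s^2\<close> term
  where \<open>V\<close> is large, the \<open>s^4\<close> term where |x_3| is large, and a truncated
  term on the bounded rest.\<close>

lemma powr_interp_eps:
  fixes q e :: real
  assumes q: "2 < q" "q < 6" and e: "0 < e"
  obtains C where "0 \<le> C" "\<And>s. 0 \<le> s \<Longrightarrow> s powr q \<le> e * s^6 + C * s^2"
    "\<And>s. 0 \<le> s \<Longrightarrow> s powr q \<le> e * (s^2 + s^6) + C * s^4" "\<And>s. 0 \<le> s \<Longrightarrow> s powr q \<le> e * s^6 + min (s powr q) C"
proof -
  \<comment> \<open>Above \<open>T\<close> the sixth power dominates with factor \<open>e\<close>,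
    using \<open>q < 6\<close>; below \<open>d\<close> the square does, using
    \<open>q > 2\<close>.\<close>
  define T where "T = max 1 ((1/e) powr (1 / (6 - q)))"
  have T1: "1 \<le> T" by (simp add: T_def)
  define d where "d = min 1 (e powr (1 / (q - 2)))"
  have d: "0 < d" "d \<le> 1" using e by (auto simp: d_def)
  have T: "s powr q \<le> e * s^6" if s: "T \<le> s" for s
  proof -
    have s0: "0 < s" using s T1 by linarith
    have "1 / e = ((1/e) powr (1 / (6 - q))) powr (6 - q)" using e q by (simp add: powr_powr)
    also have "\<dots> \<le> s powr (6 - q)" using s q by (intro powr_mono2) (auto simp: T_def)
    finally have "1 \<le> e * s powr (6 - q)" using e by (simp add: field_simps)
    then have "s powr q * 1 \<le> s powr q * (e * s powr (6 - q))" by (intro mult_left_mono) auto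
    also have "\<dots> = e * s powr 6" by (simp add: powr_add[symmetric])
    also have "s powr 6 = s^6" using s0 powr_realpow[of s 6] by simp
    finally show ?thesis by simp
  qed
  have D: "s powr q \<le> e * s^2" if s: "0 \<le> s" "s \<le> d" for s
  proof (cases "s = 0")
    case False
    then have s0: "0 < s" using s by simp
    have "s powr (q - 2) \<le> (e powr (1 / (q - 2))) powr (q - 2)" using s q by (intro powr_mono2) (auto simp: d_def)
    also have "\<dots> = e" using e q by (simp add: powr_powr)
    finally have "s powr (q - 2) * s powr 2 \<le> e * s powr 2" by (intro mult_right_mono) auto
    moreover have "s powr (q - 2) * s powr 2 = s powr q" by (simp add: powr_add[symmetric])
    moreover have "s powr 2 = s^2" using s0 powr_realpow[of s 2] by simp
    ultimately show ?thesis by simp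
  qed simp
  have M: "s powr q \<le> T powr q" if "0 \<le> s" "s \<le> T" for s using that q by (intro powr_mono2) auto
  have M2: "s powr q \<le> T powr (q - 2) * s^2" if s: "0 \<le> s" "s \<le> T" for s
  proof (cases "s = 0")
    case False
    then have s0: "0 < s" using s by simp
    have "s powr (q - 2) * s powr 2 \<le> T powr (q - 2) * s powr 2" using s q by (intro mult_right_mono powr_mono2) auto
    moreover have "s powr (q - 2) * s powr 2 = s powr q" by (simp add: powr_add[symmetric])
    moreover have "s powr 2 = s^2" using s0 powr_realpow[of s 2] by simp
    ultimately show ?thesis by simp
  qed simp
  define C where "C = T powr (q - 2) + T powr q / d^4 + T powr q"
  have C0: "0 \<le> T powr (q - 2)" "0 \<le> T powr q / d^4" "0 \<le> T powr q" using d by auto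
  have C: "0 \<le> C" "T powr (q - 2) \<le> C" "T powr q / d^4 \<le> C" "T powr q \<le> C" using C0 unfolding C_def by linarith+
  show ?thesis
  proof (rule that[OF C(1)])
    fix s :: real assume s: "0 \<le> s"
    have p: "0 \<le> e * s^6" "0 \<le> e * s^2" "0 \<le> C * s^2" "0 \<le> C * s^4" using e C(1) by auto
    show "s powr q \<le> e * s^6 + C * s^2"
    proof (cases "T \<le> s")
      case True then show ?thesis using T[OF True] p by linarith
    next
      case False
      then have "s powr q \<le> T powr (q - 2) * s^2" using M2 s by simp
      also have "\<dots> \<le> C * s^2" by (intro mult_right_mono C) simp
      finally show ?thesis using p by linarith
    qed
    show "s powr q \<le> e * s^6 + min (s powr q) C"
    proof (cases "T \<le> s")
      case True
      have "0 \<le> min (s powr q) C" using C(1) by simp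
      then show ?thesis using T[OF True] by linarith
    next
      case False
      then have "s powr q \<le> C" using M[of s] s C(4) by linarith
      then show ?thesis using p by simp
    qed
    show "s powr q \<le> e * (s^2 + s^6) + C * s^4"
    proof (cases "T \<le> s")
      case True then show ?thesis using T[OF True] p by (simp add: distrib_left)
    next
      case False
      show ?thesis
      proof (cases "s \<le> d")
        case True then show ?thesis using D[OF s True] p by (simp add: distrib_left)
      next
        case F2: False
        then have "d^4 \<le> s^4" using d by (intro power_mono) auto
        then have "1 \<le> s^4 / d^4" using d by simp
        then have "T powr q * 1 \<le> T powr q * (s^4 / d^4)" by (intro mult_left_mono) auto
        also have "\<dots> = T powr q / d^4 * s^4" by simp
        also have "\<dots> \<le> C * s^4" by (intro mult_right_mono C) simp
        finally have "s powr q \<le> C * s^4" using M[of s] s False by simp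
        then show ?thesis using p by (simp add: distrib_left)
      qed
    qed
  qed
qed

lemma abs_diff_power_le:
  fixes a b :: real
  assumes "0 \<le> a" "0 \<le> b" shows "\<bar>a - b\<bar> ^ n \<le> a ^ n + b ^ n"
proof (cases "a \<le> b")
  case True
  then have "\<bar>a - b\<bar> ^ n \<le> b ^ n" using assms by (intro power_mono) auto
  then show ?thesis using assms by (simp add: add_increasing)
next
  case False
  then have "\<bar>a - b\<bar> ^ n \<le> a ^ n" using assms by (intro power_mono) auto
  then show ?thesis using assms by (simp add: add_increasing2)
qed

text \<open>Confinement makes the \<open>L^2\<close> mass small where \<open>V\<close> is large,
  \<open>tail_bound\<close> makes the \<open>L^4\<close> norm small where |x_3| is large, and the
  rest is bounded. Interpolation with the uniform \<open>L^2\<close> and \<open>L^6\<close> bounds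
  reaches every \<open>q\<close> strictly between 2 and 6; at \<open>q = 2\<close> mass could still
  escape along x_3.\<close>

lemma compactness:
  fixes u :: "nat \<Rightarrow> R3 \<Rightarrow> real"
  assumes H: "\<And>n. H0 (R n) (u n) (g n)" and u0: "\<And>n x. 0 \<le> u n x" and decr: "\<And>n. coord_decr (u n)"
    and M: "\<And>n. sqint (u n) \<le> M" and A: "\<And>n. gradsq (g n) \<le> A" and B: "\<And>n. (\<integral>x. V x * (u n x)\<^sup>2 \<partial>lborel) \<le> B"
    and vm: "v \<in> borel_measurable borel" and v0: "\<And>x. 0 \<le> v x" and lim: "AE x in lborel. (\<lambda>n. u n x) \<longlonglongrightarrow> v x"
    and q: "2 < q" "q < 6"
  shows "L2 v" "integrable lborel (\<lambda>x. v x ^ 6)" "integrable lborel (\<lambda>x. V x * (v x)\<^sup>2)"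
    "(\<lambda>n. \<integral>x. \<bar>u n x - v x\<bar> powr q \<partial>lborel) \<longlonglongrightarrow> 0"
proof -
  note uL = H0_L2(1)[OF H]
  note [measurable] = L2_meas[OF uL] vm
  have M0: "0 \<le> M" using M[of 0] sqint_nonneg[of "u 0"] by linarith
  have A0: "0 \<le> A" using A[of 0] gradsq_nonneg[of "g 0"] by linarith
  have B0: "0 \<le> B" using B[of 0] Bochner_Integration.integral_nonneg[of lborel "\<lambda>x. V x * (u 0 x)\<^sup>2"] V_nonneg by fastforce
  have lim_pow: "AE x in lborel. (\<lambda>n. u n x ^ k * c x) \<longlonglongrightarrow> v x ^ k * c x" for k and c :: "R3 \<Rightarrow> real"
    using lim by eventually_elim (intro tendsto_intros)
  define S where "S = 4096 * A ^ 3"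
  have S0: "0 \<le> S" using A0 by (simp add: S_def)
  have u6: "integrable lborel (\<lambda>x. u n x ^ 6)" "(\<integral>x. u n x ^ 6 \<partial>lborel) \<le> S" for n
  proof -
    show "integrable lborel (\<lambda>x. u n x ^ 6)" by (rule H0_Sobolev(1)[OF H])
    have "(\<integral>x. u n x ^ 6 \<partial>lborel) \<le> 4096 * gradsq (g n) ^ 3" by (rule H0_Sobolev(2)[OF H])
    also have "\<dots> \<le> S" unfolding S_def using A by (intro mult_left_mono power_mono gradsq_nonneg) auto
    finally show "(\<integral>x. u n x ^ 6 \<partial>lborel) \<le> S" .
  qed
  have vL: "L2 v" and vM: "sqint v \<le> M" using L2_Fatou[OF uL vm lim, of M] M by auto
  show "L2 v" by (rule vL)
  have fat: "integrable lborel (\<lambda>x. v x ^ k * c x) \<and> (\<integral>x. v x ^ k * c x \<partial>lborel) \<le> b"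
    if "\<And>n. integrable lborel (\<lambda>x. u n x ^ k * c x)" "\<And>n. (\<integral>x. u n x ^ k * c x \<partial>lborel) \<le> b"
      "\<And>x. 0 \<le> c x" and [measurable]: "c \<in> borel_measurable borel" for k b and c :: "R3 \<Rightarrow> real"
  proof -
    have p: "0 \<le> u n x ^ k * c x" for n x using u0 that(3) by simp
    have m: "(\<lambda>x. v x ^ k * c x) \<in> borel_measurable borel" by measurable
    show ?thesis using Fatou_integral[OF that(1) p m lim_pow always_eventually[OF allI[OF that(2)]]] by blast
  qed
  have v6: "integrable lborel (\<lambda>x. v x ^ 6)" "(\<integral>x. v x ^ 6 \<partial>lborel) \<le> S"
    using fat[of 6 "\<lambda>x. 1" S] u6 by auto
  show "integrable lborel (\<lambda>x. v x ^ 6)" by (rule v6(1))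
  have Vu: "integrable lborel (\<lambda>x. (u n x)\<^sup>2 * V x)" "(\<integral>x. (u n x)\<^sup>2 * V x \<partial>lborel) \<le> B" for n
    using H0_V(2)[OF H, of n] B[of n] by (simp_all add: mult.commute)
  have Vv: "integrable lborel (\<lambda>x. (v x)\<^sup>2 * V x)" "(\<integral>x. (v x)\<^sup>2 * V x \<partial>lborel) \<le> B"
    using fat[of 2 V B] Vu V_nonneg by auto
  show "integrable lborel (\<lambda>x. V x * (v x)\<^sup>2)" using Vv(1) by (simp add: mult.commute)
  define D where "D n x = \<bar>u n x - v x\<bar>" for n x
  have D0: "0 \<le> D n x" for n x by (simp add: D_def)
  have Dm [measurable]: "D n \<in> borel_measurable borel" for n unfolding D_def by measurable
  have Dle: "D n x ^ k \<le> u n x ^ k + v x ^ k" for n x k unfolding D_def by (rule abs_diff_power_le[OF u0 v0])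
  have Dint: "integrable lborel (\<lambda>x. D n x ^ k * c x) \<and> (\<integral>x. D n x ^ k * c x \<partial>lborel) \<le> 2 * b"
    if "integrable lborel (\<lambda>x. u n x ^ k * c x)" "(\<integral>x. u n x ^ k * c x \<partial>lborel) \<le> b"
      "integrable lborel (\<lambda>x. v x ^ k * c x)" "(\<integral>x. v x ^ k * c x \<partial>lborel) \<le> b"
      "\<And>x. 0 \<le> c x" and [measurable]: "c \<in> borel_measurable borel" for n k b and c :: "R3 \<Rightarrow> real"
  proof -
    have le: "D n x ^ k * c x \<le> u n x ^ k * c x + v x ^ k * c x" for x
      using mult_right_mono[OF Dle that(5)] by (simp add: distrib_right)
    have i: "integrable lborel (\<lambda>x. u n x ^ k * c x + v x ^ k * c x)" using that by simp
    have j: "integrable lborel (\<lambda>x. D n x ^ k * c x)"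
    proof (rule Bochner_Integration.integrable_bound[OF i])
      show "AE x in lborel. norm (D n x ^ k * c x) \<le> norm (u n x ^ k * c x + v x ^ k * c x)"
        using le D0 that(5) by (intro AE_I2) (simp add: order_trans[OF _ abs_ge_self])
    qed simp
    have "(\<integral>x. D n x ^ k * c x \<partial>lborel) \<le> (\<integral>x. u n x ^ k * c x + v x ^ k * c x \<partial>lborel)"
      by (rule integral_mono[OF j i le])
    then show ?thesis using j that by simp
  qed
  have D2: "integrable lborel (\<lambda>x. D n x ^ 2)" "(\<integral>x. D n x ^ 2 \<partial>lborel) \<le> 2 * M" for n
    using Dint[of n 2 "\<lambda>x. 1" M] L2_sq[OF uL, of n] M[of n] L2_sq[OF vL] vM by (auto simp: sqint_def)
  have D6: "integrable lborel (\<lambda>x. D n x ^ 6)" "(\<integral>x. D n x ^ 6 \<partial>lborel) \<le> 2 * S" for n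
    using Dint[of n 6 "\<lambda>x. 1" S] u6[of n] v6 by auto
  show "(\<lambda>n. \<integral>x. \<bar>u n x - v x\<bar> powr q \<partial>lborel) \<longlonglongrightarrow> 0"
  proof (rule LIMSEQ_I)
    fix r :: real assume r: "0 < r"
    \<comment> \<open>\<open>e\<close> confines the interpolation error to a quarter of
      \<open>r\<close>, and \<open>L\<close> below confines the two tails together to another
      quarter.\<close>
    define e where "e = r / (8 * (M + S + 1))"
    have e: "0 < e" using r M0 S0 by (simp add: e_def)
    have eb: "e * (2 * M + 2 * S) \<le> r / 4" using r M0 S0 by (simp add: e_def field_simps)
    obtain C where C: "0 \<le> C" "\<And>s. 0 \<le> s \<Longrightarrow> s powr q \<le> e * s^6 + C * s^2"
      "\<And>s. 0 \<le> s \<Longrightarrow> s powr q \<le> e * (s^2 + s^6) + C * s^4" "\<And>s. 0 \<le> s \<Longrightarrow> s powr q \<le> e * s^6 + min (s powr q) C"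
      using powr_interp_eps[OF q e] by blast
    define L where "L = 1 + 16 * C * (M * A + B) / r"
    have L: "0 < L" using C(1) M0 A0 B0 r by (simp add: L_def add_pos_nonneg)
    have Lb: "C * (4 * M * A / L) + C * (2 * B / L) \<le> r / 4"
    proof -
      have "16 * C * (M * A + B) / r \<le> L" by (simp add: L_def)
      then have "16 * C * (M * A + B) \<le> L * r" using r by (simp add: field_simps)
      moreover have "C * (4 * M * A / L) + C * (2 * B / L) = C * (4 * M * A + 2 * B) / L" by (simp add: add_divide_distrib distrib_left)
      moreover have "C * (4 * M * A + 2 * B) \<le> C * (4 * (M * A + B))" using C(1) B0 by (intro mult_left_mono) (auto simp: algebra_simps)
      moreover have "16 * C * (M * A + B) = 4 * (C * (4 * (M * A + B)))" by simp
      ultimately have "C * (4 * M * A / L) + C * (2 * B / L) = C * (4 * M * A + 2 * B) / L" "4 * (C * (4 * M * A + 2 * B)) \<le> L * r"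
        by linarith+
      moreover have "X / L \<le> r / 4" if "4 * X \<le> L * r" for X using that L by (simp add: field_simps)
      ultimately show ?thesis by metis
    qed
    define Z where "Z = {x::R3. L < \<bar>x $ 3\<bar>}"
    define P where "P = {x::R3. L < V x}"
    define K where "K = - (Z \<union> P)"
    have Vc: "continuous_on UNIV V" unfolding V_def[abs_def] by (intro continuous_intros)
    have "open Z" "open P" unfolding Z_def P_def by (intro open_Collect_less continuous_intros Vc)+
    then have sets [measurable]: "Z \<in> sets borel" "P \<in> sets borel" "K \<in> sets borel" by (auto simp: K_def)
    have Zb: "integrable lborel (\<lambda>x. D n x ^ 4 * indicator Z x)" "(\<integral>x. D n x ^ 4 * indicator Z x \<partial>lborel) \<le> 4 * M * A / L" for n
    proof -
      have t: "integrable lborel (\<lambda>x. u n x ^ 4 * indicator Z x)" "(\<integral>x. u n x ^ 4 * indicator Z x \<partial>lborel) \<le> 2 * M * A / L" for n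
      proof -
        show "integrable lborel (\<lambda>x. u n x ^ 4 * indicator Z x)" unfolding Z_def by (rule tail_bound(1)[OF H u0 decr L])
        have "(\<integral>x. u n x ^ 4 * indicator Z x \<partial>lborel) \<le> 2 * sqint (u n) * gradsq (g n) / L"
          unfolding Z_def by (rule tail_bound(2)[OF H u0 decr L])
        also have "\<dots> \<le> 2 * M * A / L"
          using L M M0 A by (intro divide_right_mono mult_mono) (auto simp: gradsq_nonneg sqint_nonneg)
        finally show "(\<integral>x. u n x ^ 4 * indicator Z x \<partial>lborel) \<le> 2 * M * A / L" .
      qed
      then have "integrable lborel (\<lambda>x. v x ^ 4 * indicator Z x) \<and> (\<integral>x. v x ^ 4 * indicator Z x \<partial>lborel) \<le> 2 * M * A / L"
        by (intro fat) auto
      then have "integrable lborel (\<lambda>x. D n x ^ 4 * indicator Z x) \<and> (\<integral>x. D n x ^ 4 * indicator Z x \<partial>lborel) \<le> 2 * (2 * M * A / L)"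
        using t[of n] by (intro Dint) auto
      then show "integrable lborel (\<lambda>x. D n x ^ 4 * indicator Z x)" "(\<integral>x. D n x ^ 4 * indicator Z x \<partial>lborel) \<le> 4 * M * A / L" by auto
    qed
    have Pb: "integrable lborel (\<lambda>x. D n x ^ 2 * indicator P x)" "(\<integral>x. D n x ^ 2 * indicator P x \<partial>lborel) \<le> 2 * B / L" for n
    proof -
      have VD: "integrable lborel (\<lambda>x. D n x ^ 2 * V x)" "(\<integral>x. D n x ^ 2 * V x \<partial>lborel) \<le> 2 * B"
        using Dint[of n 2 V B] Vu[of n] Vv V_nonneg by auto
      show i: "integrable lborel (\<lambda>x. D n x ^ 2 * indicator P x)"
        using integrable_mult_indicator[of P lborel "\<lambda>x. D n x ^ 2"] D2(1)[of n] sets by (simp add: mult.commute)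
      have "(\<integral>x. D n x ^ 2 * indicator P x \<partial>lborel) \<le> (\<integral>x. D n x ^ 2 * V x / L \<partial>lborel)"
      proof (rule integral_mono[OF i])
        show "integrable lborel (\<lambda>x. D n x ^ 2 * V x / L)" using VD by simp
        show "D n x ^ 2 * indicator P x \<le> D n x ^ 2 * V x / L" for x
          using L V_nonneg[of x] by (auto simp: P_def indicator_def field_simps intro!: mult_left_mono mult_right_mono)
      qed
      also have "\<dots> \<le> 2 * B / L" using VD L by (simp add: divide_right_mono)
      finally show "(\<integral>x. D n x ^ 2 * indicator P x \<partial>lborel) \<le> 2 * B / L" .
    qed
    have Ksub: "x \<in> ball 0 (L + L + 2)" if "x \<in> K" for x
    proof -
      have "\<bar>x $ 3\<bar> \<le> L" "V x \<le> L" using that by (auto simp: K_def Z_def P_def)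
      then have "(x $ 3)\<^sup>2 \<le> L\<^sup>2" "V x \<le> L" by (auto simp: abs_le_square_iff[symmetric] L less_imp_le)
      then have "(norm x)\<^sup>2 \<le> L\<^sup>2 + L" by (simp add: norm_R3 V_def)
      also have "\<dots> < (L + L + 2)\<^sup>2" using L by (simp add: power2_eq_square algebra_simps add_pos_pos)
      finally have "norm x < L + L + 2" by (rule power2_less_imp_less) (use L in simp)
      then show ?thesis by simp
    qed
    \<comment> \<open>Truncation at \<open>C\<close> supplies the constant majorant for dominated
      convergence on the bounded set \<open>K\<close>.\<close>
    define h where "h n x = min (D n x powr q) C * indicator K x" for n x
    have hm: "h n \<in> borel_measurable borel" for n unfolding h_def[abs_def] by measurable
    have hi: "integrable lborel (h n)" for n
      by (rule integrable_bounded_ball[of _ C "L + L + 2"]) (use hm C(1) Ksub in \<open>auto simp: h_def indicator_def\<close>)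
    have "(\<lambda>n. \<integral>x. h n x \<partial>lborel) \<longlonglongrightarrow> (\<integral>x. 0 \<partial>(lborel :: R3 measure))"
    proof (rule integral_dominated_convergence[of _ _ _ "\<lambda>x. C * indicator K x"])
      show "integrable lborel (\<lambda>x. C * indicator K x)"
        by (rule integrable_bounded_ball[of _ C "L + L + 2"]) (use C(1) Ksub in \<open>auto simp: indicator_def\<close>)
      show "AE x in lborel. (\<lambda>n. h n x) \<longlonglongrightarrow> 0"
        using lim
      proof eventually_elim
        case (elim x)
        have "(\<lambda>n. D n x) \<longlonglongrightarrow> \<bar>v x - v x\<bar>" unfolding D_def by (intro tendsto_intros elim)
        then have "(\<lambda>n. D n x powr q) \<longlonglongrightarrow> 0"
          using q D0 by (intro tendsto_zero_powrI[where b=q] tendsto_const) auto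
        then have "(\<lambda>n. min (D n x powr q) C * indicator K x) \<longlonglongrightarrow> min 0 C * indicator K x" by (intro tendsto_intros)
        then show ?case using C(1) by (simp add: h_def)
      qed
      show "AE x in lborel. norm (h n x) \<le> C * indicator K x" for n
        using C(1) by (intro AE_I2) (auto simp: h_def indicator_def)
    qed (simp_all add: h_def)
    then have "\<forall>\<^sub>F n in sequentially. (\<integral>x. h n x \<partial>lborel) < r / 4" using r by (intro order_tendstoD(2)[of _ 0]) auto
    then have "\<forall>\<^sub>F n in sequentially. norm ((\<integral>x. \<bar>u n x - v x\<bar> powr q \<partial>lborel) - 0) < r"
    proof eventually_elim
      case (elim n)
      let ?b = "\<lambda>x. e * (D n x ^ 2 + D n x ^ 6) + C * (D n x ^ 4 * indicator Z x) + C * (D n x ^ 2 * indicator P x) + h n x"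
      have le: "D n x powr q \<le> ?b x" for x
      proof -
        have p: "0 \<le> e * D n x ^ 2" "0 \<le> e * D n x ^ 6" "0 \<le> C * (D n x ^ 4 * indicator Z x)"
          "0 \<le> C * (D n x ^ 2 * indicator P x)" "0 \<le> h n x"
          using e C(1) D0[of n x] by (auto simp: h_def)
        consider "x \<in> Z" | "x \<in> P" | "x \<in> K" by (auto simp: K_def)
        then show ?thesis
        proof cases
          case 1
          then have "indicator Z x = (1 :: real)" by simp
          with C(3)[OF D0, of n x] p show ?thesis unfolding distrib_left by simp
        next
          case 2
          then have "indicator P x = (1 :: real)" by simp
          with C(2)[OF D0, of n x] p show ?thesis unfolding distrib_left by simp
        next
          case 3
          then have "h n x = min (D n x powr q) C" by (simp add: h_def)
          with C(4)[OF D0, of n x] p show ?thesis unfolding distrib_left by argo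
        qed
      qed
      have bi: "integrable lborel ?b" using D2(1)[of n] D6(1)[of n] Zb(1)[of n] Pb(1)[of n] hi[of n] by simp
      have Di: "integrable lborel (\<lambda>x. D n x powr q)"
      proof (rule Bochner_Integration.integrable_bound[OF bi])
        show "AE x in lborel. norm (D n x powr q) \<le> norm (?b x)"
          using le by (intro AE_I2) (simp add: order_trans[OF _ abs_ge_self])
      qed simp
      have "(\<integral>x. D n x powr q \<partial>lborel) \<le> (\<integral>x. ?b x \<partial>lborel)" by (rule integral_mono[OF Di bi le])
      also have "\<dots> = e * ((\<integral>x. D n x ^ 2 \<partial>lborel) + (\<integral>x. D n x ^ 6 \<partial>lborel)) + C * (\<integral>x. D n x ^ 4 * indicator Z x \<partial>lborel)
          + C * (\<integral>x. D n x ^ 2 * indicator P x \<partial>lborel) + (\<integral>x. h n x \<partial>lborel)"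
        using D2(1)[of n] D6(1)[of n] Zb(1)[of n] Pb(1)[of n] hi[of n] by simp
      also have "\<dots> \<le> e * (2 * M + 2 * S) + C * (4 * M * A / L) + C * (2 * B / L) + (\<integral>x. h n x \<partial>lborel)"
        using e C(1) D2(2)[of n] D6(2)[of n] Zb(2)[of n] Pb(2)[of n]
        by (intro add_mono mult_left_mono order_refl) auto
      also have "\<dots> < r" using eb Lb elim r by linarith
      finally have "(\<integral>x. D n x powr q \<partial>lborel) < r" .
      then show ?case by (simp add: D_def)
    qed
    then show "\<exists>no. \<forall>n\<ge>no. norm ((\<integral>x. \<bar>u n x - v x\<bar> powr q \<partial>lborel) - 0) < r"
      by (simp add: eventually_sequentially)
  qed
qed

section \<open>Sequences of critical points\<close>

lemma powr_add_le:
  fixes x y q :: real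
  assumes "0 \<le> x" "0 \<le> y" "0 < q" shows "(x + y) powr q \<le> 2 powr q * (x powr q + y powr q)"
proof -
  have *: "(a + b) powr q \<le> 2 powr q * (a powr q + b powr q)" if ab: "0 \<le> a" "a \<le> b" for a b :: real
  proof -
    have "(a + b) powr q \<le> (2 * b) powr q" using ab assms by (intro powr_mono2) auto
    also have "\<dots> = 2 powr q * b powr q" using ab by (simp add: powr_mult)
    also have "\<dots> \<le> 2 powr q * (a powr q + b powr q)" by (intro mult_left_mono) auto
    finally show ?thesis .
  qed
  show ?thesis using *[of x y] *[of y x] assms by (cases "x \<le> y") (auto simp: add.commute)
qed

text \<open>The normalised \<open>u\<close> is a competitor for the infimum. It also shows the
  competing set to be nonempty, without which the lower bound from \<open>harmonic_H\<close> would
  say nothing about \<open>Inf\<close>.\<close>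

lemma Lambda0_bounds:
  assumes "u \<in> Hsp" "has_weak_grad u g" "0 < mass u"
  shows "Lambda0 * mass u \<le> gradsq g + (\<integral>x. V x * (u x)\<^sup>2 \<partial>lborel)" "2 \<le> Lambda0"
proof -
  let ?S = "{(\<integral>x. (norm (wgrad w x))\<^sup>2 + V x * (w x)\<^sup>2 \<partial>lborel) | w. w \<in> Hsp \<and> mass w = 1}"
  have Q: "(\<integral>x. (norm (wgrad w x))\<^sup>2 + V x * (w x)\<^sup>2 \<partial>lborel) = gradsq h + (\<integral>x. V x * (w x)\<^sup>2 \<partial>lborel)"
    if "w \<in> Hsp" "has_weak_grad w h" for w h
  proof -
    have "L2 w" "integrable lborel (\<lambda>x. V x * (w x)\<^sup>2)" using that by (auto simp: Hsp_def H1_def)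
    then show ?thesis using gradsq_wgrad[of w h] that by simp
  qed
  have lb: "2 \<le> s" if "s \<in> ?S" for s
  proof -
    from that obtain w where w: "s = (\<integral>x. (norm (wgrad w x))\<^sup>2 + V x * (w x)\<^sup>2 \<partial>lborel)" "w \<in> Hsp" "mass w = 1" by blast
    then obtain h where h: "has_weak_grad w h" "L2 w" "integrable lborel (\<lambda>x. V x * (w x)\<^sup>2)" by (auto simp: Hsp_def H1_def)
    show ?thesis using harmonic_H[OF h(2,1,3)] w(3) unfolding w(1) Q[OF w(2) h(1)] by (simp add: mass_def sqint_def)
  qed
  have u: "L2 u" "integrable lborel (\<lambda>x. V x * (u x)\<^sup>2)" using assms by (auto simp: Hsp_def H1_def)
  define c where "c = 1 / sqrt (mass u)"
  have c2: "c\<^sup>2 = 1 / mass u" using assms(3) by (simp add: c_def power_divide)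
  let ?w = "\<lambda>x. c * u x"
  have wg: "has_weak_grad ?w (\<lambda>x. c *\<^sub>R g x)" by (rule has_weak_grad_scale[OF u(1) assms(2)])
  have Vw: "V x * (?w x)\<^sup>2 = c\<^sup>2 * (V x * (u x)\<^sup>2)" for x by (simp add: power_mult_distrib)
  have wH: "?w \<in> Hsp" using wg L2_scale[OF u(1), of c] u(2) by (auto simp: Hsp_def H1_def Vw simp del: power_mult_distrib)
  have wm: "mass ?w = 1" using sqint_scale[of c u] c2 assms(3) by (simp add: mass_def sqint_def)
  have mem: "gradsq (\<lambda>x. c *\<^sub>R g x) + (\<integral>x. V x * (?w x)\<^sup>2 \<partial>lborel) \<in> ?S"
    using Q[OF wH wg] wH wm by (auto intro!: exI[of _ ?w])
  show "2 \<le> Lambda0" unfolding Lambda0_def by (rule cInf_greatest) (use mem lb in blast)+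
  have "Lambda0 \<le> gradsq (\<lambda>x. c *\<^sub>R g x) + (\<integral>x. V x * (?w x)\<^sup>2 \<partial>lborel)"
    unfolding Lambda0_def by (rule cInf_lower[OF mem]) (use lb in \<open>auto simp: bdd_below_def\<close>)
  also have "\<dots> = (gradsq g + (\<integral>x. V x * (u x)\<^sup>2 \<partial>lborel)) / mass u"
    unfolding gradsq_scale Vw c2 by (simp add: add_divide_distrib)
  finally show "Lambda0 * mass u \<le> gradsq g + (\<integral>x. V x * (u x)\<^sup>2 \<partial>lborel)" using assms(3) by (simp add: field_simps)
qed

text \<open>The situation after all subsequences have been extracted, with bounds by
  \<open>K\<close> that do not depend on \<open>n\<close>; everything about the limit is proved in
  this setting.\<close>

locale critical_sequence =
  fixes p \<mu> K \<Lambda> :: real and R lam :: "nat \<Rightarrow> real" and w :: "nat \<Rightarrow> R3 \<Rightarrow> real" and v :: "R3 \<Rightarrow> real"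
  assumes p: "7/3 < p" "p < 5" and \<mu>: "0 < \<mu>" and R: "filterlim R at_top sequentially"
    and H: "\<And>n. H0 (R n) (w n) (wgrad (w n))" and w0: "\<And>n x. 0 \<le> w n x"
    and wpos: "\<And>n x. x \<in> ball 0 (R n) \<Longrightarrow> 0 < w n x"
    and weak: "\<And>n. weak_sol p (lam n) (ball 0 (R n)) (w n)" and decr: "\<And>n. coord_decr (w n)"
    and M: "\<And>n. sqint (w n) = \<mu>" and AK: "\<And>n. gradsq (wgrad (w n)) \<le> K" and BK: "\<And>n. (\<integral>x. V x * (w n x)\<^sup>2 \<partial>lborel) \<le> K"
    and vm: "v \<in> borel_measurable borel" and v0: "\<And>x. 0 \<le> v x" and lim: "AE x in lborel. (\<lambda>n. w n x) \<longlonglongrightarrow> v x"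
    and vdecr: "\<And>x y. nondeg x \<Longrightarrow> (\<And>i. \<bar>x $ i\<bar> \<le> \<bar>y $ i\<bar>) \<Longrightarrow> v y \<le> v x"
    and lam: "lam \<longlonglongrightarrow> \<Lambda>"
begin

abbreviation G where "G n \<equiv> wgrad (w n)"
definition A where "A n = gradsq (G n)"
definition B where "B n = (\<integral>x. V x * (w n x)\<^sup>2 \<partial>lborel)"
definition C where "C n = (\<integral>x. w n x powr (p + 1) \<partial>lborel)"

lemma p': "1 < p" "1 < p + 1" "2 \<le> p + 1" "p + 1 \<le> 6" "2 < p" "p < 6" "2 < p + 1" "p + 1 < 6" "2 \<le> p" "p \<le> 6"
  using p by auto

lemmas wL = H0_L2(1)[OF H] and gL = H0_L2(2)[OF H]

lemma wm: "w n \<in> borel_measurable borel" by (rule L2_meas[OF wL])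

lemma decr_dilate: "1 \<le> t \<Longrightarrow> w n (t *\<^sub>R x) \<le> w n x"
  by (rule coord_decrD[OF decr]) (simp add: abs_mult mult_le_cancel_right1 mult_right_mono[of 1 t "\<bar>x $ _\<bar>", simplified])

text \<open>The equation tested with its own solution; it ties the multiplier to the energy
  terms.\<close>

lemma Nehari: "A n + B n + lam n * \<mu> = C n"
  using Pohozaev_inequality(1)[OF p'(1) p(2) weak H w0 decr_dilate] M unfolding A_def B_def C_def by simp

lemma v_props: "L2 v" "integrable lborel (\<lambda>x. v x ^ 6)" "integrable lborel (\<lambda>x. V x * (v x)\<^sup>2)"
  and Lq_lim: "2 < s \<Longrightarrow> s < 6 \<Longrightarrow> (\<lambda>n. \<integral>x. \<bar>w n x - v x\<bar> powr s \<partial>lborel) \<longlonglongrightarrow> 0"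
proof -
  have M': "sqint (w n) \<le> \<mu>" for n using M by simp
  note c = compactness[OF H w0 decr M' AK BK vm v0 lim]
  show "L2 v" "integrable lborel (\<lambda>x. v x ^ 6)" "integrable lborel (\<lambda>x. V x * (v x)\<^sup>2)" using c(1-3)[of 4] by auto
  show "2 < s \<Longrightarrow> s < 6 \<Longrightarrow> (\<lambda>n. \<integral>x. \<bar>w n x - v x\<bar> powr s \<partial>lborel) \<longlonglongrightarrow> 0" by (rule c(4))
qed

lemma K0: "0 \<le> K" using AK[of 0] gradsq_nonneg[of "G 0"] by linarith

lemma wq:
  assumes s: "2 \<le> s" "s \<le> 6"
  shows "integrable lborel (\<lambda>x. w n x powr s)" "(\<integral>x. w n x powr s \<partial>lborel) \<le> \<mu> + 4096 * K ^ 3"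
proof -
  have "4096 * gradsq (G n) ^ 3 \<le> 4096 * K ^ 3" using AK gradsq_nonneg by (intro mult_left_mono power_mono) auto
  then show "integrable lborel (\<lambda>x. w n x powr s)" "(\<integral>x. w n x powr s \<partial>lborel) \<le> \<mu> + 4096 * K ^ 3"
    using H0_Lq[OF H s, of n] w0 M[of n] by auto
qed

lemma vq: "2 \<le> s \<Longrightarrow> s \<le> 6 \<Longrightarrow> integrable lborel (\<lambda>x. v x powr s)"
  using Lq_integrable(1)[OF v_props(1,2), of s] v0 by simp

lemma dq:
  assumes s: "2 \<le> s" "s \<le> 6"
  shows "integrable lborel (\<lambda>x. \<bar>w n x - v x\<bar> powr s)"
proof -
  note [measurable] = wm vm
  have i: "integrable lborel (\<lambda>x. 2 powr s * (w n x powr s + v x powr s))" using wq(1)[OF s] vq[OF s] by simp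
  show ?thesis
  proof (rule Bochner_Integration.integrable_bound[OF i])
    have "\<bar>w n x - v x\<bar> powr s \<le> 2 powr s * (w n x powr s + v x powr s)" for x
    proof -
      have "\<bar>w n x - v x\<bar> powr s \<le> (w n x + v x) powr s" using w0[of n x] v0[of x] s by (intro powr_mono2) auto
      also have "\<dots> \<le> 2 powr s * (w n x powr s + v x powr s)" using w0 v0 s by (intro powr_add_le) auto
      finally show ?thesis .
    qed
    then show "AE x in lborel. norm (\<bar>w n x - v x\<bar> powr s) \<le> norm (2 powr s * (w n x powr s + v x powr s))"
      by (intro AE_I2) (simp add: order_trans[OF _ abs_ge_self])
  qed simp
qed

text \<open>\<open>powr_diff_le\<close> bounds the difference by
  \<open>w^(s-1) |w - v| + v^(s-1) |w - v|\<close>, and both terms are small by the uniform Young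
  estimate. It is used with \<open>s = p + 1\<close> for the energy and with \<open>s = p\<close>
  for the equation, where \<open>p > 2\<close> follows from \<open>7/3 < p\<close>.\<close>

lemma powr_L1_lim:
  assumes s: "2 < s" "s < 6"
  shows "integrable lborel (\<lambda>x. \<bar>w n x powr s - v x powr s\<bar>)" "(\<lambda>n. \<integral>x. \<bar>w n x powr s - v x powr s\<bar> \<partial>lborel) \<longlonglongrightarrow> 0"
proof -
  note [measurable] = wm vm
  have s': "2 \<le> s" "s \<le> 6" "1 < s" using s by auto
  show i: "integrable lborel (\<lambda>x. \<bar>w n x powr s - v x powr s\<bar>)" for n
    using wq(1)[OF s'(1,2)] vq[OF s'(1,2)] by (intro integrable_abs) auto
  define b where "b = max (\<mu> + 4096 * K ^ 3) (\<integral>x. v x powr s \<partial>lborel)"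
  have b: "0 \<le> b" unfolding b_def using \<mu> K0 by (simp add: le_max_iff_disj)
  have d: "integrable lborel (\<lambda>x. \<bar>\<bar>w n x - v x\<bar>\<bar> powr s)" for n using dq[OF s'(1,2)] by simp
  have dm: "(\<lambda>x. \<bar>w n x - v x\<bar>) \<in> borel_measurable borel" for n by measurable
  show "(\<lambda>n. \<integral>x. \<bar>w n x powr s - v x powr s\<bar> \<partial>lborel) \<longlonglongrightarrow> 0"
  proof (rule LIMSEQ_I)
    fix r :: real assume r: "0 < r"
    have r': "0 < r / (2 * s)" using r s by simp
    obtain \<delta> where \<delta>: "0 < \<delta>" "\<And>(u :: R3 \<Rightarrow> real) d. u \<in> borel_measurable borel \<Longrightarrow> (\<And>x. 0 \<le> u x) \<Longrightarrow> d \<in> borel_measurable borel \<Longrightarrow>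
      integrable lborel (\<lambda>x. u x powr s) \<Longrightarrow> integrable lborel (\<lambda>x. \<bar>d x\<bar> powr s) \<Longrightarrow>
      (\<integral>x. u x powr s \<partial>lborel) \<le> b \<Longrightarrow> (\<integral>x. \<bar>d x\<bar> powr s \<partial>lborel) < \<delta> \<Longrightarrow>
      \<bar>\<integral>x. u x powr (s - 1) * d x \<partial>lborel\<bar> < r / (2 * s)"
      using Lq_small_imp_nonlinear_small[OF s'(3) r' b] by blast
    have "\<forall>\<^sub>F n in sequentially. (\<integral>x. \<bar>w n x - v x\<bar> powr s \<partial>lborel) < \<delta>"
      by (rule order_tendstoD(2)[OF Lq_lim[OF s] \<delta>(1)])
    then have "\<forall>\<^sub>F n in sequentially. norm ((\<integral>x. \<bar>w n x powr s - v x powr s\<bar> \<partial>lborel) - 0) < r"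
    proof eventually_elim
      case (elim n)
      have e: "(\<integral>x. \<bar>\<bar>w n x - v x\<bar>\<bar> powr s \<partial>lborel) < \<delta>" using elim by simp
      have 1: "\<bar>\<integral>x. w n x powr (s - 1) * \<bar>w n x - v x\<bar> \<partial>lborel\<bar> < r / (2 * s)"
        by (rule \<delta>(2)[OF wm w0 dm wq(1)[OF s'(1,2)] d _ e]) (use wq(2)[OF s'(1,2), of n] in \<open>simp add: b_def\<close>)
      have 2: "\<bar>\<integral>x. v x powr (s - 1) * \<bar>w n x - v x\<bar> \<partial>lborel\<bar> < r / (2 * s)"
        by (rule \<delta>(2)[OF vm v0 dm vq[OF s'(1,2)] d _ e]) (simp add: b_def)
      have i1: "integrable lborel (\<lambda>x. w n x powr (s - 1) * \<bar>w n x - v x\<bar>)"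
        by (rule nonlinear_bound(1)[OF wm w0 dm s'(3) wq(1)[OF s'(1,2)] d zero_less_one])
      have i2: "integrable lborel (\<lambda>x. v x powr (s - 1) * \<bar>w n x - v x\<bar>)"
        by (rule nonlinear_bound(1)[OF vm v0 dm s'(3) vq[OF s'(1,2)] d zero_less_one])
      have "(\<integral>x. \<bar>w n x powr s - v x powr s\<bar> \<partial>lborel)
         \<le> (\<integral>x. s * (w n x powr (s - 1) * \<bar>w n x - v x\<bar> + v x powr (s - 1) * \<bar>w n x - v x\<bar>) \<partial>lborel)"
        using i1 i2 by (intro integral_mono i powr_diff_le w0 v0 s') auto
      also have "\<dots> = s * ((\<integral>x. w n x powr (s - 1) * \<bar>w n x - v x\<bar> \<partial>lborel) + (\<integral>x. v x powr (s - 1) * \<bar>w n x - v x\<bar> \<partial>lborel))"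
        using i1 i2 by simp
      also have "\<dots> < s * (r / (2 * s) + r / (2 * s))" using 1 2 s by (intro mult_strict_left_mono) auto
      also have "\<dots> = r" using s by (simp add: field_simps)
      finally show ?case by simp
    qed
    then show "\<exists>no. \<forall>n\<ge>no. norm ((\<integral>x. \<bar>w n x powr s - v x powr s\<bar> \<partial>lborel) - 0) < r"
      by (simp add: eventually_sequentially)
  qed
qed

lemma C_lim: "C \<longlonglongrightarrow> (\<integral>x. v x powr (p + 1) \<partial>lborel)"
proof -
  have "\<bar>C n - (\<integral>x. v x powr (p + 1) \<partial>lborel)\<bar> \<le> (\<integral>x. \<bar>w n x powr (p + 1) - v x powr (p + 1)\<bar> \<partial>lborel)" for n
    using integral_abs_bound[of lborel "\<lambda>x. w n x powr (p + 1) - v x powr (p + 1)"] wq(1)[OF p'(3,4), of n] vq[OF p'(3,4)]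
    by (simp add: C_def)
  then have "(\<lambda>n. C n - (\<integral>x. v x powr (p + 1) \<partial>lborel)) \<longlonglongrightarrow> 0"
    by (intro Lim_null_comparison[OF _ powr_L1_lim(2)[OF p'(7,8)]] always_eventually allI) simp
  then show ?thesis by (simp add: LIM_zero_iff)
qed

section \<open>Lower bounds for the limiting multiplier\<close>

lemma eventually_test:
  assumes \<phi>: "test_fun UNIV \<phi>" shows "\<forall>\<^sub>F n in sequentially. test_fun (ball 0 (R n)) \<phi>"
proof -
  obtain m where m: "0 < m" "\<And>x. x \<notin> ball 0 m \<Longrightarrow> \<phi> x = 0" using test_fun_supp_ball[OF \<phi>] by metis
  have "\<forall>\<^sub>F n in sequentially. m < R n" using R by (auto simp: filterlim_at_top_dense)
  then show ?thesis
  proof eventually_elim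
    case (elim n)
    show ?case
      by (rule test_funI[OF test_funD[OF \<phi>], of "cball 0 m"]) (use m elim in auto)
  qed
qed

lemma tested:
  assumes \<phi>: "test_fun UNIV \<phi>" and n: "test_fun (ball 0 (R n)) \<phi>"
  shows "(\<integral>x. w n x powr p * \<phi> x \<partial>lborel) = (\<integral>x. w n x * (- lap \<phi> x + V x * \<phi> x) \<partial>lborel) + lam n * (\<integral>x. w n x * \<phi> x \<partial>lborel)"
proof -
  have g: "gip (G n) (grad3 \<phi>) = - (\<integral>x. w n x * lap \<phi> x \<partial>lborel)"
    by (rule gip_grad3_lap[OF wL H0_weak_grad[OF H] \<phi>])
  have i: "integrable lborel (\<lambda>x. w n x * lap \<phi> x)" "integrable lborel (\<lambda>x. w n x * (V x * \<phi> x))"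
    by (intro L2_mult_integrable wL test_fun_L2[OF lap_test[OF \<phi>]] test_fun_L2[OF test_fun_mult[OF \<phi> smooth3_V]])+
  have "(\<integral>x. w n x * (- lap \<phi> x + V x * \<phi> x) \<partial>lborel) = - (\<integral>x. w n x * lap \<phi> x \<partial>lborel) + (\<integral>x. w n x * (V x * \<phi> x) \<partial>lborel)"
    unfolding distrib_left mult_minus_right using i by simp
  then show ?thesis using weak_sol_split[OF weak wL H0_weak_grad[OF H] w0 n] g by simp
qed

text \<open>Derivatives are moved onto \<open>\<psi>\<close>, and the sign of \<open>w n\<close>
  preserves its differential inequality. The left side is nonnegative, which restricts
  \<open>lam n\<close> from below.\<close>

lemma subsolution_bound:
  assumes \<psi>: "test_fun UNIV \<psi>" "\<And>x. 0 \<le> \<psi> x" "\<And>x. - lap \<psi> x + V x * \<psi> x \<le> k * \<psi> x" and n: "test_fun (ball 0 (R n)) \<psi>"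
  shows "(\<integral>x. w n x powr p * \<psi> x \<partial>lborel) \<le> (k + lam n) * (\<integral>x. w n x * \<psi> x \<partial>lborel)"
proof -
  have L: "L2 (\<lambda>x. - lap \<psi> x + V x * \<psi> x)"
    by (intro L2_add L2_minus test_fun_L2[OF lap_test[OF \<psi>(1)]] test_fun_L2[OF test_fun_mult[OF \<psi>(1) smooth3_V]])
  have "(\<integral>x. w n x * (- lap \<psi> x + V x * \<psi> x) \<partial>lborel) \<le> (\<integral>x. k * (w n x * \<psi> x) \<partial>lborel)"
  proof (rule integral_mono[OF L2_mult_integrable[OF wL L]])
    show "integrable lborel (\<lambda>x. k * (w n x * \<psi> x))" using L2_mult_integrable[OF wL test_fun_L2[OF \<psi>(1)]] by simp
    show "w n x * (- lap \<psi> x + V x * \<psi> x) \<le> k * (w n x * \<psi> x)" for x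
      using mult_left_mono[OF \<psi>(3)[of x] w0[of n x]] by (simp add: mult_ac)
  qed
  then show ?thesis using tested[OF \<psi>(1) n] by (simp add: distrib_right)
qed

lemma powr_test_integrable:
  assumes \<phi>: "test_fun UNIV \<phi>" shows "integrable lborel (\<lambda>x. w n x powr p * \<phi> x)"
proof -
  have "integrable lborel (\<lambda>x. \<bar>\<phi> x\<bar> powr (p + 1))"
  proof -
    have "integrable lborel (\<lambda>x. \<phi> x ^ 6)" using test_fun_integrable[OF test_fun_power[OF \<phi>, of 6]] by simp
    then show ?thesis by (rule Lq_integrable(1)[OF test_fun_L2[OF \<phi>] _ p'(3,4)])
  qed
  from nonlinear_bound(1)[OF wm w0 test_fun_measurable[OF \<phi>] p'(2) wq(1)[OF p'(3,4)] this zero_less_one, of n]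
  show ?thesis by simp
qed

text \<open>If \<open>\<Lambda> < -2\<close>, a subsolution with constant slightly above 2 makes the
  right side of \<open>subsolution_bound\<close> strictly negative for large \<open>n\<close>, since
  \<open>w n\<close> and \<open>\<psi>\<close> are both positive near the origin.\<close>

lemma multiplier_ge: "-2 \<le> \<Lambda>"
proof (rule ccontr)
  assume "\<not> -2 \<le> \<Lambda>"
  then have l: "\<Lambda> < -2" by simp
  \<comment> \<open>Dividing by 6 spends half of the gap on \<open>3 * \<eta>\<close> and leaves the
    other half for the distance between \<open>lam n\<close> and \<open>\<Lambda>\<close>.\<close>
  define \<eta> where "\<eta> = min 1 ((-2 - \<Lambda>) / 6)"
  have \<eta>: "0 < \<eta>" "\<eta> \<le> 1" "6 * \<eta> \<le> -2 - \<Lambda>" using l by (auto simp: \<eta>_def min_def)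
  obtain \<psi> where \<psi>: "test_fun UNIV \<psi>" "\<And>x. 0 \<le> \<psi> x" "\<And>x. - lap \<psi> x + V x * \<psi> x \<le> (2 + 3 * \<eta>) * \<psi> x" "0 < \<psi> 0"
    using oscillator_subsolution[OF \<eta>(1,2) zero_less_one] by metis
  have "\<forall>\<^sub>F n in sequentially. lam n < -2 - 3 * \<eta>"
    by (rule order_tendstoD(2)[OF lam]) (use \<eta> l in linarith)
  moreover have "\<forall>\<^sub>F n in sequentially. 0 < R n" using R by (auto simp: filterlim_at_top_dense)
  ultimately have "\<forall>\<^sub>F n in sequentially. lam n < -2 - 3 * \<eta> \<and> 0 < R n \<and> test_fun (ball 0 (R n)) \<psi>"
    using eventually_test[OF \<psi>(1)] by eventually_elim auto
  then obtain n where n: "lam n < -2 - 3 * \<eta>" "0 < R n" "test_fun (ball 0 (R n)) \<psi>" by (auto simp: eventually_sequentially)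
  let ?S = "{x. 0 < \<psi> x} \<inter> ball 0 (R n)"
  have "open ?S" by (intro open_Int open_Collect_less continuous_intros test_fun_continuous[OF \<psi>(1)]) auto
  moreover have "0 \<in> ?S" using \<psi>(4) n by simp
  then have "?S \<noteq> {}" by blast
  ultimately have "0 < (\<integral>x. w n x * \<psi> x \<partial>lborel)"
    by (intro integral_pos_open[of _ ?S] L2_mult_integrable wL test_fun_L2[OF \<psi>(1)]) (use w0 \<psi>(2) wpos in auto)
  then have "(2 + 3 * \<eta> + lam n) * (\<integral>x. w n x * \<psi> x \<partial>lborel) < 0" using n by (intro mult_neg_pos) auto
  moreover have "0 \<le> (\<integral>x. w n x powr p * \<psi> x \<partial>lborel)" using w0 \<psi>(2) by (intro Bochner_Integration.integral_nonneg) auto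
  ultimately show False using subsolution_bound[OF \<psi>(1-3) n(3)] by linarith
qed

text \<open>A nonzero limit keeps the integral of \<open>w n x powr p * \<psi> x\<close> above a
  fixed \<open>m\<close>, since the barriers are bounded below on a fixed box independently of
  \<open>\<eta>\<close>. The other side of \<open>subsolution_bound\<close> is at most a multiple of
  \<open>\<eta> * \<eta>^(-3/4)\<close> and becomes small. The order of the choices is
  \<open>m\<close>, then \<open>\<eta>\<close>, then \<open>n\<close>.\<close>

lemma vanishing:
  assumes l: "\<Lambda> = -2" shows "AE x in lborel. v x = 0"
proof (rule ccontr)
  assume na: "\<not> (AE x in lborel. v x = 0)"
  have "\<exists>y. nondeg y \<and> (\<lambda>n. w n y) \<longlonglongrightarrow> v y \<and> 0 < v y"
  proof (rule ccontr)
    assume no: "\<not> ?thesis"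
    have "AE x in lborel. v x = 0" using AE_nondeg lim
    proof eventually_elim
      case (elim x)
      then show ?case using no v0[of x] by (metis less_le)
    qed
    then show False using na by simp
  qed
  then obtain y where y: "nondeg y" "(\<lambda>n. w n y) \<longlonglongrightarrow> v y" "0 < v y" by blast
  define c where "c = v y / 2"
  have c: "0 < c" "c < v y" using y by (auto simp: c_def)
  define S where "S = box_within y"
  note S = box_within[OF y(1), folded S_def]
  \<comment> \<open>For \<open>\<eta> \<le> 1\<close> the exponent at \<open>x\<close> is at most
    the square of \<open>norm x\<close>, so \<open>b\<close> bounds all these Gaussians from below
    on \<open>S\<close>, independently of \<open>\<eta>\<close>.\<close>
  define b where "b = exp (- (norm y)\<^sup>2)"
  have b: "0 < b" by (simp add: b_def)
  define m where "m = c powr p * (b / 4) * measure lborel S"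
  have Si: "integrable lborel (\<lambda>x. k * indicator S x)" for k :: real using S(4,5) by simp
  have m: "0 < m" using c b S(6) by (simp add: m_def)
  obtain Gb where Gb: "0 \<le> Gb" "\<And>\<eta>. 0 < \<eta> \<Longrightarrow> \<eta> \<le> 1/2 \<Longrightarrow> L2 (gauss (osc \<eta>) 0) \<and> sqint (gauss (osc \<eta>) 0) \<le> Gb / (sqrt \<eta>) ^ 3"
    using gauss_sqint_bound by blast
  define Q where "Q = sqrt (\<mu> * Gb)"
  have Q0: "0 \<le> Q" by (simp add: Q_def \<mu> Gb(1) less_imp_le)
  \<comment> \<open>\<open>\<eta> = s^4\<close> clears the roots: \<open>\<eta>^(3/4) = s^3\<close>,
    so the upper bound becomes \<open>4 * s * Q\<close>, and this \<open>s\<close> makes it at most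
    \<open>m / 2\<close>.\<close>
  define s where "s = min (1/2) (m / (8 * (Q + 1)))"
  have s: "0 < s" "s \<le> 1/2" "s \<le> m / (8 * (Q + 1))" using m Q0 unfolding s_def by (simp_all only: min.cobounded1 min.cobounded2) simp
  define \<eta> where "\<eta> = s ^ 4"
  have "s ^ 4 \<le> (1/2) ^ 4" using s by (intro power_mono) auto
  then have \<eta>: "0 < \<eta>" "\<eta> \<le> 1" "\<eta> \<le> 1/2" using s by (auto simp: \<eta>_def power_divide)
  obtain \<psi> where \<psi>: "test_fun UNIV \<psi>" "\<And>x. 0 \<le> \<psi> x" "\<And>x. \<psi> x \<le> gauss (osc \<eta>) 0 x"
    "\<And>x. - lap \<psi> x + V x * \<psi> x \<le> (2 + 3 * \<eta>) * \<psi> x" "\<And>x. b \<le> gauss (osc \<eta>) 0 x \<Longrightarrow> gauss (osc \<eta>) 0 x / 4 \<le> \<psi> x"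
    using oscillator_subsolution[OF \<eta>(1,2) b] by metis
  have \<psi>S: "b / 4 \<le> \<psi> x" if "x \<in> S" for x
  proof -
    have "norm x \<le> norm y" using that S(3) by auto
    then have "(norm x)\<^sup>2 \<le> (norm y)\<^sup>2" by (intro power_mono) auto
    moreover have "quad (osc \<eta>) 0 x \<le> (norm x)\<^sup>2"
    proof -
      have "\<eta> * (x $ 3)\<^sup>2 \<le> 1 * (x $ 3)\<^sup>2" using \<eta> by (intro mult_right_mono) auto
      moreover have "quad (osc \<eta>) 0 x = (x $ 1)\<^sup>2 / 2 + (x $ 2)\<^sup>2 / 2 + \<eta> * (x $ 3)\<^sup>2"
        by (simp add: quad_def sum_3 osc_simps)
      moreover have "(norm x)\<^sup>2 = (x $ 1)\<^sup>2 + (x $ 2)\<^sup>2 + (x $ 3)\<^sup>2" by (simp add: norm_R3)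
      ultimately show ?thesis using zero_le_power2[of "x $ 1"] zero_le_power2[of "x $ 2"] by argo
    qed
    ultimately have "quad (osc \<eta>) 0 x \<le> (norm y)\<^sup>2" by linarith
    then have "b \<le> gauss (osc \<eta>) 0 x" by (simp add: b_def gauss_def)
    then show ?thesis using \<psi>(5)[of x] by linarith
  qed
  have "\<forall>\<^sub>F n in sequentially. lam n < -2 + \<eta>" by (rule order_tendstoD(2)[OF lam]) (use \<eta> l in simp)
  moreover have "\<forall>\<^sub>F n in sequentially. c < w n y" by (rule order_tendstoD(1)[OF y(2) c(2)])
  ultimately have "\<forall>\<^sub>F n in sequentially. lam n < -2 + \<eta> \<and> c < w n y \<and> test_fun (ball 0 (R n)) \<psi>"
    using eventually_test[OF \<psi>(1)] by eventually_elim auto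
  then obtain n where n: "lam n < -2 + \<eta>" "c < w n y" "test_fun (ball 0 (R n)) \<psi>" by (auto simp: eventually_sequentially)
  have "m = (\<integral>x. c powr p * (b / 4) * indicator S x \<partial>lborel)" using S(4) by (simp add: m_def)
  also have "\<dots> \<le> (\<integral>x. w n x powr p * \<psi> x \<partial>lborel)"
  proof (rule integral_mono[OF Si powr_test_integrable[OF \<psi>(1)]])
    fix x
    show "c powr p * (b / 4) * indicator S x \<le> w n x powr p * \<psi> x"
    proof (cases "x \<in> S")
      case True
      have "w n y \<le> w n x" by (rule box_within_coord_decr[OF decr]) (use True in \<open>simp add: S_def\<close>)
      then have "c \<le> w n x" using n by linarith
      then have "c powr p \<le> w n x powr p" using c p' by (intro powr_mono2) auto
      then have "c powr p * (b / 4) \<le> w n x powr p * \<psi> x" using \<psi>S[OF True] b by (intro mult_mono) auto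
      then show ?thesis using True by simp
    qed (use \<psi>(2) in simp)
  qed
  also have "\<dots> \<le> (2 + 3 * \<eta> + lam n) * (\<integral>x. w n x * \<psi> x \<partial>lborel)" by (rule subsolution_bound[OF \<psi>(1,2,4) n(3)])
  also have "\<dots> \<le> (4 * \<eta>) * (\<integral>x. w n x * \<psi> x \<partial>lborel)"
    using n w0 \<psi>(2) by (intro mult_right_mono Bochner_Integration.integral_nonneg) auto
  also have "\<dots> \<le> (4 * \<eta>) * (Q / s ^ 3)"
  proof (rule mult_left_mono)
    have L: "L2 (gauss (osc \<eta>) 0)" "sqint (gauss (osc \<eta>) 0) \<le> Gb / (sqrt \<eta>) ^ 3" using Gb(2)[OF \<eta>(1,3)] by auto
    have "sqrt \<eta> = s^2" unfolding \<eta>_def using s by (simp add: real_sqrt_power_even power4_eq_xxxx real_sqrt_mult power2_eq_square)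
    then have s6: "(sqrt \<eta>) ^ 3 = (s ^ 3)\<^sup>2" by (simp flip: power_mult)
    have "sqint \<psi> \<le> sqint (gauss (osc \<eta>) 0)"
      unfolding sqint_def using \<psi>(2,3) by (intro integral_mono L2_sq L test_fun_L2[OF \<psi>(1)] power_mono) auto
    then have q: "sqint \<psi> \<le> Gb / (s ^ 3)\<^sup>2" using L(2) s6 by simp
    have "(\<integral>x. w n x * \<psi> x \<partial>lborel) \<le> sqrt (sqint (w n) * sqint \<psi>)"
      by (rule real_le_rsqrt) (rule L2_Cauchy_Schwarz[OF wL test_fun_L2[OF \<psi>(1)]])
    also have "\<dots> \<le> sqrt (\<mu> * (Gb / (s ^ 3)\<^sup>2))" using q M \<mu> by (intro real_sqrt_le_mono mult_mono) (auto simp: sqint_nonneg)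
    also have "\<dots> = Q / \<bar>s ^ 3\<bar>" by (simp only: Q_def times_divide_eq_right real_sqrt_divide real_sqrt_abs)
    also have "\<dots> = Q / s ^ 3" using s by simp
    finally show "(\<integral>x. w n x * \<psi> x \<partial>lborel) \<le> Q / s ^ 3" .
  qed (use \<eta> in simp)
  also have "\<dots> = 4 * s * Q" using s by (simp add: \<eta>_def field_simps power4_eq_xxxx power3_eq_cube)
  also have "\<dots> \<le> 4 * (m / (8 * (Q + 1))) * Q" using s Q0 by (intro mult_right_mono mult_left_mono) auto
  also have "\<dots> \<le> m / 2" using m Q0 by (simp add: field_simps)
  finally show False using m by simp
qed

lemma wHsp: "w n \<in> Hsp"
  using wL H0_weak_grad[OF H] H0_V(2)[OF H] by (auto simp: Hsp_def H1_def)

text \<open>\<open>Lambda0\<close> is evaluated through the sequence itself: in the borderline case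
  \<open>Nehari\<close> makes the quadratic form of \<open>w n\<close> tend to
  \<open>2 * \<mu>\<close>, so the functions \<open>w n\<close> serve as trial functions for
  \<open>Lambda0 \<le> 2\<close>, and \<open>harmonic_H\<close> gives the reverse
  inequality.\<close>

lemma multiplier_gt:
  assumes E: "(\<lambda>n. (A n + B n) / 2 - C n / (p + 1)) \<longlonglongrightarrow> \<beta>" and \<beta>: "\<beta> \<noteq> 1/2 * Lambda0 * \<mu>"
  shows "-2 < \<Lambda>"
proof (rule ccontr)
  assume "\<not> -2 < \<Lambda>"
  then have l: "\<Lambda> = -2" using multiplier_ge by simp
  have "(\<integral>x. v x powr (p + 1) \<partial>lborel) = (\<integral>x. 0 \<partial>(lborel :: R3 measure))"
    using vanishing[OF l] vm by (intro integral_cong_AE) (auto elim!: eventually_mono)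
  then have C0: "C \<longlonglongrightarrow> 0" using C_lim by simp
  have AB: "(\<lambda>n. A n + B n) \<longlonglongrightarrow> 2 * \<mu>"
  proof -
    have "(\<lambda>n. C n - lam n * \<mu>) \<longlonglongrightarrow> 0 - (-2) * \<mu>" using lam l by (intro tendsto_intros C0) auto
    moreover have "C n - lam n * \<mu> = A n + B n" for n using Nehari[of n] by simp
    ultimately show ?thesis by simp
  qed
  have "(\<lambda>n. (A n + B n) / 2 - C n / (p + 1)) \<longlonglongrightarrow> 2 * \<mu> / 2 - 0 / (p + 1)" by (intro tendsto_intros AB C0) (use p in auto)
  then have b: "\<beta> = \<mu>" using LIMSEQ_unique[OF E] by simp
  have m: "mass (w n) = \<mu>" for n using M by (simp add: mass_def sqint_def)
  have "Lambda0 * \<mu> \<le> A n + B n" for n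
    using Lambda0_bounds(1)[OF wHsp H0_weak_grad[OF H]] m \<mu> by (simp add: A_def B_def)
  then have "Lambda0 * \<mu> \<le> 2 * \<mu>" by (intro LIMSEQ_le_const[OF AB]) auto
  then have "Lambda0 \<le> 2" using \<mu> by simp
  moreover have "2 \<le> Lambda0" using Lambda0_bounds(2)[OF wHsp H0_weak_grad[OF H]] m \<mu> by simp
  ultimately have "Lambda0 = 2" by simp
  then show False using \<beta> b by simp
qed

section \<open>Strong convergence from coercivity\<close>

definition Dir where "Dir m n = gradsq (\<lambda>x. G m x - G n x) + (\<integral>x. V x * (w m x - w n x)\<^sup>2 \<partial>lborel)"

lemma Dir_commute: "Dir m n = Dir n m"
  by (simp add: Dir_def gradsq_diff_commute[of "G m"] power2_commute[of "w m _"])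

text \<open>With \<open>R n \<le> R m\<close> the function \<open>w n\<close> may be inserted into
  the equation of \<open>w m\<close>; the equation of \<open>w n\<close> enters through
  \<open>Nehari\<close>. Equal masses turn the mixed mass term into the squared distance
  \<open>d\<close>.\<close>

lemma Dir_bound:
  assumes le: "R n \<le> R m" and \<kappa>: "0 < \<kappa>" "\<kappa> \<le> 2" "-2 + \<kappa> \<le> lam m"
  shows "\<kappa> / 2 * Dir m n \<le> (C n - C m) + 2 * (\<integral>x. w m x powr p * (w m x - w n x) \<partial>lborel) + (lam m - lam n) * \<mu>"
    "2 * sqint (\<lambda>x. w m x - w n x) \<le> Dir m n" "0 \<le> Dir m n"
proof -
  note Hn = H0_mono[OF H[of n] le]
  note HD = H0_diff[OF H[of m] Hn]
  define d where "d = sqint (\<lambda>x. w m x - w n x)"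
  show h: "2 * sqint (\<lambda>x. w m x - w n x) \<le> Dir m n"
    unfolding Dir_def by (rule harmonic_H[OF H0_L2(1)[OF HD] H0_weak_grad[OF HD] H0_V(2)[OF HD]])
  have d0: "0 \<le> d" by (simp add: d_def sqint_nonneg)
  show D0: "0 \<le> Dir m n" using h d0 by (simp add: d_def)
  define P where "P = (\<integral>x. w m x powr p * w n x \<partial>lborel)"
  define X where "X = (\<integral>x. V x * w m x * w n x \<partial>lborel)"
  have eq: "gip (G m) (G n) + X + lam m * (\<integral>x. w m x * w n x \<partial>lborel) = P"
    unfolding X_def P_def by (rule weak_sol_H0[OF p'(1) p(2) weak H w0 Hn])
  have mn: "2 * (\<integral>x. w m x * w n x \<partial>lborel) = 2 * \<mu> - d"
    using sqint_diff[OF wL wL, of m n] M by (simp add: d_def)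
  have VD: "(\<integral>x. V x * (w m x - w n x)\<^sup>2 \<partial>lborel) = B m - 2 * X + B n"
  proof -
    have i: "integrable lborel (\<lambda>x. V x * (w m x)\<^sup>2)" "integrable lborel (\<lambda>x. V x * (w n x)\<^sup>2)" "integrable lborel (\<lambda>x. V x * w m x * w n x)"
      using H0_V(2)[OF H] L2_mult_integrable[OF H0_V(1)[OF H] wL] by auto
    have "(\<integral>x. V x * (w m x - w n x)\<^sup>2 \<partial>lborel) = (\<integral>x. V x * (w m x)\<^sup>2 - 2 * (V x * w m x * w n x) + V x * (w n x)\<^sup>2 \<partial>lborel)"
      by (intro Bochner_Integration.integral_cong) (auto simp: power2_eq_square algebra_simps)
    then show ?thesis using i by (simp add: B_def X_def)
  qed
  have GD: "gradsq (\<lambda>x. G m x - G n x) = A m - 2 * gip (G m) (G n) + A n"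
    unfolding A_def by (rule gradsq_diff[OF gL gL])
  have "2 * (lam m * (\<integral>x. w m x * w n x \<partial>lborel)) = lam m * (2 * \<mu> - d)" unfolding mn[symmetric] by simp
  then have D1: "Dir m n = C m + C n - 2 * P + (lam m - lam n) * \<mu> - lam m * d"
    using eq Nehari[of m] Nehari[of n] unfolding Dir_def VD GD by (simp add: algebra_simps)
  have Pi: "integrable lborel (\<lambda>x. w m x powr p * w n x)"
  proof -
    have "integrable lborel (\<lambda>x. \<bar>w n x\<bar> powr (p + 1))" using wq(1)[OF p'(3,4)] w0 by simp
    from nonlinear_bound(1)[OF wm w0 wm p'(2) wq(1)[OF p'(3,4)] this zero_less_one] show ?thesis by simp
  qed
  have pp: "w m x powr p * w m x = w m x powr (p + 1)" for x using powr_pred_mult[OF w0, where q="p+1"] by simp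
  have CP: "(\<integral>x. w m x powr p * (w m x - w n x) \<partial>lborel) = C m - P"
    using Pi wq(1)[OF p'(3,4), of m] by (simp add: right_diff_distrib pp C_def P_def)
  \<comment> \<open>Coercivity: \<open>lam m \<ge> -2 + \<kappa>\<close> and
    \<open>2 * d \<le> Dir m n\<close> give \<open>Dir m n + lam m * d \<ge> Dir m n - (2 -
    \<kappa>) * d \<ge> \<kappa> / 2 * Dir m n\<close>.\<close>
  have "(2 - \<kappa>) * d \<le> (2 - \<kappa>) * (Dir m n / 2)" using h \<kappa> by (intro mult_left_mono) (auto simp: d_def)
  moreover have "(-2 + \<kappa>) * d \<le> lam m * d" using \<kappa> d0 by (intro mult_right_mono)
  ultimately have "\<kappa> / 2 * Dir m n \<le> Dir m n + lam m * d" by (simp add: algebra_simps)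
  then show "\<kappa> / 2 * Dir m n \<le> (C n - C m) + 2 * (\<integral>x. w m x powr p * (w m x - w n x) \<partial>lborel) + (lam m - lam n) * \<mu>"
    unfolding CP D1 by simp
qed

lemma Dir_Cauchy:
  assumes l: "-2 < \<Lambda>" and e: "0 < e"
  shows "\<exists>N. \<forall>m\<ge>N. \<forall>n\<ge>N. Dir m n < e"
proof -
  define \<kappa> where "\<kappa> = min 2 ((\<Lambda> + 2) / 2)"
  have \<kappa>: "0 < \<kappa>" "\<kappa> \<le> 2" "-2 + \<kappa> < \<Lambda>" using l by (auto simp: \<kappa>_def min_def field_simps)
  \<comment> \<open>The right side of \<open>Dir_bound\<close> will be less than
    \<open>4 * r\<close>, which is \<open>\<kappa> / 2\<close> times \<open>e / 2\<close>.\<close>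
  define r where "r = \<kappa> * e / 16"
  have r: "0 < r" using \<kappa> e by (simp add: r_def)
  define b where "b = \<mu> + 4096 * K ^ 3"
  have b: "0 \<le> b" using \<mu> K0 by (simp add: b_def)
  obtain \<delta> where \<delta>: "0 < \<delta>" "\<And>(u :: R3 \<Rightarrow> real) d. u \<in> borel_measurable borel \<Longrightarrow> (\<And>x. 0 \<le> u x) \<Longrightarrow> d \<in> borel_measurable borel \<Longrightarrow>
    integrable lborel (\<lambda>x. u x powr (p + 1)) \<Longrightarrow> integrable lborel (\<lambda>x. \<bar>d x\<bar> powr (p + 1)) \<Longrightarrow>
    (\<integral>x. u x powr (p + 1) \<partial>lborel) \<le> b \<Longrightarrow> (\<integral>x. \<bar>d x\<bar> powr (p + 1) \<partial>lborel) < \<delta> \<Longrightarrow>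
    \<bar>\<integral>x. u x powr (p + 1 - 1) * d x \<partial>lborel\<bar> < r"
    using Lq_small_imp_nonlinear_small[OF p'(2) r b] by blast
  define Cv where "Cv = (\<integral>x. v x powr (p + 1) \<partial>lborel)"
  \<comment> \<open>Accounts for the factor \<open>2 powr (p + 1)\<close> that appears when
    \<open>w m - w n\<close> is split through \<open>v\<close>, and for the two resulting
    terms.\<close>
  define \<delta>' where "\<delta>' = \<delta> / (2 * 2 powr (p + 1))"
  have \<delta>': "0 < \<delta>'" using \<delta>(1) by (simp add: \<delta>'_def)
  have "\<forall>\<^sub>F n in sequentially. (\<integral>x. \<bar>w n x - v x\<bar> powr (p + 1) \<partial>lborel) < \<delta>'"
    by (rule order_tendstoD(2)[OF Lq_lim[OF p'(7,8)] \<delta>'])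
  moreover have "\<forall>\<^sub>F n in sequentially. dist (C n) Cv < r / 2" using tendstoD[OF C_lim, of "r/2"] r by (simp add: Cv_def)
  moreover have "\<forall>\<^sub>F n in sequentially. dist (lam n) \<Lambda> < r / (2 * \<mu>)" using tendstoD[OF lam, of "r / (2 * \<mu>)"] r \<mu> by simp
  moreover have "\<forall>\<^sub>F n in sequentially. -2 + \<kappa> < lam n" by (rule order_tendstoD(1)[OF lam \<kappa>(3)])
  ultimately have "\<forall>\<^sub>F n in sequentially. (\<integral>x. \<bar>w n x - v x\<bar> powr (p + 1) \<partial>lborel) < \<delta>' \<and> dist (C n) Cv < r / 2
     \<and> dist (lam n) \<Lambda> < r / (2 * \<mu>) \<and> -2 + \<kappa> < lam n" by eventually_elim blast
  then obtain N where N: "\<And>n. n \<ge> N \<Longrightarrow> (\<integral>x. \<bar>w n x - v x\<bar> powr (p + 1) \<partial>lborel) < \<delta>'" "\<And>n. n \<ge> N \<Longrightarrow> dist (C n) Cv < r / 2"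
    "\<And>n. n \<ge> N \<Longrightarrow> dist (lam n) \<Lambda> < r / (2 * \<mu>)" "\<And>n. n \<ge> N \<Longrightarrow> -2 + \<kappa> < lam n"
    by (auto simp: eventually_sequentially)
  have main: "Dir m n < e" if m: "m \<ge> N" and n: "n \<ge> N" and le: "R n \<le> R m" for m n
  proof -
    note [measurable] = wm vm
    have dm: "(\<lambda>x. w m x - w n x) \<in> borel_measurable borel" by measurable
    have ptw: "\<bar>w m x - w n x\<bar> powr (p + 1) \<le> 2 powr (p + 1) * (\<bar>w m x - v x\<bar> powr (p + 1) + \<bar>w n x - v x\<bar> powr (p + 1))" for x
    proof -
      have "\<bar>w m x - w n x\<bar> powr (p + 1) \<le> (\<bar>w m x - v x\<bar> + \<bar>w n x - v x\<bar>) powr (p + 1)" using p' by (intro powr_mono2) auto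
      also have "\<dots> \<le> 2 powr (p + 1) * (\<bar>w m x - v x\<bar> powr (p + 1) + \<bar>w n x - v x\<bar> powr (p + 1))"
        using p' by (intro powr_add_le) auto
      finally show ?thesis .
    qed
    have i: "integrable lborel (\<lambda>x. 2 powr (p + 1) * (\<bar>w m x - v x\<bar> powr (p + 1) + \<bar>w n x - v x\<bar> powr (p + 1)))"
      using dq[OF p'(3,4), of m] dq[OF p'(3,4), of n] by simp
    have di: "integrable lborel (\<lambda>x. \<bar>w m x - w n x\<bar> powr (p + 1))"
      by (rule H0_Lq(1)[OF H0_diff[OF H[of m] H0_mono[OF H[of n] le]] p'(3,4)])
    have "(\<integral>x. \<bar>w m x - w n x\<bar> powr (p + 1) \<partial>lborel) \<le> (\<integral>x. 2 powr (p + 1) * (\<bar>w m x - v x\<bar> powr (p + 1) + \<bar>w n x - v x\<bar> powr (p + 1)) \<partial>lborel)"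
      by (rule integral_mono[OF di i ptw])
    also have "\<dots> = 2 powr (p + 1) * ((\<integral>x. \<bar>w m x - v x\<bar> powr (p + 1) \<partial>lborel) + (\<integral>x. \<bar>w n x - v x\<bar> powr (p + 1) \<partial>lborel))"
      using dq[OF p'(3,4), of m] dq[OF p'(3,4), of n] by simp
    also have "\<dots> < 2 powr (p + 1) * (\<delta>' + \<delta>')" using N(1)[OF m] N(1)[OF n] by (intro mult_strict_left_mono add_strict_mono) auto
    also have "\<dots> = \<delta>" by (simp add: \<delta>'_def)
    finally have ds: "(\<integral>x. \<bar>w m x - w n x\<bar> powr (p + 1) \<partial>lborel) < \<delta>" .
    have "\<bar>\<integral>x. w m x powr (p + 1 - 1) * (w m x - w n x) \<partial>lborel\<bar> < r"
      by (rule \<delta>(2)[OF wm w0 dm wq(1)[OF p'(3,4)] di _ ds]) (use wq(2)[OF p'(3,4), of m] in \<open>simp add: b_def\<close>)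
    then have a1: "(\<integral>x. w m x powr p * (w m x - w n x) \<partial>lborel) < r" by simp
    have a2: "C n - C m < r" using N(2)[OF m] N(2)[OF n] unfolding dist_real_def by linarith
    have "lam m - lam n < r / \<mu>" using N(3)[OF m] N(3)[OF n] by (simp add: dist_real_def)
    then have a3: "(lam m - lam n) * \<mu> < r" using \<mu> by (simp add: field_simps)
    have "\<kappa> / 2 * Dir m n < 4 * r" using Dir_bound(1)[OF le \<kappa>(1,2) less_imp_le[OF N(4)[OF m]]] a1 a2 a3 by linarith
    also have "\<dots> = \<kappa> / 2 * (e / 2)" by (simp add: r_def)
    finally have "Dir m n < e / 2" using \<kappa> by simp
    then show ?thesis using e by simp
  qed
  \<comment> \<open>\<open>Dir\<close> is symmetric, so the index with the larger ball can always be
    put first.\<close>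
  have "Dir m n < e" if "m \<ge> N" "n \<ge> N" for m n
    using main[OF that] main[OF that(2,1)] Dir_commute[of m n] by (cases "R n \<le> R m") auto
  then show ?thesis by blast
qed

lemma sqint_le_Dir: "2 * sqint (\<lambda>x. w m x - w n x) \<le> Dir m n"
proof (cases "R n \<le> R m")
  case True
  note HD = H0_diff[OF H[of m] H0_mono[OF H[of n] True]]
  show ?thesis unfolding Dir_def by (rule harmonic_H[OF H0_L2(1)[OF HD] H0_weak_grad[OF HD] H0_V(2)[OF HD]])
next
  case False
  then have le: "R m \<le> R n" by simp
  note HD = H0_diff[OF H0_mono[OF H[of m] le] H[of n]]
  show ?thesis unfolding Dir_def by (rule harmonic_H[OF H0_L2(1)[OF HD] H0_weak_grad[OF HD] H0_V(2)[OF HD]])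
qed

lemma V_diff_nonneg: "0 \<le> (\<integral>x. V x * (f x)\<^sup>2 \<partial>lborel)"
  using V_nonneg by (intro Bochner_Integration.integral_nonneg) auto

text \<open>Completeness produces limits of the functions and of each gradient component; the former
  is identified with \<open>v\<close> along an almost everywhere convergent subsequence. The
  weighted part follows from Fatou's lemma in the second index of the Cauchy estimate.\<close>

lemma strong_limit:
  assumes l: "-2 < \<Lambda>"
  obtains g where "L2lim w v" "\<And>i. L2lim (\<lambda>n x. G n x $ i) (\<lambda>x. g x $ i)" "has_weak_grad v g"
    "(\<lambda>n. \<integral>x. V x * (w n x - v x)\<^sup>2 \<partial>lborel) \<longlonglongrightarrow> 0"
proof -
  note Cau = Dir_Cauchy[OF l]
  have w_le: "sqint (\<lambda>x. w m x - w n x) \<le> Dir m n" for m n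
    using sqint_le_Dir[of m n] sqint_nonneg[of "\<lambda>x. w m x - w n x"] by linarith
  have g_le: "sqint (\<lambda>x. G m x $ i - G n x $ i) \<le> Dir m n" for m n i
    using gradsq_ge[of "\<lambda>x. G m x - G n x" i] V_diff_nonneg[of "\<lambda>x. w m x - w n x"] by (simp add: Dir_def)
  have V_le: "(\<integral>x. V x * (w m x - w n x)\<^sup>2 \<partial>lborel) \<le> Dir m n" for m n
    using gradsq_nonneg[of "\<lambda>x. G m x - G n x"] by (simp add: Dir_def)
  have cw: "\<exists>N. \<forall>m\<ge>N. \<forall>n\<ge>N. sqint (\<lambda>x. w m x - w n x) < \<epsilon>" if "0 < \<epsilon>" for \<epsilon>
    using Cau[OF that] w_le by (meson le_less_trans)
  have cg: "\<exists>N. \<forall>m\<ge>N. \<forall>n\<ge>N. sqint (\<lambda>x. G m x $ i - G n x $ i) < \<epsilon>" if "0 < \<epsilon>" for \<epsilon> i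
    using Cau[OF that] g_le by (meson le_less_trans)
  obtain f where f: "L2lim w f" using L2_complete[OF wL cw] by blast
  obtain r where r: "strict_mono r" "AE x in lborel. (\<lambda>k. w (r k) x) \<longlonglongrightarrow> f x" using L2lim_AE_subseq[OF f] by blast
  have fv: "AE x in lborel. f x = v x"
    using r(2) lim
  proof eventually_elim
    case (elim x)
    show ?case by (rule LIMSEQ_unique[OF elim(1) LIMSEQ_subseq_LIMSEQ[OF elim(2) r(1), unfolded o_def]])
  qed
  have fL: "L2 f" using f by (simp add: L2lim_def)
  have "sqint (\<lambda>x. w n x - v x) = sqint (\<lambda>x. w n x - f x)" for n
    by (rule sqint_cong_AE[OF L2_diff[OF wL v_props(1)] L2_diff[OF wL fL]]) (use fv in eventually_elim, simp)
  then have wv: "L2lim w v" using f v_props(1) by (simp add: L2lim_def)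
  have "\<exists>h. L2lim (\<lambda>n x. G n x $ i) h" for i
    by (rule L2_complete[OF gL cg])
  then obtain h where h: "\<And>i. L2lim (\<lambda>n x. G n x $ i) (h i)" by metis
  define g where "g x = (\<chi> i. h i x)" for x
  have gl: "L2lim (\<lambda>n x. G n x $ i) (\<lambda>x. g x $ i)" for i using h by (simp add: g_def)
  have vg: "has_weak_grad v g" unfolding has_weak_grad_def
  proof (intro conjI allI impI)
    show "L2 (\<lambda>x. g x $ i)" for i using gl by (simp add: L2lim_def)
    fix \<phi> :: "R3 \<Rightarrow> real" and i assume \<phi>: "test_fun UNIV \<phi>"
    have "(\<lambda>n. \<integral>x. w n x * pderiv3 i \<phi> x \<partial>lborel) \<longlonglongrightarrow> (\<integral>x. v x * pderiv3 i \<phi> x \<partial>lborel)"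
      by (intro L2lim_mult wv L2lim_const test_fun_L2[OF test_fun_pderiv3[OF \<phi>]])
    moreover have "(\<lambda>n. \<integral>x. w n x * pderiv3 i \<phi> x \<partial>lborel) \<longlonglongrightarrow> - (\<integral>x. g x $ i * \<phi> x \<partial>lborel)"
      unfolding has_weak_grad_eq[OF H0_weak_grad[OF H] \<phi>]
      by (intro tendsto_minus L2lim_mult gl L2lim_const test_fun_L2[OF \<phi>])
    ultimately show "(\<integral>x. v x * pderiv3 i \<phi> x \<partial>lborel) = - (\<integral>x. g x $ i * \<phi> x \<partial>lborel)" by (rule LIMSEQ_unique)
  qed
  have "(\<lambda>n. \<integral>x. V x * (w n x - v x)\<^sup>2 \<partial>lborel) \<longlonglongrightarrow> 0"
  proof (rule LIMSEQ_I)
    fix e :: real assume e: "0 < e"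
    then obtain N where N: "\<forall>m\<ge>N. \<forall>n\<ge>N. Dir m n < e / 2" using Cau[of "e/2"] by auto
    have "(\<integral>x. V x * (w n x - v x)\<^sup>2 \<partial>lborel) \<le> e / 2" if n: "n \<ge> N" for n
    proof (rule Fatou_integral(2)[where F="\<lambda>k x. V x * (w n x - w k x)\<^sup>2"])
      note [measurable] = wm vm
      show "integrable lborel (\<lambda>x. V x * (w n x - w k x)\<^sup>2)" for k
      proof (cases "R k \<le> R n")
        case True
        show ?thesis by (rule H0_V(2)[OF H0_diff[OF H[of n] H0_mono[OF H[of k] True]]])
      next
        case False
        then have le: "R n \<le> R k" by simp
        show ?thesis by (rule H0_V(2)[OF H0_diff[OF H0_mono[OF H[of n] le] H[of k]]])
      qed
      show "0 \<le> V x * (w n x - w k x)\<^sup>2" for k x using V_nonneg by simp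
      show "(\<lambda>x. V x * (w n x - v x)\<^sup>2) \<in> borel_measurable borel" by measurable
      show "AE x in lborel. (\<lambda>k. V x * (w n x - w k x)\<^sup>2) \<longlonglongrightarrow> V x * (w n x - v x)\<^sup>2"
        using lim by eventually_elim (intro tendsto_intros)
      show "\<forall>\<^sub>F k in sequentially. (\<integral>x. V x * (w n x - w k x)\<^sup>2 \<partial>lborel) \<le> e / 2"
        using eventually_ge_at_top[of N]
      proof eventually_elim
        case (elim k)
        then show ?case using N n V_le[of n k] by fastforce
      qed
    qed
    then show "\<exists>no. \<forall>n\<ge>no. norm ((\<integral>x. V x * (w n x - v x)\<^sup>2 \<partial>lborel) - 0) < e"
      using e V_diff_nonneg by (intro exI[of _ N]) (fastforce simp: abs_of_nonneg)
  qed
  then show ?thesis using that wv gl vg by blast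
qed

text \<open>Every test function is eventually supported in \<open>ball 0 (R n)\<close>, so the
  equation can be used for large \<open>n\<close>; against a bounded \<open>\<phi>\<close>, the
  nonlinear term passes to the limit by \<open>L^1\<close> convergence of the powers.\<close>

lemma limit_equation:
  assumes wv: "L2lim w v" and gl: "\<And>i. L2lim (\<lambda>n x. G n x $ i) (\<lambda>x. g x $ i)" and \<phi>: "test_fun UNIV \<phi>"
  shows "gip g (grad3 \<phi>) + (\<integral>x. v x * (V x * \<phi> x) \<partial>lborel) + \<Lambda> * (\<integral>x. v x * \<phi> x \<partial>lborel) = (\<integral>x. v x powr p * \<phi> x \<partial>lborel)"
    "integrable lborel (\<lambda>x. v x powr p * \<phi> x)"
proof -
  note [measurable] = wm vm test_fun_measurable[OF \<phi>]
  obtain K' where K': "0 < K'" "\<And>x. \<bar>\<phi> x\<bar> \<le> K'" using test_fun_bounded[OF \<phi>] by metis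
  have l: "(\<lambda>n. gip (G n) (grad3 \<phi>) + (\<integral>x. w n x * (V x * \<phi> x) \<partial>lborel) + lam n * (\<integral>x. w n x * \<phi> x \<partial>lborel))
     \<longlonglongrightarrow> gip g (grad3 \<phi>) + (\<integral>x. v x * (V x * \<phi> x) \<partial>lborel) + \<Lambda> * (\<integral>x. v x * \<phi> x \<partial>lborel)"
    unfolding gip_def grad3_nth
    by (intro tendsto_intros L2lim_mult L2lim_const gl wv lam test_fun_L2[OF \<phi>] test_fun_L2[OF test_fun_pderiv3[OF \<phi>]]
        test_fun_L2[OF test_fun_mult[OF \<phi> smooth3_V]])
  have bi: "integrable lborel (\<lambda>x. h x * \<phi> x)" if h: "integrable lborel h" for h :: "R3 \<Rightarrow> real"
  proof (rule Bochner_Integration.integrable_bound)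
    show "integrable lborel (\<lambda>x. K' * \<bar>h x\<bar>)" using h by simp
    show "(\<lambda>x. h x * \<phi> x) \<in> borel_measurable lborel" using h by simp
    show "AE x in lborel. norm (h x * \<phi> x) \<le> norm (K' * \<bar>h x\<bar>)"
      using K' by (intro AE_I2) (auto simp: abs_mult mult.commute intro!: mult_right_mono)
  qed
  show vi: "integrable lborel (\<lambda>x. v x powr p * \<phi> x)" by (rule bi[OF vq[OF p'(9,10)]])
  have "(\<lambda>n. (\<integral>x. w n x powr p * \<phi> x \<partial>lborel) - (\<integral>x. v x powr p * \<phi> x \<partial>lborel)) \<longlonglongrightarrow> 0"
  proof (rule Lim_null_comparison)
    have "(\<lambda>n. K' * (\<integral>x. \<bar>w n x powr p - v x powr p\<bar> \<partial>lborel)) \<longlonglongrightarrow> K' * 0"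
      by (intro tendsto_intros powr_L1_lim(2)[OF p'(5,6)])
    then show "(\<lambda>n. K' * (\<integral>x. \<bar>w n x powr p - v x powr p\<bar> \<partial>lborel)) \<longlonglongrightarrow> 0" by simp
    show "\<forall>\<^sub>F n in sequentially. norm ((\<integral>x. w n x powr p * \<phi> x \<partial>lborel) - (\<integral>x. v x powr p * \<phi> x \<partial>lborel)) \<le> K' * (\<integral>x. \<bar>w n x powr p - v x powr p\<bar> \<partial>lborel)"
    proof (intro always_eventually allI)
      fix n
      have d: "integrable lborel (\<lambda>x. w n x powr p - v x powr p)" using wq(1)[OF p'(9,10)] vq[OF p'(9,10)] by simp
      have "norm ((\<integral>x. w n x powr p * \<phi> x \<partial>lborel) - (\<integral>x. v x powr p * \<phi> x \<partial>lborel)) = \<bar>\<integral>x. (w n x powr p - v x powr p) * \<phi> x \<partial>lborel\<bar>"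
        using bi[OF wq(1)[OF p'(9,10)], of n] vi by (simp add: left_diff_distrib)
      also have "\<dots> \<le> (\<integral>x. \<bar>(w n x powr p - v x powr p) * \<phi> x\<bar> \<partial>lborel)" by (rule integral_abs_bound)
      also have "\<dots> \<le> (\<integral>x. K' * \<bar>w n x powr p - v x powr p\<bar> \<partial>lborel)"
      proof (rule integral_mono)
        show "integrable lborel (\<lambda>x. \<bar>(w n x powr p - v x powr p) * \<phi> x\<bar>)" by (rule integrable_abs[OF bi[OF d]])
        show "integrable lborel (\<lambda>x. K' * \<bar>w n x powr p - v x powr p\<bar>)" using powr_L1_lim(1)[OF p'(5,6)] by simp
        show "\<bar>(w n x powr p - v x powr p) * \<phi> x\<bar> \<le> K' * \<bar>w n x powr p - v x powr p\<bar>" for x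
          using mult_left_mono[OF K'(2)[of x], of "\<bar>w n x powr p - v x powr p\<bar>"] by (simp add: abs_mult mult.commute)
      qed
      finally show "norm ((\<integral>x. w n x powr p * \<phi> x \<partial>lborel) - (\<integral>x. v x powr p * \<phi> x \<partial>lborel)) \<le> K' * (\<integral>x. \<bar>w n x powr p - v x powr p\<bar> \<partial>lborel)"
        by simp
    qed
  qed
  then have r: "(\<lambda>n. \<integral>x. w n x powr p * \<phi> x \<partial>lborel) \<longlonglongrightarrow> (\<integral>x. v x powr p * \<phi> x \<partial>lborel)" by (simp add: LIM_zero_iff)
  have "\<forall>\<^sub>F n in sequentially. gip (G n) (grad3 \<phi>) + (\<integral>x. w n x * (V x * \<phi> x) \<partial>lborel) + lam n * (\<integral>x. w n x * \<phi> x \<partial>lborel)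
     = (\<integral>x. w n x powr p * \<phi> x \<partial>lborel)"
    using eventually_test[OF \<phi>] by eventually_elim (rule weak_sol_split[OF weak wL H0_weak_grad[OF H] w0])
  from Lim_transform_eventually[OF l this]
  show "gip g (grad3 \<phi>) + (\<integral>x. v x * (V x * \<phi> x) \<partial>lborel) + \<Lambda> * (\<integral>x. v x * \<phi> x \<partial>lborel) = (\<integral>x. v x powr p * \<phi> x \<partial>lborel)"
    by (rule LIMSEQ_unique[OF _ r])
qed

text \<open>By monotonicity a zero of \<open>v\<close> produces a ball of zeros, which Hopf subsolutions spread to the whole space.\<close>
lemma limit_positive:
  assumes wv: "L2lim w v" and gl: "\<And>i. L2lim (\<lambda>n x. G n x $ i) (\<lambda>x. g x $ i)" and vg: "has_weak_grad v g" and x0: "nondeg x0"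
  shows "0 < v x0"
proof (rule ccontr)
  assume "\<not> 0 < v x0"
  then have z: "v x0 = 0" using v0[of x0] by simp
  \<comment> \<open>The shift by 1 makes every coordinate of a point in the unit ball around
    \<open>y\<close> at least as large, in absolute value, as that of \<open>x0\<close>.\<close>
  define y :: R3 where "y = (\<chi> i. \<bar>x0 $ i\<bar> + 1)"
  have vz: "v x = 0" if "dist y x < 1" for x
  proof -
    have "\<bar>x0 $ i\<bar> \<le> \<bar>x $ i\<bar>" for i
    proof -
      have "\<bar>y $ i - x $ i\<bar> \<le> norm (y - x)" using component_le_norm_cart[of "y - x" i] by simp
      then have "\<bar>y $ i - x $ i\<bar> < 1" using that by (simp add: dist_norm)
      then show ?thesis by (simp add: y_def)
    qed
    then have "v x \<le> v x0" by (rule vdecr[OF x0])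
    then show ?thesis using z v0[of x] by simp
  qed
  have "AE x in lborel. x \<in> ball y (real k + 1) \<longrightarrow> v x = 0" for k :: nat
  proof -
    define r where "r = real k + 1"
    \<comment> \<open>Bounds \<open>V + \<Lambda>\<close> from above on the ball of radius
      \<open>r\<close> about \<open>y\<close>, so that the barrier absorbs the zero-order
      terms.\<close>
    define M' where "M' = (norm y + r)\<^sup>2 + \<bar>\<Lambda>\<bar>"
    have r: "(0::real) < 1/2" "1/2 < r" "0 \<le> M'" by (auto simp: r_def M'_def)
    obtain \<psi> where \<psi>: "test_fun UNIV \<psi>" "\<And>x. 0 \<le> \<psi> x" "\<And>x. x \<notin> ball y r \<Longrightarrow> \<psi> x = 0 \<and> lap \<psi> x = 0"
      "\<And>x. 1/2 \<le> dist y x \<Longrightarrow> dist y x < r \<Longrightarrow> - lap \<psi> x + M' * \<psi> x < 0"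
      using Hopf_subsolution[OF r] by metis
    define F where "F x = v x * (- lap \<psi> x + V x * \<psi> x + \<Lambda> * \<psi> x)" for x
    have L: "L2 (\<lambda>x. - lap \<psi> x + V x * \<psi> x + \<Lambda> * \<psi> x)"
      by (intro L2_add L2_minus L2_scale test_fun_L2[OF \<psi>(1)] test_fun_L2[OF lap_test[OF \<psi>(1)]] test_fun_L2[OF test_fun_mult[OF \<psi>(1) smooth3_V]])
    have Fi: "integrable lborel F" unfolding F_def by (rule L2_mult_integrable[OF v_props(1) L])
    have neg: "- lap \<psi> x + V x * \<psi> x + \<Lambda> * \<psi> x < 0" if x: "1/2 \<le> dist y x" "dist y x < r" for x
    proof -
      have "norm x \<le> norm y + r" using x(2) norm_triangle_ineq4[of y "y - x"] by (simp add: dist_norm)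
      then have "(norm x)\<^sup>2 \<le> (norm y + r)\<^sup>2" by (intro power_mono) auto
      then have "V x + \<Lambda> \<le> M'" using V_le_norm[of x] unfolding M'_def by linarith
      then have "(V x + \<Lambda>) * \<psi> x \<le> M' * \<psi> x" by (intro mult_right_mono \<psi>(2))
      then show ?thesis using \<psi>(4)[OF x] by (simp add: distrib_right)
    qed
    have Fle: "F x \<le> 0" and Fneg: "x \<in> ball y r \<Longrightarrow> F x = 0 \<Longrightarrow> v x = 0" for x
    proof -
      consider "x \<notin> ball y r" | "dist y x < 1/2" | "1/2 \<le> dist y x" "dist y x < r" by fastforce
      then have "F x \<le> 0 \<and> (x \<in> ball y r \<longrightarrow> F x = 0 \<longrightarrow> v x = 0)"
      proof cases
        case 1
        then show ?thesis using \<psi>(3)[of x] by (simp add: F_def)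
      next
        case 2
        then show ?thesis using vz[of x] by (simp add: F_def)
      next
        case 3
        then show ?thesis using neg[OF 3] v0[of x] by (auto simp: F_def mult_nonneg_nonpos less_imp_le)
      qed
      then show "F x \<le> 0" "x \<in> ball y r \<Longrightarrow> F x = 0 \<Longrightarrow> v x = 0" by auto
    qed
    have i: "integrable lborel (\<lambda>x. v x * lap \<psi> x)" "integrable lborel (\<lambda>x. v x * (V x * \<psi> x))" "integrable lborel (\<lambda>x. v x * \<psi> x)"
      by (intro L2_mult_integrable v_props test_fun_L2[OF lap_test[OF \<psi>(1)]] test_fun_L2[OF test_fun_mult[OF \<psi>(1) smooth3_V]] test_fun_L2[OF \<psi>(1)])+
    have "(\<integral>x. F x \<partial>lborel) = (\<integral>x. - (v x * lap \<psi> x) + v x * (V x * \<psi> x) + \<Lambda> * (v x * \<psi> x) \<partial>lborel)"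
      unfolding F_def by (intro Bochner_Integration.integral_cong) (auto simp: algebra_simps)
    also have "\<dots> = gip g (grad3 \<psi>) + (\<integral>x. v x * (V x * \<psi> x) \<partial>lborel) + \<Lambda> * (\<integral>x. v x * \<psi> x \<partial>lborel)"
      using i gip_grad3_lap[OF v_props(1) vg \<psi>(1)] by simp
    also have "\<dots> = (\<integral>x. v x powr p * \<psi> x \<partial>lborel)" by (rule limit_equation(1)[OF wv gl \<psi>(1)])
    also have "\<dots> \<ge> 0" using \<psi>(2) by (intro Bochner_Integration.integral_nonneg) auto
    \<comment> \<open>\<open>F\<close> is nonpositive everywhere and yet has a nonnegative integral,
      hence vanishes almost everywhere; the strict inequality in the annulus then forces
      \<open>v = 0\<close> there.\<close>
    finally have "0 \<le> (\<integral>x. F x \<partial>lborel)" .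
    moreover have "(\<integral>x. - F x \<partial>lborel) = - (\<integral>x. F x \<partial>lborel)" using Fi by simp
    moreover have "0 \<le> (\<integral>x. - F x \<partial>lborel)" using Fle by (intro Bochner_Integration.integral_nonneg) auto
    ultimately have "(\<integral>x. - F x \<partial>lborel) = 0" by linarith
    then have "AE x in lborel. - F x = 0"
      using integral_nonneg_eq_0_iff_AE[of lborel "\<lambda>x. - F x"] Fi Fle by auto
    then show ?thesis by eventually_elim (use Fneg in \<open>auto simp: r_def\<close>)
  qed
  then have "AE x in lborel. \<forall>k::nat. x \<in> ball y (real k + 1) \<longrightarrow> v x = 0" unfolding AE_all_countable by blast
  then have "AE x in lborel. v x = 0"
  proof eventually_elim
    case (elim x)
    obtain k :: nat where "dist y x < real k" using reals_Archimedean2 by blast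
    then have "x \<in> ball y (real k + 1)" by simp
    then show ?case using elim by blast
  qed
  \<comment> \<open>Strong convergence preserves the mass, so \<open>v\<close> cannot vanish almost
    everywhere.\<close>
  then have "sqint v = 0" using sqint_cong_AE[OF v_props(1) L2_zero] by (simp add: sqint_def)
  moreover have "sqint v = \<mu>" using LIMSEQ_unique[OF L2lim_sqint[OF wv]] M by simp
  ultimately show False using \<mu> by simp
qed

end

section \<open>From the hypotheses of the theorem to the setting of the locale, and back\<close>

lemma has_weak_grad_cong_AE:
  assumes u: "L2 u" and g: "has_weak_grad u g" and v: "L2 v" and eq: "AE x in lborel. u x = v x"
  shows "has_weak_grad v g"
  unfolding has_weak_grad_def
proof (intro conjI allI impI)
  show "L2 (\<lambda>x. g x $ i)" for i by (rule has_weak_grad_L2[OF g])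
  fix \<phi> :: "R3 \<Rightarrow> real" and i assume \<phi>: "test_fun UNIV \<phi>"
  note [measurable] = L2_meas[OF u] L2_meas[OF v] test_fun_measurable[OF test_fun_pderiv3[OF \<phi>]]
  have "(\<integral>x. v x * pderiv3 i \<phi> x \<partial>lborel) = (\<integral>x. u x * pderiv3 i \<phi> x \<partial>lborel)"
    using eq by (intro integral_cong_AE) (auto elim!: eventually_mono)
  then show "(\<integral>x. v x * pderiv3 i \<phi> x \<partial>lborel) = - (\<integral>x. g x $ i * \<phi> x \<partial>lborel)"
    using has_weak_grad_eq[OF g \<phi>] by simp
qed

text \<open>Pass through the point \<open>z\<close> that has the first two coordinates of
  \<open>y\<close> and the third of \<open>x\<close>, so that each hypothesis changes its own
  variables.\<close>

lemma coord_decrI: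
  assumes u: "radial_decr_12 u" "decr_3 u" shows "coord_decr u"
  unfolding coord_decr_def
proof (intro allI impI)
  fix x y :: R3 assume le: "\<forall>i. \<bar>x $ i\<bar> \<le> \<bar>y $ i\<bar>"
  define z :: R3 where "z = (\<chi> i. if i = 3 then x $ 3 else y $ i)"
  have z: "z $ 1 = y $ 1" "z $ 2 = y $ 2" "z $ 3 = x $ 3" by (simp_all add: z_def)
  have "u y \<le> u z" using u(2) le z unfolding decr_3_def by simp
  also have "u z \<le> u x"
    using u(1) z le add_mono[of "(x $ 1)\<^sup>2" "(y $ 1)\<^sup>2" "(x $ 2)\<^sup>2" "(y $ 2)\<^sup>2"]
    unfolding radial_decr_12_def by (simp add: abs_le_square_iff)
  finally show "u y \<le> u x" .
qed

text \<open>The integrals over the ball are integrals over the whole space: \<open>u\<close>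
  vanishes outside by hypothesis, its weak gradient almost everywhere by
  \<open>H0_grad_outside\<close>.\<close>

lemma Energy_R_eq:
  assumes u: "H0 R u (wgrad u)" and out: "\<And>x. x \<notin> ball 0 R \<Longrightarrow> u x = 0" and u0: "\<And>x. 0 \<le> u x"
  shows "Energy_R p R u = (gradsq (wgrad u) + (\<integral>x. V x * (u x)\<^sup>2 \<partial>lborel)) / 2 - (\<integral>x. u x powr (p + 1) \<partial>lborel) / (p + 1)"
proof -
  note g = gradsq_wgrad[OF H0_L2(1)[OF u] H0_weak_grad[OF u]]
  have Vi: "integrable lborel (\<lambda>x. V x * (u x)\<^sup>2)" by (rule H0_V(2)[OF u])
  have gi: "integrable lborel (\<lambda>x. (norm (wgrad u x))\<^sup>2 + V x * (u x)\<^sup>2)" using g(1) Vi by simp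
  have [measurable]: "(\<lambda>x. (norm (wgrad u x))\<^sup>2 + V x * (u x)\<^sup>2) \<in> borel_measurable borel"
    using borel_measurable_integrable[OF gi] by simp
  have "(\<integral>x\<in>ball 0 R. (norm (wgrad u x))\<^sup>2 + V x * (u x)\<^sup>2 \<partial>lborel) = (\<integral>x. (norm (wgrad u x))\<^sup>2 + V x * (u x)\<^sup>2 \<partial>lborel)"
    unfolding set_lebesgue_integral_def
  proof (rule integral_cong_AE)
    show "AE x in lborel. indicator (ball 0 R) x *\<^sub>R ((norm (wgrad u x))\<^sup>2 + V x * (u x)\<^sup>2) = (norm (wgrad u x))\<^sup>2 + V x * (u x)\<^sup>2"
      using H0_grad_outside[OF u] by eventually_elim (auto simp: indicator_def out)
  qed (use borel_measurable_indicator[of "ball 0 R" "borel :: R3 measure"] in \<open>auto intro: borel_measurable_times\<close>)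
  moreover have "(\<integral>x\<in>ball 0 R. \<bar>u x\<bar> powr (p + 1) \<partial>lborel) = (\<integral>x. u x powr (p + 1) \<partial>lborel)"
    unfolding set_lebesgue_integral_def using out u0 by (intro Bochner_Integration.integral_cong) (auto simp: indicator_def)
  ultimately show ?thesis using g Vi by (simp add: Energy_R_def)
qed

lemma L2lim_gradsq:
  assumes "\<And>i. L2lim (\<lambda>n x. F n x $ i) (\<lambda>x. f x $ i)"
  shows "(\<lambda>n. gradsq (F n)) \<longlonglongrightarrow> gradsq f" "(\<lambda>n. gradsq (\<lambda>x. F n x - f x)) \<longlonglongrightarrow> 0"
proof -
  show "(\<lambda>n. gradsq (F n)) \<longlonglongrightarrow> gradsq f" unfolding gradsq_def by (intro tendsto_sum L2lim_sqint assms)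
  have "(\<lambda>n. \<Sum>i\<in>UNIV. sqint (\<lambda>x. F n x $ i - f x $ i)) \<longlonglongrightarrow> (\<Sum>i\<in>(UNIV::3 set). 0)"
    using assms by (intro tendsto_sum) (simp add: L2lim_def)
  then show "(\<lambda>n. gradsq (\<lambda>x. F n x - f x)) \<longlonglongrightarrow> 0" by (simp add: gradsq_def)
qed

text \<open>\<open>V\<close> is a sum of two squares, so weighted convergence is \<open>L2\<close>
  convergence of \<open>x $ 1 * w n x\<close> and \<open>x $ 2 * w n x\<close>, and the norm is
  continuous.\<close>

lemma V_integral_lim:
  assumes w: "\<And>n. L2 (w n)" "\<And>n. integrable lborel (\<lambda>x. V x * (w n x)\<^sup>2)" and v: "L2 v" "integrable lborel (\<lambda>x. V x * (v x)\<^sup>2)"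
    and d: "\<And>n. integrable lborel (\<lambda>x. V x * (w n x - v x)\<^sup>2)" and lim: "(\<lambda>n. \<integral>x. V x * (w n x - v x)\<^sup>2 \<partial>lborel) \<longlonglongrightarrow> 0"
  shows "(\<lambda>n. \<integral>x. V x * (w n x)\<^sup>2 \<partial>lborel) \<longlonglongrightarrow> (\<integral>x. V x * (v x)\<^sup>2 \<partial>lborel)"
proof -
  have D: "(\<integral>x. V x * (w n x - v x)\<^sup>2 \<partial>lborel) = sqint (\<lambda>x. x $ 1 * w n x - x $ 1 * v x) + sqint (\<lambda>x. x $ 2 * w n x - x $ 2 * v x)" for n
    using V_integrable(2)[OF L2_diff[OF w(1) v(1)] d] by (simp add: right_diff_distrib)
  have "L2lim (\<lambda>n x. x $ i * w n x) (\<lambda>x. x $ i * v x)" if i: "i = 1 \<or> i = 2" for i :: 3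
  proof -
    have "(\<lambda>n. sqint (\<lambda>x. x $ i * w n x - x $ i * v x)) \<longlonglongrightarrow> 0"
    proof (rule tendsto_sandwich[OF _ _ tendsto_const lim])
      show "\<forall>\<^sub>F n in sequentially. sqint (\<lambda>x. x $ i * w n x - x $ i * v x) \<le> (\<integral>x. V x * (w n x - v x)\<^sup>2 \<partial>lborel)"
        using i sqint_nonneg unfolding D by (intro always_eventually) (auto simp: add_increasing add_increasing2)
    qed (simp add: sqint_nonneg)
    moreover have "i \<noteq> 3" using i by auto
    ultimately show ?thesis using V_integrable(1)[OF w] V_integrable(1)[OF v] by (simp add: L2lim_def)
  qed
  then show ?thesis
    unfolding V_integrable(2)[OF w] V_integrable(2)[OF v] by (intro tendsto_add L2lim_sqint) auto
qed

text \<open>Pohozaev gives \<open>C / (p + 1) \<le> k * (A - B)\<close>. Inserted into the energy it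
  leaves \<open>(1/2 - k) * (A + B) \<le> E0\<close>, and \<open>k < 1/2\<close> is exactly
  \<open>p > 7/3\<close>. The multiplier is then read off the tested equation.\<close>

lemma critical_bounds:
  assumes p: "7/3 < p" "p < 5" and \<mu>: "0 < \<mu>" and w: "weak_sol p lam (ball 0 R) u" and u: "H0 R u (wgrad u)" and u0: "\<And>x. 0 \<le> u x"
    and decr: "coord_decr u" and M: "sqint u = \<mu>"
    and E: "(gradsq (wgrad u) + (\<integral>x. V x * (u x)\<^sup>2 \<partial>lborel)) / 2 - (\<integral>x. u x powr (p + 1) \<partial>lborel) / (p + 1) \<le> E0"
  defines "k \<equiv> 2 / (3 * (p - 1))"
  shows "gradsq (wgrad u) \<le> E0 / (1/2 - k)" "(\<integral>x. V x * (u x)\<^sup>2 \<partial>lborel) \<le> E0 / (1/2 - k)"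
    "\<bar>lam\<bar> \<le> (2 + (p + 1) * k) * (E0 / (1/2 - k)) / \<mu>"
proof -
  define A where "A = gradsq (wgrad u)"
  define B where "B = (\<integral>x. V x * (u x)\<^sup>2 \<partial>lborel)"
  define C where "C = (\<integral>x. u x powr (p + 1) \<partial>lborel)"
  have p1: "1 < p" using p by simp
  have k: "0 < k" "0 < 1/2 - k" using p by (auto simp: k_def field_simps)
  have dil: "u (t *\<^sub>R x) \<le> u x" if "1 \<le> t" for t x
    by (rule coord_decrD[OF decr]) (use that in \<open>simp add: abs_mult mult_right_mono[of 1 t "\<bar>x $ _\<bar>", simplified]\<close>)
  have P: "A + B + lam * sqint u = C" "0 \<le> A - B - 3 * (p - 1) / (2 * (p + 1)) * C"
    unfolding A_def B_def C_def by (rule Pohozaev_inequality[OF p1 p(2) w u u0 dil]; assumption)+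
  have A0: "0 \<le> A" by (simp add: A_def gradsq_nonneg)
  have B0: "0 \<le> B" unfolding B_def using V_nonneg by (intro Bochner_Integration.integral_nonneg) auto
  have C0: "0 \<le> C" unfolding C_def by (intro Bochner_Integration.integral_nonneg) auto
  have "3 * (p - 1) / (2 * (p + 1)) * C = (C / (p + 1)) / k" using p1 by (simp add: k_def field_simps)
  then have "(C / (p + 1)) / k \<le> A - B" using P(2) by linarith
  then have Ck: "C / (p + 1) \<le> k * (A - B)" unfolding pos_divide_le_eq[OF k(1)] by (simp only: mult.commute)
  have "(1/2 - k) * A + (1/2 + k) * B = (A + B) / 2 - k * (A - B)" by (simp add: algebra_simps)
  also have "\<dots> \<le> E0" using E[folded A_def B_def C_def] Ck by linarith
  finally have "(1/2 - k) * A + (1/2 + k) * B \<le> E0" .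
  moreover have "(1/2 - k) * B \<le> (1/2 + k) * B" using k B0 by (intro mult_right_mono) auto
  ultimately have s: "(1/2 - k) * (A + B) \<le> E0" by (simp add: algebra_simps)
  then have AB: "A + B \<le> E0 / (1/2 - k)" using k(2) by (simp add: pos_le_divide_eq mult.commute)
  then have A: "A \<le> E0 / (1/2 - k)" and B: "B \<le> E0 / (1/2 - k)" using A0 B0 by linarith+
  then show "gradsq (wgrad u) \<le> E0 / (1/2 - k)" "(\<integral>x. V x * (u x)\<^sup>2 \<partial>lborel) \<le> E0 / (1/2 - k)" by (simp_all add: A_def B_def)
  have "C \<le> (p + 1) * (k * (A - B))" using Ck p1 by (simp add: pos_divide_le_eq mult.commute)
  also have "\<dots> \<le> (p + 1) * (k * (E0 / (1/2 - k)))" using A B0 k p1 by (intro mult_left_mono) auto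
  finally have "A + B + C \<le> (2 + (p + 1) * k) * (E0 / (1/2 - k))" using A B unfolding distrib_right mult.assoc by linarith
  moreover have "\<bar>lam * \<mu>\<bar> \<le> A + B + C" using P(1)[unfolded M] A0 B0 C0 by linarith
  ultimately have "\<bar>lam\<bar> * \<mu> \<le> (2 + (p + 1) * k) * (E0 / (1/2 - k))" using \<mu> by (simp add: abs_mult)
  then show "\<bar>lam\<bar> \<le> (2 + (p + 1) * k) * (E0 / (1/2 - k)) / \<mu>" unfolding pos_le_divide_eq[OF \<mu>] .
qed

lemma (in critical_sequence) limit_solution:
  assumes E: "(\<lambda>n. (A n + B n) / 2 - C n / (p + 1)) \<longlonglongrightarrow> \<beta>" and \<beta>: "\<beta> \<noteq> 1/2 * Lambda0 * \<mu>"
  obtains v' where "(\<lambda>n. H_norm (\<lambda>x. w n x - v' x)) \<longlonglongrightarrow> 0" "crit_S_mu p \<mu> v'" "\<And>x. 0 < v' x" "Energy p v' = \<beta>"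
proof -
  obtain g where wv: "L2lim w v" and gl: "\<And>i. L2lim (\<lambda>n x. G n x $ i) (\<lambda>x. g x $ i)" and vg: "has_weak_grad v g"
    and Vl: "(\<lambda>n. \<integral>x. V x * (w n x - v x)\<^sup>2 \<partial>lborel) \<longlonglongrightarrow> 0"
    using strong_limit[OF multiplier_gt[OF E \<beta>]] by blast
  \<comment> \<open>\<open>v\<close> is known to be positive only off the coordinate planes. Any
    positive value on the exceptional null set, here 1, gives positivity everywhere and changes no
    integral.\<close>
  define v' where "v' x = (if 0 < v x then v x else 1)" for x
  note [measurable] = vm wm
  have vm'[measurable]: "v' \<in> borel_measurable borel" unfolding v'_def by measurable
  have pos: "0 < v' x" for x by (simp add: v'_def)
  have eq: "AE x in lborel. v x = v' x"
    using AE_nondeg by eventually_elim (simp add: v'_def limit_positive[OF wv gl vg])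
  have eq': "AE x in lborel. v' x = v x" using eq by eventually_elim simp
  have vL: "L2 v'" by (rule L2_cong_AE[OF v_props(1) vm' eq])
  have vg': "has_weak_grad v' g" by (rule has_weak_grad_cong_AE[OF v_props(1) vg vL eq])
  have Vv: "integrable lborel (\<lambda>x. V x * (v' x)\<^sup>2)"
    by (rule integrable_cong_AE_imp[OF v_props(3)]) (use eq in \<open>auto elim!: eventually_mono\<close>)
  have Vv_eq: "(\<integral>x. V x * (v' x)\<^sup>2 \<partial>lborel) = (\<integral>x. V x * (v x)\<^sup>2 \<partial>lborel)"
    by (rule integral_cong_AE) (use eq in \<open>auto elim!: eventually_mono\<close>)
  have Pv_eq: "(\<integral>x. v' x powr (p + 1) \<partial>lborel) = (\<integral>x. v x powr (p + 1) \<partial>lborel)"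
    by (rule integral_cong_AE) (use eq in \<open>auto elim!: eventually_mono\<close>)
  have sq: "sqint (\<lambda>x. w n x - v' x) = sqint (\<lambda>x. w n x - v x)" for n
    by (rule sqint_cong_AE[OF L2_diff[OF wL vL] L2_diff[OF wL v_props(1)]]) (use eq in \<open>auto elim!: eventually_mono\<close>)
  have Vd: "(\<integral>x. V x * (w n x - v' x)\<^sup>2 \<partial>lborel) = (\<integral>x. V x * (w n x - v x)\<^sup>2 \<partial>lborel)" for n
    by (rule integral_cong_AE) (use eq in \<open>auto elim!: eventually_mono\<close>)
  have Vi: "integrable lborel (\<lambda>x. V x * (w n x - f x)\<^sup>2)"
    if f: "L2 f" "integrable lborel (\<lambda>x. V x * (f x)\<^sup>2)" for n f
  proof -
    note [measurable] = L2_meas[OF f(1)]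
    have i: "integrable lborel (\<lambda>x. 2 * (V x * (w n x)\<^sup>2) + 2 * (V x * (f x)\<^sup>2))" using H0_V(2)[OF H, of n] f(2) by simp
    show ?thesis
    proof (rule Bochner_Integration.integrable_bound[OF i])
      have "V x * (w n x - f x)\<^sup>2 \<le> 2 * (V x * (w n x)\<^sup>2) + 2 * (V x * (f x)\<^sup>2)" for x
      proof -
        have "(w n x - f x)\<^sup>2 \<le> 2 * (w n x)\<^sup>2 + 2 * (f x)\<^sup>2"
          using zero_le_power2[of "w n x + f x"] by (simp add: power2_eq_square algebra_simps)
        from mult_left_mono[OF this V_nonneg[of x]] show ?thesis by (simp add: algebra_simps)
      qed
      then show "AE x in lborel. norm (V x * (w n x - f x)\<^sup>2) \<le> norm (2 * (V x * (w n x)\<^sup>2) + 2 * (V x * (f x)\<^sup>2))"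
        using V_nonneg by (intro AE_I2) (simp add: abs_mult order_trans[OF _ abs_ge_self])
    qed simp
  qed
  have m: "sqint v' = \<mu>"
    using sqint_cong_AE[OF vL v_props(1) eq'] LIMSEQ_unique[OF L2lim_sqint[OF wv]] M by simp
  have "(\<lambda>n. H_norm (\<lambda>x. w n x - v' x)) \<longlonglongrightarrow> 0"
  proof -
    have h: "H_norm (\<lambda>x. w n x - v' x) = sqrt (gradsq (\<lambda>x. G n x - g x) + (\<integral>x. V x * (w n x - v x)\<^sup>2 \<partial>lborel) + sqint (\<lambda>x. w n x - v x))" for n
      unfolding H_norm_eq[OF L2_diff[OF wL vL] has_weak_grad_diff[OF wL H0_weak_grad[OF H] vL vg'] Vi[OF vL Vv]] sq Vd ..
    have "(\<lambda>n. sqrt (gradsq (\<lambda>x. G n x - g x) + (\<integral>x. V x * (w n x - v x)\<^sup>2 \<partial>lborel) + sqint (\<lambda>x. w n x - v x))) \<longlonglongrightarrow> sqrt (0 + 0 + 0)"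
      using wv by (intro tendsto_intros L2lim_gradsq(2)[OF gl] Vl) (simp add: L2lim_def)
    then show ?thesis unfolding h by simp
  qed
  moreover have "crit_S_mu p \<mu> v'"
  proof -
    have "weak_sol p \<Lambda> UNIV v'" unfolding weak_sol_def
    proof (intro allI impI)
      fix \<phi> assume \<phi>: "test_fun UNIV \<phi>"
      note [measurable] = test_fun_measurable[OF \<phi>]
      have e: "\<bar>v' x\<bar> powr (p - 1) * v' x = v' x powr p" for x
        using powr_mult_base[of "v' x" "p - 1"] pos[of x] by (simp add: mult.commute)
      have 1: "(\<integral>x. v' x * (V x * \<phi> x) \<partial>lborel) = (\<integral>x. v x * (V x * \<phi> x) \<partial>lborel)"
        by (rule integral_cong_AE) (use eq in \<open>auto elim!: eventually_mono\<close>)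
      have 2: "(\<integral>x. v' x * \<phi> x \<partial>lborel) = (\<integral>x. v x * \<phi> x \<partial>lborel)"
        by (rule integral_cong_AE) (use eq in \<open>auto elim!: eventually_mono\<close>)
      have 3: "(\<integral>x. v' x powr p * \<phi> x \<partial>lborel) = (\<integral>x. v x powr p * \<phi> x \<partial>lborel)"
        by (rule integral_cong_AE) (use eq in \<open>auto elim!: eventually_mono\<close>)
      show "(\<integral>x. wgrad v' x \<bullet> grad3 \<phi> x + V x * v' x * \<phi> x + \<Lambda> * v' x * \<phi> x \<partial>lborel) = (\<integral>x. \<bar>v' x\<bar> powr (p - 1) * v' x * \<phi> x \<partial>lborel)"
        unfolding weak_form_split[OF vL vg' \<phi>] e 1 2 3 by (rule limit_equation(1)[OF wv gl \<phi>])
    qed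
    moreover have "mass v' = \<mu>" using m by (simp add: mass_def sqint_def)
    ultimately show ?thesis using vL vg' Vv by (auto simp: crit_S_mu_def S_mu_def Hsp_def H1_def)
  qed
  moreover have "Energy p v' = \<beta>"
  proof -
    note gv = gradsq_wgrad[OF vL vg']
    have "Energy p v' = (gradsq g + (\<integral>x. V x * (v x)\<^sup>2 \<partial>lborel)) / 2 - (\<integral>x. v x powr (p + 1) \<partial>lborel) / (p + 1)"
      using gv(1,2) Vv Vv_eq Pv_eq pos by (simp add: Energy_def abs_of_pos)
    moreover have "(\<lambda>n. (A n + B n) / 2 - C n / (p + 1)) \<longlonglongrightarrow> (gradsq g + (\<integral>x. V x * (v x)\<^sup>2 \<partial>lborel)) / 2 - (\<integral>x. v x powr (p + 1) \<partial>lborel) / (p + 1)"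
      unfolding A_def B_def using p
      by (intro tendsto_intros L2lim_gradsq(1)[OF gl] C_lim V_integral_lim[OF wL H0_V(2)[OF H] v_props(1,3) Vi[OF v_props(1,3)] Vl]) auto
    ultimately show ?thesis using LIMSEQ_unique[OF E] by simp
  qed
  ultimately show ?thesis using that pos by blast
qed

theorem theorem4p1:
  fixes p \<mu> \<beta> :: real and R :: "nat \<Rightarrow> real" and u :: "nat \<Rightarrow> R3 \<Rightarrow> real"
  assumes "7/3 < p" and "p < 5" and "\<mu> > 0"
    and "filterlim R at_top sequentially"
    and "\<And>n. crit_S_mu_R p \<mu> (R n) (u n)"
    and "\<And>n x. x \<in> ball 0 (R n) \<Longrightarrow> u n x > 0"
    and "\<And>n x. x \<notin> ball 0 (R n) \<Longrightarrow> u n x = 0"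
    and "\<And>n. radial_decr_12 (u n)" and "\<And>n. decr_3 (u n)"
    and "(\<lambda>n. Energy_R p (R n) (u n)) \<longlonglongrightarrow> \<beta>"
    and "\<beta> \<noteq> 1/2 * Lambda0 * \<mu>"
  shows "\<exists>r v. strict_mono r \<and> (\<lambda>k. H_norm (\<lambda>x. u (r k) x - v x)) \<longlonglongrightarrow> 0 \<and>
           crit_S_mu p \<mu> v \<and> (\<forall>x. v x > 0) \<and> Energy p v = \<beta>"
proof -
  note p = assms(1,2) and \<mu> = assms(3) and R = assms(4) and crit = assms(5) and pos = assms(6) and out = assms(7)
    and E = assms(10) and \<beta> = assms(11)
  have u0: "0 \<le> u n x" for n x using pos[of x n] out[of x n] by (cases "x \<in> ball 0 (R n)") (auto intro: less_imp_le)
  have "u n \<in> H10_ball (R n)" for n using crit[of n] by (simp add: crit_S_mu_R_def S_mu_R_def)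
  then have H: "H0 (R n) (u n) (wgrad (u n))" for n by (rule H10_ball_H0(3))
  have M: "sqint (u n) = \<mu>" for n
  proof -
    have "(\<integral>x\<in>ball 0 (R n). (u n x)\<^sup>2 \<partial>lborel) = sqint (u n)" unfolding set_lebesgue_integral_def sqint_def
      by (intro Bochner_Integration.integral_cong) (use out[of _ n] in \<open>auto simp: indicator_def\<close>)
    then show ?thesis using crit[of n] by (simp add: crit_S_mu_R_def S_mu_R_def)
  qed
  obtain lam where weak: "\<And>n. weak_sol p (lam n) (ball 0 (R n)) (u n)" using crit unfolding crit_S_mu_R_def by metis
  have decr: "coord_decr (u n)" for n by (rule coord_decrI[OF assms(8,9)])
  have E_eq: "Energy_R p (R n) (u n) = (gradsq (wgrad (u n)) + (\<integral>x. V x * (u n x)\<^sup>2 \<partial>lborel)) / 2 - (\<integral>x. u n x powr (p + 1) \<partial>lborel) / (p + 1)" for n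
    by (rule Energy_R_eq[OF H out u0])
  obtain E0 where E0: "\<And>n. Energy_R p (R n) (u n) \<le> E0"
  proof -
    have "Bseq (\<lambda>n. Energy_R p (R n) (u n))" by (rule convergent_imp_Bseq[OF convergentI[OF E]])
    then obtain E0 where "\<forall>n. norm (Energy_R p (R n) (u n)) \<le> E0" unfolding Bseq_def by blast
    then show ?thesis by (intro that[of E0]) (simp add: abs_le_D1)
  qed
  \<comment> \<open>The constants of \<open>critical_bounds\<close>, which are uniform in
    \<open>n\<close> because the convergent energies are bounded.\<close>
  define K where "K = E0 / (1/2 - 2 / (3 * (p - 1)))"
  define L where "L = (2 + (p + 1) * (2 / (3 * (p - 1)))) * K / \<mu>"
  note bd = critical_bounds[OF p \<mu> weak H u0 decr M E0[unfolded E_eq], folded K_def L_def]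
  have M': "sqint (u n) \<le> \<mu>" for n using M by simp
  obtain r1 v where r1: "strict_mono r1" and vm: "v \<in> borel_measurable borel" and v0: "\<And>x. 0 \<le> v x"
    and lim: "AE x in lborel. (\<lambda>n. u (r1 n) x) \<longlonglongrightarrow> v x"
    and vdecr: "\<And>x y. nondeg x \<Longrightarrow> (\<And>i. \<bar>x $ i\<bar> \<le> \<bar>y $ i\<bar>) \<Longrightarrow> v y \<le> v x"
  proof (rule Helly_selection_decr[of u \<mu>, OF u0 decr H0_L2(1)[OF H] M'], goal_cases)
    case (1 r v)
    show ?case by (rule 1(1)[OF 1(2-6)])
  qed
  \<comment> \<open>A second extraction makes the bounded multipliers converge; the almost
    everywhere limit of the first survives it.\<close>
  have "bounded (range (\<lambda>n. lam (r1 n)))" using bd(3) by (auto simp: bounded_iff)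
  then obtain \<Lambda> r2 where r2: "strict_mono r2" and lam: "(\<lambda>n. lam (r1 (r2 n))) \<longlonglongrightarrow> \<Lambda>"
    using bounded_imp_convergent_subsequence[of "\<lambda>n. lam (r1 n)"] by (auto simp: o_def)
  define r where "r n = r1 (r2 n)" for n
  have r: "strict_mono r" unfolding r_def using strict_mono_o[OF r1 r2] by (simp add: o_def)
  interpret critical_sequence p \<mu> K \<Lambda> "\<lambda>n. R (r n)" "\<lambda>n. lam (r n)" "\<lambda>n. u (r n)" v
  proof
    show "filterlim (\<lambda>n. R (r n)) at_top sequentially" by (rule filterlim_compose[OF R filterlim_subseq[OF r]])
    show "AE x in lborel. (\<lambda>n. u (r n) x) \<longlonglongrightarrow> v x"
      using lim
    proof eventually_elim
      case (elim x)
      show ?case unfolding r_def by (rule LIMSEQ_subseq_LIMSEQ[OF elim r2, unfolded o_def])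
    qed
    show "(\<lambda>n. lam (r n)) \<longlonglongrightarrow> \<Lambda>" using lam by (simp add: r_def)
  qed (fact p \<mu> H u0 pos weak decr M bd(1,2) vm v0 vdecr)+
  have "(\<lambda>n. (A n + B n) / 2 - C n / (p + 1)) \<longlonglongrightarrow> \<beta>"
    using LIMSEQ_subseq_LIMSEQ[OF E r] unfolding o_def E_eq A_def B_def C_def .
  from limit_solution[OF this \<beta>] show ?thesis using r by blast
qed

end
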